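(* (Limiting absorption principle.) There are constants $g_0>0$ and $C>0$ such that for all $0<g<g_0$, all $\epsilon\in(0,1)$ and all $z,z'\in[e_1-\delta/4,e_1+\delta/4]$, the following hold (for either choice of sign, the same throughout each formula), with $\langle d\Gamma(D)\rangle:=\big((d\Gamma(D))^2+1\big)^{1/2}$: (i) $\sigma_{\mathrm{pp}}(H_{\overline P})\cap[e_1-\delta/4,e_1+\delta/4]=\emptyset$, where $\sigma_{\mathrm{pp}}$ denotes the pure point spectrum; (ii) $\big\|\langle d\Gamma(D)\rangle^{-1}(H_{\overline P}-z\pm i\epsilon)^{-1}\langle d\Gamma(D)\rangle^{-1}\big\|\le C$ and $\big\|\langle d\Gamma(D)\rangle^{-1}(H_{0,\overline P}-z\pm i\epsilon)^{-1}\langle d\Gamma(D)\rangle^{-1}\big\|\le C$; (iii) $\big\|\langle d\Gamma(D)\rangle^{-1}\big((H_{\overline P}-z\pm i\epsilon)^{-1}-(H_{0,\overline P}-z'\pm i\epsilon)^{-1}\big)\langle d\Gamma(D)\rangle^{-1}\big\|\le C\big(g^{1/2}+|z-z'|^{1/2}\big)$. The constant $C$ does not depend on $\epsilon,z,z',g$.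
   Context: Fix $m>0$, $\Lambda>0$ and $0=e_0<m<e_1$ with $e_1\notin m\mathbb N$, $\mathbb N=\{1,2,\dots\}$, and $\delta:=\mathrm{dist}(e_1-e_0,m\mathbb N)>0$. Let $\omega(k)=\sqrt{k^2+m^2}$, $f(k)=e^{-k^2/\Lambda^2}\omega(k)^{-1/2}$, $k\in\mathbb R^3$. $\mathfrak h=L^2(\mathbb R^3,\mathbb C)$, $\mathcal F=\bigoplus_{n\ge0}\mathfrak h^{\odot n}$ the bosonic Fock space with vacuum $\Omega$, $\mathcal H=\mathbb C^2\otimes\mathcal F$. $a(h)^*,a(h)$ are the usual creation/annihilation operators with $[a(h),a(l)^*]=\langle h,l\rangle$. $K=\mathrm{diag}(e_1,e_0)$, $\varphi_1=(1,0)^T$, $\sigma_1=\begin{pmatrix}0&1\\1&0\end{pmatrix}$, $H_f=d\Gamma(\omega)$, $H_0=K+H_f$, $V=\sigma_1\otimes(a(f)+a(f)^* )$, $H=H_0+gV$, self-adjoint on $\mathcal D(H_0)$. For self-adjoint $O$ on $\mathfrak h$, $d\Gamma(O)$ is the self-adjoint generator of $\Gamma(e^{-itO})=\bigoplus_n(e^{-itO})^{\odot n}$ (identified with $1\otimes d\Gamma(O)$ on $\mathcal H$). $D$ is the self-adjoint generator of dilations: $e^{-i\beta D}=u_\beta$ with $(u_\beta\varphi)(k)=e^{3\beta/2}\varphi(e^\beta k)$. $P$ is the orthogonal projection onto $\mathbb C\,\varphi_1\otimes\Omega$, $\overline P=1-P$, $H_{\overline P}=\overline PH\overline P$, $H_{0,\overline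 P}=\overline PH_0\overline P$, regarded as self-adjoint operators on $\mathcal H$ with domain $\mathcal D(H_0)$. *)

theory Defs
  imports "HOL-Analysis.Analysis" "HOL-Combinatorics.Multiset_Permutations"
begin

section \<open>Complex inner product spaces\<close>

text \<open>Inner products are conjugate-linear in the first argument. The underlying real inner product
  space is the one of the library, so that norm, topology and \<open>onorm\<close> are those of the library.\<close>

class complex_inner = real_inner +
  fixes scaleC :: "complex \<Rightarrow> 'a \<Rightarrow> 'a"  (infixr "*\<^sub>C" 75)
    and cinner :: "'a \<Rightarrow> 'a \<Rightarrow> complex"
  assumes scaleC_add_right: "c *\<^sub>C (x + y) = c *\<^sub>C x + c *\<^sub>C y"
    and scaleC_add_left: "(c + d) *\<^sub>C x = c *\<^sub>C x + d *\<^sub>C x"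
    and scaleC_scaleC: "c *\<^sub>C d *\<^sub>C x = (c * d) *\<^sub>C x"
    and scaleR_scaleC: "r *\<^sub>R x = complex_of_real r *\<^sub>C x"
    and cinner_commute: "cinner x y = cnj (cinner y x)"
    and cinner_add_right: "cinner x (y + z) = cinner x y + cinner x z"
    and cinner_scaleC_right: "cinner x (c *\<^sub>C y) = c * cinner x y"
    and inner_eq_Re_cinner: "inner x y = Re (cinner x y)"

instantiation vec :: (complex_inner, finite) complex_inner
begin

definition "c *\<^sub>C x = (\<chi> i. c *\<^sub>C (x $ i))"
definition "cinner x y = (\<Sum>i\<in>UNIV. cinner (x $ i) (y $ i))"

instance
proof
  fix x y z :: "'a ^ 'b" and c d :: complex and r :: real
  show "c *\<^sub>C (x + y) = c *\<^sub>C x + c *\<^sub>C y"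
    by (simp add: scaleC_vec_def vec_eq_iff scaleC_add_right)
  show "(c + d) *\<^sub>C x = c *\<^sub>C x + d *\<^sub>C x"
    by (simp add: scaleC_vec_def vec_eq_iff scaleC_add_left)
  show "c *\<^sub>C d *\<^sub>C x = (c * d) *\<^sub>C x"
    by (simp add: scaleC_vec_def vec_eq_iff scaleC_scaleC)
  show "r *\<^sub>R x = complex_of_real r *\<^sub>C x"
    by (simp add: scaleC_vec_def vec_eq_iff scaleR_scaleC)
  show "cinner x y = cnj (cinner y x)"
    unfolding cinner_vec_def cnj_sum by (rule sum.cong[OF refl], rule cinner_commute)
  show "cinner x (y + z) = cinner x y + cinner x z"
    by (simp add: cinner_vec_def cinner_add_right sum.distrib)
  show "cinner x (c *\<^sub>C y) = c * cinner x y"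
    by (simp add: cinner_vec_def scaleC_vec_def cinner_scaleC_right sum_distrib_left)
  show "inner x y = Re (cinner x y)"
    by (simp add: cinner_vec_def inner_vec_def inner_eq_Re_cinner)
qed

end

section \<open>Unbounded operators\<close>

text \<open>A possibly unbounded operator is represented by its graph; its domain is \<open>Domain A\<close>,
  the identity is \<open>Id\<close>, and sums and products carry their natural domains.\<close>

type_synonym 'a operator = "('a \<times> 'a) set"

definition fun_graph :: "('a \<Rightarrow> 'a) \<Rightarrow> 'a operator" where
  "fun_graph F = {(x, F x) |x. True}"

definition op_add :: "'a::complex_inner operator \<Rightarrow> 'a operator \<Rightarrow> 'a operator" where
  "op_add A B = {(x, y + z) |x y z. (x, y) \<in> A \<and> (x, z) \<in> B}"

definition op_scale :: "complex \<Rightarrow> 'a::complex_inner operator \<Rightarrow> 'a operator" where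
  "op_scale c A = {(x, c *\<^sub>C y) |x y. (x, y) \<in> A}"

definition op_diff :: "'a::complex_inner operator \<Rightarrow> 'a operator \<Rightarrow> 'a operator" where
  "op_diff A B = op_add A (op_scale (-1) B)"

definition op_comp :: "'a operator \<Rightarrow> 'a operator \<Rightarrow> 'a operator" where
  "op_comp A B = B O A"

definition op_inverse :: "'a operator \<Rightarrow> 'a operator" where
  "op_inverse A = A\<inverse>"

definition adjoint_op :: "'a::complex_inner operator \<Rightarrow> 'a operator" where
  "adjoint_op A = {(x, y). \<forall>(u, v)\<in>A. cinner x v = cinner y u}"

definition self_adjoint :: "'a::complex_inner operator \<Rightarrow> bool" where
  "self_adjoint A \<longleftrightarrow> closure (Domain A) = UNIV \<and> adjoint_op A = A"

definition positive_op :: "'a::complex_inner operator \<Rightarrow> bool" where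
  "positive_op A \<longleftrightarrow> (\<forall>(x, y)\<in>A. 0 \<le> Re (cinner x y))"

definition op_sqrt :: "'a::complex_inner operator \<Rightarrow> 'a operator" where
  "op_sqrt A = (THE B. self_adjoint B \<and> positive_op B \<and> op_comp B B = A)"

definition japanese_bracket :: "'a::complex_inner operator \<Rightarrow> 'a operator" where
  "japanese_bracket A = op_sqrt (op_add (op_comp A A) Id)"

definition resolvent :: "'a::complex_inner operator \<Rightarrow> complex \<Rightarrow> 'a operator" where
  "resolvent A \<zeta> = op_inverse (op_diff A (op_scale \<zeta> Id))"

definition point_spectrum :: "'a::complex_inner operator \<Rightarrow> complex set" where
  "point_spectrum A = {\<mu>. \<exists>x. x \<noteq> 0 \<and> (x, \<mu> *\<^sub>C x) \<in> A}"

text \<open>The norm bound includes that the operator is everywhere defined and bounded.\<close>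

definition op_norm_le :: "'a::complex_inner operator \<Rightarrow> real \<Rightarrow> bool" where
  "op_norm_le A C \<longleftrightarrow> (\<exists>F. bounded_linear F \<and> A = fun_graph F \<and> onorm F \<le> C)"

definition orth_projection :: "'a::complex_inner set \<Rightarrow> 'a \<Rightarrow> 'a" where
  "orth_projection S x = (THE y. y \<in> S \<and> (\<forall>s\<in>S. cinner s (x - y) = 0))"

definition bounded_clinear :: "('a::complex_inner \<Rightarrow> 'a) \<Rightarrow> bool" where
  "bounded_clinear F \<longleftrightarrow> bounded_linear F \<and> (\<forall>c x. F (c *\<^sub>C x) = c *\<^sub>C F x)"

definition unitary_op :: "('a::complex_inner \<Rightarrow> 'a) \<Rightarrow> bool" where
  "unitary_op U \<longleftrightarrow> bounded_clinear U \<and> surj U \<and> (\<forall>x y. cinner (U x) (U y) = cinner x y)"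

definition unitary_group :: "(real \<Rightarrow> 'a::complex_inner \<Rightarrow> 'a) \<Rightarrow> bool" where
  "unitary_group U \<longleftrightarrow> (\<forall>t. unitary_op (U t)) \<and> U 0 = id \<and> (\<forall>s t. U (s + t) = U s \<circ> U t)
     \<and> (\<forall>x. continuous_on UNIV (\<lambda>t. U t x))"

text \<open>The operator \<open>A\<close> with \<open>U t = exp (- \<i> t A)\<close>, that is \<open>A x = \<i> (d/dt) U t x\<close> at \<open>t = 0\<close>,
  defined where this derivative exists.\<close>

definition generator :: "(real \<Rightarrow> 'a::complex_inner \<Rightarrow> 'a) \<Rightarrow> 'a operator" where
  "generator U = {(x, y). ((\<lambda>t. \<i> *\<^sub>C ((U t x - x) /\<^sub>R t)) \<longlongrightarrow> y) (at 0)}"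

text \<open>The unitary group \<open>t \<mapsto> exp (- \<i> t A)\<close> of a self-adjoint operator \<open>A\<close>.\<close>

definition exp_group :: "'a::complex_inner operator \<Rightarrow> real \<Rightarrow> 'a \<Rightarrow> 'a" where
  "exp_group A = (THE U. unitary_group U \<and> generator U = A)"

section \<open>Square-integrable functions\<close>

class measured =
  fixes volume :: "'a measure"

instantiation vec :: (euclidean_space, finite) measured
begin
definition volume_vec :: "('a ^ 'b) measure" where "volume_vec = lborel"
instance ..
end

definition square_integrable :: "('a::measured \<Rightarrow> complex) \<Rightarrow> bool" where
  "square_integrable f \<longleftrightarrow>
     f \<in> borel_measurable volume \<and> integrable volume (\<lambda>x. (cmod (f x))\<^sup>2)"

lemma square_integrable_zero: "square_integrable (\<lambda>x. 0)"
  by (simp add: square_integrable_def)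

lemma square_integrable_add:
  assumes "square_integrable f" "square_integrable g"
  shows "square_integrable (\<lambda>x. f x + g x)"
  unfolding square_integrable_def
proof
  have [measurable]: "f \<in> borel_measurable volume" "g \<in> borel_measurable volume"
    using assms by (auto simp: square_integrable_def)
  show "(\<lambda>x. f x + g x) \<in> borel_measurable volume" by measurable
  have "integrable volume (\<lambda>x. 2 * (cmod (f x))\<^sup>2 + 2 * (cmod (g x))\<^sup>2)"
    using assms by (auto simp: square_integrable_def)
  then show "integrable volume (\<lambda>x. (cmod (f x + g x))\<^sup>2)"
  proof (rule Bochner_Integration.integrable_bound)
    have "(cmod (a + b))\<^sup>2 \<le> 2 * (cmod a)\<^sup>2 + 2 * (cmod b)\<^sup>2" for a b :: complex
    proof -
      have "(cmod (a + b))\<^sup>2 \<le> (cmod a + cmod b)\<^sup>2"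
        by (intro power_mono norm_triangle_ineq) auto
      also have "\<dots> \<le> 2 * (cmod a)\<^sup>2 + 2 * (cmod b)\<^sup>2"
        using zero_le_power2[of "cmod a - cmod b"]
        unfolding power2_sum power2_diff by linarith
      finally show ?thesis .
    qed
    then show "AE x in volume. norm ((cmod (f x + g x))\<^sup>2)
        \<le> norm (2 * (cmod (f x))\<^sup>2 + 2 * (cmod (g x))\<^sup>2)"
      by (intro AE_I2) (simp only: real_norm_def abs_of_nonneg sum_power2_ge_zero
          zero_le_power2 add_nonneg_nonneg mult_nonneg_nonneg zero_le_numeral)
  qed measurable
qed

lemma square_integrable_scale:
  assumes "square_integrable f" shows "square_integrable (\<lambda>x. c * f x)"
  using assms by (auto simp: square_integrable_def norm_mult power_mult_distrib)

lemma cnj_measurable [measurable]: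
  "f \<in> borel_measurable M \<Longrightarrow> (\<lambda>x. cnj (f x)) \<in> borel_measurable M"
  by (rule borel_measurable_continuous_on[of cnj]) (auto intro: continuous_intros)

lemma square_integrable_inner:
  assumes "square_integrable f" "square_integrable g"
  shows "integrable volume (\<lambda>x. cnj (f x) * g x)"
proof -
  have [measurable]: "f \<in> borel_measurable volume" "g \<in> borel_measurable volume"
    using assms by (auto simp: square_integrable_def)
  have "integrable volume (\<lambda>x. (cmod (f x))\<^sup>2 + (cmod (g x))\<^sup>2)"
    using assms by (auto simp: square_integrable_def)
  then show ?thesis
  proof (rule Bochner_Integration.integrable_bound)
    have "cmod (cnj a * b) \<le> (cmod a)\<^sup>2 + (cmod b)\<^sup>2" for a b :: complex
    proof -
      have "2 * (cmod a * cmod b) \<le> (cmod a)\<^sup>2 + (cmod b)\<^sup>2"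
        using zero_le_power2[of "cmod a - cmod b"] unfolding power2_diff by linarith
      moreover have "0 \<le> cmod a * cmod b" by simp
      ultimately show ?thesis unfolding norm_mult complex_mod_cnj by linarith
    qed
    then show "AE x in volume. norm (cnj (f x) * g x)
        \<le> norm ((cmod (f x))\<^sup>2 + (cmod (g x))\<^sup>2)"
      by (intro AE_I2) (metis abs_ge_self order_trans real_norm_def)
  qed measurable
qed

quotient_type (overloaded) 'a L2 = "'a::measured \<Rightarrow> complex" / partial:
  "\<lambda>f g. square_integrable f \<and> square_integrable g \<and> (AE x in volume. f x = g x)"
proof (rule part_equivpI)
  show "\<exists>f :: 'a \<Rightarrow> complex. square_integrable f \<and> square_integrable f \<and> (AE x in volume. f x = f x)"
    using square_integrable_zero by auto
qed (auto simp: symp_def transp_def)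

text \<open>\<open>fun_of \<phi>\<close> is an arbitrary representative of \<open>\<phi>\<close>; \<open>L2_of f\<close> is the class of \<open>f\<close>,
  meaningful only for square-integrable \<open>f\<close>.\<close>

definition fun_of :: "'a::measured L2 \<Rightarrow> 'a \<Rightarrow> complex" where
  "fun_of \<phi> = rep_L2 \<phi>"

definition L2_of :: "('a::measured \<Rightarrow> complex) \<Rightarrow> 'a L2" where
  "L2_of f = abs_L2 f"

instantiation L2 :: (measured) complex_inner
begin

lift_definition zero_L2 :: "'a L2" is "\<lambda>x. 0"
  by (simp add: square_integrable_zero)

lift_definition plus_L2 :: "'a L2 \<Rightarrow> 'a L2 \<Rightarrow> 'a L2" is "\<lambda>f g x. f x + g x"
  by (auto intro: square_integrable_add)

lift_definition scaleC_L2 :: "complex \<Rightarrow> 'a L2 \<Rightarrow> 'a L2" is "\<lambda>c f x. c * f x"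
  by (auto intro: square_integrable_scale)

definition uminus_L2 :: "'a L2 \<Rightarrow> 'a L2" where "uminus_L2 \<phi> = (- 1) *\<^sub>C \<phi>"
definition minus_L2 :: "'a L2 \<Rightarrow> 'a L2 \<Rightarrow> 'a L2" where "minus_L2 \<phi> \<psi> = \<phi> + - \<psi>"
definition scaleR_L2 :: "real \<Rightarrow> 'a L2 \<Rightarrow> 'a L2" where "scaleR_L2 r \<phi> = complex_of_real r *\<^sub>C \<phi>"

lift_definition cinner_L2 :: "'a L2 \<Rightarrow> 'a L2 \<Rightarrow> complex" is
  "\<lambda>f g. LINT x|volume. cnj (f x) * g x"
  by (rule integral_cong_AE) (auto simp: square_integrable_def cnj_measurable)

definition inner_L2 :: "'a L2 \<Rightarrow> 'a L2 \<Rightarrow> real" where "inner_L2 \<phi> \<psi> = Re (cinner \<phi> \<psi>)"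
definition norm_L2 :: "'a L2 \<Rightarrow> real" where "norm_L2 \<phi> = sqrt (inner \<phi> \<phi>)"
definition sgn_L2 :: "'a L2 \<Rightarrow> 'a L2" where "sgn_L2 \<phi> = inverse (norm \<phi>) *\<^sub>R \<phi>"
definition dist_L2 :: "'a L2 \<Rightarrow> 'a L2 \<Rightarrow> real" where "dist_L2 \<phi> \<psi> = norm (\<phi> - \<psi>)"
definition uniformity_L2 :: "('a L2 \<times> 'a L2) filter" where
  "uniformity_L2 = (INF e\<in>{0<..}. principal {(x, y). dist x y < e})"
definition open_L2 :: "'a L2 set \<Rightarrow> bool" where
  "open_L2 S = (\<forall>x\<in>S. \<forall>\<^sub>F (x', y) in uniformity. x' = x \<longrightarrow> y \<in> S)"

instance
proof
  fix x y z :: "'a L2" and c d :: complex and r s :: real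
  show add_assoc: "x + y + z = x + (y + z)"
    by transfer (auto simp: add.assoc intro!: square_integrable_add)
  show add_comm: "x + y = y + x"
    by transfer (auto simp: add.commute intro!: square_integrable_add)
  show "0 + x = x" by transfer auto
  show "- x + x = 0" unfolding uminus_L2_def
    by transfer (auto intro!: square_integrable_add square_integrable_zero
        square_integrable_scale[where c = "-1", simplified])
  show "x - y = x + - y" by (rule minus_L2_def)
  show scC_addr: "c *\<^sub>C (x + y) = c *\<^sub>C x + c *\<^sub>C y" for c and x y :: "'a L2"
    by transfer (auto simp: distrib_left intro!: square_integrable_add square_integrable_scale)
  show scC_addl: "(c + d) *\<^sub>C x = c *\<^sub>C x + d *\<^sub>C x" for c d and x :: "'a L2"
    by transfer (auto simp: distrib_right intro!: square_integrable_add square_integrable_scale)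
  show scC_scC: "c *\<^sub>C d *\<^sub>C x = (c * d) *\<^sub>C x" for c d and x :: "'a L2"
    by transfer (auto simp: mult.assoc intro!: square_integrable_scale)
  show "r *\<^sub>R x = complex_of_real r *\<^sub>C x" by (rule scaleR_L2_def)
  show "r *\<^sub>R (x + y) = r *\<^sub>R x + r *\<^sub>R y" by (simp add: scaleR_L2_def scC_addr)
  show "(r + s) *\<^sub>R x = r *\<^sub>R x + s *\<^sub>R x" by (simp add: scaleR_L2_def scC_addl)
  show "r *\<^sub>R s *\<^sub>R x = (r * s) *\<^sub>R x" by (simp add: scaleR_L2_def scC_scC)
  show "1 *\<^sub>R x = x" unfolding scaleR_L2_def by transfer auto
  show comm: "cinner x y = cnj (cinner y x)" for x y :: "'a L2"
    by transfer (simp flip: Bochner_Integration.integral_cnj add: mult.commute)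
  show addr: "cinner x (y + z) = cinner x y + cinner x z" for x y z :: "'a L2"
  proof transfer
    fix x y z :: "'a \<Rightarrow> complex"
    assume "square_integrable x \<and> square_integrable x \<and> (AE t in volume. x t = x t)"
      "square_integrable y \<and> square_integrable y \<and> (AE t in volume. y t = y t)"
      "square_integrable z \<and> square_integrable z \<and> (AE t in volume. z t = z t)"
    then show "(LINT t|volume. cnj (x t) * (y t + z t))
        = (LINT t|volume. cnj (x t) * y t) + (LINT t|volume. cnj (x t) * z t)"
      by (simp add: distrib_left square_integrable_inner)
  qed
  show scr: "cinner x (c *\<^sub>C y) = c * cinner x y" for x y :: "'a L2" and c
    by transfer (simp add: mult.left_commute)
  show "inner x y = Re (cinner x y)" by (rule inner_L2_def)
  show "inner x y = inner y x"
    unfolding inner_L2_def by (subst comm) simp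
  show "inner (x + y) z = inner x z + inner y z"
    unfolding inner_L2_def by (subst (1 2 3) comm) (simp add: addr)
  show "inner (r *\<^sub>R x) y = r * inner x y"
    unfolding inner_L2_def scaleR_L2_def by (subst (1 2) comm) (simp add: scr)
  have Re_cinner: "Re (cinner x x) = (LINT t|volume. (cmod (fun_of x t))\<^sup>2)
      \<and> square_integrable (fun_of x)" for x :: "'a L2"
  proof -
    have sq: "square_integrable (fun_of x)"
      using Quotient_rep_reflp[OF Quotient_L2, of x] by (simp add: fun_of_def)
    have "cinner x x = (LINT t|volume. cnj (fun_of x t) * fun_of x t)"
      by (simp add: cinner_L2_def fun_of_def)
    also have "\<dots> = (LINT t|volume. complex_of_real ((cmod (fun_of x t))\<^sup>2))"
      by (rule arg_cong[where f = "integral\<^sup>L _"]) (auto simp: complex_norm_square mult.commute simp del: of_real_power)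
    also have "\<dots> = complex_of_real (LINT t|volume. (cmod (fun_of x t))\<^sup>2)"
      by (rule integral_complex_of_real)
    finally show ?thesis using sq by simp
  qed
  show "0 \<le> inner x x"
    using Re_cinner[of x] by (simp add: inner_L2_def)
  show "inner x x = 0 \<longleftrightarrow> x = 0"
  proof
    assume "inner x x = 0"
    then have "(LINT t|volume. (cmod (fun_of x t))\<^sup>2) = 0"
      using Re_cinner[of x] by (simp add: inner_L2_def)
    then have "AE t in volume. (cmod (fun_of x t))\<^sup>2 = 0"
      using Re_cinner[of x]
      by (subst (asm) integral_nonneg_eq_0_iff_AE) (auto simp: square_integrable_def)
    then have ae: "AE t in volume. fun_of x t = 0" by simp
    have "x = abs_L2 (fun_of x)"
      unfolding fun_of_def by (simp add: Quotient_abs_rep[OF Quotient_L2])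
    also have "\<dots> = abs_L2 (\<lambda>t. 0)"
      using ae Re_cinner[of x] square_integrable_zero
      by (intro Quotient_rel_abs[OF Quotient_L2]) auto
    finally show "x = 0" by (simp add: zero_L2_def)
  next
    assume "x = 0"
    moreover have "(0 :: 'a L2) + 0 = 0" by transfer (simp add: square_integrable_zero)
    ultimately show "inner x x = 0" using addr[of x x x] by (simp add: inner_L2_def)
  qed
qed (simp_all add: norm_L2_def sgn_L2_def dist_L2_def uniformity_L2_def open_L2_def)

end

definition multiplication_op :: "('a::measured \<Rightarrow> complex) \<Rightarrow> 'a L2 operator" where
  "multiplication_op w = {(\<phi>, \<psi>). AE k in volume. fun_of \<psi> k = w k * fun_of \<phi> k}"

section \<open>Bosonic Fock space\<close>

text \<open>The \<open>n\<close>-fold symmetric tensor power of \<open>'a L2\<close> is the space of symmetric square-integrable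
  functions of \<open>n\<close> variables. A symmetric function of \<open>n\<close> variables is a function of multisets
  of size \<open>n\<close>, so Fock space (the Hilbert sum over all \<open>n\<close>) is the \<open>L2\<close>-space of finite multisets;
  the multisets of size \<open>n\<close> carry the image of the \<open>n\<close>-fold product measure.\<close>

definition configuration :: "nat \<Rightarrow> (nat \<Rightarrow> 'a) \<Rightarrow> 'a multiset" where
  "configuration n x = mset (map x [0..<n])"

abbreviation particle_space :: "nat \<Rightarrow> (nat \<Rightarrow> 'a::measured) measure" where
  "particle_space n \<equiv> PiM {..<n} (\<lambda>_. volume)"

definition preconfiguration :: "nat \<Rightarrow> 'a::measured multiset set \<Rightarrow> (nat \<Rightarrow> 'a) set" where
  "preconfiguration n A = configuration n -` A \<inter> space (particle_space n)"

instantiation multiset :: (measured) measured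
begin

definition volume_multiset :: "'a multiset measure" where
  "volume_multiset = measure_of UNIV
     {A. \<forall>n. preconfiguration n A \<in> sets (particle_space n)}
     (\<lambda>A. \<Sum>n. emeasure (particle_space n) (preconfiguration n A))"

instance ..

end

lemma sigma_algebra_multiset:
  "sigma_algebra UNIV {A :: 'a::measured multiset set.
     \<forall>n. preconfiguration n A \<in> sets (particle_space n)}"
proof (rule sigma_algebra_iff2[THEN iffD2], intro conjI ballI allI impI)
  let ?S = "{A :: 'a multiset set. \<forall>n. preconfiguration n A \<in> sets (particle_space n)}"
  show "{} \<in> ?S" by (simp add: preconfiguration_def)
  show "UNIV - s \<in> ?S" if "s \<in> ?S" for s
  proof -
    have "preconfiguration n (UNIV - s) = space (particle_space n) - preconfiguration n s" for n
      by (auto simp: preconfiguration_def)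
    then show ?thesis using that by auto
  qed
  show "(\<Union>i. F i) \<in> ?S" if "range F \<subseteq> ?S" for F :: "nat \<Rightarrow> 'a multiset set"
  proof -
    have "preconfiguration n (\<Union>i. F i) = (\<Union>i. preconfiguration n (F i))" for n
      by (auto simp: preconfiguration_def)
    then show ?thesis using that by (auto intro!: sets.countable_UN)
  qed
qed simp

lemma sets_volume_multiset:
  "sets (volume :: 'a::measured multiset measure)
     = {A. \<forall>n. preconfiguration n A \<in> sets (particle_space n)}"
  unfolding volume_multiset_def
  by (rule sigma_algebra.sets_measure_of_eq[OF sigma_algebra_multiset])

lemma emeasure_volume_multiset:
  assumes "A \<in> sets (volume :: 'a::measured multiset measure)"
  shows "emeasure volume A = (\<Sum>n. emeasure (particle_space n) (preconfiguration n A))"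
  unfolding volume_multiset_def
proof (rule emeasure_measure_of_sigma[OF sigma_algebra_multiset])
  let ?S = "{A :: 'a multiset set. \<forall>n. preconfiguration n A \<in> sets (particle_space n)}"
  let ?\<mu> = "\<lambda>A :: 'a multiset set. \<Sum>n. emeasure (particle_space n) (preconfiguration n A)"
  show "positive ?S ?\<mu>" by (simp add: positive_def preconfiguration_def)
  show "countably_additive ?S ?\<mu>"
  proof (rule countably_additiveI)
    fix F :: "nat \<Rightarrow> 'a multiset set"
    assume F: "range F \<subseteq> ?S" "disjoint_family F"
    have "(\<Sum>i. ?\<mu> (F i)) = (\<Sum>n. \<Sum>i. emeasure (particle_space n) (preconfiguration n (F i)))"
      using nn_integral_suminf[of "\<lambda>i n. emeasure (particle_space n) (preconfiguration n (F i))"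
          "count_space UNIV"]
      by (simp add: nn_integral_count_space_nat)
    also have "\<dots> = ?\<mu> (\<Union>i. F i)"
    proof (rule suminf_cong)
      fix n
      have "preconfiguration n (\<Union>i. F i) = (\<Union>i. preconfiguration n (F i))"
        by (auto simp: preconfiguration_def)
      moreover have "disjoint_family (\<lambda>i. preconfiguration n (F i))"
        using F(2) by (auto simp: disjoint_family_on_def preconfiguration_def)
      ultimately show "(\<Sum>i. emeasure (particle_space n) (preconfiguration n (F i)))
          = emeasure (particle_space n) (preconfiguration n (\<Union>i. F i))"
        using F(1) by (subst suminf_emeasure) auto
    qed
    finally show "(\<Sum>i. ?\<mu> (F i)) = ?\<mu> (\<Union>i. F i)" .
  qed
  show "A \<in> ?S" using assms by (simp add: sets_volume_multiset)
qed

type_synonym 'a fock = "'a multiset L2"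

definition vacuum :: "'a::measured fock" where
  "vacuum = L2_of (\<lambda>X. if X = {#} then 1 else 0)"

text \<open>\<open>(a(h) \<psi>)(k\<^sub>1, \<dots>, k\<^sub>n) = sqrt (n + 1) \<integral> cnj (h k) \<psi>(k, k\<^sub>1, \<dots>, k\<^sub>n) dk\<close>, defined for all \<open>\<psi>\<close>
  for which the right-hand side belongs to Fock space.\<close>

definition annihilation :: "'a::measured L2 \<Rightarrow> 'a fock operator" where
  "annihilation h = {(\<psi>, \<eta>). AE X in volume. fun_of \<eta> X =
     complex_of_real (sqrt (real (size X) + 1))
       * (LINT k|volume. cnj (fun_of h k) * fun_of \<psi> (add_mset k X))}"

definition creation :: "'a::measured L2 \<Rightarrow> 'a fock operator" where
  "creation h = adjoint_op (annihilation h)"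

text \<open>The symmetrisation of \<open>h\<^sub>1 \<otimes> \<dots> \<otimes> h\<^sub>n\<close>: its value at a multiset is the average over all
  orderings of the multiset.\<close>

definition sym_tensor :: "'a::measured L2 list \<Rightarrow> 'a fock" where
  "sym_tensor hs = L2_of (\<lambda>X. if size X = length hs then
     (\<Sum>ks\<in>permutations_of_multiset X. \<Prod>i<length hs. fun_of (hs ! i) (ks ! i))
       / of_nat (card (permutations_of_multiset X)) else 0)"

text \<open>\<open>\<Gamma>(U)\<close> is the bounded operator restricting to \<open>U \<otimes> \<dots> \<otimes> U\<close> on every symmetric tensor power;
  it is determined by its values on symmetrised product vectors.\<close>

definition second_quant :: "('a::measured L2 \<Rightarrow> 'a L2) \<Rightarrow> 'a fock \<Rightarrow> 'a fock" where
  "second_quant U = (THE T. bounded_clinear T \<and>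
     (\<forall>hs. T (sym_tensor hs) = sym_tensor (map U hs)))"

definition dGamma :: "'a::measured L2 operator \<Rightarrow> 'a fock operator" where
  "dGamma A = generator (\<lambda>t. second_quant (exp_group A t))"

section \<open>The spin-boson model\<close>

text \<open>\<open>\<complex>\<^sup>2 \<otimes> \<F>\<close> is realised as \<open>\<F>\<^sup>2\<close>.\<close>

type_synonym state = "(real ^ 3) fock ^ 2"

definition pure_tensor :: "complex ^ 2 \<Rightarrow> (real ^ 3) fock \<Rightarrow> state" where
  "pure_tensor v \<psi> = (\<chi> i. (v $ i) *\<^sub>C \<psi>)"

text \<open>\<open>M \<otimes> A\<close> with domain \<open>\<complex>\<^sup>2 \<otimes> Domain A\<close>.\<close>

definition tensor_op :: "complex ^ 2 ^ 2 \<Rightarrow> (real ^ 3) fock operator \<Rightarrow> state operator" where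
  "tensor_op M A = {(x, \<chi> i. \<Sum>j\<in>UNIV. (M $ i $ j) *\<^sub>C (y $ j)) |x y. \<forall>j. (x $ j, y $ j) \<in> A}"

definition \<omega> :: "real \<Rightarrow> real ^ 3 \<Rightarrow> real" where
  "\<omega> m k = sqrt ((norm k)\<^sup>2 + m\<^sup>2)"

definition form_factor :: "real \<Rightarrow> real \<Rightarrow> (real ^ 3) L2" where
  "form_factor m \<Lambda> =
     L2_of (\<lambda>k. complex_of_real (exp (- (norm k)\<^sup>2 / \<Lambda>\<^sup>2) * \<omega> m k powr (- 1 / 2)))"

definition H_field :: "real \<Rightarrow> (real ^ 3) fock operator" where
  "H_field m = dGamma (multiplication_op (\<lambda>k. complex_of_real (\<omega> m k)))"

definition K_matrix :: "real \<Rightarrow> real \<Rightarrow> complex ^ 2 ^ 2" where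
  "K_matrix e0 e1 = vector [vector [complex_of_real e1, 0], vector [0, complex_of_real e0]]"

definition \<sigma>\<^sub>1 :: "complex ^ 2 ^ 2" where
  "\<sigma>\<^sub>1 = vector [vector [0, 1], vector [1, 0]]"

definition H\<^sub>0 :: "real \<Rightarrow> real \<Rightarrow> real \<Rightarrow> state operator" where
  "H\<^sub>0 m e0 e1 = op_add (tensor_op (K_matrix e0 e1) Id) (tensor_op (mat 1) (H_field m))"

definition V :: "real \<Rightarrow> real \<Rightarrow> state operator" where
  "V m \<Lambda> = tensor_op \<sigma>\<^sub>1
     (op_add (annihilation (form_factor m \<Lambda>)) (creation (form_factor m \<Lambda>)))"

definition H :: "real \<Rightarrow> real \<Rightarrow> real \<Rightarrow> real \<Rightarrow> real \<Rightarrow> state operator" where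
  "H m \<Lambda> e0 e1 g = op_add (H\<^sub>0 m e0 e1) (op_scale (complex_of_real g) (V m \<Lambda>))"

definition \<phi>\<^sub>1 :: "complex ^ 2" where
  "\<phi>\<^sub>1 = vector [1, 0]"

definition P :: "state \<Rightarrow> state" where
  "P = orth_projection {c *\<^sub>C pure_tensor \<phi>\<^sub>1 vacuum |c. True}"

definition P_bar :: "state operator" where
  "P_bar = op_diff Id (fun_graph P)"

definition compress :: "state operator \<Rightarrow> state operator" where
  "compress A = op_comp P_bar (op_comp A P_bar)"

definition dilation :: "real \<Rightarrow> (real ^ 3) L2 \<Rightarrow> (real ^ 3) L2" where
  "dilation \<beta> \<phi> = L2_of (\<lambda>k. complex_of_real (exp (3 * \<beta> / 2)) * fun_of \<phi> (exp \<beta> *\<^sub>R k))"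

definition D :: "(real ^ 3) L2 operator" where
  "D = generator dilation"

definition weight :: "state operator" where
  "weight = op_inverse (japanese_bracket (tensor_op (mat 1) (dGamma D)))"

definition weighted :: "state operator \<Rightarrow> state operator" where
  "weighted A = op_comp weight (op_comp A weight)"

definition mN :: "real \<Rightarrow> real set" where
  "mN m = {m * real n |n. n \<ge> 1}"

definition \<delta> :: "real \<Rightarrow> real \<Rightarrow> real \<Rightarrow> real" where
  "\<delta> m e0 e1 = infdist (e1 - e0) (mN m)"

end

theory Submission
  imports Defs "HOL-Complex_Analysis.Complex_Analysis" "HOL-Probability.Distributions"
begin

text \<open>The proof uses complex dilations. Conjugation with the dilation group replaces \<open>\<omega>\<close> and the form
  factor by dilated versions, which are analytic in the dilation parameter \<open>th\<close>. If \<open>Im th = \<mp>\<epsilon>\<close> has the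
  sign opposite to \<open>Im ze\<close>, the dilated field energy gains an imaginary part of size at least
  \<open>\<epsilon> \<Sum>(\<omega> - m) / 16\<close>, and close to the energy shell \<open>\<Sum>(\<omega> - m) \<ge> \<delta> / 2\<close> because \<open>e\<^sub>1\<close> has distance \<open>\<delta>\<close>
  from \<open>m\<nat>\<close>. Hence the dilated resolvent \<open>G\<close> satisfies \<open>\<parallel>G v\<parallel>\<^sup>2 \<le> C (\<parallel>v\<parallel>\<^sup>2 + \<bar>\<langle>v, G v\<rangle>\<bar> / \<epsilon>)\<close>. By analyticity
  and covariance, the derivative of \<open>\<langle>u, G v\<rangle>\<close> in \<open>\<epsilon>\<close> is bounded by \<open>\<parallel>A u\<parallel> \<parallel>G v\<parallel> + \<parallel>G\<^sup>* u\<parallel> \<parallel>A v\<parallel>\<close> with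
  \<open>A = d\<Gamma>(D)\<close>, hence by \<open>C \<epsilon>\<^sup>-\<^sup>1\<^sup>/\<^sup>2\<close>, which is integrable at \<open>\<epsilon> = 0\<close>. For the difference of the two
  resolvents the derivative is also bounded by \<open>C \<kappa> \<epsilon>\<^sup>-\<^sup>3\<^sup>/\<^sup>2\<close> with \<open>\<kappa> = g + \<bar>z - z'\<bar>\<close>; splitting the
  integral at \<open>\<epsilon> = \<kappa>\<close> gives \<open>C \<kappa>\<^sup>1\<^sup>/\<^sup>2\<close>.\<close>

text \<open>All operators are made bounded. Vectors of the domain are written as \<open>R0 y\<close>
  with \<open>R0 = (1 + H\<^sub>0)^-1\<close>, and \<open>(H - ze) R0\<close> becomes the family
  \<open>Q\<close>, built from bounded multipliers and from the field operator relative to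
  \<open>(N + 1)^(1/2)\<close>; here \<open>m > 0\<close> enters, since it bounds the particle
  number by the free energy. No commutator with the unbounded generator has to be given a meaning:
  real dilations act unitarily, so the analytic derivative, computed in the real direction, falls on
  the two test vectors. The compression is what makes escape possible: \<phi>1 \<otimes> \<Omega>
  lies in the energy window but has no particle to dilate. The interaction costs only
  \<open>g\<close> times the gain, because it is symmetric for real dilations. The bound for
  \<open>G v\<close> contains \<langle>v, G v\<rangle> itself, so diagonal matrix elements are
  treated before all others, by absorption on a short interval. Since \<open>op_sqrt\<close>,
  \<open>exp_group\<close> and \<open>second_quant\<close> are unique descriptions, uniqueness of
  roots and groups and totality of symmetric tensors have to be established as well.\<close>

notation LIMSEQ (infix "---->" 60)

abbreviation cx :: "real => complex" where "cx \<equiv> complex_of_real"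

abbreviation cfg :: "nat => (nat => 'a) => 'a multiset" where "cfg \<equiv> configuration"

abbreviation bmv :: "('a::measured => 'b::topological_space) set" where "bmv \<equiv> borel_measurable volume"

section \<open>Hilbert spaces\<close>

lemma scaleC_one [simp]: "1 *\<^sub>C x = (x::'a::complex_inner)"
  using scaleR_scaleC[of 1 x] by simp

lemma scaleC_zero_left [simp]: "0 *\<^sub>C x = (0::'a::complex_inner)"
  using scaleR_scaleC[of 0 x] by simp

lemma scaleC_zero_right [simp]: "c *\<^sub>C 0 = (0::'a::complex_inner)"
  using scaleC_add_right[of c 0 0] by simp

lemma scaleC_minus_right: "c *\<^sub>C (- x) = - (c *\<^sub>C (x::'a::complex_inner))"
  using scaleC_add_right[of c x "-x"] by (simp add: eq_neg_iff_add_eq_0 add.commute)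

lemma scaleC_minus_left: "(- c) *\<^sub>C x = - (c *\<^sub>C (x::'a::complex_inner))"
  using scaleC_add_left[of c "-c" x] by (simp add: eq_neg_iff_add_eq_0 add.commute)

lemma scaleC_minus_one [simp]: "(-1) *\<^sub>C x = - (x::'a::complex_inner)"
  by (simp add: scaleC_minus_left)

lemma scaleC_diff_right: "c *\<^sub>C (x - y) = c *\<^sub>C x - c *\<^sub>C (y::'a::complex_inner)"
  using scaleC_add_right[of c x "-y"] by (simp add: scaleC_minus_right)

lemma scaleC_diff_left: "(c - d) *\<^sub>C x = c *\<^sub>C x - d *\<^sub>C (x::'a::complex_inner)"
  using scaleC_add_left[of c "-d" x] by (simp add: scaleC_minus_left)

lemma cinner_add_left: "cinner (x + y) z = cinner x z + cinner y (z::'a::complex_inner)"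
  by (subst (1 2 3) cinner_commute) (simp add: cinner_add_right)

lemma cinner_scaleC_left: "cinner (c *\<^sub>C x) y = cnj c * cinner x (y::'a::complex_inner)"
  by (subst (1 2) cinner_commute) (simp add: cinner_scaleC_right)

lemma cinner_zero_right [simp]: "cinner x (0::'a::complex_inner) = 0"
  using cinner_add_right[of x 0 0] by simp

lemma cinner_zero_left [simp]: "cinner (0::'a::complex_inner) x = 0"
  using cinner_add_left[of 0 0 x] by simp

lemma cinner_minus_right: "cinner x (- y) = - cinner x (y::'a::complex_inner)"
  using cinner_scaleC_right[of x "-1" y] by simp

lemma cinner_minus_left: "cinner (- x) y = - cinner x (y::'a::complex_inner)"
  using cinner_scaleC_left[of "-1" x y] by simp

lemma cinner_diff_right: "cinner x (y - z) = cinner x y - cinner x (z::'a::complex_inner)"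
  using cinner_add_right[of x y "-z"] by (simp add: cinner_minus_right)

lemma cinner_diff_left: "cinner (x - y) z = cinner x z - cinner y (z::'a::complex_inner)"
  using cinner_add_left[of x "-y" z] by (simp add: cinner_minus_left)

lemma cinner_scaleR_right: "cinner x (r *\<^sub>R y) = of_real r * cinner x (y::'a::complex_inner)"
  by (simp add: scaleR_scaleC cinner_scaleC_right)

lemma cinner_scaleR_left: "cinner (r *\<^sub>R x) y = of_real r * cinner x (y::'a::complex_inner)"
  by (simp add: scaleR_scaleC cinner_scaleC_left)

lemma cinner_self: "cinner x x = of_real ((norm (x::'a::complex_inner))^2)"
proof (rule complex_eqI)
  show "Re (cinner x x) = Re (of_real ((norm x)^2))"
    using inner_eq_Re_cinner[of x x] by (simp add: power2_norm_eq_inner)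
  show "Im (cinner x x) = Im (of_real ((norm x)^2))"
    using arg_cong[OF cinner_commute[of x x], of Im] by simp
qed

lemma norm_scaleC: "norm (c *\<^sub>C x) = cmod c * norm (x::'a::complex_inner)"
proof -
  have "cx ((norm (c *\<^sub>C x))^2) = of_real ((cmod c * norm x)^2)"
    by (simp only: cinner_self[symmetric] cinner_scaleC_left cinner_scaleC_right)
       (simp add: cinner_self power_mult_distrib complex_norm_square[symmetric] mult.assoc[symmetric] mult.commute[of "cnj c"] del: of_real_power)
  then have "(norm (c *\<^sub>C x))^2 = (cmod c * norm x)^2" using of_real_eq_iff by blast
  then show ?thesis by (rule power2_eq_imp_eq) auto
qed

lemma cinner_le_norm: "cmod (cinner x y) <= norm x * norm (y::'a::complex_inner)"
proof (cases "cinner x y = 0")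
  case False
  \<comment> \<open>The phase \<open>c\<close> makes the inner product real and nonnegative, so that
    the Cauchy-Schwarz inequality of the underlying real space applies.\<close>
  define c where "c = cnj (cinner x y) / cmod (cinner x y)"
  have c: "cmod c = 1" using False by (simp add: c_def norm_divide)
  have "cinner x (c *\<^sub>C y) = of_real (cmod (cinner x y))"
    using False by (simp add: cinner_scaleC_right c_def complex_norm_square[symmetric] mult.commute power2_eq_square)
  then have "cmod (cinner x y) = inner x (c *\<^sub>C y)" by (simp add: inner_eq_Re_cinner)
  also have "... <= norm x * norm (c *\<^sub>C y)" by (rule norm_cauchy_schwarz)
  finally show ?thesis by (simp add: norm_scaleC c)
qed auto

lemma bounded_bilinear_cinner: "bounded_bilinear (cinner :: 'a::complex_inner => _)"
proof
  show "\<exists>K. \<forall>a b. norm (cinner (a::'a) b) <= norm a * norm b * K"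
    using cinner_le_norm by (intro exI[of _ 1]) auto
qed (auto simp: cinner_add_left cinner_add_right cinner_scaleR_left cinner_scaleR_right scaleR_conv_of_real)

lemma bounded_bilinear_scaleC: "bounded_bilinear ((*\<^sub>C) :: complex => 'a::complex_inner => 'a)"
proof
  show "\<exists>K. \<forall>a b. norm (a *\<^sub>C (b::'a)) <= norm a * norm b * K"
    by (intro exI[of _ 1]) (auto simp: norm_scaleC)
qed (auto simp: scaleC_add_left scaleC_add_right scaleR_scaleC scaleC_scaleC mult.commute scaleR_conv_of_real)

lemmas tendsto_cinner [tendsto_intros] = bounded_bilinear.tendsto[OF bounded_bilinear_cinner]
lemmas tendsto_scaleC [tendsto_intros] = bounded_bilinear.tendsto[OF bounded_bilinear_scaleC]
lemmas continuous_on_cinner [continuous_intros] = bounded_bilinear.continuous_on[OF bounded_bilinear_cinner]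
lemmas bounded_linear_scaleC = bounded_bilinear.bounded_linear_right[OF bounded_bilinear_scaleC]
lemmas bounded_linear_cinner_right = bounded_bilinear.bounded_linear_right[OF bounded_bilinear_cinner]

lemma cinner_eqI:
  assumes "!!u. cinner u x = cinner u (y::'a::complex_inner)" shows "x = y"
proof -
  have "cinner (x - y) (x - y) = 0" using assms[of "x - y"] by (simp add: cinner_diff_right)
  then show ?thesis by (simp add: cinner_self)
qed

lemma norm_le_by_cinner:
  assumes "!!u. cmod (cinner u x) <= c * norm (u::'a::complex_inner)" "0 <= c"
  shows "norm x <= c"
  using assms(1)[of x] assms(2) by (cases "x = 0") (auto simp: cinner_self norm_mult power2_eq_square)

text \<open>Used with \<open>c = 0\<close>: a vector orthogonal to a dense set, such as the domain
  of a self-adjoint operator, vanishes.\<close>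

lemma norm_le_by_cinner_dense:
  fixes x :: "'a::complex_inner"
  assumes "closure T = UNIV" "!!u. u \<in> T ==> cmod (cinner u x) <= c * norm u" "0 <= c"
  shows "norm x <= c"
proof (rule norm_le_by_cinner)
  fix u
  have "u \<in> closure T" using assms by simp
  then obtain f where f: "!!n. f n \<in> T" "f ----> u" unfolding closure_sequential by blast
  show "cmod (cinner u x) <= c * norm u"
    by (rule LIMSEQ_le[of "\<lambda>n. cmod (cinner (f n) x)" _ "\<lambda>n. c * norm (f n)"])
       (auto intro!: tendsto_intros f assms exI[of _ 0])
qed fact

section \<open>Closed subspaces, orthogonal projections, Riesz representation and adjoints\<close>

definition csubspace :: "'a::complex_inner set => bool" where
  "csubspace M \<longleftrightarrow> 0 \<in> M & (\<forall>x\<in>M. \<forall>y\<in>M. x + y \<in> M) & (\<forall>c. \<forall>x\<in>M. c *\<^sub>C x \<in> M)"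

lemma csubspaceD:
  assumes "csubspace M"
  shows "0 \<in> M" "x \<in> M ==> y \<in> M ==> x + y \<in> M" "x \<in> M ==> c *\<^sub>C x \<in> M"
    "x \<in> M ==> r *\<^sub>R x \<in> M" "x \<in> M ==> y \<in> M ==> x - y \<in> M"
proof -
  have d: "x + (-1) *\<^sub>C y \<in> M" if "x \<in> M" "y \<in> M" using that assms unfolding csubspace_def by blast
  then show "x \<in> M ==> y \<in> M ==> x - y \<in> M" by simp
qed (use assms in "auto simp: csubspace_def scaleR_scaleC")

lemma parallelogram: "(norm (x + y))^2 + (norm (x - y))^2 = 2 * (norm x)^2 + 2 * (norm (y::'a::real_inner))^2"
  by (simp add: power2_norm_eq_inner inner_add_left inner_add_right inner_diff_left inner_diff_right)

text \<open>A minimising sequence is Cauchy by the parallelogram identity. At the minimum the first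
  variation vanishes, which gives orthogonality for the real inner product; replacing
  \<open>s\<close> by \<open>\<i> *\<^sub>C s\<close> gives the imaginary part.\<close>

theorem projection_exists:
  fixes x :: "'a::{complex_inner,banach}"
  assumes M: "csubspace M" "closed M"
  obtains p where "p \<in> M" "!!s. s \<in> M ==> cinner s (x - p) = 0"
proof -
  note M' = csubspaceD[OF M(1)]
  define d where "d = infdist x M"
  have ne: "M ~= {}" using M'(1) by auto
  have d_le: "d <= norm (x - s)" if "s \<in> M" for s
    using infdist_le[OF that, of x] by (simp add: d_def dist_norm)
  have "\<exists>s\<in>M. norm (x - s) < d + 1 / real (Suc n)" for n
  proof (rule ccontr)
    assume "\<not> (\<exists>s\<in>M. norm (x - s) < d + 1 / real (Suc n))"
    then have "d + 1 / real (Suc n) <= infdist x M" unfolding infdist_notempty[OF ne]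
      by (intro cINF_greatest ne) (auto simp: dist_norm not_less)
    then show False by (simp add: d_def)
  qed
  then obtain f where f: "!!n. f n \<in> M" "!!n. norm (x - f n) < d + 1 / real (Suc n)" by metis
  have lim: "(\<lambda>n. norm (x - f n)) ----> d"
  proof (rule real_tendsto_sandwich[of "\<lambda>n. d" _ _ "\<lambda>n. d + 1 / real (Suc n)"])
    show "(\<lambda>n. d + 1 / real (Suc n)) ----> d"
      using tendsto_add[OF tendsto_const[of d] LIMSEQ_inverse_real_of_nat]
      by (simp add: inverse_eq_divide)
  qed (use f d_le in "auto intro!: always_eventually less_imp_le")
  have sq: "(norm (f i - f j))^2 <= 2 * (norm (x - f i))^2 + 2 * (norm (x - f j))^2 - 4 * d^2" for i j
  proof -
    have "d <= norm (x - (1/2) *\<^sub>R (f i + f j))" using f by (intro d_le M') auto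
    also have "x - (1/2) *\<^sub>R (f i + f j) = (1/2) *\<^sub>R ((x - f i) + (x - f j))"
      by (simp add: algebra_simps scaleR_2[symmetric] flip: scaleR_add_left)
    finally have "2 * d <= norm ((x - f i) + (x - f j))" by simp
    moreover have "0 <= d" by (simp add: d_def infdist_nonneg)
    ultimately have "4 * d^2 <= (norm ((x - f i) + (x - f j)))^2"
      using power_mono[of "2*d" "norm ((x - f i) + (x - f j))" 2] by (simp add: power_mult_distrib)
    then show ?thesis using parallelogram[of "x - f i" "x - f j"] by (simp add: norm_minus_commute)
  qed
  have "Cauchy f"
  proof (rule metric_CauchyI)
    fix e :: real assume e: "0 < e"
    have "(\<lambda>n. (norm (x - f n))^2) ----> d^2" by (intro tendsto_intros lim)
    then have "\<forall>\<^sub>F n in sequentially. (norm (x - f n))^2 < d^2 + e^2 / 4"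
      by (rule order_tendstoD) (use e in auto)
    then obtain N where N: "!!n. n >= N ==> (norm (x - f n))\<^sup>2 < d^2 + e^2 / 4"
      by (auto simp: eventually_sequentially)
    have "dist (f i) (f j) < e" if "i >= N" "j >= N" for i j
    proof -
      have "(norm (f i - f j))^2 < e^2" using sq[of i j] N[OF that(1)] N[OF that(2)] by linarith
      then show ?thesis using e by (simp add: dist_norm power_less_imp_less_base)
    qed
    then show "\<exists>N. \<forall>i\<ge>N. \<forall>j\<ge>N. dist (f i) (f j) < e" by blast
  qed
  then obtain p where p: "f ----> p" by (auto simp: Cauchy_convergent_iff convergent_def)
  have pM: "p \<in> M" using closed_sequentially[OF M(2)] f(1) p by blast
  have "(\<lambda>n. norm (x - f n)) ----> norm (x - p)" by (intro tendsto_intros p)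
  then have dp: "norm (x - p) = d" using lim LIMSEQ_unique by blast
  have re: "inner s (x - p) = 0" if s: "s \<in> M" for s
  proof (cases "s = 0")
    case False
    \<comment> \<open>The minimiser in \<open>t\<close> of the squared distance from
      \<open>x\<close> to \<open>p + t *\<^sub>R s\<close>; unless \<open>s\<close> is already
      orthogonal to \<open>x - p\<close>, it would undercut \<open>d\<close>.\<close>
    define t where "t = inner s (x - p) / (norm s)^2"
    have "d^2 <= (norm (x - (p + t *\<^sub>R s)))^2"
      by (intro power_mono d_le M' pM s) (simp add: d_def infdist_nonneg)
    also have "x - (p + t *\<^sub>R s) = (x - p) - t *\<^sub>R s" by simp
    also have "(norm ((x - p) - t *\<^sub>R s))^2 = d^2 - 2 * t * inner s (x - p) + t^2 * (norm s)^2"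
      unfolding dp[symmetric] power2_norm_eq_inner by (simp add: inner_diff_left inner_diff_right inner_commute power2_eq_square algebra_simps)
    also have "... = d^2 - (inner s (x - p))^2 / (norm s)^2"
      using False by (simp add: t_def field_simps power2_eq_square)
    finally have "(inner s (x - p))^2 / (norm s)^2 <= 0" by simp
    then show ?thesis using False by (simp add: divide_le_0_iff)
  qed auto
  have "cinner s (x - p) = 0" if s: "s \<in> M" for s
  proof (rule complex_eqI)
    show "Re (cinner s (x - p)) = Re 0" using re[OF s] by (simp add: inner_eq_Re_cinner)
    show "Im (cinner s (x - p)) = Im 0"
      using re[OF M'(3)[OF s, of \<i>]] by (simp add: inner_eq_Re_cinner cinner_scaleC_left)
  qed
  then show ?thesis using that pM by blast
qed

text \<open>The density principle of the development: a closed linear condition holds for all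
  vectors as soon as only \<open>0\<close> is orthogonal to the vectors satisfying it.\<close>

lemma closed_csubspace_UNIV:
  fixes M :: "'a::{complex_inner,banach} set"
  assumes "csubspace M" "closed M" "!!x. (!!s. s \<in> M ==> cinner s x = 0) ==> x = 0"
  shows "M = UNIV"
proof -
  have "x \<in> M" for x
  proof -
    obtain p where p: "p \<in> M" "!!s. s \<in> M ==> cinner s (x - p) = 0"
      using projection_exists[OF assms(1,2)] by metis
    then show ?thesis using assms(3)[of "x - p"] by simp
  qed
  then show ?thesis by auto
qed

lemma bounded_clinearD:
  assumes "bounded_clinear F"
  shows "bounded_linear F" "F (c *\<^sub>C x) = c *\<^sub>C F x" "F (x + y) = F x + F y" "F (x - y) = F x - F y"
    "F 0 = 0" "F (r *\<^sub>R x) = r *\<^sub>R F x" "F (- x) = - F x" "continuous_on S F"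
  using assms by (auto simp: bounded_clinear_def linear_simps linear_continuous_on)

lemma bounded_clinearI:
  assumes "!!x y. F (x + y) = F x + F y" "!!c x. F (c *\<^sub>C x) = c *\<^sub>C F x" "!!x. norm (F x) <= K * norm x"
  shows "bounded_clinear F"
  unfolding bounded_clinear_def using assms
  by (auto intro!: bounded_linear_intro[where K=K] simp: scaleR_scaleC mult.commute)

lemma bounded_clinear_compose: "bounded_clinear F ==> bounded_clinear G ==> bounded_clinear (\<lambda>x. F (G x))"
  unfolding bounded_clinear_def by (auto intro: bounded_linear_compose)

lemma bounded_clinear_add: "bounded_clinear F ==> bounded_clinear G ==> bounded_clinear (\<lambda>x. F x + G x)"
  unfolding bounded_clinear_def by (auto intro: bounded_linear_add simp: scaleC_add_right)

lemma bounded_clinear_diff: "bounded_clinear F ==> bounded_clinear G ==> bounded_clinear (\<lambda>x. F x - G x)"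
  unfolding bounded_clinear_def by (auto intro: bounded_linear_sub simp: scaleC_diff_right)

lemma bounded_clinear_ident: "bounded_clinear (\<lambda>x. x)"
  unfolding bounded_clinear_def by auto

lemma bounded_clinear_zero: "bounded_clinear (\<lambda>x. 0)"
  unfolding bounded_clinear_def by auto

lemma bounded_clinear_scaleC: "bounded_clinear F ==> bounded_clinear (\<lambda>x. c *\<^sub>C F x)"
  unfolding bounded_clinear_def
  by (auto intro: bounded_linear_compose[OF bounded_linear_scaleC] simp: scaleC_scaleC mult.commute)

text \<open>The representing vector is a multiple of \<open>w\<close>, the component of some
  \<open>x\<close> with \<open>f x ~= 0\<close> orthogonal to the kernel of
  \<open>f\<close>.\<close>

lemma riesz:
  fixes f :: "'a::{complex_inner,banach} => complex"
  assumes f: "bounded_linear f" "!!c x. f (c *\<^sub>C x) = c * f x"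
  obtains z where "!!y. f y = cinner z y"
proof (cases "\<forall>x. f x = 0")
  case True then show ?thesis using that[of 0] by simp
next
  case False
  then obtain x where x: "f x ~= 0" by blast
  let ?M = "{y. f y = 0}"
  have "csubspace ?M" using f by (auto simp: csubspace_def linear_simps)
  moreover have "closed ?M"
    using continuous_closed_vimage[of "{0}" f] linear_continuous_at[OF f(1)] by (simp add: vimage_def)
  ultimately obtain p where p: "f p = 0" "!!s. f s = 0 ==> cinner s (x - p) = 0"
    using projection_exists[of ?M x] by auto
  define w where "w = x - p"
  have fw: "f w ~= 0" using x p f by (simp add: w_def linear_simps)
  then have w0: "w ~= 0" using f by (auto simp: linear_simps)
  have "f y = cinner (cnj (f w / (norm w)^2) *\<^sub>C w) y" for y
  proof -
    have "f (y - (f y / f w) *\<^sub>C w) = 0" using fw f by (simp add: linear_simps)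
    then have "cinner (y - (f y / f w) *\<^sub>C w) w = 0" using p(2) by (simp add: w_def)
    then have "cinner w (y - (f y / f w) *\<^sub>C w) = 0" by (subst cinner_commute) simp
    then have "cinner w y = (f y / f w) * (norm w)^2"
      by (simp add: cinner_diff_right cinner_scaleC_right cinner_self)
    then show ?thesis using fw w0 by (simp add: cinner_scaleC_left)
  qed
  then show ?thesis using that by blast
qed

text \<open>The adjoint of an everywhere defined bounded operator as a function, in contrast to the
  graph \<open>adjoint_op\<close>; the choice picks the Riesz representative.\<close>

definition adj :: "('a => 'b::complex_inner) => 'b => 'a::complex_inner" where
  "adj F x = (SOME z. \<forall>y. cinner z y = cinner x (F y))"

lemma cinner_adj_left:
  fixes F :: "'a::{complex_inner,banach} => 'a"
  assumes "bounded_clinear F" shows "cinner (adj F x) y = cinner x (F y)"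
proof -
  have "bounded_linear (\<lambda>y. cinner x (F y))"
    using bounded_linear_compose[OF bounded_linear_cinner_right] bounded_clinearD(1)[OF assms] by blast
  then obtain z where "!!y. cinner x (F y) = cinner z y"
    by (rule riesz) (use bounded_clinearD(2)[OF assms] in "auto simp: cinner_scaleC_right")
  then have "\<exists>z. \<forall>y. cinner z y = cinner x (F y)" by metis
  then show ?thesis unfolding adj_def by (rule someI2_ex) auto
qed

lemma cinner_adj_right:
  fixes F :: "'a::{complex_inner,banach} => 'a"
  assumes "bounded_clinear F" shows "cinner y (adj F x) = cinner (F y) x"
  using cinner_adj_left[OF assms, of x y] by (subst (1 2) cinner_commute) simp

lemma bounded_clinear_adj:
  fixes F :: "'a::{complex_inner,banach} => 'a"
  assumes F: "bounded_clinear F" and K: "!!x. norm (F x) <= K * norm x"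
  shows "bounded_clinear (adj F)" "norm (adj F x) <= K * norm x"
proof -
  show b: "norm (adj F x) <= K * norm x" for x
  proof -
    have "(norm (adj F x))^2 = cmod (cinner (adj F x) (adj F x))" by (simp add: cinner_self norm_power)
    also have "... <= norm x * (K * norm (adj F x))"
      unfolding cinner_adj_left[OF F] by (rule order_trans[OF cinner_le_norm mult_left_mono[OF K]]) simp
    finally show ?thesis using order_trans[OF norm_ge_zero K, of x]
      by (cases "adj F x = 0") (auto simp: power2_eq_square mult.commute mult.left_commute)
  qed
  show "bounded_clinear (adj F)"
    by (rule bounded_clinearI[OF _ _ b]; rule cinner_eqI)
       (simp_all add: cinner_adj_right[OF F] cinner_add_right cinner_scaleC_right)
qed

section \<open>Unitary groups and their generators\<close>

lemma unitary_opD: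
  assumes "unitary_op U"
  shows "bounded_clinear U" "surj U" "cinner (U x) (U y) = cinner x y" "norm (U x) = norm x"
proof -
  show *: "cinner (U x) (U y) = cinner x y" for x y using assms by (auto simp: unitary_op_def)
  have "cx ((norm (U x))^2) = of_real ((norm x)^2)"
    using *[of x x] by (simp only: cinner_self)
  then have "(norm (U x))^2 = (norm x)^2" using of_real_eq_iff by blast
  then show "norm (U x) = norm x" by (rule power2_eq_imp_eq) auto
qed (use assms in "auto simp: unitary_op_def")

locale unitary_group_locale =
  fixes U :: "real => 'a::{complex_inner,banach} => 'a"
  assumes U: "unitary_group U"
begin

lemma unitary: "unitary_op (U t)" using U by (auto simp: unitary_group_def)
lemmas bounded_clinear = unitary_opD(1)[OF unitary]
lemmas cinner_U = unitary_opD(3)[OF unitary]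
lemmas lin = bounded_clinearD[OF bounded_clinear]
lemma zero: "U 0 x = x" using U by (auto simp: unitary_group_def)
lemma add: "U (s + t) x = U s (U t x)" using U by (auto simp: unitary_group_def)
lemma minus: "U (-t) (U t x) = x" "U t (U (-t) x) = x" using add[of "-t" t] add[of t "-t"] zero by auto
lemma cont: "continuous_on S (\<lambda>t. U t x)"
  using U by (auto simp: unitary_group_def intro: continuous_on_subset)
lemma cinner_move: "cinner (U t x) y = cinner x (U (-t) y)"
  using cinner_U[of "-t" "U t x" y] by (simp add: minus)

text \<open>Replaces the limit of difference quotients by a vector derivative of the orbit at
  \<open>0\<close>, so that chain and product rules become available.\<close>

lemma generator_iff:
  "(x, y) \<in> generator U \<longleftrightarrow> ((\<lambda>t. U t x) has_vector_derivative (- \<i>) *\<^sub>C y) (at 0)"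
proof -
  have "(x, y) \<in> generator U \<longleftrightarrow> ((\<lambda>t. \<i> *\<^sub>C ((U t x - x) /\<^sub>R t)) \<longlongrightarrow> y) (at 0)"
    by (simp add: generator_def)
  also have "... \<longleftrightarrow> ((\<lambda>t. (U t x - x) /\<^sub>R t) \<longlongrightarrow> (- \<i>) *\<^sub>C y) (at 0)"
  proof
    assume "((\<lambda>t. \<i> *\<^sub>C ((U t x - x) /\<^sub>R t)) \<longlongrightarrow> y) (at 0)"
    from tendsto_scaleC[OF tendsto_const[of "-\<i>"] this]
    show "((\<lambda>t. (U t x - x) /\<^sub>R t) \<longlongrightarrow> (- \<i>) *\<^sub>C y) (at 0)" by (simp add: scaleC_scaleC)
  next
    assume "((\<lambda>t. (U t x - x) /\<^sub>R t) \<longlongrightarrow> (- \<i>) *\<^sub>C y) (at 0)"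
    from tendsto_scaleC[OF tendsto_const[of "\<i>"] this]
    show "((\<lambda>t. \<i> *\<^sub>C ((U t x - x) /\<^sub>R t)) \<longlongrightarrow> y) (at 0)" by (simp add: scaleC_scaleC)
  qed
  also have "... \<longleftrightarrow> ((\<lambda>t. (1 / norm t) *\<^sub>R (U t x - (x + t *\<^sub>R (- \<i>) *\<^sub>C y))) \<longlongrightarrow> 0) (at 0)"
  proof -
    have "norm ((U t x - x) /\<^sub>R t - (- \<i>) *\<^sub>C y) = norm ((1 / norm t) *\<^sub>R (U t x - (x + t *\<^sub>R (- \<i>) *\<^sub>C y)))"
      if "t ~= 0" for t
    proof -
      have "(U t x - x) /\<^sub>R t - (- \<i>) *\<^sub>C y = (1 / t) *\<^sub>R (U t x - (x + t *\<^sub>R (- \<i>) *\<^sub>C y))"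
        using that by (simp add: algebra_simps inverse_eq_divide)
      then show ?thesis by simp
    qed
    then have "\<forall>\<^sub>F t in at 0. norm ((U t x - x) /\<^sub>R t - (- \<i>) *\<^sub>C y) = norm ((1 / norm t) *\<^sub>R (U t x - (x + t *\<^sub>R (- \<i>) *\<^sub>C y)))"
      by (auto simp: eventually_at intro: exI[of _ 1])
    then show ?thesis
      unfolding LIM_zero_iff[of "\<lambda>t. (U t x - x) /\<^sub>R t", symmetric]
      by (subst (1 2) tendsto_norm_zero_iff[symmetric]) (rule tendsto_cong)
  qed
  also have "... \<longleftrightarrow> ((\<lambda>t. U t x) has_vector_derivative (- \<i>) *\<^sub>C y) (at 0)"
    unfolding has_vector_derivative_def has_derivative_within zero
    by (simp only: diff_0_right bounded_linear_scaleR_left simp_thms)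
  finally show ?thesis .
qed

lemma generator_deriv:
  assumes "(x, y) \<in> generator U"
  shows "((\<lambda>t. U t x) has_vector_derivative U t ((- \<i>) *\<^sub>C y)) (at t within S)"
proof -
  have d: "((\<lambda>s. U s x) has_vector_derivative (- \<i>) *\<^sub>C y) (at (t - t))"
    using assms by (simp add: generator_iff)
  have "((\<lambda>s. s - t) has_vector_derivative 1) (at t)"
    by (auto intro!: derivative_eq_intros)
  from vector_diff_chain_at[OF this d]
  have "((\<lambda>s. U (s - t) x) has_vector_derivative (- \<i>) *\<^sub>C y) (at t)" by (simp add: o_def)
  from bounded_linear.has_vector_derivative[OF lin(1)[of t] this]
  have "((\<lambda>s. U s x) has_vector_derivative U t ((- \<i>) *\<^sub>C y)) (at t)"
    by (simp add: add[symmetric])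
  then show ?thesis by (rule has_vector_derivative_at_within)
qed

lemma generator_csubspace:
  "csubspace (Domain (generator U))"
proof -
  have z: "(0, 0) \<in> generator U" by (simp add: generator_def lin)
  have a: "(x + x', y + y') \<in> generator U" if "(x, y) \<in> generator U" "(x', y') \<in> generator U" for x y x' y'
    using that has_vector_derivative_add[of "\<lambda>t. U t x" "(- \<i>) *\<^sub>C y" _ "\<lambda>t. U t x'"]
    by (simp add: generator_iff lin scaleC_add_right)
  have s: "(c *\<^sub>C x, c *\<^sub>C y) \<in> generator U" if "(x, y) \<in> generator U" for x y c
    using bounded_linear.has_vector_derivative[OF bounded_linear_scaleC[of c], of "\<lambda>t. U t x" "(- \<i>) *\<^sub>C y"] that
    by (simp add: generator_iff lin scaleC_scaleC mult.commute)
  show ?thesis unfolding csubspace_def using z a s by blast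
qed

text \<open>The averages of an orbit over \<open>{0..h}\<close> lie in the domain, because applying
  \<open>U t\<close> only shifts the interval of integration, and they converge to \<open>x\<close>
  as \<open>h\<close> tends to \<open>0\<close>.\<close>

lemma generator_dense: "closure (Domain (generator U)) = UNIV"
proof -
  have "x \<in> closure (Domain (generator U))" for x
  proof -
    define J where "J h = integral {0..h} (\<lambda>s. U s x)" for h
    have int: "(\<lambda>s. U s x) integrable_on {a..b}" for a b by (intro integrable_continuous_real cont)
    have J: "J h \<in> Domain (generator U)" if h: "h > 0" for h
    proof -
      \<comment> \<open>The antiderivative starts at \<open>-1\<close> so that it is differentiable
        on both sides of \<open>0\<close>.\<close>
      define \<Phi> where "\<Phi> t = integral {-1..t} (\<lambda>s. U s x)" for t
      have \<Phi>d: "(\<Phi> has_vector_derivative U t x) (at t)" if "t > -1" for t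
      proof -
        have "(\<Phi> has_vector_derivative U t x) (at t within {-1..t+1})"
          unfolding \<Phi>_def by (rule integral_has_vector_derivative) (use that cont in auto)
        then show ?thesis using that by (simp only: at_within_Icc_at less_add_one)
      qed
      have *: "U t (J h) = \<Phi> (t + h) - \<Phi> t" if t: "\<bar>t\<bar> < 1" for t
      proof -
        have "U t (J h) = integral {0..h} (\<lambda>s. U t (U s x))"
          unfolding J_def using integral_linear[OF int lin(1)[of t]] by (simp add: o_def)
        also have "... = integral {0..h} (\<lambda>s. U (s + t) x)" by (simp add: add[symmetric] add.commute)
        also have "... = \<Phi> (t + h) - \<Phi> t"
        proof (rule integral_unique)
          have "((\<lambda>s. U (s + t) x) has_integral \<Phi> (h + t) - \<Phi> (0 + t)) {0..h}"
          proof (rule fundamental_theorem_of_calculus)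
            fix s assume s: "s \<in> {0..h}"
            then have st: "-1 < s + t" using t by auto
            have "((\<lambda>s. s + t) has_vector_derivative 1) (at s)" by (auto intro!: derivative_eq_intros)
            from vector_diff_chain_at[OF this, of \<Phi> "U (s + t) x"] \<Phi>d[OF st]
            have "((\<lambda>s. \<Phi> (s + t)) has_vector_derivative U (s + t) x) (at s)" by (simp add: o_def)
            then show "((\<lambda>s. \<Phi> (s + t)) has_vector_derivative U (s + t) x) (at s within {0..h})"
              by (rule has_vector_derivative_at_within)
          qed (use h in simp)
          then show "((\<lambda>s. U (s + t) x) has_integral \<Phi> (t + h) - \<Phi> t) {0..h}" by (simp add: add.commute)
        qed
        finally show ?thesis .
      qed
      have "((\<lambda>t. \<Phi> (t + h) - \<Phi> t) has_vector_derivative U h x - x) (at 0)"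
      proof (rule has_vector_derivative_diff)
        show "(\<Phi> has_vector_derivative x) (at 0)" using \<Phi>d[of 0] by (simp add: zero)
        have h1: "-1 < h" using h by simp
        have "((\<lambda>t. t + h) has_vector_derivative 1) (at 0)" by (auto intro!: derivative_eq_intros)
        from vector_diff_chain_at[OF this, of \<Phi> "U h x"] \<Phi>d[OF h1]
        show "((\<lambda>t. \<Phi> (t + h)) has_vector_derivative U h x) (at 0)" by (simp add: o_def)
      qed
      then have "((\<lambda>t. U t (J h)) has_vector_derivative U h x - x) (at 0)"
        by (rule has_vector_derivative_transform_within[where d=1]) (auto simp: * dist_norm)
      then have "(J h, \<i> *\<^sub>C (U h x - x)) \<in> generator U" by (simp add: generator_iff scaleC_scaleC)
      then show ?thesis by blast
    qed
    have "((\<lambda>h. J h) has_vector_derivative U 0 x) (at 0 within {0..1})"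
      unfolding J_def by (rule integral_has_vector_derivative) (use cont in auto)
    then have "((\<lambda>h. (1 / norm h) *\<^sub>R (J h - h *\<^sub>R x)) \<longlongrightarrow> 0) (at 0 within {0..1})"
      unfolding has_vector_derivative_def has_derivative_within zero
      by (simp only: diff_0_right) (simp add: J_def)
    then have "((\<lambda>h. (1 / norm h) *\<^sub>R (J h - h *\<^sub>R x)) \<longlongrightarrow> 0) (at_right 0)"
      by (simp only: at_within_Icc_at_right zero_less_one)
    then have "((\<lambda>h. (1 / h) *\<^sub>R J h - x) \<longlongrightarrow> 0) (at_right 0)"
      by (rule Lim_transform_eventually) (auto simp: eventually_at scaleR_diff_right intro!: exI[of _ 1])
    then have "((\<lambda>h. (1 / h) *\<^sub>R J h) \<longlongrightarrow> x) (at_right 0)"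
      by (simp only: LIM_zero_iff)
    moreover
    have "\<forall>\<^sub>F h in at_right 0. (1 / h) *\<^sub>R J h \<in> Domain (generator U)"
      by (auto simp: eventually_at intro!: exI[of _ 1] csubspaceD(4)[OF generator_csubspace] J)
    then have "\<forall>\<^sub>F h in at_right 0. (1 / h) *\<^sub>R J h \<in> closure (Domain (generator U))"
      by (rule eventually_mono) (rule subsetD[OF closure_subset])
    ultimately show ?thesis
      by (intro Lim_in_closed_set[OF closed_closure _ trivial_limit_at_right_real])
  qed
  then show ?thesis by auto
qed

text \<open>Unitarity moves \<open>U t\<close> to the other argument as \<open>U (-t)\<close>, and
  the difference quotient defining \<open>y\<close> may equally be taken along
  \<open>-t\<close>.\<close>

lemma generator_symmetric:
  assumes "(x, y) \<in> generator U" "(u, v) \<in> generator U"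
  shows "cinner x v = cinner y u"
proof -
  have "((\<lambda>t. cinner x (\<i> *\<^sub>C ((U t u - u) /\<^sub>R t))) \<longlongrightarrow> cinner x v) (at 0)"
    using assms(2) by (intro tendsto_intros) (simp add: generator_def)
  moreover have "((\<lambda>t. cinner x (\<i> *\<^sub>C ((U t u - u) /\<^sub>R t))) \<longlongrightarrow> cinner y u) (at 0)"
  proof -
    have "((\<lambda>t. \<i> *\<^sub>C ((U t x - x) /\<^sub>R t)) \<longlongrightarrow> y) (at 0)" using assms(1) by (simp add: generator_def)
    then have "((\<lambda>t. \<i> *\<^sub>C ((U t x - x) /\<^sub>R t)) \<longlongrightarrow> y) (filtermap uminus (at 0))"
      by (simp add: filtermap_at_minus)
    then have "((\<lambda>t. \<i> *\<^sub>C ((U (-t) x - x) /\<^sub>R (-t))) \<longlongrightarrow> y) (at 0)"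
      by (simp add: filterlim_filtermap)
    from tendsto_cinner[OF this tendsto_const[of u]]
    show ?thesis
    proof (rule Lim_transform_eventually)
      show "\<forall>\<^sub>F t in at 0. cinner (\<i> *\<^sub>C ((U (- t) x - x) /\<^sub>R - t)) u = cinner x (\<i> *\<^sub>C ((U t u - u) /\<^sub>R t))"
        by (intro always_eventually allI)
           (simp add: cinner_scaleC_left cinner_scaleC_right cinner_scaleR_left cinner_scaleR_right
             cinner_diff_left cinner_diff_right cinner_move inverse_eq_divide cinner_minus_left)
    qed
  qed
  ultimately show ?thesis by (rule tendsto_unique[OF at_neq_bot])
qed

text \<open>One half of Stone's theorem. For \<open>(x, y)\<close> in the adjoint, testing against
  the dense domain shows that \<open>U t x - x\<close> equals \<open>- \<i>\<close> times the
  integral of \<open>U s y\<close> over \<open>{0..t}\<close>; this is differentiable at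
  \<open>0\<close>, so \<open>x\<close> was in the domain already.\<close>

lemma generator_self_adjoint: "self_adjoint (generator U)"
  unfolding self_adjoint_def
proof (intro conjI generator_dense set_eqI iffI; clarify)
  fix x y assume "(x, y) \<in> generator U"
  then show "(x, y) \<in> adjoint_op (generator U)" unfolding adjoint_op_def using generator_symmetric by auto
next
  fix x y assume xy: "(x, y) \<in> adjoint_op (generator U)"
  then have xy: "cinner x v = cinner y u" if "(u, v) \<in> generator U" for u v
    using that by (auto simp: adjoint_op_def)
  define \<Psi> where "\<Psi> t = integral {-1..t} (\<lambda>s. U s y)" for t
  have int: "(\<lambda>s. U s y) integrable_on {a..b}" for a b by (intro integrable_continuous_real cont)
  have \<Psi>d: "(\<Psi> has_vector_derivative U t y) (at t)" if "\<bar>t\<bar> < 1" for t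
  proof -
    have "(\<Psi> has_vector_derivative U t y) (at t within {-1..1})"
      unfolding \<Psi>_def by (rule integral_has_vector_derivative) (use that cont in auto)
    then show ?thesis using that at_within_Icc_at[of "-1" t 1] by (simp add: abs_less_iff)
  qed
  have eq: "U t x - x = (- \<i>) *\<^sub>C (\<Psi> t - \<Psi> 0)" if t: "\<bar>t\<bar> < 1" for t
  proof -
    have "cinner u (U t x - x - (- \<i>) *\<^sub>C (\<Psi> t - \<Psi> 0)) = 0" if u: "(u, v) \<in> generator U" for u v
    proof -
      have d: "((\<lambda>s. cinner u (U s x - x - (- \<i>) *\<^sub>C (\<Psi> s - \<Psi> 0))) has_vector_derivative 0) (at s within {-1<..<1})"
        if s: "s \<in> {-1<..<1}" for s
      proof -
        have "((\<lambda>s. cinner (U s u) x) has_vector_derivative cinner (U s ((- \<i>) *\<^sub>C v)) x) (at s)" for s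
          by (rule bounded_linear.has_vector_derivative[OF bounded_bilinear.bounded_linear_left[OF bounded_bilinear_cinner] generator_deriv[OF u]])
        then have "((\<lambda>s. cinner (U s u) x) has_vector_derivative cinner (U (-s) ((- \<i>) *\<^sub>C v)) x) (at (-s))" .
        moreover have "(uminus has_vector_derivative (-1)) (at s)" by (auto intro!: derivative_eq_intros)
        ultimately have "((\<lambda>s. cinner (U (-s) u) x) has_vector_derivative - cinner (U (-s) ((- \<i>) *\<^sub>C v)) x) (at s)"
          using vector_diff_chain_at[of uminus "-1" s "\<lambda>s. cinner (U s u) x"] by (simp add: o_def)
        moreover have "cinner (U (-s) u) x = cinner u (U s x)" for s by (simp add: cinner_move)
        moreover have "cinner (U (-s) ((- \<i>) *\<^sub>C v)) x = \<i> * cinner (U (-s) v) x"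
          by (simp add: lin cinner_scaleC_left)
        moreover have "cinner (U (-s) v) x = cinner u (U s y)"
        proof -
          have "((\<lambda>t. U t (U (-s) u)) has_vector_derivative U (-s) ((- \<i>) *\<^sub>C v)) (at 0)"
          proof -
            have "((\<lambda>t. U t u) has_vector_derivative U 0 ((- \<i>) *\<^sub>C v)) (at 0)"
              by (rule generator_deriv[OF u])
            from bounded_linear.has_vector_derivative[OF lin(1)[of "-s"] this]
            show ?thesis by (simp add: zero add[symmetric] add.commute)
          qed
          then have "(U (-s) u, U (-s) v) \<in> generator U" by (simp add: generator_iff lin)
          from xy[OF this] have "cinner (U (-s) v) x = cinner (U (-s) u) y"
            by (subst cinner_commute, subst (asm) cinner_commute, subst (2) cinner_commute)
               (metis cinner_commute)
          then show ?thesis by (simp add: cinner_move)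
        qed
        ultimately have d1: "((\<lambda>s. cinner u (U s x)) has_vector_derivative - \<i> * cinner u (U s y)) (at s)" by simp
        have "((\<lambda>s. cinner u (\<Psi> s)) has_vector_derivative cinner u (U s y)) (at s)"
          by (rule bounded_linear.has_vector_derivative[OF bounded_linear_cinner_right \<Psi>d]) (use s in auto)
        then have "((\<lambda>s. \<i> * cinner u (\<Psi> s)) has_vector_derivative \<i> * cinner u (U s y)) (at s)"
          by (rule has_vector_derivative_mult_right)
        from has_vector_derivative_add[OF has_vector_derivative_diff[OF d1 has_vector_derivative_const[of "cinner u x + \<i> * cinner u (\<Psi> 0)"]] this]
        show ?thesis
          by (simp add: cinner_diff_right cinner_scaleC_right cinner_add_right algebra_simps cinner_minus_right scaleC_minus_left scaleC_diff_right has_vector_derivative_at_within)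
      qed
      obtain c where c: "!!s. s \<in> {-1<..<1} ==> cinner u (U s x - x - (- \<i>) *\<^sub>C (\<Psi> s - \<Psi> 0)) = c"
        by (rule has_vector_derivative_zero_constant[OF _ d]) auto
      have "t \<in> {-1<..<1}" "(0::real) \<in> {-1<..<1}" using t by auto
      from c[OF this(1)] c[OF this(2)]
      have "cinner u (U t x - x - (- \<i>) *\<^sub>C (\<Psi> t - \<Psi> 0)) = cinner u (U 0 x - x - (- \<i>) *\<^sub>C (\<Psi> 0 - \<Psi> 0))"
        by simp
      then show ?thesis by (simp add: zero)
    qed
    then have "norm (U t x - x - (- \<i>) *\<^sub>C (\<Psi> t - \<Psi> 0)) <= 0"
      by (intro norm_le_by_cinner_dense[OF generator_dense]) auto
    then show ?thesis by simp
  qed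
  have "((\<lambda>t. x + (- \<i>) *\<^sub>C (\<Psi> t - \<Psi> 0)) has_vector_derivative (- \<i>) *\<^sub>C y) (at 0)"
  proof -
    have "((\<lambda>t. \<Psi> t - \<Psi> 0) has_vector_derivative y) (at 0)"
      using has_vector_derivative_diff[OF \<Psi>d[of 0] has_vector_derivative_const] by (simp add: zero)
    from has_vector_derivative_add[OF has_vector_derivative_const bounded_linear.has_vector_derivative[OF bounded_linear_scaleC this]]
    show ?thesis by simp
  qed
  then have "((\<lambda>t. U t x) has_vector_derivative (- \<i>) *\<^sub>C y) (at 0)"
    by (rule has_vector_derivative_transform_within[where d=1]) (auto simp: eq[symmetric] dist_norm)
  then show "(x, y) \<in> generator U" by (simp add: generator_iff)
qed

end

text \<open>On the common domain \<open>cinner (U' t x) (U t x)\<close> has derivative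
  \<open>0\<close> and hence keeps its value at \<open>t = 0\<close>. Two vectors whose norms are
  \<open>norm x\<close> and whose inner product is \<open>(norm x)^2\<close> coincide; density
  extends this to all \<open>x\<close>. It gives \<open>exp_group\<close> its meaning.\<close>

lemma unitary_group_unique:
  fixes U U' :: "real => 'a::{complex_inner,banach} => 'a"
  assumes "unitary_group U" "unitary_group U'" "generator U = generator U'"
  shows "U = U'"
proof -
  interpret U: unitary_group_locale U by unfold_locales fact
  interpret U': unitary_group_locale U' by unfold_locales fact
  have inv: "(U t x, U t y) \<in> generator U" "(U' t x, U' t y) \<in> generator U" if xy: "(x, y) \<in> generator U" for t x y
  proof -
    have "((\<lambda>s. U s (U t x)) has_vector_derivative U t ((- \<i>) *\<^sub>C y)) (at 0)"
      using bounded_linear.has_vector_derivative[OF U.lin(1)[of t] U.generator_deriv[OF xy, of 0]]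
      by (simp add: U.zero U.add[symmetric] add.commute)
    then show "(U t x, U t y) \<in> generator U" by (simp add: U.generator_iff U.lin)
    have "((\<lambda>s. U' s (U' t x)) has_vector_derivative U' t ((- \<i>) *\<^sub>C y)) (at 0)"
      using bounded_linear.has_vector_derivative[OF U'.lin(1)[of t] U'.generator_deriv[of x y 0]] xy assms(3)
      by (simp add: U'.zero U'.add[symmetric] add.commute)
    then show "(U' t x, U' t y) \<in> generator U" using assms(3) by (simp add: U'.generator_iff U'.lin)
  qed
  have eqD: "U t x = U' t x" if xy: "(x, y) \<in> generator U" for t x y
  proof -
    have d: "((\<lambda>t. cinner (U' t x) (U t x)) has_vector_derivative 0) (at t within UNIV)" for t
    proof -
      have d1: "((\<lambda>t. U t x) has_vector_derivative U t ((- \<i>) *\<^sub>C y)) (at t)"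
        by (rule U.generator_deriv[OF xy])
      have d2: "((\<lambda>t. U' t x) has_vector_derivative U' t ((- \<i>) *\<^sub>C y)) (at t)"
        by (rule U'.generator_deriv) (use xy assms(3) in auto)
      have "cinner (U' t x) (U t ((- \<i>) *\<^sub>C y)) + cinner (U' t ((- \<i>) *\<^sub>C y)) (U t x) = 0"
        using U.generator_symmetric[OF inv(2)[OF xy, of t] inv(1)[OF xy, of t]]
        by (simp add: U.lin U'.lin cinner_scaleC_left cinner_scaleC_right)
      then show ?thesis
        using bounded_bilinear.has_vector_derivative[OF bounded_bilinear_cinner d2 d1] by simp
    qed
    obtain c where c: "!!t. t \<in> UNIV ==> cinner (U' t x) (U t x) = c"
      using has_vector_derivative_zero_constant[OF convex_UNIV d] by blast
    have "cinner (U' t x) (U t x) = cinner (U' 0 x) (U 0 x)" using c by simp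
    then have e: "cinner (U' t x) (U t x) = cinner x x" by (simp add: U.zero U'.zero)
    then have e2: "cinner (U t x) (U' t x) = cinner x x" by (metis cinner_commute)
    have "cinner (U t x - U' t x) (U t x - U' t x) = 0"
      by (simp add: cinner_diff_left cinner_diff_right e e2 U.cinner_U U'.cinner_U)
    then show ?thesis by (simp add: cinner_self)
  qed
  have "U t x = U' t x" for t x
  proof -
    have "x \<in> closure (Domain (generator U))" by (simp add: U.generator_dense)
    then obtain f where f: "!!n. f n \<in> Domain (generator U)" "f ----> x" unfolding closure_sequential by blast
    have "(\<lambda>n. U t (f n)) ----> U t x" "(\<lambda>n. U' t (f n)) ----> U' t x"
      by (intro bounded_linear.tendsto[OF U.lin(1)] bounded_linear.tendsto[OF U'.lin(1)] f)+
    moreover have "U t (f n) = U' t (f n)" for n using f(1)[of n] eqD by blast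
    ultimately show ?thesis using LIMSEQ_unique by simp
  qed
  then show ?thesis by (intro ext)
qed

lemma exp_group_eq:
  fixes U :: "real => 'a::{complex_inner,banach} => 'a"
  assumes "unitary_group U" "generator U = A"
  shows "exp_group A = U"
  unfolding exp_group_def
  by (rule the_equality) (use assms unitary_group_unique in auto)

section \<open>The inverse of the Japanese bracket of a self-adjoint operator\<close>

lemma self_adjoint_mem:
  "self_adjoint A ==> (x, y) \<in> A \<longleftrightarrow> (\<forall>u v. (u, v) \<in> A --> cinner x v = cinner y u)"
proof -
  assume "self_adjoint A"
  then have "A = adjoint_op A" by (auto simp: self_adjoint_def)
  then have "(x, y) \<in> A \<longleftrightarrow> (x, y) \<in> adjoint_op A" by metis
  then show ?thesis by (auto simp: adjoint_op_def)
qed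

lemma self_adjointD:
  assumes A: "self_adjoint A"
  shows "(x, y) \<in> A ==> (u, v) \<in> A ==> cinner x v = cinner y u"
    "(x, y) \<in> A ==> (u, v) \<in> A ==> (x + u, y + v) \<in> A"
    "(x, y) \<in> A ==> (u, v) \<in> A ==> (x - u, y - v) \<in> A"
    "(x, y) \<in> A ==> (c *\<^sub>C x, c *\<^sub>C y) \<in> A"
    "(0, 0) \<in> A"
proof -
  note m = self_adjoint_mem[OF A]
  show *: "(x, y) \<in> A ==> (u, v) \<in> A ==> cinner x v = cinner y u" for x y u v using m by blast
  show "(x, y) \<in> A ==> (u, v) \<in> A ==> (x + u, y + v) \<in> A"
    by (subst m) (auto simp: cinner_add_left *)
  show "(x, y) \<in> A ==> (u, v) \<in> A ==> (x - u, y - v) \<in> A"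
    by (subst m) (auto simp: cinner_diff_left *)
  show "(x, y) \<in> A ==> (c *\<^sub>C x, c *\<^sub>C y) \<in> A"
    by (subst m) (auto simp: cinner_scaleC_left *)
  show "(0, 0) \<in> A" by (subst m) auto
qed

lemma self_adjoint_closed:
  assumes A: "self_adjoint A" and f: "!!n. (f n, h n) \<in> A" "f ----> x" "h ----> y"
  shows "(x, y) \<in> A"
proof (subst self_adjoint_mem[OF A], intro allI impI)
  fix u v assume uv: "(u, v) \<in> A"
  have "(\<lambda>n. cinner (f n) v) ----> cinner x v" "(\<lambda>n. cinner (h n) u) ----> cinner y u"
    by (intro tendsto_intros f)+
  moreover have "cinner (f n) v = cinner (h n) u" for n using self_adjointD(1)[OF A f(1) uv] .
  ultimately show "cinner x v = cinner y u" using LIMSEQ_unique by auto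
qed

lemma self_adjoint_single_valued:
  assumes A: "self_adjoint A" and xy: "(x, y) \<in> A" "(x, y') \<in> A"
  shows "y = y'"
proof -
  have "norm (y - y') <= 0"
  proof (rule norm_le_by_cinner_dense)
    show "closure (Domain A) = UNIV" using A by (simp add: self_adjoint_def)
    fix u assume "u \<in> Domain A"
    then obtain v where "(u, v) \<in> A" by blast
    from self_adjointD(1)[OF A this xy(1)] self_adjointD(1)[OF A this xy(2)]
    show "cmod (cinner u (y - y')) <= 0 * norm u" by (simp add: cinner_diff_right)
  qed simp
  then show ?thesis by simp
qed

text \<open>The cross terms cancel because \<open>cinner x y\<close> is real.\<close>

lemma self_adjoint_norm_shift:
  assumes A: "self_adjoint A" and xy: "(x, y) \<in> A" and c: "c = \<i> \<or> c = - \<i>"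
  shows "(norm (y + c *\<^sub>C x))^2 = (norm y)^2 + (norm x)^2"
proof -
  have e: "cinner y x = cinner x y" using self_adjointD(1)[OF A xy xy] by simp
  have "cx ((norm (y + c *\<^sub>C x))^2) = of_real ((norm y)^2 + (norm x)^2)"
    using c by (auto simp only: cinner_self[symmetric] of_real_add)
      (auto simp: cinner_add_left cinner_add_right cinner_scaleC_left cinner_scaleC_right e algebra_simps)
  then show ?thesis using of_real_eq_iff by blast
qed

lemma csubspace_closure:
  assumes "csubspace M" shows "csubspace (closure M)"
proof -
  note M = csubspaceD[OF assms]
  have "x + y \<in> closure M" if "x \<in> closure M" "y \<in> closure M" for x y
  proof -
    obtain f h where "!!n. f n \<in> M" "f ----> x" "!!n. h n \<in> M" "h ----> y"
      using \<open>x \<in> closure M\<close> \<open>y \<in> closure M\<close> unfolding closure_sequential by metis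
    then show ?thesis unfolding closure_sequential
      by (intro exI[of _ "\<lambda>n. f n + h n"]) (auto intro!: tendsto_intros M)
  qed
  moreover have "c *\<^sub>C x \<in> closure M" if "x \<in> closure M" for x c
  proof -
    obtain f where "!!n. f n \<in> M" "f ----> x"
      using \<open>x \<in> closure M\<close> unfolding closure_sequential by metis
    then show ?thesis unfolding closure_sequential
      by (intro exI[of _ "\<lambda>n. c *\<^sub>C f n"]) (auto intro!: tendsto_intros M)
  qed
  ultimately show ?thesis using M(1) closure_subset[of M] by (auto simp: csubspace_def)
qed

text \<open>The range is closed since the shifted operator is bounded below, and a vector orthogonal
  to it would be an eigenvector of \<open>A\<close> with a non-real eigenvalue.\<close>

lemma self_adjoint_shift_surj:
  fixes A :: "'a::{complex_inner,banach} operator"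
  assumes A: "self_adjoint A" and c: "c = \<i> \<or> c = - \<i>"
  shows "\<exists>x y. (x, y) \<in> A & y + c *\<^sub>C x = h"
proof -
  let ?R = "{y + c *\<^sub>C x |x y. (x, y) \<in> A}"
  note AD = self_adjointD[OF A]
  have "?R = UNIV"
  proof (rule closed_csubspace_UNIV)
    show "csubspace ?R" unfolding csubspace_def
    proof (intro conjI ballI allI)
      show "0 \<in> ?R" using AD(5) by force
    next
      fix a b assume "a \<in> ?R" "b \<in> ?R"
      then obtain x y u v where "(x, y) \<in> A" "a = y + c *\<^sub>C x" "(u, v) \<in> A" "b = v + c *\<^sub>C u" by blast
      then have "(x + u, y + v) \<in> A" "a + b = (y + v) + c *\<^sub>C (x + u)"
        by (auto simp: AD scaleC_add_right)
      then show "a + b \<in> ?R" by blast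
    next
      fix d a assume "a \<in> ?R"
      then obtain x y where "(x, y) \<in> A" "a = y + c *\<^sub>C x" by blast
      then have "(d *\<^sub>C x, d *\<^sub>C y) \<in> A" "d *\<^sub>C a = d *\<^sub>C y + c *\<^sub>C d *\<^sub>C x"
        by (auto simp: AD scaleC_add_right scaleC_scaleC mult.commute)
      then show "d *\<^sub>C a \<in> ?R" by blast
    qed
    show "closed ?R" unfolding closed_sequential_limits
    proof (intro allI impI, elim conjE)
      fix f l assume "\<forall>n. f n \<in> ?R" and lim: "f ----> l"
      then have "\<forall>n. \<exists>x y. (x, y) \<in> A & f n = y + c *\<^sub>C x" by blast
      then obtain X Y where XY: "!!n. (X n, Y n) \<in> A" "!!n. f n = Y n + c *\<^sub>C X n" by metis
      have e: "(norm (f i - f j))^2 = (norm (Y i - Y j))^2 + (norm (X i - X j))^2" for i j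
      proof -
        have "f i - f j = (Y i - Y j) + c *\<^sub>C (X i - X j)" by (simp add: XY scaleC_diff_right)
        then show ?thesis using self_adjoint_norm_shift[OF A AD(3)[OF XY(1) XY(1)] c, of i j] by simp
      qed
      have "norm (Y i - Y j) <= norm (f i - f j)" "norm (X i - X j) <= norm (f i - f j)" for i j
        by (rule power2_le_imp_le, use e[of i j] in auto)+
      moreover have "Cauchy f" using lim by (rule LIMSEQ_imp_Cauchy)
      ultimately have "Cauchy X" "Cauchy Y"
        unfolding Cauchy_def dist_norm by (meson le_less_trans)+
      then obtain x y where "X ----> x" "Y ----> y" by (auto simp: Cauchy_convergent_iff convergent_def)
      moreover have "f = (\<lambda>n. Y n + c *\<^sub>C X n)" using XY(2) by (intro ext)
      ultimately have "(x, y) \<in> A" "f ----> y + c *\<^sub>C x"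
        by (auto intro!: self_adjoint_closed[OF A XY(1)] tendsto_intros)
      then show "l \<in> ?R" using LIMSEQ_unique[OF lim] by blast
    qed
    fix w assume w: "!!s. s \<in> ?R ==> cinner s w = 0"
    have "(w, - cnj c *\<^sub>C w) \<in> A"
    proof (subst self_adjoint_mem[OF A], intro allI impI)
      fix u v assume "(u, v) \<in> A"
      then have "cinner (v + c *\<^sub>C u) w = 0" using w by blast
      then have "cinner w (v + c *\<^sub>C u) = 0" by (subst cinner_commute) simp
      then show "cinner w v = cinner (- cnj c *\<^sub>C w) u"
        by (simp add: cinner_add_right cinner_scaleC_right cinner_scaleC_left cinner_minus_left scaleC_minus_left eq_neg_iff_add_eq_0)
    qed
    from AD(1)[OF this this] have "2 * c * cinner w w = 0"
      using c by (auto simp: cinner_scaleC_left cinner_scaleC_right)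
    then show "w = 0" using c by (auto simp: cinner_self)
  qed
  then have "h \<in> ?R" by simp
  then show ?thesis by blast
qed

text \<open>Positivity along the line \<open>y + t *\<^sub>R S y\<close> yields a quadratic
  polynomial without constant term that is nonnegative for every \<open>t\<close>, so its linear
  coefficient \<open>2 * a\<close> must vanish.\<close>

lemma positive_symmetric_zero:
  assumes S: "bounded_clinear S" "!!x y. cinner (S x) y = cinner x (S y)" "!!x. 0 <= Re (cinner x (S x))"
    and y: "Re (cinner y (S y)) = 0"
  shows "S y = 0"
proof -
  note L = bounded_clinearD[OF S(1)]
  define a b where "a = (norm (S y))^2" and "b = Re (cinner (S y) (S (S y)))"
  have "0 <= 2 * t * a + t^2 * b" for t
  proof -
    have 1: "cinner y (S (S y)) = cinner (S y) (S y)" using S(2)[of y "S y"] by simp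
    have "0 <= Re (cinner (y + t *\<^sub>R S y) (S (y + t *\<^sub>R S y)))" by (rule S(3))
    also have "... = 2 * t * a + t^2 * b"
      by (simp add: L cinner_add_left cinner_add_right cinner_scaleR_left cinner_scaleR_right 1 y)
         (simp add: a_def b_def cinner_self power2_eq_square algebra_simps)
    finally show ?thesis .
  qed
  \<comment> \<open>A negative multiple of \<open>a\<close> small enough for the linear term to win;
    the \<open>1\<close> covers the case \<open>b = 0\<close>.\<close>
  from this[of "- a / (b + 1)"] have *: "0 <= 2 * (- a / (b + 1)) * a + (- a / (b + 1))^2 * b" .
  have b: "0 <= b" by (simp add: b_def S(3))
  have "(- a / (b + 1))^2 * b = a^2 / (b + 1) * (b / (b + 1))" by (simp add: power2_eq_square)
  also have "... <= a^2 / (b + 1) * 1" using b by (intro mult_left_mono) auto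
  finally have "2 * (- a / (b + 1)) * a + a^2 / (b + 1) >= 0" using * by linarith
  then have "a^2 / (b + 1) <= 0" by (simp add: power2_eq_square)
  with b have "a = 0" by (simp add: divide_le_0_iff)
  then show ?thesis by (simp add: a_def)
qed

text \<open>The iteration \<open>Y \<mapsto> ((1 - B) + Y^2) / 2\<close> converges in norm to \<open>1 - sqrt B\<close>, since it is
  dominated by the same iteration for the scalar \<open>B = 0\<close>.\<close>

lemma bounded_positive_sqrt:
  fixes B :: "'a::{complex_inner,banach} => 'a"
  assumes B: "bounded_clinear B" "!!x y. cinner (B x) y = cinner x (B y)"
    "!!x. (norm (B x))^2 <= Re (cinner (B x) x)"
  obtains S where "bounded_clinear S" "!!x y. cinner (S x) y = cinner x (S y)" "!!x. 0 <= Re (cinner x (S x))"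
    "!!x. S (S x) = B x" "\<forall>T. bounded_linear T --> (\<forall>x. T (B x) = B (T x)) --> (\<forall>x. T (S x) = S (T x))"
proof -
  note BL = bounded_clinearD[OF B(1)]
  \<comment> \<open>The third hypothesis on \<open>B\<close> makes \<open>1 - B\<close> a
    contraction.\<close>
  define X where "X x = x - B x" for x
  have X: "bounded_clinear X" unfolding X_def by (intro bounded_clinear_diff bounded_clinear_ident B(1))
  note XL = bounded_clinearD[OF X]
  have X1: "norm (X x) <= norm x" for x
  proof (rule power2_le_imp_le)
    have "(norm (X x))^2 = (norm x)^2 - 2 * inner (B x) x + (norm (B x))^2"
      by (simp add: X_def power2_norm_eq_inner inner_diff_left inner_diff_right inner_commute)
    then show "(norm (X x))^2 <= (norm x)^2" using B(3)[of x] by (simp add: inner_eq_Re_cinner)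
        (use zero_le_power2[of "norm (B x)"] in linarith)
  qed simp
  define Y where "Y = rec_nat (\<lambda>x::'a. 0) (\<lambda>n Z x. (1/2) *\<^sub>R (X x + Z (Z x)))"
  define r where "r = rec_nat (0::real) (\<lambda>n s. (1 + s^2) / 2)"
  have Y0: "Y 0 x = 0" and YS: "Y (Suc n) x = (1/2) *\<^sub>R (X x + Y n (Y n x))" for n x by (simp_all add: Y_def)
  have r0: "r 0 = 0" and rS: "r (Suc n) = (1 + (r n)^2) / 2" for n by (simp_all add: r_def)
  have r_bd: "0 <= r n & r n <= 1" for n
    by (induction n) (auto simp: r0 rS power_le_one)
  have Yc: "bounded_clinear (Y n)" for n
  proof (induction n)
    case 0 show ?case using bounded_clinear_zero by (simp add: Y0[abs_def])
  next
    case (Suc n)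
    have "Y (Suc n) = (\<lambda>x. (1/2) *\<^sub>C (X x + Y n (Y n x)))"
      by (intro ext) (simp add: YS scaleR_scaleC)
    then show ?case
      by (simp only:) (intro bounded_clinear_scaleC bounded_clinear_add X bounded_clinear_compose[OF Suc Suc])
  qed
  note YL = bounded_clinearD[OF Yc]
  have Yb: "norm (Y n x) <= r n * norm x" for n x
  proof (induction n arbitrary: x)
    case (Suc n)
    have "norm (Y n (Y n x)) <= r n * (r n * norm x)"
      by (rule order_trans[OF Suc mult_left_mono[OF Suc]]) (use r_bd in auto)
    then have "norm (X x + Y n (Y n x)) <= norm x + r n * (r n * norm x)"
      using norm_triangle_ineq[of "X x" "Y n (Y n x)"] X1[of x] by linarith
    then show ?case unfolding YS rS norm_scaleR by (simp add: power2_eq_square algebra_simps)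
  qed (simp add: Y0 r0)
  \<comment> \<open>The iterates are polynomials in \<open>B\<close>. This survives the limit, and
    uniqueness of the root rests on it.\<close>
  have Ycomm: "T (Y n x) = Y n (T x)" if T: "bounded_linear T" "!!x. T (B x) = B (T x)" for T n x
    using T by (induction n arbitrary: x) (auto simp: Y0 YS linear_simps X_def)
  have Ysym: "cinner (Y n x) y = cinner x (Y n y)" for n x y
    by (induction n arbitrary: x y)
       (auto simp: Y0 YS cinner_scaleR_left cinner_scaleR_right cinner_add_left cinner_add_right
         X_def cinner_diff_left cinner_diff_right B(2))
  have YB: "Y n (B x) = B (Y n x)" for n x using Ycomm[OF BL(1) refl] by simp
  have YY: "Y n (Y m x) = Y m (Y n x)" for n m x by (rule Ycomm[OF YL(1) YB])
  have step: "norm (Y (Suc n) x - Y n x) <= (r (Suc n) - r n) * norm x & r n <= r (Suc n)" for n x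
  proof (induction n arbitrary: x)
    case 0 show ?case using X1[of x] by (simp add: YS Y0 YL rS r0)
  next
    case (Suc n)
    let ?d = "Y (Suc n) x - Y n x"
    have "Y (Suc (Suc n)) x - Y (Suc n) x = (1/2) *\<^sub>R (Y (Suc n) (Y (Suc n) x) - Y n (Y n x))"
      by (simp add: YS[of "Suc n"] YS[of n x] scaleR_diff_right algebra_simps)
    \<comment> \<open>Because the iterates commute, the difference of squares factors as for
      scalars, and the increment is bounded by that of \<open>r\<close>.\<close>
    also have "Y (Suc n) (Y (Suc n) x) - Y n (Y n x) = Y (Suc n) ?d + Y n ?d"
      by (simp add: YL YY[of n "Suc n"])
    finally have "norm (Y (Suc (Suc n)) x - Y (Suc n) x) <= (1/2) * (norm (Y (Suc n) ?d) + norm (Y n ?d))"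
      using norm_triangle_ineq[of "Y (Suc n) ?d" "Y n ?d"] by simp
    also have "... <= (1/2) * (r (Suc n) * norm ?d + r n * norm ?d)"
      by (intro mult_left_mono add_mono Yb) auto
    also have "... = (1/2) * (r (Suc n) + r n) * norm ?d" by (simp add: algebra_simps)
    also have "... <= (1/2) * (r (Suc n) + r n) * ((r (Suc n) - r n) * norm x)"
      using Suc[of x] r_bd[of n] r_bd[of "Suc n"] by (intro mult_left_mono) auto
    also have "... = (r (Suc (Suc n)) - r (Suc n)) * norm x"
      by (simp add: rS[of "Suc n"] rS[of n] power2_eq_square field_simps)
    finally have 1: "norm (Y (Suc (Suc n)) x - Y (Suc n) x) <= (r (Suc (Suc n)) - r (Suc n)) * norm x" .
    have "r (Suc n) <= r (Suc (Suc n))"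
      using Suc[of x] r_bd[of n] power_mono[of "r n" "r (Suc n)" 2] by (simp add: rS[of "Suc n"]) (simp add: rS[of n])
    with 1 show ?case by blast
  qed
  have r_mono: "incseq r" using step by (intro incseq_SucI) blast
  then have r_conv: "convergent r"
    using r_bd by (metis incseq_convergent convergent_def)
  have diff: "norm (Y (n + k) x - Y n x) <= (r (n + k) - r n) * norm x" for n k x
  proof (induction k)
    case (Suc k)
    show ?case using norm_triangle_ineq[of "Y (Suc (n+k)) x - Y (n+k) x" "Y (n+k) x - Y n x"] step[of "n+k" x] Suc
      by (simp add: algebra_simps)
  qed simp
  have "Cauchy (\<lambda>n. Y n x)" for x
  proof (rule metric_CauchyI)
    fix e :: real assume e: "0 < e"
    then have "0 < e / (norm x + 1)" by (simp add: add_nonneg_pos)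
    then obtain N where N: "!!m n. m >= N ==> n >= N ==> dist (r m) (r n) < e / (norm x + 1)"
      using convergent_Cauchy[OF r_conv] unfolding Cauchy_def by blast
    have *: "dist (Y m x) (Y n x) < e" if "N <= n" "n <= m" for m n
    proof -
      have "dist (Y m x) (Y n x) <= (r m - r n) * norm x"
        using diff[of n "m - n" x] that by (simp add: dist_norm)
      also have "... <= (r m - r n) * (norm x + 1)"
        using incseqD[OF r_mono that(2)] by (intro mult_left_mono) auto
      also have "... < e / (norm x + 1) * (norm x + 1)"
        using N[of m n] that by (intro mult_strict_right_mono) (auto simp: dist_real_def add_nonneg_pos)
      also have "norm x + 1 ~= 0" using norm_ge_zero[of x] by linarith
      then have "e / (norm x + 1) * (norm x + 1) = e" by simp
      finally show ?thesis .
    qed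
    have "dist (Y m x) (Y n x) < e" if "N <= n" "N <= m" for m n
      using *[of n m] *[of m n] that by (cases "n <= m") (auto simp: dist_commute)
    then show "\<exists>M. \<forall>m\<ge>M. \<forall>n\<ge>M. dist (Y m x) (Y n x) < e" by blast
  qed
  then have "\<exists>l. (\<lambda>n. Y n x) ----> l" for x by (simp add: Cauchy_convergent_iff convergent_def)
  then obtain Z where Z: "!!x. (\<lambda>n. Y n x) ----> Z x" by metis
  have Zb: "norm (Z x) <= norm x" for x
  proof (rule LIMSEQ_le[OF tendsto_norm[OF Z] tendsto_const], intro exI allI impI)
    fix n show "norm (Y n x) <= norm x"
      by (rule order_trans[OF Yb]) (use r_bd in "simp add: mult_left_le_one_le")
  qed
  have Zc: "bounded_clinear Z"
  proof (rule bounded_clinearI[where K=1])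
    fix x y and c
    show "Z (x + y) = Z x + Z y"
      using LIMSEQ_unique[OF Z] tendsto_add[OF Z Z] by (simp add: YL)
    show "Z (c *\<^sub>C x) = c *\<^sub>C Z x"
      using LIMSEQ_unique[OF Z] tendsto_scaleC[OF tendsto_const Z, of c x] by (simp add: YL)
  qed (use Zb in simp)
  note ZL = bounded_clinearD[OF Zc]
  have Zeq: "2 *\<^sub>R Z x = X x + Z (Z x)" for x
  proof -
    have "(\<lambda>n. Y n (Y n x)) ----> Z (Z x)"
    proof (rule Lim_transform2[OF Z])
      have "(\<lambda>n. Y n (Z x) - Y n (Y n x)) ----> 0"
      proof (rule Lim_null_comparison)
        have "norm (Y n (Z x) - Y n (Y n x)) <= norm (Z x - Y n x)" for n
          using order_trans[OF Yb[of n "Z x - Y n x"], of "norm (Z x - Y n x)"] r_bd[of n]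
          by (simp add: YL mult_left_le_one_le)
        then show "\<forall>\<^sub>F n in sequentially. norm (Y n (Z x) - Y n (Y n x)) <= norm (Z x - Y n x)" by simp
        show "(\<lambda>n. norm (Z x - Y n x)) ----> 0"
          using tendsto_norm[OF tendsto_diff[OF tendsto_const Z, of "Z x" x]] by simp
      qed
      then show "(\<lambda>n. Y n (Z x) - Y n (Y n x)) ----> 0" .
    qed
    then have "(\<lambda>n. (1/2) *\<^sub>R (X x + Y n (Y n x))) ----> (1/2) *\<^sub>R (X x + Z (Z x))"
      by (intro tendsto_intros)
    moreover have "(\<lambda>n. (1/2) *\<^sub>R (X x + Y n (Y n x))) ----> Z x"
      using LIMSEQ_Suc[OF Z[of x]] by (simp add: YS)
    ultimately have "Z x = (1/2) *\<^sub>R (X x + Z (Z x))" by (rule LIMSEQ_unique[symmetric])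
    moreover have "2 *\<^sub>R ((1/2) *\<^sub>R v) = v" for v :: 'a by simp
    ultimately show ?thesis by metis
  qed
  \<comment> \<open>The fixed point equation \<open>2 Z = X + Z^2\<close> says precisely that
    \<open>(1 - Z)^2 = 1 - X = B\<close>.\<close>
  define S where "S x = x - Z x" for x
  show ?thesis
  proof
    show "bounded_clinear S" unfolding S_def by (intro bounded_clinear_diff bounded_clinear_ident Zc)
    have Zsym: "cinner (Z x) y = cinner x (Z y)" for x y
      using LIMSEQ_unique[OF tendsto_cinner[OF Z tendsto_const]] tendsto_cinner[OF tendsto_const Z, of x y] by (simp add: Ysym)
    then show "cinner (S x) y = cinner x (S y)" for x y
      by (simp add: S_def cinner_diff_left cinner_diff_right)
    show "0 <= Re (cinner x (S x))" for x
    proof -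
      have "Re (cinner x (Z x)) <= norm x * norm x"
        by (rule order_trans[OF complex_Re_le_cmod order_trans[OF cinner_le_norm mult_left_mono[OF Zb]]]) simp
      then show ?thesis by (simp add: S_def cinner_diff_right cinner_self power2_eq_square)
    qed
    show "S (S x) = B x" for x
      using Zeq[of x] by (simp add: S_def ZL X_def scaleR_2 algebra_simps)
    show "\<forall>T. bounded_linear T --> (\<forall>x. T (B x) = B (T x)) --> (\<forall>x. T (S x) = S (T x))"
    proof (intro allI impI)
      fix T x assume "bounded_linear T" "\<forall>x. T (B x) = B (T x)"
      then have T: "bounded_linear T" "!!x. T (B x) = B (T x)" by auto
      have "T (Z x) = Z (T x)"
        using LIMSEQ_unique[OF bounded_linear.tendsto[OF T(1) Z[of x]]] Z[of "T x"] by (simp add: Ycomm[OF T])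
      then show "T (S x) = S (T x)" by (simp add: S_def linear_simps T(1))
    qed
  qed
qed

text \<open>For \<open>y = S x - T x\<close> the product \<open>(S + T) y\<close> is
  \<open>S^2 x - T^2 x = 0\<close>, so both nonnegative forms vanish at \<open>y\<close>; then
  \<open>S y = T y = 0\<close> and \<open>cinner y y = 0\<close>.\<close>

lemma bounded_positive_sqrt_unique:
  fixes S T :: "'a::{complex_inner,banach} => 'a"
  assumes S: "bounded_clinear S" "!!x y. cinner (S x) y = cinner x (S y)" "!!x. 0 <= Re (cinner x (S x))"
    and T: "bounded_clinear T" "!!x y. cinner (T x) y = cinner x (T y)" "!!x. 0 <= Re (cinner x (T x))"
    and eq: "!!x. S (S x) = T (T x)" and comm: "!!x. T (S x) = S (T x)"
  shows "S x = T x"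
proof -
  note SL = bounded_clinearD[OF S(1)] and TL = bounded_clinearD[OF T(1)]
  define y where "y = S x - T x"
  have "S y + T y = 0" by (simp add: y_def SL TL eq comm)
  then have "Re (cinner y (S y)) + Re (cinner y (T y)) = 0"
    by (simp flip: plus_complex.simps cinner_add_right)
  then have "Re (cinner y (S y)) = 0" "Re (cinner y (T y)) = 0" using S(3)[of y] T(3)[of y] by linarith+
  then have "S y = 0" "T y = 0"
    using positive_symmetric_zero[OF S] positive_symmetric_zero[OF T] by auto
  then have "cinner y y = 0"
    by (subst (2) y_def) (simp add: cinner_diff_right S(2)[symmetric] T(2)[symmetric])
  then show ?thesis by (simp add: cinner_self y_def)
qed

text \<open>The bounded positive operator \<open>(1 + A^2)^-1\<close> has a bounded positive root
  \<open>S\<close>, and the inverse of \<open>S\<close> is the bracket. The last conclusion is the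
  only trace of the weight in the estimates: \<open>S\<close> maps the unit ball to vectors
  \<open>v\<close> with \<open>norm v <= 1\<close> and \<open>norm (A v) <= 1\<close>.\<close>

theorem inverse_japanese_bracket:
  fixes A :: "'a::{complex_inner,banach} operator"
  assumes A: "self_adjoint A"
  obtains S where "bounded_clinear S" "op_inverse (japanese_bracket A) = fun_graph S"
    "!!x y. cinner (S x) y = cinner x (S y)"
    "!!x. \<exists>y. (S x, y) \<in> A & (norm y)\<^sup>2 + (norm (S x))^2 = (norm x)^2"
proof -
  note AD = self_adjointD[OF A]
  define Q where "Q = op_add (op_comp A A) Id"
  have Q: "(x, h) \<in> Q \<longleftrightarrow> (\<exists>y w. (x, y) \<in> A & (y, w) \<in> A & h = w + x)" for x h
    by (auto simp: Q_def op_add_def op_comp_def)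
  \<comment> \<open>\<open>1 + A^2\<close> is the product of \<open>A - \<i>\<close> and
    \<open>A + \<i>\<close>, which are inverted one after the other.\<close>
  have surj: "\<exists>x. (x, h) \<in> Q" for h
  proof -
    obtain a b where 1: "(a, b) \<in> A" "b + (- \<i>) *\<^sub>C a = h" using self_adjoint_shift_surj[OF A] by blast
    obtain x y where 2: "(x, y) \<in> A" "y + \<i> *\<^sub>C x = a" using self_adjoint_shift_surj[OF A] by blast
    have "(a - \<i> *\<^sub>C x, b - \<i> *\<^sub>C y) \<in> A" by (intro AD 1 2)
    moreover have "a - \<i> *\<^sub>C x = y" using 2 by auto
    moreover have "h = (b - \<i> *\<^sub>C y) + x"
      using 1(2)[symmetric] by (simp add: 2(2)[symmetric] scaleC_add_right scaleC_scaleC scaleC_minus_left)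
    ultimately show ?thesis using 2(1) unfolding Q by metis
  qed
  have key: "(norm y)^2 + (norm x)^2 = Re (cinner x h)" "Im (cinner x h) = 0"
    if "(x, y) \<in> A" "(y, w) \<in> A" "h = w + x" for x y w h
  proof -
    have "cinner x h = cinner y y + cinner x x" using AD(1)[OF that(1,2)] that(3) by (simp add: cinner_add_right)
    then show "(norm y)^2 + (norm x)^2 = Re (cinner x h)" "Im (cinner x h) = 0" by (simp_all add: cinner_self)
  qed
  have Qadd: "(x + x', h + h') \<in> Q" if "(x, h) \<in> Q" "(x', h') \<in> Q" for x x' h h'
  proof -
    from that obtain y w y' w' where 1: "(x, y) \<in> A" "(y, w) \<in> A" "h = w + x"
      and 2: "(x', y') \<in> A" "(y', w') \<in> A" "h' = w' + x'" unfolding Q by blast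
    have "h + h' = (w + w') + (x + x')" by (simp add: 1 2)
    then show ?thesis unfolding Q using AD(2)[OF 1(1) 2(1)] AD(2)[OF 1(2) 2(2)] by blast
  qed
  have Qscale: "(c *\<^sub>C x, c *\<^sub>C h) \<in> Q" if "(x, h) \<in> Q" for x h c
  proof -
    from that obtain y w where 1: "(x, y) \<in> A" "(y, w) \<in> A" "h = w + x" unfolding Q by blast
    have "c *\<^sub>C h = c *\<^sub>C w + c *\<^sub>C x" by (simp add: 1 scaleC_add_right)
    then show ?thesis unfolding Q using AD(4)[OF 1(1)] AD(4)[OF 1(2)] by blast
  qed
  have Q0: "x = 0" if "(x, 0) \<in> Q" for x
  proof -
    from that obtain y w where "(x, y) \<in> A" "(y, w) \<in> A" "0 = w + x" unfolding Q by blast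
    from key(1)[OF this] show ?thesis by (simp add: sum_power2_eq_zero_iff)
  qed
  have uniq: "x = x'" if "(x, h) \<in> Q" "(x', h) \<in> Q" for x x' h
    using Q0[of "x - x'"] Qadd[OF that(1) Qscale[OF that(2), of "-1"]] by simp
  define B where "B h = (THE x. (x, h) \<in> Q)" for h
  have BQ: "(x, h) \<in> Q \<longleftrightarrow> B h = x" for x h
  proof -
    have "(B h, h) \<in> Q" unfolding B_def by (rule theI') (use surj uniq in blast)
    then show ?thesis using uniq by blast
  qed
  have Badd: "B (h + k) = B h + B k" for h k using Qadd BQ by metis
  have Bsc: "B (c *\<^sub>C h) = c *\<^sub>C B h" for c h using Qscale BQ by metis
  have Bpos: "(norm (B h))^2 <= Re (cinner (B h) h)" for h
  proof -
    have "(B h, h) \<in> Q" using BQ by blast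
    then obtain y w where "(B h, y) \<in> A" "(y, w) \<in> A" "h = w + B h" unfolding Q by blast
    from key(1)[OF this] show ?thesis using zero_le_power2[of "norm y"] by linarith
  qed
  have Bbd: "norm (B h) <= 1 * norm h" for h
  proof (cases "B h = 0")
    case False
    have "norm (B h) * norm (B h) <= norm (B h) * norm h"
      using Bpos[of h] order_trans[OF complex_Re_le_cmod cinner_le_norm, of "B h" h]
      by (simp add: power2_eq_square)
    then show ?thesis using False by simp
  qed simp
  have B: "bounded_clinear B" by (rule bounded_clinearI[OF Badd Bsc Bbd])
  have Bsym: "cinner (B h) k = cinner h (B k)" for h k
  proof -
    have "(B h, h) \<in> Q" "(B k, k) \<in> Q" using BQ by blast+
    then obtain y w y' w' where 1: "(B h, y) \<in> A" "(y, w) \<in> A" "h = w + B h"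
      and 2: "(B k, y') \<in> A" "(y', w') \<in> A" "k = w' + B k" unfolding Q by blast
    have "cinner (B h) k = cinner (B h) w' + cinner (B h) (B k)" using 2(3) by (metis cinner_add_right)
    also have "cinner (B h) w' = cinner y y'" using AD(1)[OF 1(1) 2(2)] .
    also have "cinner y y' = cinner w (B k)" using AD(1)[OF 1(2) 2(1)] .
    also have "cinner w (B k) + cinner (B h) (B k) = cinner h (B k)" using 1(3) by (metis cinner_add_left)
    finally show ?thesis .
  qed
  obtain S where S: "bounded_clinear S" "!!x y. cinner (S x) y = cinner x (S y)" "!!x. 0 <= Re (cinner x (S x))"
    "!!x. S (S x) = B x" "\<forall>T. bounded_linear T --> (\<forall>x. T (B x) = B (T x)) --> (\<forall>x. T (S x) = S (T x))"
    using bounded_positive_sqrt[OF B Bsym Bpos] by blast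
  note SL = bounded_clinearD[OF S(1)]
  have Binj: "h = 0" if "B h = 0" for h
  proof -
    have "(0, h) \<in> Q" using BQ[of "B h" h] that by simp
    then obtain y w where 1: "(0, y) \<in> A" "(y, w) \<in> A" "h = w + 0" unfolding Q by blast
    have "y = 0" using self_adjoint_single_valued[OF A 1(1) AD(5)] .
    then have "w = 0" using self_adjoint_single_valued[OF A _ AD(5)] 1(2) by blast
    then show ?thesis using 1(3) by simp
  qed
  have Sinj: "h = 0" if "S h = 0" for h using Binj[of h] that S(4)[of h] by (simp add: SL)
  have dense: "closure (range S) = UNIV"
  proof (rule closed_csubspace_UNIV)
    have "csubspace (range S)" unfolding csubspace_def
      by (auto simp: SL(2)[symmetric] SL(3)[symmetric]) (metis SL(5) rangeI)
    then show "csubspace (closure (range S))" by (rule csubspace_closure)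
    fix x assume "!!s. s \<in> closure (range S) ==> cinner s x = 0"
    then have "cinner (S (S x)) x = 0" using closure_subset by blast
    then have "cinner (S x) (S x) = 0" by (simp add: S(2))
    then show "x = 0" using Sinj by (simp add: cinner_self)
  qed simp
  \<comment> \<open>The inverse of \<open>S\<close> as a graph; its domain is the range of
    \<open>S\<close>.\<close>
  define J where "J = {(S x, x) |x. True}"
  have "japanese_bracket A = J"
    unfolding japanese_bracket_def op_sqrt_def Q_def[symmetric]
  proof (rule the_equality)
    have "Domain J = range S" by (auto simp: J_def)
    moreover have "adjoint_op J = J"
    proof (intro set_eqI iffI; clarify)
      fix x y assume "(x, y) \<in> adjoint_op J"
      then have *: "cinner x u = cinner y (S u)" for u by (auto simp: adjoint_op_def J_def)
      have "cinner u x = cinner u (S y)" for u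
        using *[of u] S(2)[of y u] by (subst (1 2) cinner_commute) simp
      then have "x = S y" by (rule cinner_eqI)
      then show "(x, y) \<in> J" by (auto simp: J_def)
    next
      fix x y assume "(x, y) \<in> J"
      then show "(x, y) \<in> adjoint_op J" by (auto simp: J_def adjoint_op_def S(2))
    qed
    ultimately have "self_adjoint J" using dense by (simp add: self_adjoint_def)
    moreover have "positive_op J" by (auto simp: positive_op_def J_def S(2) S(3))
    moreover have "op_comp J J = Q"
    proof (intro set_eqI iffI; clarify)
      fix x y assume "(x, y) \<in> op_comp J J"
      then show "(x, y) \<in> Q" by (auto simp: op_comp_def J_def BQ S(4))
    next
      fix x y assume "(x, y) \<in> Q"
      then have "x = S (S y)" by (simp add: BQ S(4))
      then show "(x, y) \<in> op_comp J J" by (auto simp: op_comp_def J_def)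
    qed
    ultimately show "self_adjoint J & positive_op J & op_comp J J = Q" by blast
  next
    fix J' assume J': "self_adjoint J' & positive_op J' & op_comp J' J' = Q"
    then have sa: "self_adjoint J'" and pos: "!!x y. (x, y) \<in> J' ==> 0 <= Re (cinner x y)"
      and JJ: "!!x h. (x, h) \<in> Q \<longleftrightarrow> (\<exists>y. (x, y) \<in> J' & (y, h) \<in> J')"
      by (auto simp: positive_op_def op_comp_def)
    note JD = self_adjointD[OF sa]
    have Jsurj: "\<exists>x. (x, h) \<in> J'" for h using surj[of h] JJ by blast
    have J0: "x = 0" if "(x, 0) \<in> J'" for x
    proof -
      obtain u where "(u, x) \<in> J'" using Jsurj by blast
      from JD(1)[OF that this] show ?thesis by (simp add: cinner_self)
    qed
    have Juniq: "x = x'" if "(x, h) \<in> J'" "(x', h) \<in> J'" for x x' h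
      using J0[of "x - x'"] JD(3)[OF that] by simp
    \<comment> \<open>The inverse of a competing root is bounded with square \<open>B\<close>, hence
      commutes with \<open>B\<close>, hence with \<open>S\<close>. Uniqueness for unbounded roots is
      thus reduced to bounded ones.\<close>
    define T where "T h = (THE x. (x, h) \<in> J')" for h
    have TJ: "(x, h) \<in> J' \<longleftrightarrow> T h = x" for x h
    proof -
      have "(T h, h) \<in> J'" unfolding T_def by (rule theI') (use Jsurj Juniq in blast)
      then show ?thesis using Juniq by blast
    qed
    have TT: "T (T h) = B h" for h
      using JJ[of "B h" h] BQ[of "B h" h] by (auto simp: TJ)
    have Tsym: "cinner (T x) y = cinner x (T y)" for x y
      using JD(1)[of "T x" x "T y" y] TJ by auto
    have Tb: "norm (T h) <= 1 * norm h" for h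
    proof -
      have "(norm (T h))^2 = Re (cinner h (B h))"
        using cinner_self[of "T h"] by (simp add: Tsym TT)
      also have "... <= norm h * (1 * norm h)"
        by (rule order_trans[OF complex_Re_le_cmod order_trans[OF cinner_le_norm mult_left_mono[OF Bbd]]]) simp
      finally show ?thesis by (simp add: power2_eq_square[symmetric])
    qed
    have T: "bounded_clinear T"
    proof (rule bounded_clinearI[OF _ _ Tb])
      show "T (x + y) = T x + T y" for x y using JD(2) TJ by metis
      show "T (c *\<^sub>C x) = c *\<^sub>C T x" for c x using JD(4) TJ by metis
    qed
    have "S x = T x" for x
    proof (rule bounded_positive_sqrt_unique[OF S(1-3) T Tsym])
      show "0 <= Re (cinner x (T x))" for x using pos[of "T x" x] TJ Tsym by auto
      show "S (S x) = T (T x)" for x by (simp add: S(4) TT)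
      show "T (S x) = S (T x)" for x
        using S(5) bounded_clinearD(1)[OF T] by (simp add: TT[symmetric])
    qed
    then show "J' = J" by (auto simp: J_def TJ)
  qed
  then have W: "op_inverse (japanese_bracket A) = fun_graph S"
    by (auto simp: op_inverse_def J_def fun_graph_def)
  \<comment> \<open>On the range of \<open>S\<close> the identity is the form identity of
    \<open>1 + A^2\<close>. Applied to differences it makes the vectors \<open>Y n\<close> Cauchy,
    and closedness of \<open>A\<close> extends it to all \<open>x\<close>.\<close>
  have main: "\<exists>y. (S x, y) \<in> A & (norm y)\<^sup>2 + (norm (S x))^2 = (norm x)^2" for x
  proof -
    have "x \<in> closure (range S)" by (simp add: dense)
    then obtain f where f: "!!n. f n \<in> range S" "f ----> x" unfolding closure_sequential by blast
    from f(1) have "\<forall>n. \<exists>h. f n = S h" by blast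
    then obtain k where k: "!!n. f n = S (k n)" by metis
    have "\<exists>y w. (B (k n), y) \<in> A & (y, w) \<in> A & k n = w + B (k n)" for n
      using BQ[of "B (k n)" "k n"] unfolding Q by simp
    then obtain Y W where YW: "!!n. (B (k n), Y n) \<in> A" "!!n. (Y n, W n) \<in> A" "!!n. k n = W n + B (k n)" by metis
    have nrm: "(norm y)^2 + (norm (B h))^2 = (norm (S h))^2" if "(B h, y) \<in> A" "(y, w) \<in> A" "h = w + B h" for h y w
    proof -
      have "Re (cinner (B h) h) = (norm (S h))^2"
        using cinner_self[of "S h"] by (simp flip: S(4) add: S(2))
      then show ?thesis using key(1)[OF that] by simp
    qed
    have dif: "(norm (Y i - Y j))^2 <= (norm (f i - f j))^2" for i j
    proof -
      have "(norm (Y i - Y j))^2 + (norm (B (k i - k j)))^2 = (norm (S (k i - k j)))^2"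
      proof (rule nrm[where w = "W i - W j"])
        show "(B (k i - k j), Y i - Y j) \<in> A" using AD(3)[OF YW(1) YW(1)] bounded_clinearD(4)[OF B] by simp
        show "(Y i - Y j, W i - W j) \<in> A" using AD(3)[OF YW(2) YW(2)] .
        show "k i - k j = W i - W j + B (k i - k j)"
          by (subst YW(3)[of i], subst YW(3)[of j]) (simp add: bounded_clinearD(4)[OF B])
      qed
      then show ?thesis unfolding k SL(4)[symmetric]
        using zero_le_power2[of "norm (B (k i - k j))"] by linarith
    qed
    then have "norm (Y i - Y j) <= norm (f i - f j)" for i j by (rule power2_le_imp_le) simp
    moreover have "Cauchy f" using f(2) by (rule LIMSEQ_imp_Cauchy)
    ultimately have "Cauchy Y" unfolding Cauchy_def dist_norm by (meson le_less_trans)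
    then obtain y where y: "Y ----> y" by (auto simp: Cauchy_convergent_iff convergent_def)
    have Sf: "(\<lambda>n. S (f n)) ----> S x" by (rule bounded_linear.tendsto[OF SL(1) f(2)])
    have "(S x, y) \<in> A"
      by (rule self_adjoint_closed[OF A _ Sf y]) (use YW(1) in "simp add: k S(4)")
    moreover have "(norm y)^2 + (norm (S x))^2 = (norm x)^2"
    proof (rule LIMSEQ_unique)
      show "(\<lambda>n. (norm (Y n))^2 + (norm (S (f n)))^2) ----> (norm y)^2 + (norm (S x))^2"
        by (intro tendsto_intros y Sf)
      have "(norm (Y n))^2 + (norm (S (f n)))^2 = (norm (f n))^2" for n
        using nrm[OF YW] by (simp add: k S(4))
      then show "(\<lambda>n. (norm (Y n))^2 + (norm (S (f n)))^2) ----> (norm x)^2"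
        by (simp add: tendsto_power tendsto_norm f(2))
    qed
    ultimately show ?thesis by blast
  qed
  show ?thesis by (rule that[OF S(1) W S(2) main])
qed

section \<open>The spaces \<open>L\<^sup>2\<close>\<close>

lemma square_integrable_fun_of: "square_integrable (fun_of ph)"
  using Quotient_rep_reflp[OF Quotient_L2, of ph] by (simp add: fun_of_def)

lemma fun_of_measurable [measurable]: "fun_of ph \<in> bmv"
  using square_integrable_fun_of by (auto simp: square_integrable_def)

lemma fun_of_L2_of:
  assumes "square_integrable f" shows "AE x in volume. fun_of (L2_of f) x = f x"
  using Quotient_rep_abs[OF Quotient_L2, of f] assms by (auto simp: fun_of_def L2_of_def)

lemma L2_of_fun_of: "L2_of (fun_of ph) = ph"
  unfolding fun_of_def L2_of_def by (rule Quotient_abs_rep[OF Quotient_L2])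

lemma L2_of_cong:
  assumes "square_integrable f" "square_integrable g" "AE x in volume. f x = g x"
  shows "L2_of f = L2_of g"
  unfolding L2_of_def by (rule Quotient_rel_abs[OF Quotient_L2]) (use assms in auto)

lemma L2_eqI: "AE x in volume. fun_of ph x = fun_of ps x ==> ph = ps"
  using L2_of_cong[OF square_integrable_fun_of square_integrable_fun_of, of ph ps] by (simp add: L2_of_fun_of)

lemma plus_L2_of: "square_integrable f ==> square_integrable g ==> L2_of f + L2_of g = L2_of (\<lambda>x. f x + g x)"
  unfolding L2_of_def by (rule plus_L2.abs_eq) auto

lemma scaleC_L2_of: "square_integrable f ==> c *\<^sub>C L2_of f = L2_of (\<lambda>x. c * f x)"
  unfolding L2_of_def by (rule scaleC_L2.abs_eq) auto

lemma fun_of_add: "AE x in volume. fun_of (ph + ps) x = fun_of ph x + fun_of ps x"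
  using fun_of_L2_of[OF square_integrable_add[OF square_integrable_fun_of square_integrable_fun_of], of ph ps]
    plus_L2_of[OF square_integrable_fun_of square_integrable_fun_of, of ph ps] by (simp add: L2_of_fun_of)

lemma fun_of_scaleC: "AE x in volume. fun_of (c *\<^sub>C ph) x = c * fun_of ph x"
  using fun_of_L2_of[OF square_integrable_scale[OF square_integrable_fun_of], of c ph]
    scaleC_L2_of[OF square_integrable_fun_of, of c ph] by (simp add: L2_of_fun_of)

lemma fun_of_diff: "AE x in volume. fun_of (ph - ps) x = fun_of ph x - fun_of ps x"
  using fun_of_add[of ph "(-1) *\<^sub>C ps"] fun_of_scaleC[of "-1" ps]
  by eventually_elim simp

lemma fun_of_zero: "AE x in volume. fun_of 0 x = 0"
  using fun_of_scaleC[of 0 0] by simp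

lemma cinner_fun_of: "cinner ph ps = (LINT x|volume. cnj (fun_of ph x) * fun_of ps x)"
  by (simp add: cinner_L2_def fun_of_def)

lemma cinner_L2_of:
  assumes "square_integrable f" "square_integrable g"
  shows "cinner (L2_of f) (L2_of g) = (LINT x|volume. cnj (f x) * g x)"
  unfolding L2_of_def by (rule cinner_L2.abs_eq) (use assms in auto)

lemma norm_fun_of: "(norm ph)^2 = (LINT x|volume. (cmod (fun_of ph x))^2)"
proof -
  have "cx ((norm ph)^2) = (LINT x|volume. cnj (fun_of ph x) * fun_of ph x)"
    by (simp only: cinner_self[symmetric] cinner_fun_of)
  also have "... = (LINT x|volume. cx ((cmod (fun_of ph x))^2))"
    by (rule arg_cong[where f = "integral\<^sup>L _"]) (auto simp: complex_norm_square mult.commute simp del: of_real_power)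
  finally show ?thesis by (simp only: integral_complex_of_real of_real_eq_iff)
qed

lemma nn_integral_fun_of: "(\<integral>\<^sup>+x. ennreal ((cmod (fun_of ph x))^2) \<partial>volume) = ennreal ((norm ph)^2)"
  unfolding norm_fun_of
  by (rule nn_integral_eq_integral) (use square_integrable_fun_of[of ph] in "auto simp: square_integrable_def")

lemma square_integrable_iff_nn_integral:
  "square_integrable f \<longleftrightarrow> f \<in> bmv & (\<integral>\<^sup>+x. ennreal ((cmod (f x))^2) \<partial>volume) < \<infinity>"
  unfolding square_integrable_def
  by (intro conj_cong refl) (subst integrable_iff_bounded, auto)

lemma norm_L2_of_nn:
  assumes "square_integrable f"
  shows "ennreal ((norm (L2_of f))^2) = (\<integral>\<^sup>+x. ennreal ((cmod (f x))^2) \<partial>volume)"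
  unfolding nn_integral_fun_of[symmetric]
  by (rule nn_integral_cong_AE) (use fun_of_L2_of[OF assms] in "auto elim: eventually_mono")

lemma L2_norm_le:
  assumes "AE x in volume. cmod (fun_of ph x) <= K * cmod (fun_of ps x)" "0 <= K"
  shows "norm ph <= K * norm ps"
proof (rule power2_le_imp_le)
  have "ennreal ((norm ph)^2) <= (\<integral>\<^sup>+x. ennreal (K^2) * ennreal ((cmod (fun_of ps x))^2) \<partial>volume)"
    unfolding nn_integral_fun_of[symmetric]
  proof (rule nn_integral_mono_AE)
    show "AE x in volume. ennreal ((cmod (fun_of ph x))^2) <= ennreal (K^2) * ennreal ((cmod (fun_of ps x))^2)"
      using assms(1)
    proof eventually_elim
      case (elim x)
      then have "(cmod (fun_of ph x))^2 <= (K * cmod (fun_of ps x))^2" by (intro power_mono) auto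
      then show ?case by (simp add: ennreal_mult[symmetric] power_mult_distrib ennreal_leI)
    qed
  qed
  also have "... = ennreal (K^2) * ennreal ((norm ps)^2)"
    by (subst nn_integral_cmult) (auto simp: nn_integral_fun_of)
  also have "... = ennreal ((K * norm ps)^2)"
    by (simp add: ennreal_mult[symmetric] power_mult_distrib)
  finally show "(norm ph)^2 <= (K * norm ps)^2" by (simp add: ennreal_le_iff)
qed (use assms in auto)

text \<open>The weights \<open>2 ^ n\<close> still leave the summable integrals
  \<open>(1/8) ^ n\<close>. Where the weighted sum of squares is finite, the terms decay at least
  like \<open>(1 / sqrt 2) ^ n\<close>.\<close>

lemma L2_AE_summable:
  fixes d :: "nat => 'a::measured L2"
  assumes "!!n. norm (d n) <= (1/4) ^ n"
  shows "AE x in volume. summable (\<lambda>n. cmod (fun_of (d n) x))"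
proof -
  have "(\<integral>\<^sup>+x. (\<Sum>n. ennreal (2 ^ n * (cmod (fun_of (d n) x))^2)) \<partial>volume)
      = (\<Sum>n. \<integral>\<^sup>+x. ennreal (2 ^ n) * ennreal ((cmod (fun_of (d n) x))^2) \<partial>volume)"
    by (subst nn_integral_suminf) (auto simp: ennreal_mult)
  also have "... = (\<Sum>n. ennreal (2 ^ n * (norm (d n))^2))"
    by (subst nn_integral_cmult) (auto simp: nn_integral_fun_of ennreal_mult)
  also have "... <= (\<Sum>n. ennreal ((1/8) ^ n))"
  proof (intro suminf_le ennreal_leI summableI)
    fix n
    have "(norm (d n))^2 <= ((1/4) ^ n)^2" by (intro power_mono assms) auto
    then have "2 ^ n * (norm (d n))^2 <= 2 ^ n * ((1/4) ^ n)^2" by simp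
    also have "... = (1/8) ^ n" by (simp add: power_mult_distrib[symmetric] power2_eq_square)
    finally show "2 ^ n * (norm (d n))^2 <= (1/8) ^ n" .
  qed
  also have "... < \<infinity>" by (subst suminf_ennreal_eq[OF _ geometric_sums]) auto
  finally have "AE x in volume. (\<Sum>n. ennreal (2 ^ n * (cmod (fun_of (d n) x))^2)) ~= \<infinity>"
    by (intro nn_integral_noteq_infinite) auto
  then show ?thesis
  proof eventually_elim
    case (elim x)
    define a where "a n = cmod (fun_of (d n) x)" for n
    have "(\<Sum>n. ennreal (2 ^ n * (a n)^2)) ~= \<infinity>" unfolding a_def by (rule elim)
    moreover have "\<exists>K\<ge>0. z = ennreal K" if "z ~= \<infinity>" for z :: ennreal
      using that by (cases z rule: ennreal_cases) auto
    ultimately obtain K where K: "0 <= K" "(\<Sum>n. ennreal (2 ^ n * (a n)^2)) = ennreal K"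
      by blast
    have bd: "a n <= sqrt K * (1 / sqrt 2) ^ n" for n
    proof (rule power2_le_imp_le)
      define e where "e n = ennreal (2 ^ n * (a n)^2)" for n
      have "sum e {n} <= suminf e" by (rule sum_le_suminf) (auto intro: summableI)
      then have "ennreal (2 ^ n * (a n)^2) <= ennreal K" unfolding K(2)[symmetric] by (simp add: e_def[abs_def])
      then have "2 ^ n * (a n)^2 <= K" using K(1) by (simp add: ennreal_le_iff)
      then have "(a n)^2 <= K * (1 / 2) ^ n" by (simp add: power_divide field_simps)
      also have "(1 / 2) ^ n = ((1 / sqrt 2) ^ n)^2"
        unfolding power_mult[symmetric] mult.commute[of n 2] unfolding power_mult by (simp add: power_divide)
      also have "K * ((1 / sqrt 2) ^ n)^2 = (sqrt K * (1 / sqrt 2) ^ n)^2"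
        unfolding power_mult_distrib using K(1) by simp
      finally show "(a n)^2 <= (sqrt K * (1 / sqrt 2) ^ n)^2" .
    qed (use K in auto)
    show ?case unfolding a_def[symmetric]
    proof (rule summable_comparison_test')
      show "summable (\<lambda>n. sqrt K * (1 / sqrt 2) ^ n)"
        by (intro summable_mult summable_geometric) (auto simp: real_less_lsqrt)
      show "norm (a n) <= sqrt K * (1 / sqrt 2) ^ n" if "0 <= n" for n using bd[of n] by (simp add: a_def)
    qed
  qed
qed

lemma Cauchy_fast_subseq:
  fixes f :: "nat => 'a::metric_space"
  assumes "Cauchy f"
  obtains r where "strict_mono r" "!!n m. n <= m ==> dist (f (r m)) (f (r n)) <= (1/4) ^ n"
proof -
  have "\<exists>r. \<forall>n. (\<forall>j\<ge>r n. \<forall>k\<ge>r n. dist (f j) (f k) <= (1/4::real) ^ n) & r n < r (Suc n)"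
  proof (rule dependent_nat_choice)
    have ex: "\<exists>N. \<forall>j\<ge>N. \<forall>k\<ge>N. dist (f j) (f k) <= (1/4::real) ^ n" for n
      using metric_CauchyD[OF assms, of "(1/4)^n"] by (auto intro: less_imp_le)
    show "\<exists>x. \<forall>j\<ge>x. \<forall>k\<ge>x. dist (f j) (f k) <= (1/4::real) ^ 0" by (rule ex)
    show "\<exists>y. (\<forall>j\<ge>y. \<forall>k\<ge>y. dist (f j) (f k) <= (1/4::real) ^ Suc n) & x < y" for x n
    proof -
      obtain N where "\<forall>j\<ge>N. \<forall>k\<ge>N. dist (f j) (f k) <= (1/4::real) ^ Suc n" using ex by blast
      then show ?thesis by (intro exI[of _ "max N (Suc x)"]) auto
    qed
  qed
  then obtain r where r: "!!n. \<forall>j\<ge>r n. \<forall>k\<ge>r n. dist (f j) (f k) <= (1/4::real) ^ n" "!!n. r n < r (Suc n)" by blast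
  have sm: "strict_mono r" using r(2) by (simp add: strict_mono_Suc_iff)
  show ?thesis
    by (rule that[OF sm]) (use r(1) sm in "auto simp: strict_mono_less_eq")
qed

text \<open>The Riesz-Fischer argument: a fast subsequence converges almost everywhere, and Fatou's
  lemma turns this into convergence in norm.\<close>

instance L2 :: (measured) complete_space
proof
  fix f :: "nat => 'a L2" assume C: "Cauchy f"
  obtain r where r: "strict_mono r" "!!n m. n <= m ==> dist (f (r m)) (f (r n)) <= (1/4) ^ n"
    using Cauchy_fast_subseq[OF C] by blast
  define g where "g n = fun_of (f (r n))" for n
  define G where "G x = lim (\<lambda>n. g n x)" for x
  have [measurable]: "g n \<in> bmv" for n by (simp add: g_def)
  have G_meas [measurable]: "G \<in> bmv"
    unfolding G_def by (rule borel_measurable_lim_metric) simp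
  have lim: "AE x in volume. (\<lambda>n. g n x) ----> G x"
  proof -
    have "AE x in volume. \<forall>n. fun_of (f (r (Suc n)) - f (r n)) x = fun_of (f (r (Suc n))) x - fun_of (f (r n)) x"
      unfolding AE_all_countable by (intro allI fun_of_diff)
    moreover have "AE x in volume. summable (\<lambda>n. cmod (fun_of (f (r (Suc n)) - f (r n)) x))"
      by (rule L2_AE_summable) (use r(2)[of n "Suc n" for n] in "simp add: dist_norm")
    ultimately show ?thesis
    proof eventually_elim
      case (elim x)
      have "summable (\<lambda>n. norm (g (Suc n) x - g n x))"
        using elim(2) unfolding elim(1)[rule_format] g_def .
      then have "summable (\<lambda>n. g (Suc n) x - g n x)" by (rule summable_norm_cancel)
      then have "(\<lambda>n. \<Sum>k<n. g (Suc k) x - g k x) ----> (\<Sum>k. g (Suc k) x - g k x)"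
        by (rule summable_LIMSEQ)
      then have "(\<lambda>n. g n x - g 0 x) ----> (\<Sum>k. g (Suc k) x - g k x)"
        by (simp only: sum_lessThan_telescope[of "\<lambda>k. g k x"])
      from tendsto_add[OF this tendsto_const[of "g 0 x"]]
      have "convergent (\<lambda>n. g n x)" by (auto simp: convergent_def)
      then show ?case unfolding G_def by (rule convergent_LIMSEQ_iff[THEN iffD1])
    qed
  qed
  have est: "(\<integral>\<^sup>+x. ennreal ((cmod (G x - g n x))^2) \<partial>volume) <= ennreal (((1/4)^n)^2)" for n
  proof -
    have "(\<integral>\<^sup>+x. ennreal ((cmod (G x - g n x))^2) \<partial>volume)
        = (\<integral>\<^sup>+x. liminf (\<lambda>m. ennreal ((cmod (g m x - g n x))^2)) \<partial>volume)"
    proof (rule nn_integral_cong_AE)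
      show "AE x in volume. ennreal ((cmod (G x - g n x))^2) = liminf (\<lambda>m. ennreal ((cmod (g m x - g n x))^2))"
        using lim
      proof eventually_elim
        case (elim x)
        have "(\<lambda>m. ennreal ((cmod (g m x - g n x))^2)) ----> ennreal ((cmod (G x - g n x))^2)"
          by (intro tendsto_intros elim)
        then show ?case by (intro lim_imp_Liminf[symmetric]) auto
      qed
    qed
    also have "... <= liminf (\<lambda>m. \<integral>\<^sup>+x. ennreal ((cmod (g m x - g n x))^2) \<partial>volume)"
      by (rule nn_integral_liminf) measurable
    also have "... <= ennreal (((1/4)^n)^2)"
    proof (rule Liminf_le)
      show "\<forall>\<^sub>F m in sequentially. (\<integral>\<^sup>+x. ennreal ((cmod (g m x - g n x))^2) \<partial>volume) <= ennreal (((1/4)^n)^2)"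
        using eventually_ge_at_top[of n]
      proof eventually_elim
        case (elim m)
        have "(\<integral>\<^sup>+x. ennreal ((cmod (g m x - g n x))^2) \<partial>volume) = ennreal ((norm (f (r m) - f (r n)))^2)"
          unfolding nn_integral_fun_of[symmetric]
          by (rule nn_integral_cong_AE) (use fun_of_diff[of "f (r m)" "f (r n)"] in "auto simp: g_def elim: eventually_mono")
        also have "... <= ennreal (((1/4)^n)^2)"
          using r(2)[OF elim] by (intro ennreal_leI power_mono) (auto simp: dist_norm)
        finally show ?case .
      qed
    qed simp
    finally show ?thesis .
  qed
  have sq: "square_integrable (\<lambda>x. G x - g n x)" for n
    unfolding square_integrable_iff_nn_integral using le_less_trans[OF est[of n]] by auto
  have sqG: "square_integrable G"
    using square_integrable_add[OF sq[of 0], of "g 0"] square_integrable_fun_of[of "f (r 0)"] by (simp add: g_def)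
  have bound: "norm (L2_of G - f (r n)) <= (1/4)^n" for n
  proof (rule power2_le_imp_le)
    have "ennreal ((norm (L2_of G - f (r n)))^2) = (\<integral>\<^sup>+x. ennreal ((cmod (G x - g n x))^2) \<partial>volume)"
      unfolding nn_integral_fun_of[symmetric]
      by (rule nn_integral_cong_AE) (use fun_of_diff[of "L2_of G" "f (r n)"] fun_of_L2_of[OF sqG] in "eventually_elim, simp add: g_def")
    then have "ennreal ((norm (L2_of G - f (r n)))^2) <= ennreal (((1/4)^n)^2)" using est by simp
    then show "(norm (L2_of G - f (r n)))^2 <= ((1/4)^n)^2" by (simp add: ennreal_le_iff)
  qed simp
  have "(\<lambda>n. f (r n)) ----> L2_of G"
  proof (rule LIM_zero_cancel, rule Lim_null_comparison)
    show "\<forall>\<^sub>F n in sequentially. norm (f (r n) - L2_of G) <= (1/4)^n"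
      using bound by (simp add: norm_minus_commute)
    show "(\<lambda>n. (1/4::real)^n) ----> 0" by (rule LIMSEQ_realpow_zero) auto
  qed
  then have "f ----> L2_of G"
    using Cauchy_converges_subseq[OF C r(1), of "L2_of G"] by (simp add: o_def)
  then show "convergent f" by (auto simp: convergent_def)
qed

instance L2 :: (measured) banach ..

lemma L2_dominated_convergence:
  fixes f :: "nat => 'a::measured L2"
  assumes F: "square_integrable F" "!!n. AE x in volume. cmod (fun_of (f n) x) <= cmod (F x)"
    and lim: "AE x in volume. (\<lambda>n. fun_of (f n) x) ----> fun_of g x"
  shows "f ----> g"
proof -
  have [measurable]: "F \<in> bmv" using F(1) by (auto simp: square_integrable_def)
  have F2: "integrable volume (\<lambda>x. (cmod (F x))^2)" using F(1) by (auto simp: square_integrable_def)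
  have "(\<lambda>n. LINT x|volume. (cmod (fun_of (f n) x - fun_of g x))^2) ----> (LINT x|(volume :: 'a measure). (0::real))"
  proof (rule integral_dominated_convergence[where w = "\<lambda>x. 4 * (cmod (F x))^2"])
    show "AE x in volume. (\<lambda>n. (cmod (fun_of (f n) x - fun_of g x))^2) ----> 0"
      using lim
    proof eventually_elim
      case (elim x)
      have "(\<lambda>n. (cmod (fun_of (f n) x - fun_of g x))^2) ----> (cmod (fun_of g x - fun_of g x))^2"
        by (intro tendsto_intros elim)
      then show ?case by simp
    qed
    show "AE x in volume. norm ((cmod (fun_of (f n) x - fun_of g x))^2) <= 4 * (cmod (F x))^2" for n
    proof -
      have "AE x in volume. \<forall>n. cmod (fun_of (f n) x) <= cmod (F x)"
        unfolding AE_all_countable using F(2) by blast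
      with lim show ?thesis
      proof eventually_elim
        case (elim x)
        have "cmod (fun_of g x) <= cmod (F x)"
          by (rule LIMSEQ_le_const2[OF tendsto_norm[OF elim(1)]]) (use elim(2) in auto)
        then have "cmod (fun_of (f n) x - fun_of g x) <= 2 * cmod (F x)"
          using norm_triangle_ineq4[of "fun_of (f n) x" "fun_of g x"] elim(2) by (smt (verit))
        from power_mono[OF this, of 2] show ?case by (simp add: power_mult_distrib)
      qed
    qed
  qed (use F2 in auto)
  moreover have "(LINT x|volume. (cmod (fun_of (f n) x - fun_of g x))^2) = (norm (f n - g))^2" for n
    unfolding norm_fun_of
    by (rule integral_cong_AE) (use fun_of_diff[of "f n" g] in "auto elim: eventually_mono")
  ultimately have "(\<lambda>n. sqrt ((norm (f n - g))^2)) ----> sqrt 0" by (intro tendsto_real_sqrt) simp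
  then show ?thesis by (simp add: tendsto_norm_zero_iff LIM_zero_iff)
qed

section \<open>Multiplication by bounded functions, and the unitary groups generated by real
  functions\<close>

definition mulop :: "('a::measured => complex) => 'a L2 => 'a L2" where
  "mulop w ph = L2_of (\<lambda>x. w x * fun_of ph x)"

definition bmult :: "('a::measured => complex) => bool" where
  "bmult w \<longleftrightarrow> w \<in> bmv & (\<exists>K. \<forall>x. cmod (w x) <= K)"

lemma bmultI:
  "w \<in> bmv ==> (!!x. cmod (w x) <= K) ==> bmult w"
  by (auto simp: bmult_def)

lemma square_integrable_mult:
  assumes "bmult w" "square_integrable f" shows "square_integrable (\<lambda>x. w x * f x)"
proof -
  obtain K where K: "!!x. cmod (w x) <= K" and [measurable]: "w \<in> bmv"
    using assms(1) by (auto simp: bmult_def)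
  have [measurable]: "f \<in> bmv" using assms(2) by (auto simp: square_integrable_def)
  have "integrable volume (\<lambda>x. K^2 * (cmod (f x))^2)" using assms(2) by (auto simp: square_integrable_def)
  then have "integrable volume (\<lambda>x. (cmod (w x * f x))^2)"
    by (rule Bochner_Integration.integrable_bound)
       (auto simp: norm_mult power_mult_distrib intro!: mult_right_mono power_mono K)
  then show ?thesis by (simp add: square_integrable_def)
qed

lemma fun_of_mulop:
  assumes "bmult w" shows "AE x in volume. fun_of (mulop w ph) x = w x * fun_of ph x"
  unfolding mulop_def by (intro fun_of_L2_of square_integrable_mult assms square_integrable_fun_of)

lemma mulop_norm_le:
  assumes "w \<in> bmv" "!!x. cmod (w x) <= K" shows "norm (mulop w ph) <= K * norm ph"
proof (rule L2_norm_le)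
  show "AE x in volume. cmod (fun_of (mulop w ph) x) <= K * cmod (fun_of ph x)"
    using fun_of_mulop[OF bmultI[OF assms], of ph]
    by eventually_elim (auto simp: norm_mult intro!: mult_right_mono assms)
  show "0 <= K" using order_trans[OF norm_ge_zero assms(2)] .
qed

lemma mulop_add: "bmult w ==> mulop w (ph + ps) = mulop w ph + mulop w ps"
  using fun_of_mulop[of w ph] fun_of_mulop[of w ps] fun_of_mulop[of w "ph + ps"]
    fun_of_add[of ph ps] fun_of_add[of "mulop w ph" "mulop w ps"]
  by (intro L2_eqI) (auto elim!: eventually_elim2 simp: distrib_left)

lemma mulop_scaleC: "bmult w ==> mulop w (c *\<^sub>C ph) = c *\<^sub>C mulop w ph"
proof (rule L2_eqI)
  assume w: "bmult w"
  show "AE x in volume. fun_of (mulop w (c *\<^sub>C ph)) x = fun_of (c *\<^sub>C mulop w ph) x"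
    using fun_of_mulop[OF w, of ph] fun_of_mulop[OF w, of "c *\<^sub>C ph"] fun_of_scaleC[of c ph] fun_of_scaleC[of c "mulop w ph"]
    by eventually_elim simp
qed

lemma bounded_clinear_mulop:
  assumes "bmult w" shows "bounded_clinear (mulop w)"
proof -
  obtain K where K: "!!x. cmod (w x) <= K" and w: "w \<in> bmv"
    using assms by (auto simp: bmult_def)
  show ?thesis by (rule bounded_clinearI[OF mulop_add[OF assms] mulop_scaleC[OF assms] mulop_norm_le[OF w K]])
qed

lemma mulop_mulop:
  assumes "bmult w" "bmult v"
  shows "mulop w (mulop v ph) = mulop (\<lambda>x. w x * v x) ph"
proof -
  have "bmult (\<lambda>x. w x * v x)"
  proof -
    obtain K L where "!!x. cmod (w x) <= K" "!!x. cmod (v x) <= L" and "w \<in> bmv" "v \<in> bmv"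
      using assms by (auto simp: bmult_def)
    moreover have "0 <= K" using order_trans[OF norm_ge_zero calculation(1)] .
    ultimately show ?thesis
      by (intro bmultI[where K = "K * L"]) (auto simp: norm_mult intro!: mult_mono)
  qed
  from fun_of_mulop[OF this, of ph] fun_of_mulop[OF assms(1), of "mulop v ph"] fun_of_mulop[OF assms(2), of ph]
  show ?thesis by (intro L2_eqI, eventually_elim) simp
qed

lemma mulop_one: "mulop (\<lambda>x. 1) ph = ph"
  by (simp add: mulop_def L2_of_fun_of)

lemma cinner_mulop:
  assumes w: "bmult w"
  shows "cinner ph (mulop w ps) = (LINT x|volume. w x * (cnj (fun_of ph x) * fun_of ps x))"
proof -
  have [measurable]: "w \<in> bmv" using w by (auto simp: bmult_def)
  show ?thesis unfolding cinner_fun_of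
  proof (rule integral_cong_AE)
    show "AE x in volume. cnj (fun_of ph x) * fun_of (mulop w ps) x = w x * (cnj (fun_of ph x) * fun_of ps x)"
      using fun_of_mulop[OF w, of ps] by eventually_elim simp
  qed measurable
qed

lemma cinner_mulop_left:
  assumes w: "bmult w"
  shows "cinner (mulop w ph) ps = cinner ph (mulop (\<lambda>x. cnj (w x)) ps)"
proof -
  have w': "bmult (\<lambda>x. cnj (w x))" using w by (auto simp: bmult_def)
  have [measurable]: "w \<in> bmv" using w by (auto simp: bmult_def)
  show ?thesis unfolding cinner_mulop[OF w'] unfolding cinner_fun_of
  proof (rule integral_cong_AE)
    show "AE x in volume. cnj (fun_of (mulop w ph) x) * fun_of ps x = cnj (w x) * (cnj (fun_of ph x) * fun_of ps x)"
      using fun_of_mulop[OF w, of ph] by eventually_elim simp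
  qed measurable
qed

lemma unitary_groupI:
  assumes "!!t. bounded_clinear (U t)" "!!t x y. cinner (U t x) (U t y) = cinner x y"
    "!!x. U 0 x = x" "!!s t x. U (s + t) x = U s (U t x)" "!!x. continuous_on UNIV (\<lambda>t. U t x)"
  shows "unitary_group U"
proof -
  have "surj (U t)" for t
    by (rule surjI[where f = "U (-t)"]) (use assms(4)[of t "-t"] assms(3) in simp)
  then show ?thesis using assms by (auto simp: unitary_group_def unitary_op_def fun_eq_iff)
qed

lemma cmod_cis_minus_one_le: "cmod (cis a - 1) <= \<bar>a\<bar>"
proof (rule power2_le_imp_le)
  have "(cmod (cis a - 1))^2 = (cos a - 1)^2 + (sin a)^2" by (simp add: cmod_power2)
  also have "... = 2 - 2 * cos (2 * (a / 2))"
    using sin_cos_squared_add[of a] by (simp add: power2_eq_square algebra_simps)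
  also have "... = (2 * \<bar>sin (a / 2)\<bar>)^2" by (simp only: cos_double_sin) (simp add: power_mult_distrib)
  also have "... <= (2 * \<bar>a / 2\<bar>)^2" by (intro power_mono mult_left_mono abs_sin_x_le_abs_x) auto
  finally show "(cmod (cis a - 1))^2 <= \<bar>a\<bar>^2" by simp
qed simp

definition phase_group :: "('a::measured => real) => real => 'a L2 => 'a L2" where
  "phase_group w t = mulop (\<lambda>x. cis (- t * w x))"

lemma cis_measurable [measurable]:
  "f \<in> borel_measurable M ==> (\<lambda>x. cis (f x)) \<in> borel_measurable M"
  by (rule borel_measurable_continuous_on[of cis]) (auto intro!: continuous_intros simp: cis_conv_exp)

text \<open>Vectors in the domain of the multiplication operator are differentiated by dominated
  convergence. Conversely, an element of the generator is tested by symmetry against such vectors,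
  which determines its image almost everywhere.\<close>

lemma phase_group:
  assumes [measurable]: "w \<in> bmv"
  shows "unitary_group (phase_group w)"
    and "generator (phase_group w) = multiplication_op (\<lambda>x. cx (w x))"
proof -
  have bm: "bmult (\<lambda>x. cis (- t * w x))" for t
    by (rule bmultI[where K=1]) auto
  note fm = fun_of_mulop[OF bm]
  show U: "unitary_group (phase_group w)" unfolding phase_group_def
  proof (rule unitary_groupI)
    show "bounded_clinear (mulop (\<lambda>x. cis (- t * w x)))" for t by (rule bounded_clinear_mulop[OF bm])
    have bm': "bmult (\<lambda>x. cnj (cis (- t * w x)))" for t
      using bm[of t] by (auto simp: bmult_def)
    show "cinner (mulop (\<lambda>x. cis (- t * w x)) x) (mulop (\<lambda>x. cis (- t * w x)) y) = cinner x y" for t x y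
      by (simp only: cinner_mulop_left[OF bm] mulop_mulop[OF bm' bm])
         (simp add: cis_cnj cis_mult mulop_one)
    show "mulop (\<lambda>x. cis (- 0 * w x)) x = x" for x by (simp add: mulop_one)
    show "mulop (\<lambda>x. cis (- (s + t) * w x)) x = mulop (\<lambda>x. cis (- s * w x)) (mulop (\<lambda>x. cis (- t * w x)) x)" for s t x
      by (simp only: mulop_mulop[OF bm bm] cis_mult) (simp add: algebra_simps)
    show "continuous_on UNIV (\<lambda>t. mulop (\<lambda>x. cis (- t * w x)) ph)" for ph
      unfolding continuous_on_sequentially
    proof (intro allI ballI impI, elim conjE)
      fix t :: "nat => real" and s assume t: "t ----> s"
      show "((\<lambda>t. mulop (\<lambda>x. cis (- t * w x)) ph) \<circ> t) ----> mulop (\<lambda>x. cis (- s * w x)) ph"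
        unfolding o_def
      proof (rule L2_dominated_convergence[OF square_integrable_fun_of[of ph]])
        show "AE x in volume. cmod (fun_of (mulop (\<lambda>x. cis (- t n * w x)) ph) x) <= cmod (fun_of ph x)" for n
          using fm[of "t n" ph] by eventually_elim (simp add: norm_mult)
        have "AE x in volume. \<forall>n. fun_of (mulop (\<lambda>x. cis (- t n * w x)) ph) x = cis (- t n * w x) * fun_of ph x"
          unfolding AE_all_countable by (intro allI fm)
        with fm[of s ph] show "AE x in volume. (\<lambda>n. fun_of (mulop (\<lambda>x. cis (- t n * w x)) ph) x)
            ----> fun_of (mulop (\<lambda>x. cis (- s * w x)) ph) x"
          by eventually_elim (auto simp: cis_conv_exp intro!: tendsto_intros t)
      qed
    qed
  qed
  interpret unitary_group_locale "phase_group w" by unfold_locales (rule U)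
  have quot: "AE x in volume. fun_of (\<i> *\<^sub>C ((phase_group w t ph - ph) /\<^sub>R t)) x
      = \<i> * ((cis (- t * w x) - 1) / t) * fun_of ph x" for t ph
    using fm[of t ph] fun_of_diff[of "mulop (\<lambda>x. cis (- t * w x)) ph" ph]
      fun_of_scaleC[of "\<i> * of_real (inverse t)" "mulop (\<lambda>x. cis (- t * w x)) ph - ph"]
    by eventually_elim (simp add: scaleR_scaleC scaleC_scaleC phase_group_def divide_inverse left_diff_distrib right_diff_distrib mult_ac)
  have lim: "(\<lambda>n. \<i> * ((cis (- t n * w x) - 1) / t n) * c) ----> w x * c"
    if t: "t ----> 0" "!!n. t n ~= 0" for t :: "nat => real" and x and c :: complex
  proof (cases "w x = 0")
    case True then show ?thesis by (simp add: cis_zero)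
  next
    case False
    define z where "z n = - \<i> * of_real (t n * w x)" for n
    have z0: "z n ~= 0" for n using False that by (simp add: z_def)
    have "z ----> - \<i> * of_real (0 * w x)" unfolding z_def by (intro tendsto_intros t)
    then have "z ----> 0" by simp
    moreover have "((\<lambda>h. (exp h - 1) / h) \<longlongrightarrow> (1::complex)) (at 0)"
      using DERIV_exp[of "0::complex"] by (simp add: has_field_derivative_def[symmetric] DERIV_def)
    ultimately have "(\<lambda>n. (exp (z n) - 1) / z n) ----> 1"
      using z0 by (auto simp: tendsto_at_iff_sequentially o_def)
    from tendsto_mult[OF this tendsto_const[of "w x * c"]]
    have "(\<lambda>n. (exp (z n) - 1) / z n * (w x * c)) ----> w x * c" by simp
    moreover have "(exp (z n) - 1) / z n * (w x * c) = \<i> * ((cis (- t n * w x) - 1) / t n) * c" for n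
    proof -
      have "cis (- t n * w x) = exp (z n)" by (simp add: cis_conv_exp z_def)
      then show ?thesis using False that(2)[of n] by (simp add: z_def field_simps)
    qed
    ultimately show ?thesis by simp
  qed
  have sub: "(ph, ps) \<in> generator (phase_group w)" if "(ph, ps) \<in> multiplication_op (\<lambda>x. cx (w x))" for ph ps
  proof -
    have ps: "AE x in volume. fun_of ps x = cx (w x) * fun_of ph x" using that by (simp add: multiplication_op_def)
    show ?thesis
      unfolding generator_def mem_Collect_eq prod.case tendsto_at_iff_sequentially o_def
    proof (intro allI impI)
      fix t :: "nat => real" assume "\<forall>n. t n \<in> UNIV - {0}" and t: "t ----> 0"
      then have t0: "!!n. t n ~= 0" by auto
      show "(\<lambda>n. \<i> *\<^sub>C ((phase_group w (t n) ph - ph) /\<^sub>R t n)) ----> ps"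
      proof (rule L2_dominated_convergence[OF square_integrable_fun_of[of ps]])
        show "AE x in volume. cmod (fun_of (\<i> *\<^sub>C ((phase_group w (t n) ph - ph) /\<^sub>R t n)) x) <= cmod (fun_of ps x)" for n
          using quot[of "t n" ph] ps
        proof eventually_elim
          case (elim x)
          have "cmod (cis (- t n * w x) - 1) <= \<bar>t n * w x\<bar>"
            using cmod_cis_minus_one_le[of "- t n * w x"] by simp
          then have "cmod (cis (- t n * w x) - 1) / \<bar>t n\<bar> <= \<bar>w x\<bar>"
            using t0[of n] by (simp add: abs_mult field_simps)
          then show ?case unfolding elim norm_mult norm_divide
            by (intro mult_right_mono) auto
        qed
        have "AE x in volume. \<forall>n. fun_of (\<i> *\<^sub>C ((phase_group w (t n) ph - ph) /\<^sub>R t n)) x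
          = \<i> * ((cis (- t n * w x) - 1) / t n) * fun_of ph x" unfolding AE_all_countable by (intro allI quot)
        with ps show "AE x in volume. (\<lambda>n. fun_of (\<i> *\<^sub>C ((phase_group w (t n) ph - ph) /\<^sub>R t n)) x) ----> fun_of ps x"
          by eventually_elim (use lim[OF t t0] in simp)
      qed
    qed
  qed
  show "generator (phase_group w) = multiplication_op (\<lambda>x. cx (w x))"
  proof (intro set_eqI iffI; clarify)
    fix ph ps assume g: "(ph, ps) \<in> generator (phase_group w)"
    \<comment> \<open>Both \<open>b\<close> and \<open>w b\<close> are bounded, so
      \<open>mulop b u\<close> lies in the domain of the multiplication operator for every
      \<open>u\<close>; and \<open>b\<close> has no zeros, so it can be cancelled at the
      end.\<close>
    define b where "b x = cx (1 / (1 + \<bar>w x\<bar>))" for x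
    have b: "bmult b" "bmult (\<lambda>x. w x * b x)"
      unfolding b_def by (rule bmultI[where K=1]; simp add: norm_divide norm_mult flip: of_real_add of_real_divide)+
    have cb: "cnj (b x) = b x" for x by (simp add: b_def)
    have "cinner u (mulop (\<lambda>x. w x * b x) ph) = cinner u (mulop b ps)" for u
    proof -
      have "AE x in volume. fun_of (mulop (\<lambda>x. w x * b x) u) x = cx (w x) * fun_of (mulop b u) x"
        using fun_of_mulop[OF b(1), of u] fun_of_mulop[OF b(2), of u] by eventually_elim simp
      from generator_symmetric[OF g sub, unfolded multiplication_op_def, OF CollectI, of "mulop b u" "mulop (\<lambda>x. w x * b x) u"] this
      have "cinner (mulop (\<lambda>x. w x * b x) ph) u = cinner (mulop b ps) u"
        unfolding cinner_mulop_left[OF b(1)] cinner_mulop_left[OF b(2)] by (simp add: cb)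
      then show ?thesis by (metis cinner_commute)
    qed
    then have e: "mulop (\<lambda>x. w x * b x) ph = mulop b ps" by (rule cinner_eqI)
    have b0: "b x ~= 0" for x unfolding b_def by (simp add: add_nonneg_eq_0_iff flip: of_real_add)
    have "AE x in volume. fun_of ps x = w x * fun_of ph x"
      using fun_of_mulop[OF b(1), of ps] fun_of_mulop[OF b(2), of ph] unfolding e
      by eventually_elim (simp add: b0 mult.left_commute mult.assoc)
    then show "(ph, ps) \<in> multiplication_op (\<lambda>x. cx (w x))" by (simp add: multiplication_op_def)
  qed (rule sub)
qed

section \<open>The measure on configurations\<close>

type_synonym momentum = "real ^ 3"

lemma volume_momentum: "(volume :: momentum measure) = lborel"
  by (rule volume_vec_def)

lemma sets_volume_momentum [measurable_cong]: "sets (volume :: momentum measure) = sets borel"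
  by (simp add: volume_momentum)

lemma space_volume_momentum [simp]: "space (volume :: momentum measure) = UNIV"
  by (simp add: volume_momentum)

interpretation momentum: product_sigma_finite "\<lambda>_::nat. volume :: momentum measure"
  unfolding volume_momentum by (rule product_sigma_finite.intro) (rule lborel.sigma_finite_measure_axioms)

interpretation momentum1: sigma_finite_measure "volume :: momentum measure"
  unfolding volume_momentum by (rule lborel.sigma_finite_measure_axioms)

lemma sigma_finite_particle_space: "sigma_finite_measure (particle_space n :: (nat => momentum) measure)"
  by (rule momentum.sigma_finite) simp

abbreviation particles :: "nat => (nat => momentum) measure" where
  "particles \<equiv> particle_space"

lemma space_volume_multiset [simp]: "space (volume :: 'a::measured multiset measure) = UNIV"
  unfolding volume_multiset_def by (rule space_measure_of) simp

lemma size_configuration [simp]: "size (cfg n x) = n"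
  by (simp add: configuration_def)

lemma configuration_cong: "(!!i. i < n ==> x i = y i) ==> cfg n x = configuration n y"
  unfolding configuration_def by (intro arg_cong[where f = mset] map_cong) auto

lemma configuration_Suc: "configuration (Suc n) (x(n := k)) = add_mset k (cfg n x)"
proof -
  have "map (x(n := k)) [0..<n] = map x [0..<n]" by (auto simp: map_eq_conv)
  then show ?thesis by (simp add: configuration_def)
qed

lemma configuration_surj: "\<exists>x. X = configuration (size X) x"
proof -
  obtain xs where xs: "mset xs = X" using ex_mset by blast
  have "configuration (size X) ((!) xs) = mset (map ((!) xs) [0..<length xs])"
    unfolding configuration_def xs[symmetric] size_mset ..
  then have "configuration (size X) ((!) xs) = X" by (simp only: map_nth xs)
  then show ?thesis by metis
qed

lemma configuration_measurable [measurable]: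
  "configuration n \<in> measurable (particle_space n) (volume :: 'a::measured multiset measure)"
  by (rule measurableI) (auto simp: sets_volume_multiset preconfiguration_def)

lemma measurable_multiset_iff:
  assumes "range f \<subseteq> space N"
  shows "f \<in> measurable (volume :: 'a::measured multiset measure) N
    \<longleftrightarrow> (\<forall>n. (\<lambda>x. f (cfg n x)) \<in> measurable (particle_space n) N)"
proof
  assume "\<forall>n. (\<lambda>x. f (cfg n x)) \<in> measurable (particle_space n) N"
  then have "(\<lambda>x. f (cfg n x)) -` A \<inter> space (particle_space n) \<in> sets (particle_space n)" if "A \<in> sets N" for n A
    using that measurable_sets by blast
  then show "f \<in> measurable volume N" using assms
    by (intro measurableI) (auto simp: sets_volume_multiset preconfiguration_def vimage_def)
qed (auto intro: measurable_compose[OF configuration_measurable])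

lemma nn_integral_multiset:
  assumes "f \<in> borel_measurable (volume :: 'a::measured multiset measure)"
  shows "(\<integral>\<^sup>+X. f X \<partial>volume) = (\<Sum>n. \<integral>\<^sup>+x. f (cfg n x) \<partial>particle_space n)"
  using assms
proof induction
  case (cong f g)
  then show ?case by simp
next
  case (set A)
  have "(\<integral>\<^sup>+x. indicator A (cfg n x) \<partial>particle_space n) = emeasure (particle_space n) (preconfiguration n A)" for n
  proof -
    have "(\<integral>\<^sup>+x. indicator A (cfg n x) \<partial>particle_space n) = (\<integral>\<^sup>+x. indicator (preconfiguration n A) x \<partial>particle_space n)"
      by (rule nn_integral_cong) (auto simp: preconfiguration_def indicator_def)
    then show ?thesis using set by (simp add: sets_volume_multiset)
  qed
  then show ?case using set by (simp add: emeasure_volume_multiset)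
next
  case (mult u c)
  have [measurable]: "u \<in> bmv" by fact
  have "(\<integral>\<^sup>+x. c * u (cfg n x) \<partial>particle_space n) = c * (\<integral>\<^sup>+x. u (cfg n x) \<partial>particle_space n)" for n
    by (rule nn_integral_cmult) measurable
  then show ?case using mult by (simp add: nn_integral_cmult)
next
  case (add u v)
  have [measurable]: "u \<in> bmv" "v \<in> bmv" by fact+
  have "(\<integral>\<^sup>+x. v (cfg n x) + u (cfg n x) \<partial>particle_space n)
      = (\<integral>\<^sup>+x. v (cfg n x) \<partial>particle_space n) + (\<integral>\<^sup>+x. u (cfg n x) \<partial>particle_space n)" for n
    by (rule nn_integral_add) measurable
  then show ?case using add by (simp add: nn_integral_add suminf_add)
next
  case (seq U)
  have [measurable]: "U i \<in> bmv" for i by fact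
  have inc: "incseq (\<lambda>i. U i X)" for X using \<open>incseq U\<close> by (auto simp: mono_def le_fun_def)
  have "(\<integral>\<^sup>+X. (SUP i. U i) X \<partial>volume) = (SUP i. \<integral>\<^sup>+X. U i X \<partial>volume)"
    unfolding SUP_apply by (rule nn_integral_monotone_convergence_SUP) (use \<open>incseq U\<close> in auto)
  also have "... = (SUP i. \<Sum>n. \<integral>\<^sup>+x. U i (cfg n x) \<partial>particle_space n)" using seq by simp
  also have "... = (\<Sum>n. SUP i. \<integral>\<^sup>+x. U i (cfg n x) \<partial>particle_space n)"
    by (rule ennreal_suminf_SUP_eq[symmetric])
       (use inc in "auto simp: mono_def intro!: nn_integral_mono")
  also have "... = (\<Sum>n. \<integral>\<^sup>+x. (SUP i. U i) (cfg n x) \<partial>particle_space n)"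
  proof (rule suminf_cong)
    fix n
    have "(\<integral>\<^sup>+x. (SUP i. U i (cfg n x)) \<partial>particle_space n) = (SUP i. \<integral>\<^sup>+x. U i (cfg n x) \<partial>particle_space n)"
      by (rule nn_integral_monotone_convergence_SUP) (use inc in "auto simp: mono_def le_fun_def")
    then show "(SUP i. \<integral>\<^sup>+x. U i (cfg n x) \<partial>particle_space n) = (\<integral>\<^sup>+x. (SUP i. U i) (cfg n x) \<partial>particle_space n)"
      by (simp only: SUP_apply)
  qed
  finally show ?case .
qed

lemma AE_multisetI:
  assumes "!!n. AE x in particle_space n. Q (cfg n x)" and "{X. Q X} \<in> sets (volume :: 'a::measured multiset measure)"
  shows "AE X in volume. Q X"
proof -
  have [measurable]: "{X. \<not> Q X} \<in> sets volume"
    using sets.compl_sets[OF assms(2)] by (simp add: Collect_neg_eq Compl_eq_Diff_UNIV)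
  have "emeasure volume {X. \<not> Q X} = 0"
  proof -
    have "emeasure (particle_space n) (preconfiguration n {X. \<not> Q X}) = 0" for n
    proof -
      have "preconfiguration n {X. \<not> Q X} = {x \<in> space (particle_space n). \<not> Q (cfg n x)}"
        by (auto simp: preconfiguration_def)
      note eq = this
      have "preconfiguration n {X. \<not> Q X} \<in> sets (particle_space n)"
        using \<open>{X. \<not> Q X} \<in> sets volume\<close> by (simp add: sets_volume_multiset)
      from AE_iff_measurable[OF this eq[symmetric]] assms(1)[of n] show ?thesis by blast
    qed
    then show ?thesis by (simp add: emeasure_volume_multiset)
  qed
  then show ?thesis by (intro AE_I[of _ _ "{X. \<not> Q X}"]) auto
qed

lemma fun_upd_particles [measurable]:
  "(\<lambda>(x, k). x(n := k)) \<in> measurable (particles n \<Otimes>\<^sub>M volume) (particles (Suc n))"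
  unfolding lessThan_Suc by (rule measurable_add_dim)

lemma fun_upd_particles1 [measurable]:
  "(\<lambda>x. x(n := k)) \<in> measurable (particles n) (particles (Suc n))"
  using measurable_compose[OF _ fun_upd_particles[of n], of "\<lambda>x. (x, k)" "particles n"]
  by simp

lemma add_configuration_measurable [measurable]:
  "(\<lambda>(x, k). add_mset k (cfg n x)) \<in> measurable (particles n \<Otimes>\<^sub>M volume) volume"
proof -
  have "(\<lambda>z. configuration (Suc n) ((\<lambda>(x, k). x(n := k)) z)) \<in> measurable (particles n \<Otimes>\<^sub>M volume) volume"
    by (rule measurable_compose[OF fun_upd_particles configuration_measurable])
  then show ?thesis by (simp add: case_prod_unfold configuration_Suc)
qed

lemma add_mset_measurable [measurable]: "add_mset (k::momentum) \<in> measurable volume volume"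
proof (subst measurable_multiset_iff, simp, intro allI)
  fix n
  have "(\<lambda>x. configuration (Suc n) (x(n := k))) \<in> measurable (particles n) volume"
    by (rule measurable_compose[OF fun_upd_particles1 configuration_measurable])
  then show "(\<lambda>x. add_mset k (cfg n x)) \<in> measurable (particles n) volume"
    by (simp add: configuration_Suc)
qed

text \<open>Separates the last particle; this is the step in inductions on the particle number and
  the link between adjacent sectors used for annihilation operators.\<close>

lemma nn_integral_particles_Suc:
  assumes [measurable]: "f \<in> borel_measurable (volume :: momentum multiset measure)"
  shows "(\<integral>\<^sup>+x. f (configuration (Suc n) x) \<partial>particles (Suc n))
      = (\<integral>\<^sup>+x. \<integral>\<^sup>+k. f (add_mset k (cfg n x)) \<partial>volume \<partial>particles n)"
    "(\<integral>\<^sup>+x. f (configuration (Suc n) x) \<partial>particles (Suc n))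
      = (\<integral>\<^sup>+k. \<integral>\<^sup>+x. f (add_mset k (cfg n x)) \<partial>particles n \<partial>volume)"
proof -
  have m: "(\<lambda>x. f (configuration (Suc n) x)) \<in> borel_measurable (Pi\<^sub>M (insert n {..<n}) (\<lambda>_. volume))"
    unfolding lessThan_Suc[symmetric] by measurable
  show "(\<integral>\<^sup>+x. f (configuration (Suc n) x) \<partial>particles (Suc n))
      = (\<integral>\<^sup>+x. \<integral>\<^sup>+k. f (add_mset k (cfg n x)) \<partial>volume \<partial>particles n)"
    using momentum.product_nn_integral_insert[OF _ _ m] by (simp add: lessThan_Suc configuration_Suc)
  show "(\<integral>\<^sup>+x. f (configuration (Suc n) x) \<partial>particles (Suc n))
      = (\<integral>\<^sup>+k. \<integral>\<^sup>+x. f (add_mset k (cfg n x)) \<partial>particles n \<partial>volume)"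
    using momentum.product_nn_integral_insert_rev[OF _ _ m] by (simp add: lessThan_Suc configuration_Suc)
qed

lemma finite_measurable_conj_elems:
  assumes [measurable]: "N \<in> sets (volume :: momentum measure)"
  shows "{X. \<forall>k\<in>#X. k \<in> N} \<in> sets volume"
proof -
  have "preconfiguration n {X. \<forall>k\<in>#X. k \<in> N} = {x \<in> space (particles n). \<forall>i\<in>{..<n}. x i \<in> N}" for n
    by (auto simp: preconfiguration_def configuration_def)
  moreover have "{x \<in> space (particles n). \<forall>i\<in>{..<n}. x i \<in> N} \<in> sets (particles n)" for n
    by measurable
  ultimately show ?thesis by (simp add: sets_volume_multiset)
qed

text \<open>In each sector there are finitely many coordinates, and each of them avoids a null set
  almost everywhere. This carries almost-everywhere identities for one-particle representatives over
  to Fock space.\<close>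

lemma AE_all_elements:
  assumes "AE k in (volume :: momentum measure). Q k"
  shows "AE X in volume. \<forall>k\<in>#X. Q k"
proof -
  obtain N where N: "{k. \<not> Q k} \<subseteq> N" "N \<in> null_sets volume"
    using assms by (auto elim!: AE_E simp: null_sets_def)
  have [measurable]: "N \<in> sets volume" using N by auto
  have "AE X in volume. \<forall>k\<in>#X. k \<in> - N"
  proof (rule AE_multisetI)
    fix n
    have *: "AE x in particles n. x i \<notin> N" if i: "i < n" for i
    proof -
      have "emeasure (particles n) {x \<in> space (particles n). x i \<in> N} = 0"
      proof -
        have "{x \<in> space (particles n). x i \<in> N} = Pi\<^sub>E {..<n} (\<lambda>j. if j = i then N else UNIV)"
        proof (rule set_eqI)
          fix x
          have "(\<forall>j\<in>{..<n}. x j \<in> (if j = i then N else UNIV)) \<longleftrightarrow> x i \<in> N" using i by auto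
          then show "x \<in> {x \<in> space (particles n). x i \<in> N} \<longleftrightarrow> x \<in> Pi\<^sub>E {..<n} (\<lambda>j. if j = i then N else UNIV)"
            unfolding mem_Collect_eq space_PiM PiE_iff by auto
        qed
        moreover have "emeasure (particles n) (Pi\<^sub>E {..<n} (\<lambda>j. if j = i then N else UNIV))
          = (\<Prod>j<n. emeasure volume (if j = i then N else UNIV))"
          by (rule momentum.emeasure_PiM) auto
        moreover have "... = 0" using i N by (auto intro!: prod_zero)
        ultimately show ?thesis by simp
      qed
      then show ?thesis using i by (subst AE_iff_measurable[OF _ refl]) auto
    qed
    have "AE x in particles n. \<forall>i\<in>{..<n}. x i \<notin> N"
      by (subst AE_finite_all) (auto intro: *)
    then show "AE x in particles n. \<forall>k\<in>#cfg n x. k \<in> - N"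
      by eventually_elim (auto simp: configuration_def)
    have "- N \<in> sets volume" using sets.compl_sets[of N volume] N by (simp add: Compl_eq_Diff_UNIV)
    then show "{X. \<forall>k\<in>#X. k \<in> - N} \<in> sets volume" by (rule finite_measurable_conj_elems)
  qed
  then show ?thesis by eventually_elim (use N(1) in auto)
qed

lemma prod_configuration: "(\<Prod>k\<in>#cfg n x. c k) = (\<Prod>i<n. (c (x i) :: 'b::comm_monoid_mult))"
  by (simp add: configuration_def prod_unfold_prod_mset lessThan_atLeast0 image_mset.compositionality o_def)

lemma sum_configuration: "(\<Sum>k\<in>#cfg n x. c k) = (\<Sum>i<n. (c (x i) :: 'b::comm_monoid_add))"
  by (simp add: configuration_def sum_unfold_sum_mset lessThan_atLeast0 image_mset.compositionality o_def)

lemma prod_mset_measurable [measurable]: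
  fixes c :: "momentum => complex"
  assumes [measurable]: "c \<in> bmv"
  shows "(\<lambda>X. \<Prod>k\<in>#X. c k) \<in> bmv"
  by (subst measurable_multiset_iff) (auto simp: prod_configuration)

lemma sum_mset_measurable [measurable]:
  fixes c :: "momentum => 'b::{second_countable_topology, topological_comm_monoid_add}"
  assumes [measurable]: "c \<in> bmv"
  shows "(\<lambda>X. \<Sum>k\<in>#X. c k) \<in> bmv"
  by (subst measurable_multiset_iff) (auto simp: sum_configuration)

lemma size_measurable [measurable]: "size \<in> measurable (volume :: 'a::measured multiset measure) (count_space UNIV)"
  by (subst measurable_multiset_iff) auto

subsection \<open>Scaling\<close>

lemma scaleR_measurable_momentum [measurable]: "(\<lambda>k. s *\<^sub>R k) \<in> measurable (volume :: momentum measure) volume"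
  by measurable

lemma image_mset_configuration: "image_mset f (cfg n x) = configuration n (\<lambda>i. f (x i))"
  by (simp add: configuration_def image_mset.compositionality o_def)

lemma image_mset_scale_measurable [measurable]:
  "image_mset ((*\<^sub>R) s) \<in> measurable (volume :: momentum multiset measure) volume"
proof (subst measurable_multiset_iff, simp, intro allI)
  fix n
  have "(\<lambda>x. configuration n (\<lambda>i\<in>{..<n}. s *\<^sub>R x i)) \<in> measurable (particles n) volume"
    by (rule measurable_compose[OF _ configuration_measurable]) measurable
  moreover have "configuration n (\<lambda>i\<in>{..<n}. s *\<^sub>R x i) = image_mset ((*\<^sub>R) s) (cfg n x)" for x :: "nat => momentum"
    unfolding image_mset_configuration by (rule configuration_cong) simp
  ultimately show "(\<lambda>x. image_mset ((*\<^sub>R) s) (cfg n x)) \<in> measurable (particles n) volume" by simp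
qed

lemma nn_integral_scale:
  assumes s: "0 < s" and [measurable]: "f \<in> borel_measurable (volume :: momentum measure)"
  shows "ennreal (s ^ 3) * (\<integral>\<^sup>+k. f (s *\<^sub>R k) \<partial>volume) = (\<integral>\<^sup>+k. f k \<partial>volume)"
proof -
  have [measurable]: "f \<in> borel_measurable borel" using assms(2) by (simp add: volume_momentum)
  have "(\<integral>\<^sup>+k. f k \<partial>(lborel :: momentum measure))
      = (\<integral>\<^sup>+k. f k \<partial>density (distr lborel borel (\<lambda>x. 0 + s *\<^sub>R x)) (\<lambda>_. \<bar>s\<bar> ^ DIM(momentum)))"
    using lborel_affine[of s "0::momentum"] s by simp
  also have "... = (\<integral>\<^sup>+k. ennreal (s ^ 3) * f (s *\<^sub>R k) \<partial>lborel)"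
    using s by (subst nn_integral_density) (auto simp: nn_integral_distr)
  also have "... = ennreal (s ^ 3) * (\<integral>\<^sup>+k. f (s *\<^sub>R k) \<partial>lborel)" by (rule nn_integral_cmult) measurable
  finally show ?thesis by (simp add: volume_momentum)
qed

lemma nn_integral_particles_scale:
  assumes s: "0 < s" and "f \<in> borel_measurable (volume :: momentum multiset measure)"
  shows "ennreal (s ^ (3 * n)) * (\<integral>\<^sup>+x. f (image_mset ((*\<^sub>R) s) (cfg n x)) \<partial>particles n)
    = (\<integral>\<^sup>+x. f (cfg n x) \<partial>particles n)"
  using assms(2)
proof (induction n arbitrary: f)
  case 0
  show ?case by (simp add: configuration_def)
next
  case (Suc n)
  note [measurable] = Suc.prems
  have mk: "(\<lambda>X. f (add_mset k X)) \<in> bmv" for k by measurable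
  let ?G = "\<lambda>k. \<integral>\<^sup>+x. f (add_mset k (cfg n x)) \<partial>particles n"
  have G: "?G \<in> bmv"
  proof -
    interpret sigma_finite_measure "particles n" by (rule sigma_finite_particle_space)
    have "(\<lambda>(k, x). f (add_mset k (cfg n x))) \<in> borel_measurable (volume \<Otimes>\<^sub>M particles n)"
      using measurable_compose[OF measurable_pair_swap' measurable_compose[OF add_configuration_measurable Suc.prems]]
      by (simp add: case_prod_unfold)
    then show ?thesis using borel_measurable_nn_integral[of "\<lambda>k x. f (add_mset k (cfg n x))" volume] by simp
  qed
  have "ennreal (s ^ (3 * Suc n)) * (\<integral>\<^sup>+x. f (image_mset ((*\<^sub>R) s) (configuration (Suc n) x)) \<partial>particles (Suc n))
      = ennreal (s ^ 3) * (ennreal (s ^ (3 * n)) * (\<integral>\<^sup>+k. \<integral>\<^sup>+x. f (image_mset ((*\<^sub>R) s) (add_mset k (cfg n x))) \<partial>particles n \<partial>volume))"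
    using s by (subst nn_integral_particles_Suc(2)) (auto simp: power_add ennreal_mult mult.assoc)
  also have "... = ennreal (s ^ 3) * (\<integral>\<^sup>+k. ennreal (s ^ (3 * n)) * (\<integral>\<^sup>+x. f (add_mset (s *\<^sub>R k) (image_mset ((*\<^sub>R) s) (cfg n x))) \<partial>particles n) \<partial>volume)"
  proof -
    interpret sigma_finite_measure "particles n" by (rule sigma_finite_particle_space)
    have "(\<lambda>(k, x). f (image_mset ((*\<^sub>R) s) (add_mset k (cfg n x)))) \<in> borel_measurable (volume \<Otimes>\<^sub>M particles n)"
      using measurable_compose[OF measurable_pair_swap' measurable_compose[OF add_configuration_measurable measurable_compose[OF image_mset_scale_measurable Suc.prems]]]
      by (simp add: case_prod_unfold)
    then have "(\<lambda>k. \<integral>\<^sup>+x. f (image_mset ((*\<^sub>R) s) (add_mset k (cfg n x))) \<partial>particles n) \<in> bmv"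
      using borel_measurable_nn_integral[of "\<lambda>k x. f (image_mset ((*\<^sub>R) s) (add_mset k (cfg n x)))" volume] by simp
    then show ?thesis by (subst nn_integral_cmult[symmetric]) auto
  qed
  also have "... = ennreal (s ^ 3) * (\<integral>\<^sup>+k. ?G (s *\<^sub>R k) \<partial>volume)"
    by (simp add: Suc.IH[OF mk])
  also have "... = (\<integral>\<^sup>+k. ?G k \<partial>volume)" by (rule nn_integral_scale[OF s G])
  also have "... = (\<integral>\<^sup>+x. f (configuration (Suc n) x) \<partial>particles (Suc n))"
    by (rule nn_integral_particles_Suc(2)[symmetric]) measurable
  finally show ?case .
qed

lemma nn_integral_multiset_scale:
  assumes s: "0 < s" and [measurable]: "f \<in> borel_measurable (volume :: momentum multiset measure)"
  shows "(\<integral>\<^sup>+X. ennreal (s ^ (3 * size X)) * f (image_mset ((*\<^sub>R) s) X) \<partial>volume) = (\<integral>\<^sup>+X. f X \<partial>volume)"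
proof -
  have "(\<integral>\<^sup>+x. ennreal (s ^ (3 * n)) * f (image_mset ((*\<^sub>R) s) (cfg n x)) \<partial>particles n)
     = (\<integral>\<^sup>+x. f (cfg n x) \<partial>particles n)" for n
    unfolding nn_integral_particles_scale[OF s assms(2), symmetric] by (rule nn_integral_cmult) measurable
  then show ?thesis by (simp add: nn_integral_multiset)
qed

text \<open>Makes composition with a scaling well defined on classes of functions: the Jacobian
  \<open>s ^ (3 * size X)\<close> is positive, so null sets go to null sets.\<close>

lemma AE_scale_multiset:
  assumes s: "0 < s" and Q: "AE X in (volume :: momentum multiset measure). Q X"
  shows "AE X in volume. Q (image_mset ((*\<^sub>R) s) X)"
proof -
  obtain N where N: "{X. \<not> Q X} \<subseteq> N" "N \<in> null_sets volume"
    using Q by (auto elim!: AE_E simp: null_sets_def)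
  have [measurable]: "N \<in> sets volume" using N by auto
  have "(\<integral>\<^sup>+X. ennreal (s ^ (3 * size X)) * indicator N (image_mset ((*\<^sub>R) s) X) \<partial>volume) = 0"
    using N by (subst nn_integral_multiset_scale[OF s]) auto
  then have "AE X in volume. ennreal (s ^ (3 * size X)) * indicator N (image_mset ((*\<^sub>R) s) X) = 0"
    by (subst (asm) nn_integral_0_iff_AE) auto
  then show ?thesis
    by eventually_elim (use N(1) s in "auto split: split_indicator_asm")
qed

lemma AE_scale_momentum:
  assumes s: "0 < s" and Q: "AE k in (volume :: momentum measure). Q k"
  shows "AE k in volume. Q (s *\<^sub>R k)"
proof -
  obtain N where N: "{X. \<not> Q X} \<subseteq> N" "N \<in> null_sets volume"
    using Q by (auto elim!: AE_E simp: null_sets_def)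
  have [measurable]: "N \<in> sets volume" using N by auto
  have "ennreal (s ^ 3) * (\<integral>\<^sup>+k. indicator N (s *\<^sub>R k) \<partial>volume) = 0"
    using N by (subst nn_integral_scale[OF s]) auto
  then have "(\<integral>\<^sup>+k. indicator N (s *\<^sub>R k) \<partial>volume) = (0::ennreal)" using s by auto
  then have "AE k in volume. indicator N (s *\<^sub>R k) = (0::ennreal)"
    by (subst (asm) nn_integral_0_iff_AE) auto
  then show ?thesis
    by eventually_elim (use N(1) s in "auto split: split_indicator_asm")
qed

subsection \<open>Weighted compositions with scalings\<close>

text \<open>The common form of the two one-particle groups in use: dilations have
  \<open>s = exp t\<close> and a constant weight, the free evolution has \<open>s = 1\<close> and a
  phase. Second quantisation preserves this form, with the product of the weights over the
  configuration.\<close>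

definition wcomp :: "real => (momentum => complex) => momentum L2 => momentum L2" where
  "wcomp s c ph = L2_of (\<lambda>k. c k * fun_of ph (s *\<^sub>R k))"

definition wcomp_fock :: "real => (momentum => complex) => momentum fock => momentum fock" where
  "wcomp_fock s c ps = L2_of (\<lambda>X. (\<Prod>k\<in>#X. c k) * fun_of ps (image_mset ((*\<^sub>R) s) X))"

definition isometric_weight :: "real => (momentum => complex) => bool" where
  "isometric_weight s c \<longleftrightarrow> 0 < s & c \<in> bmv & (\<forall>k. (cmod (c k))^2 = s ^ 3)"

lemma isometric_weight_prod:
  assumes "isometric_weight s c"
  shows "(cmod (\<Prod>k\<in>#X. c k))^2 = s ^ (3 * size X)"
proof (induction X)
  case (add x X)
  then show ?case using assms by (simp add: isometric_weight_def norm_mult power_mult_distrib power_add)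
qed simp

lemma nn_integral_wcomp:
  assumes "isometric_weight s c" "square_integrable f"
  shows "(\<integral>\<^sup>+k. ennreal ((cmod (c k * f (s *\<^sub>R k)))^2) \<partial>volume) = (\<integral>\<^sup>+k. ennreal ((cmod (f k))^2) \<partial>volume)"
proof -
  have [measurable]: "f \<in> bmv" using assms by (auto simp: square_integrable_def)
  have s: "0 < s" and c: "!!k. (cmod (c k))^2 = s ^ 3" using assms by (auto simp: isometric_weight_def)
  have "(\<integral>\<^sup>+k. ennreal ((cmod (c k * f (s *\<^sub>R k)))^2) \<partial>volume) = (\<integral>\<^sup>+k. ennreal (s ^ 3) * ennreal ((cmod (f (s *\<^sub>R k)))^2) \<partial>volume)"
    using s by (simp add: norm_mult power_mult_distrib c ennreal_mult)
  also have "... = ennreal (s ^ 3) * (\<integral>\<^sup>+k. ennreal ((cmod (f (s *\<^sub>R k)))^2) \<partial>volume)" by (rule nn_integral_cmult) measurable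
  also have "... = (\<integral>\<^sup>+k. ennreal ((cmod (f k))^2) \<partial>volume)" by (rule nn_integral_scale[OF s]) measurable
  finally show ?thesis .
qed

lemma nn_integral_wcomp_fock:
  assumes "isometric_weight s c" "square_integrable f"
  shows "(\<integral>\<^sup>+X. ennreal ((cmod ((\<Prod>k\<in>#X. c k) * f (image_mset ((*\<^sub>R) s) X)))^2) \<partial>volume) = (\<integral>\<^sup>+X. ennreal ((cmod (f X))^2) \<partial>volume)"
proof -
  have [measurable]: "f \<in> bmv" using assms by (auto simp: square_integrable_def)
  have s: "0 < s" using assms by (auto simp: isometric_weight_def)
  have "(\<integral>\<^sup>+X. ennreal ((cmod ((\<Prod>k\<in>#X. c k) * f (image_mset ((*\<^sub>R) s) X)))^2) \<partial>volume)
     = (\<integral>\<^sup>+X. ennreal (s ^ (3 * size X)) * ennreal ((cmod (f (image_mset ((*\<^sub>R) s) X)))^2) \<partial>volume)"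
    using s by (simp add: norm_mult power_mult_distrib isometric_weight_prod[OF assms(1)] ennreal_mult)
  also have "... = (\<integral>\<^sup>+X. ennreal ((cmod (f X))^2) \<partial>volume)" by (rule nn_integral_multiset_scale[OF s]) measurable
  finally show ?thesis .
qed

lemma square_integrable_wcomp:
  assumes "isometric_weight s c" "square_integrable f"
  shows "square_integrable (\<lambda>k. c k * f (s *\<^sub>R k))"
    and "square_integrable g ==> square_integrable (\<lambda>X. (\<Prod>k\<in>#X. c k) * g (image_mset ((*\<^sub>R) s) X))"
proof -
  have [measurable]: "f \<in> bmv" "c \<in> bmv"
    using assms by (auto simp: square_integrable_def isometric_weight_def)
  show "square_integrable (\<lambda>k. c k * f (s *\<^sub>R k))"
    using assms unfolding square_integrable_iff_nn_integral by (subst nn_integral_wcomp) (auto simp: square_integrable_iff_nn_integral)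
  assume g: "square_integrable g"
  then have [measurable]: "g \<in> bmv" by (auto simp: square_integrable_def)
  show "square_integrable (\<lambda>X. (\<Prod>k\<in>#X. c k) * g (image_mset ((*\<^sub>R) s) X))"
    using assms g unfolding square_integrable_iff_nn_integral by (subst nn_integral_wcomp_fock) (auto simp: square_integrable_iff_nn_integral)
qed

lemma fun_of_wcomp:
  assumes "isometric_weight s c"
  shows "AE k in volume. fun_of (wcomp s c ph) k = c k * fun_of ph (s *\<^sub>R k)"
  unfolding wcomp_def by (intro fun_of_L2_of square_integrable_wcomp[OF assms] square_integrable_fun_of)

lemma fun_of_wcomp_fock:
  assumes "isometric_weight s c"
  shows "AE X in volume. fun_of (wcomp_fock s c ps) X = (\<Prod>k\<in>#X. c k) * fun_of ps (image_mset ((*\<^sub>R) s) X)"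
  unfolding wcomp_fock_def
  by (intro fun_of_L2_of square_integrable_wcomp(2)[OF assms square_integrable_zero] square_integrable_fun_of)

lemma norm_wcomp:
  assumes "isometric_weight s c"
  shows "norm (wcomp s c ph) = norm ph" "norm (wcomp_fock s c ps) = norm ps"
proof -
  have "ennreal ((norm (wcomp s c ph))^2) = ennreal ((norm ph)^2)" unfolding wcomp_def
    by (subst norm_L2_of_nn)
       (auto simp: nn_integral_wcomp[OF assms square_integrable_fun_of] nn_integral_fun_of square_integrable_wcomp[OF assms square_integrable_fun_of])
  then have "(norm (wcomp s c ph))^2 = (norm ph)^2" by simp
  then show "norm (wcomp s c ph) = norm ph" by (rule power2_eq_imp_eq) auto
  have "ennreal ((norm (wcomp_fock s c ps))^2) = ennreal ((norm ps)^2)" unfolding wcomp_fock_def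
    by (subst norm_L2_of_nn)
       (auto simp: nn_integral_wcomp_fock[OF assms square_integrable_fun_of] nn_integral_fun_of square_integrable_wcomp(2)[OF assms square_integrable_zero square_integrable_fun_of])
  then have "(norm (wcomp_fock s c ps))^2 = (norm ps)^2" by simp
  then show "norm (wcomp_fock s c ps) = norm ps" by (rule power2_eq_imp_eq) auto
qed

lemma bounded_clinear_wcomp:
  assumes c: "isometric_weight s c"
  shows "bounded_clinear (wcomp s c)" "bounded_clinear (wcomp_fock s c)"
proof -
  have s: "0 < s" using c by (simp add: isometric_weight_def)
  show "bounded_clinear (wcomp s c)"
  proof (rule bounded_clinearI[where K=1])
    fix ph ps :: "momentum L2" and d
    show "wcomp s c (ph + ps) = wcomp s c ph + wcomp s c ps"
      using fun_of_wcomp[OF c, of ph] fun_of_wcomp[OF c, of ps] fun_of_wcomp[OF c, of "ph + ps"]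
        AE_scale_momentum[OF s fun_of_add[of ph ps]] fun_of_add[of "wcomp s c ph" "wcomp s c ps"]
      by (intro L2_eqI, eventually_elim) (simp add: distrib_left)
    show "wcomp s c (d *\<^sub>C ph) = d *\<^sub>C wcomp s c ph"
      using fun_of_wcomp[OF c, of ph] fun_of_wcomp[OF c, of "d *\<^sub>C ph"]
        AE_scale_momentum[OF s fun_of_scaleC[of d ph]] fun_of_scaleC[of d "wcomp s c ph"]
      by (intro L2_eqI, eventually_elim) simp
  qed (simp add: norm_wcomp[OF c])
  show "bounded_clinear (wcomp_fock s c)"
  proof (rule bounded_clinearI[where K=1])
    fix ph ps :: "momentum fock" and d
    show "wcomp_fock s c (ph + ps) = wcomp_fock s c ph + wcomp_fock s c ps"
      using fun_of_wcomp_fock[OF c, of ph] fun_of_wcomp_fock[OF c, of ps] fun_of_wcomp_fock[OF c, of "ph + ps"]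
        AE_scale_multiset[OF s fun_of_add[of ph ps]] fun_of_add[of "wcomp_fock s c ph" "wcomp_fock s c ps"]
      by (intro L2_eqI, eventually_elim) (simp add: distrib_left)
    show "wcomp_fock s c (d *\<^sub>C ph) = d *\<^sub>C wcomp_fock s c ph"
      using fun_of_wcomp_fock[OF c, of ph] fun_of_wcomp_fock[OF c, of "d *\<^sub>C ph"]
        AE_scale_multiset[OF s fun_of_scaleC[of d ph]] fun_of_scaleC[of d "wcomp_fock s c ph"]
      by (intro L2_eqI, eventually_elim) simp
  qed (simp add: norm_wcomp[OF c])
qed

lemma isometric_weight_compose:
  "isometric_weight s c ==> isometric_weight t d ==> isometric_weight (s * t) (\<lambda>k. c k * d (s *\<^sub>R k))"
  by (auto simp: isometric_weight_def norm_mult power_mult_distrib)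

lemma wcomp_compose:
  assumes c: "isometric_weight s c" and d: "isometric_weight t d"
  shows "wcomp s c (wcomp t d ph) = wcomp (s * t) (\<lambda>k. c k * d (s *\<^sub>R k)) ph"
    "wcomp_fock s c (wcomp_fock t d ps) = wcomp_fock (s * t) (\<lambda>k. c k * d (s *\<^sub>R k)) ps"
proof -
  have s: "0 < s" using c by (simp add: isometric_weight_def)
  note cd = isometric_weight_compose[OF c d]
  show "wcomp s c (wcomp t d ph) = wcomp (s * t) (\<lambda>k. c k * d (s *\<^sub>R k)) ph"
    using fun_of_wcomp[OF c, of "wcomp t d ph"] AE_scale_momentum[OF s fun_of_wcomp[OF d, of ph]] fun_of_wcomp[OF cd, of ph]
    by (intro L2_eqI, eventually_elim) (simp add: mult.assoc mult.commute[of t s])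
  show "wcomp_fock s c (wcomp_fock t d ps) = wcomp_fock (s * t) (\<lambda>k. c k * d (s *\<^sub>R k)) ps"
    using fun_of_wcomp_fock[OF c, of "wcomp_fock t d ps"] AE_scale_multiset[OF s fun_of_wcomp_fock[OF d, of ps]] fun_of_wcomp_fock[OF cd, of ps]
    by (intro L2_eqI, eventually_elim)
       (simp add: prod_mset.distrib image_mset.compositionality o_def mult.assoc mult.commute[of t s])
qed

section \<open>Symmetric tensors and second quantisation\<close>

text \<open>All fibres of \<open>\<pi> \<mapsto> permute_list \<pi> xs\<close> are cosets of the stabiliser of \<open>xs\<close>.\<close>

lemma permutations_of_multiset_average:
  fixes F :: "'a list => 'b::field_char_0"
  shows "(\<Sum>ks\<in>permutations_of_multiset (mset xs). F ks) / of_nat (card (permutations_of_multiset (mset xs)))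
    = (\<Sum>\<pi>\<in>{\<pi>. \<pi> permutes {..<length xs}}. F (permute_list \<pi> xs)) / fact (length xs)"
proof -
  define S where "S = {\<pi>. \<pi> permutes {..<length xs}}"
  define g where "g \<pi> = permute_list \<pi> xs" for \<pi>
  let ?Q = "permutations_of_multiset (mset xs)"
  have fin: "finite S" by (simp add: S_def finite_permutations)
  have img: "g ` S = ?Q"
  proof (intro equalityI subsetI)
    fix ks assume "ks \<in> g ` S" then show "ks \<in> ?Q" by (auto simp: g_def S_def permutations_of_multiset_def)
  next
    fix ks assume "ks \<in> ?Q"
    then have "mset ks = mset xs" by (rule permutations_of_multisetD)
    then obtain p where "p permutes {..<length xs}" "permute_list p xs = ks" by (rule mset_eq_permutation)
    then show "ks \<in> g ` S" by (auto simp: g_def S_def)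
  qed
  have fib: "card {\<pi>\<in>S. g \<pi> = ks} = card {\<pi>\<in>S. g \<pi> = xs}" if ks: "ks \<in> ?Q" for ks
  proof -
    from ks img obtain p where p: "p \<in> S" "g p = ks" by (metis imageE)
    have pp: "p permutes {..<length xs}" and ip: "inv p permutes {..<length xs}"
      using p by (auto simp: S_def permutes_inv)
    have len: "length ks = length xs" using p by (auto simp: g_def)
    have "bij_betw (\<lambda>s. s \<circ> p) {\<pi>\<in>S. g \<pi> = xs} {\<pi>\<in>S. g \<pi> = ks}"
    proof (rule bij_betw_byWitness[where f' = "\<lambda>s. s \<circ> inv p"])
      show "\<forall>a\<in>{\<pi>\<in>S. g \<pi> = xs}. (a \<circ> p) \<circ> inv p = a" "\<forall>a\<in>{\<pi>\<in>S. g \<pi> = ks}. (a \<circ> inv p) \<circ> p = a"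
        using permutes_inv_o[OF pp] by (auto simp: o_assoc[symmetric])
      show "(\<lambda>s. s \<circ> p) ` {\<pi>\<in>S. g \<pi> = xs} \<subseteq> {\<pi>\<in>S. g \<pi> = ks}"
        using p pp by (auto simp: S_def g_def permutes_compose permute_list_compose)
      show "(\<lambda>s. s \<circ> inv p) ` {\<pi>\<in>S. g \<pi> = ks} \<subseteq> {\<pi>\<in>S. g \<pi> = xs}"
      proof clarsimp
        fix \<pi> assume \<pi>: "\<pi> \<in> S" "ks = g \<pi>"
        have "g (\<pi> \<circ> inv p) = permute_list (inv p) (g \<pi>)" unfolding g_def by (rule permute_list_compose[OF ip])
        also have "... = permute_list (inv p) (permute_list p xs)" using \<pi> p by (simp add: g_def)
        also have "... = permute_list (p \<circ> inv p) xs" by (rule permute_list_compose[OF ip, symmetric])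
        finally show "\<pi> \<circ> inv p \<in> S & g (\<pi> \<circ> inv p) = xs"
          using \<pi> permutes_compose[OF ip, of \<pi>] permutes_inv_o(1)[OF pp] by (auto simp: S_def)
      qed
    qed
    then show ?thesis by (rule bij_betw_same_card[symmetric])
  qed
  define c where "c = card {\<pi>\<in>S. g \<pi> = xs}"
  have sum_eq: "(\<Sum>\<pi>\<in>S. G (g \<pi>)) = of_nat c * (\<Sum>ks\<in>?Q. G ks)" for G :: "'a list => 'b"
  proof -
    have "(\<Sum>\<pi>\<in>S. G (g \<pi>)) = (\<Sum>ks\<in>g ` S. \<Sum>\<pi>\<in>{\<pi>\<in>S. g \<pi> = ks}. G (g \<pi>))"
      by (rule sum.image_gen[OF fin])
    also have "... = (\<Sum>ks\<in>?Q. of_nat c * G ks)"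
      unfolding img by (rule sum.cong) (auto simp: fib c_def)
    finally show ?thesis by (simp add: sum_distrib_left)
  qed
  have "of_nat (fact (length xs)) = (of_nat c * of_nat (card ?Q) :: 'b)"
    using sum_eq[of "\<lambda>_. 1"] card_permutations[of "{..<length xs}" "length xs"] by (simp add: S_def)
  then have f: "fact (length xs) = (of_nat c * of_nat (card ?Q) :: 'b)" by simp
  then have "(of_nat c :: 'b) ~= 0" by (metis fact_nonzero mult_zero_left)
  then show ?thesis
    using sum_eq[of F] unfolding S_def[symmetric] g_def[symmetric] f by (simp add: field_simps)
qed

definition sym_prod :: "nat => (nat => momentum => complex) => momentum multiset => complex" where
  "sym_prod n h X = (if size X = n then
     (\<Sum>ks\<in>permutations_of_multiset X. \<Prod>i<n. h i (ks ! i)) / of_nat (card (permutations_of_multiset X)) else 0)"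

lemma sym_tensor_eq: "sym_tensor hs = L2_of (sym_prod (length hs) (\<lambda>i. fun_of (hs ! i)))"
  unfolding sym_tensor_def sym_prod_def ..

text \<open>Averaging over distinct orderings equals averaging over all \<open>n!\<close>
  permutations even where momenta coincide, so that one formula holds at every point of the
  sector.\<close>

lemma sym_prod_configuration:
  "sym_prod n h (cfg n x) = (\<Sum>\<pi>\<in>{\<pi>. \<pi> permutes {..<n}}. \<Prod>i<n. h i (x (\<pi> i))) / fact n"
proof -
  have "sym_prod n h (cfg n x)
    = (\<Sum>\<pi>\<in>{\<pi>. \<pi> permutes {..<n}}. \<Prod>i<n. h i (permute_list \<pi> (map x [0..<n]) ! i)) / fact n"
    using permutations_of_multiset_average[of "\<lambda>ks. \<Prod>i<n. h i (ks ! i)" "map x [0..<n]"]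
    by (simp only: sym_prod_def size_configuration simp_thms if_True) (simp add: configuration_def del: mset_map)
  also have "... = (\<Sum>\<pi>\<in>{\<pi>. \<pi> permutes {..<n}}. \<Prod>i<n. h i (x (\<pi> i))) / fact n"
  proof -
    have "permute_list \<pi> (map x [0..<n]) ! i = x (\<pi> i)" if "\<pi> permutes {..<n}" "i < n" for \<pi> i
      using permute_list_nth[of \<pi> "map x [0..<n]" i] that permutes_in_image[OF that(1), of i] by simp
    then show ?thesis by (auto intro!: arg_cong2[where f = "(/)"] sum.cong prod.cong)
  qed
  finally show ?thesis .
qed

lemma sym_prod_size: "size X ~= n ==> sym_prod n h X = 0"
  by (simp add: sym_prod_def)

lemma sym_prod_measurable:
  assumes "!!i. i < n ==> h i \<in> bmv"
  shows "sym_prod n h \<in> bmv"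
proof (subst measurable_multiset_iff, simp, intro allI)
  fix k
  show "(\<lambda>x. sym_prod n h (configuration k x)) \<in> borel_measurable (particles k)"
  proof (cases "k = n")
    case True
    have "(\<lambda>x. h i (x (\<pi> i))) \<in> borel_measurable (particles n)" if "\<pi> permutes {..<n}" "i < n" for \<pi> i
    proof -
      have "\<pi> i \<in> {..<n}" using that permutes_in_image[OF that(1), of i] by simp
      then have "(\<lambda>x. x (\<pi> i)) \<in> measurable (particles n) volume" by (rule measurable_component_singleton)
      then show ?thesis using assms[OF that(2)] by (rule measurable_compose)
    qed
    then show ?thesis unfolding True sym_prod_configuration
      by (intro borel_measurable_divide borel_measurable_sum borel_measurable_prod borel_measurable_const) auto
  qed (simp add: sym_prod_size)
qed

lemma nn_integral_sector:
  assumes "f \<in> borel_measurable (volume :: momentum multiset measure)" "!!X. size X ~= n ==> f X = 0"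
  shows "(\<integral>\<^sup>+X. f X \<partial>volume) = (\<integral>\<^sup>+x. f (cfg n x) \<partial>particles n)"
proof -
  have "(\<integral>\<^sup>+X. f X \<partial>volume) = (\<Sum>k\<in>{n}. \<integral>\<^sup>+x. f (configuration k x) \<partial>particles k)"
    unfolding nn_integral_multiset[OF assms(1)] by (rule suminf_finite) (auto simp: assms(2))
  then show ?thesis by simp
qed

text \<open>By the Cauchy-Schwarz inequality for the finite sum it is enough to integrate the square
  of one permuted product, and that integral factorises over the coordinates.\<close>

lemma square_integrable_sym_prod:
  assumes h: "!!i. i < n ==> square_integrable (h i)"
  shows "square_integrable (sym_prod n h)"
proof -
  let ?S = "{\<pi>. \<pi> permutes {..<n}}"
  have hm: "h i \<in> bmv" if "i < n" for i using h[OF that] by (simp add: square_integrable_def)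
  note m [measurable] = sym_prod_measurable[of n h, OF hm]
  have fin: "finite ?S" by (simp add: finite_permutations)
  have bound: "(cmod (sym_prod n h (cfg n x)))^2 <= real (card ?S) * (\<Sum>\<pi>\<in>?S. \<Prod>i<n. (cmod (h i (x (\<pi> i))))^2)" for x
  proof -
    have "cmod (sym_prod n h (cfg n x)) = cmod (\<Sum>\<pi>\<in>?S. \<Prod>i<n. h i (x (\<pi> i))) / fact n"
      by (simp add: sym_prod_configuration norm_divide)
    also have "... <= cmod (\<Sum>\<pi>\<in>?S. \<Prod>i<n. h i (x (\<pi> i)))"
      by (simp add: divide_le_eq mult_right_le_one_le fact_ge_1 mult_le_cancel_left1)
    also have "... <= (\<Sum>\<pi>\<in>?S. cmod (\<Prod>i<n. h i (x (\<pi> i))))" by (rule norm_sum)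
    finally have "(cmod (sym_prod n h (cfg n x)))^2 <= (\<Sum>\<pi>\<in>?S. cmod (\<Prod>i<n. h i (x (\<pi> i))))^2"
      by (intro power_mono) auto
    also have "... <= (\<Sum>\<pi>\<in>?S. (cmod (\<Prod>i<n. h i (x (\<pi> i))))^2) * real (card ?S)"
      by (rule sum_squared_le_sum_of_squares)
    finally show ?thesis by (simp add: prod_norm[symmetric] prod_power_distrib[symmetric] mult.commute)
  qed
  have one: "(\<integral>\<^sup>+x. ennreal (\<Prod>i<n. (cmod (h i (x (\<pi> i))))^2) \<partial>particles n) < \<infinity>"
    "(\<lambda>x. ennreal (\<Prod>i<n. (cmod (h i (x (\<pi> i))))^2)) \<in> borel_measurable (particles n)" if \<pi>: "\<pi> permutes {..<n}" for \<pi>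
  proof -
    have inv: "inv \<pi> j < n" if "j < n" for j
      using permutes_in_image[OF permutes_inv[OF \<pi>], of j] that by simp
    have re: "(\<Prod>i<n. (cmod (h i (x (\<pi> i))))^2) = (\<Prod>j<n. (cmod (h (inv \<pi> j) (x j)))^2)" for x
      by (rule prod.reindex_bij_witness[of _ "inv \<pi>" \<pi>])
         (use \<pi> inv permutes_inverses[OF \<pi>] permutes_in_image[OF \<pi>] in auto)
    have hm': "(\<lambda>k. ennreal ((cmod (h (inv \<pi> j) k))^2)) \<in> bmv" if "j < n" for j
      using hm[OF inv[OF that]] by measurable
    have "(\<integral>\<^sup>+x. ennreal (\<Prod>i<n. (cmod (h i (x (\<pi> i))))^2) \<partial>particles n)
      = (\<integral>\<^sup>+x. (\<Prod>j<n. ennreal ((cmod (h (inv \<pi> j) (x j)))^2)) \<partial>particles n)"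
      unfolding re by (simp add: prod_ennreal)
    also have "... = (\<Prod>j<n. \<integral>\<^sup>+k. ennreal ((cmod (h (inv \<pi> j) k))^2) \<partial>volume)"
      by (rule momentum.product_nn_integral_prod) (use hm' in auto)
    also have "... < \<infinity>"
    proof -
      have "(\<integral>\<^sup>+k. ennreal ((cmod (h (inv \<pi> j) k))^2) \<partial>volume) < top" if "j < n" for j
        using h[OF inv[OF that]] by (simp add: square_integrable_iff_nn_integral)
      moreover have "(\<Prod>j<k. f j) < (top::ennreal)" if "!!j. j < k ==> f j < top" for f :: "nat => ennreal" and k
        using that by (induction k) (auto simp: ennreal_mult_less_top)
      ultimately show ?thesis by simp
    qed
    finally show "(\<integral>\<^sup>+x. ennreal (\<Prod>i<n. (cmod (h i (x (\<pi> i))))^2) \<partial>particles n) < \<infinity>" .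
    have "(\<lambda>x. ennreal ((cmod (h (inv \<pi> j) (x j)))^2)) \<in> borel_measurable (particles n)" if "j < n" for j
    proof -
      have "(\<lambda>x. x j) \<in> measurable (particles n) volume" by (rule measurable_component_singleton) (use that in simp)
      then show ?thesis using hm'[OF that] by (rule measurable_compose)
    qed
    then have "(\<lambda>x. \<Prod>j<n. ennreal ((cmod (h (inv \<pi> j) (x j)))^2)) \<in> borel_measurable (particles n)"
      by (intro borel_measurable_prod_ennreal) auto
    then show "(\<lambda>x. ennreal (\<Prod>i<n. (cmod (h i (x (\<pi> i))))^2)) \<in> borel_measurable (particles n)"
      unfolding re by (simp add: prod_ennreal)
  qed
  have "(\<integral>\<^sup>+X. ennreal ((cmod (sym_prod n h X))^2) \<partial>volume) = (\<integral>\<^sup>+x. ennreal ((cmod (sym_prod n h (cfg n x)))^2) \<partial>particles n)"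
    by (rule nn_integral_sector) (auto simp: sym_prod_size)
  also have "... <= (\<integral>\<^sup>+x. ennreal (real (card ?S)) * (\<Sum>\<pi>\<in>?S. ennreal (\<Prod>i<n. (cmod (h i (x (\<pi> i))))^2)) \<partial>particles n)"
  proof (rule nn_integral_mono)
    fix x
    show "ennreal ((cmod (sym_prod n h (cfg n x)))^2) <= ennreal (real (card ?S)) * (\<Sum>\<pi>\<in>?S. ennreal (\<Prod>i<n. (cmod (h i (x (\<pi> i))))^2))"
      using ennreal_leI[OF bound[of x]] by (simp add: sum_ennreal prod_nonneg ennreal_mult sum_nonneg del: of_nat_eq_1_iff)
  qed
  also have "... = ennreal (real (card ?S)) * (\<Sum>\<pi>\<in>?S. \<integral>\<^sup>+x. ennreal (\<Prod>i<n. (cmod (h i (x (\<pi> i))))^2) \<partial>particles n)"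
    by (subst nn_integral_cmult, (intro borel_measurable_sum one(2), simp)[1], subst nn_integral_sum) (use one(2) in auto)
  also have "... < \<infinity>"
    using one(1) fin by (simp add: ennreal_mult_less_top)
  finally show ?thesis using m by (simp add: square_integrable_iff_nn_integral)
qed

lemma sym_prod_cong:
  assumes "!!i k. i < n ==> k \<in># X ==> h i k = h' i k"
  shows "sym_prod n h X = sym_prod n h' X"
proof -
  have "(\<Prod>i<n. h i (ks ! i)) = (\<Prod>i<n. h' i (ks ! i))" if "size X = n" "ks \<in> permutations_of_multiset X" for ks
  proof (rule prod.cong)
    fix i assume "i \<in> {..<n}"
    moreover have "length ks = n" "set ks = set_mset X"
      using permutations_of_multisetD[OF that(2)] that(1) by auto
    ultimately show "h i (ks ! i) = h' i (ks ! i)" by (intro assms) (auto simp flip: \<open>set ks = set_mset X\<close>)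
  qed simp
  then show ?thesis by (auto simp: sym_prod_def intro!: sum.cong)
qed

lemma sym_prod_cong_AE:
  assumes "!!i. i < n ==> AE k in volume. h i k = h' i k"
  shows "AE X in volume. sym_prod n h X = sym_prod n h' X"
proof -
  have "AE k in volume. \<forall>i\<in>{..<n}. h i k = h' i k" by (subst AE_finite_all) (auto intro: assms)
  then have "AE X in volume. \<forall>k\<in>#X. \<forall>i\<in>{..<n}. h i k = h' i k" by (rule AE_all_elements)
  then show ?thesis by eventually_elim (auto intro!: sym_prod_cong)
qed

lemma sym_prod_image:
  assumes "0 < s"
  shows "(\<Prod>k\<in>#X. c k) * sym_prod n h (image_mset ((*\<^sub>R) s) X) = sym_prod n (\<lambda>i k. c k * h i (s *\<^sub>R k)) X"
proof (cases "size X = n")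
  case True
  have inj: "inj_on (map ((*\<^sub>R) s)) A" for A :: "momentum list set"
    using assms by (auto simp: inj_on_def inj_def intro!: inj_onI dest!: map_injective)
  have e: "permutations_of_multiset (image_mset ((*\<^sub>R) s) X) = map ((*\<^sub>R) s) ` permutations_of_multiset X"
    by (rule permutations_of_multiset_image)
  have p: "(\<Prod>k\<in>#X. c k) * (\<Prod>i<n. h i (map ((*\<^sub>R) s) ks ! i)) = (\<Prod>i<n. c (ks ! i) * h i (s *\<^sub>R (ks ! i)))"
    if "ks \<in> permutations_of_multiset X" for ks
  proof -
    have ks: "mset ks = X" "length ks = n" using permutations_of_multisetD[OF that] True by auto
    have "(\<Prod>k\<in>#X. c k) = prod_list (map c ks)" unfolding ks(1)[symmetric] by (simp flip: mset_map add: prod_mset_prod_list)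
    also have "... = (\<Prod>i<n. c (ks ! i))" using ks(2) by (simp add: prod.list_conv_set_nth lessThan_atLeast0)
    finally show ?thesis using ks(2) by (simp add: prod.distrib)
  qed
  show ?thesis using True p
    by (simp add: sym_prod_def e sum.reindex[OF inj] card_image[OF inj] sum_distrib_left o_def)
qed (simp add: sym_prod_size)

lemma wcomp_fock_sym_tensor:
  assumes c: "isometric_weight s c"
  shows "wcomp_fock s c (sym_tensor hs) = sym_tensor (map (wcomp s c) hs)"
proof (rule L2_eqI)
  have s: "0 < s" using c by (simp add: isometric_weight_def)
  let ?n = "length hs"
  have sq: "square_integrable (sym_prod ?n (\<lambda>i. fun_of (hs ! i)))"
    by (rule square_integrable_sym_prod) (rule square_integrable_fun_of)
  have sq': "square_integrable (sym_prod ?n (\<lambda>i. fun_of (map (wcomp s c) hs ! i)))"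
    by (rule square_integrable_sym_prod) (rule square_integrable_fun_of)
  have "AE X in volume. fun_of (sym_tensor (map (wcomp s c) hs)) X = sym_prod ?n (\<lambda>i. fun_of (map (wcomp s c) hs ! i)) X"
    using fun_of_L2_of[OF sq'] by (simp add: sym_tensor_eq)
  moreover have "AE X in volume. sym_prod ?n (\<lambda>i. fun_of (map (wcomp s c) hs ! i)) X
      = sym_prod ?n (\<lambda>i k. c k * fun_of (hs ! i) (s *\<^sub>R k)) X"
    by (rule sym_prod_cong_AE) (use fun_of_wcomp[OF c] in simp)
  moreover have "AE X in volume. fun_of (sym_tensor hs) (image_mset ((*\<^sub>R) s) X) = sym_prod ?n (\<lambda>i. fun_of (hs ! i)) (image_mset ((*\<^sub>R) s) X)"
    using AE_scale_multiset[OF s fun_of_L2_of[OF sq]] by (simp add: sym_tensor_eq)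
  ultimately show "AE X in volume. fun_of (wcomp_fock s c (sym_tensor hs)) X = fun_of (sym_tensor (map (wcomp s c) hs)) X"
    using fun_of_wcomp_fock[OF c, of "sym_tensor hs"]
    by eventually_elim (simp add: sym_prod_image[OF s])
qed

subsection \<open>Totality\<close>

text \<open>The image of the \<open>n\<close>-particle measure under \<open>configuration n\<close>
  is the restriction of \<open>volume\<close> to multisets of size \<open>n\<close>; the nonnegative
  version shows this on sets and the general integral follows.\<close>

lemma integral_sector:
  fixes f :: "momentum multiset => complex"
  assumes [measurable]: "f \<in> bmv" and "!!X. size X ~= n ==> f X = 0"
  shows "(LINT X|volume. f X) = (LINT x|particles n. f (cfg n x))"
proof -
  have "distr (particles n) volume (configuration n) = density volume (\<lambda>X. ennreal (indicator {X. size X = n} X))"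
  proof (rule measure_eqI)
    fix A assume "A \<in> sets (distr (particles n) volume (configuration n))"
    then have [measurable]: "A \<in> sets volume" by simp
    have "emeasure (density volume (\<lambda>X. ennreal (indicator {X. size X = n} X))) A
        = (\<integral>\<^sup>+X. indicator {X. size X = n} X * indicator A X \<partial>volume)"
      by (subst emeasure_density) (auto simp: ennreal_indicator)
    also have "... = (\<integral>\<^sup>+x. indicator A (cfg n x) \<partial>particles n)"
      by (subst nn_integral_sector[where n = n]) (auto simp: indicator_def)
    also have "... = (\<integral>\<^sup>+X. indicator A X \<partial>distr (particles n) volume (configuration n))"
      by (subst nn_integral_distr) auto
    also have "... = emeasure (distr (particles n) volume (configuration n)) A" by simp
    finally show "emeasure (distr (particles n) volume (configuration n)) A
      = emeasure (density volume (\<lambda>X. ennreal (indicator {X. size X = n} X))) A" ..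
  qed simp
  then have "(LINT x|particles n. f (cfg n x)) = (LINT X|density volume (\<lambda>X. ennreal (indicator {X. size X = n} X)). f X)"
    by (subst integral_distr[symmetric, of "configuration n" _ volume]) auto
  also have "... = (LINT X|volume. indicator {X. size X = n} X *\<^sub>R f X)"
    by (rule integral_density) auto
  also have "... = (LINT X|volume. f X)"
    by (rule Bochner_Integration.integral_cong) (auto simp: indicator_def assms(2))
  finally show ?thesis ..
qed

section \<open>Permutation invariance, rectangles of boxes, and totality of symmetrised
  products\<close>

lemma configuration_permute:
  assumes "\<pi> permutes {..<n}" shows "configuration n (\<lambda>i. x (\<pi> i)) = cfg n x"
proof -
  have "image_mset \<pi> (mset_set {..<n}) = mset_set {..<n}"
    using assms by (simp add: image_mset_mset_set permutes_inj_on permutes_image)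
  then have "image_mset x (image_mset \<pi> (mset_set {..<n})) = image_mset x (mset_set {..<n})" by simp
  then show ?thesis by (simp add: configuration_def lessThan_atLeast0 image_mset.compositionality o_def)
qed

abbreviation "rearr n \<pi> \<equiv> (\<lambda>x. \<lambda>i\<in>{..<n::nat}. x (\<pi> i))"

text \<open>Product measures are determined by their values on rectangles, and a permutation of the
  coordinates merely permutes the factors of these values.\<close>

lemma integral_permute:
  fixes f :: "(nat => momentum) => complex"
  assumes \<pi>: "\<pi> permutes {..<n}" and [measurable]: "f \<in> borel_measurable (particles n)"
  shows "(LINT x|particles n. f (rearr n \<pi> x)) = (LINT x|particles n. f x)"
proof -
  have pin: "\<pi> i < n" if "i < n" for i using permutes_in_image[OF \<pi>, of i] that by simp
  have inv: "inv \<pi> i < n" if "i < n" for i using permutes_in_image[OF permutes_inv[OF \<pi>], of i] that by simp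
  have [measurable]: "(rearr n \<pi>) \<in> measurable (particles n) (particles n)"
    by (rule measurable_restrict, rule measurable_component_singleton) (use pin in auto)
  have "distr (particles n) (particles n) (rearr n \<pi>) = particles n"
  proof (rule momentum.PiM_eqI)
    fix A :: "nat => momentum set" assume A: "!!i. i \<in> {..<n} ==> A i \<in> sets volume"
    have "(rearr n \<pi>) -` Pi\<^sub>E {..<n} A \<inter> space (particles n) = Pi\<^sub>E {..<n} (\<lambda>j. A (inv \<pi> j))"
    proof (rule set_eqI)
      fix x
      have "(\<forall>i\<in>{..<n}. x (\<pi> i) \<in> A i) \<longleftrightarrow> (\<forall>j\<in>{..<n}. x j \<in> A (inv \<pi> j))"
        using pin inv permutes_inverses[OF \<pi>] by (metis lessThan_iff)
      then show "x \<in> (rearr n \<pi>) -` Pi\<^sub>E {..<n} A \<inter> space (particles n) \<longleftrightarrow> x \<in> Pi\<^sub>E {..<n} (\<lambda>j. A (inv \<pi> j))"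
        by (auto simp: space_PiM PiE_iff)
    qed
    then have "emeasure (distr (particles n) (particles n) (rearr n \<pi>)) (Pi\<^sub>E {..<n} A)
      = emeasure (particles n) (Pi\<^sub>E {..<n} (\<lambda>j. A (inv \<pi> j)))"
      using A by (subst emeasure_distr) (auto intro!: sets_PiM_I_finite)
    also have "... = (\<Prod>j<n. emeasure volume (A (inv \<pi> j)))"
      by (rule momentum.emeasure_PiM) (use A inv in auto)
    also have "... = (\<Prod>i<n. emeasure volume (A i))"
      by (rule prod.reindex_bij_witness[of _ \<pi> "inv \<pi>"]) (use pin inv permutes_inverses[OF \<pi>] in auto)
    finally show "emeasure (distr (particles n) (particles n) (rearr n \<pi>)) (Pi\<^sub>E {..<n} A)
      = (\<Prod>i<n. emeasure volume (A i))" .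
  qed auto
  then have "(LINT x|particles n. f x) = (LINT x|distr (particles n) (particles n) (rearr n \<pi>). f x)" by simp
  also have "... = (LINT x|particles n. f (rearr n \<pi> x))" by (rule integral_distr) measurable
  finally show ?thesis ..
qed

definition cube :: "nat => momentum set" where
  "cube N = box (- (real N *\<^sub>R One)) (real N *\<^sub>R One)"

lemma cube_mono: "N <= M ==> cube N \<subseteq> cube M"
  unfolding cube_def by (rule subset_box_imp) auto

lemma cube_finite_cover:
  fixes x :: "nat => momentum" shows "\<exists>N. \<forall>i<n. x i \<in> cube N"
proof -
  have "\<forall>i. \<exists>N. x i \<in> cube N" using UN_box_eq_UNIV by (auto simp: cube_def)
  then obtain f where f: "!!i. x i \<in> cube (f i)" by metis
  have "x i \<in> cube (sum f {..<n})" if "i < n" for i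
    using f[of i] cube_mono[of "f i" "sum f {..<n}"] member_le_sum[of i "{..<n}" f] that by auto
  then show ?thesis by blast
qed

abbreviation rect :: "nat => (nat => momentum) => (nat => momentum) => (nat => momentum) set" where
  "rect n a b \<equiv> Pi\<^sub>E {..<n} (\<lambda>i. box (a i) (b i))"

text \<open>Bounded rectangles generate the product structure. They, rather than general rectangles,
  are needed because their indicators are square integrable.\<close>

lemma sets_particles_boxes:
  "sets (particles n) = sigma_sets (space (particles n)) {rect n a b |a b. True}"
  (is "_ = sigma_sets ?\<Omega> ?E")
proof
  have E: "?E \<subseteq> Pow ?\<Omega>" by (auto simp: space_PiM PiE_iff)
  define N where "N = sigma ?\<Omega> ?E"
  have spN: "space N = ?\<Omega>" and seN: "sets N = sigma_sets ?\<Omega> ?E"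
    using E by (auto simp: N_def)
  have "sets (Pi\<^sub>M {..<n} (\<lambda>_. volume :: momentum measure)) \<subseteq> sets N"
  proof (rule sets_PiM_in_sets)
    show "space N = Pi\<^sub>E {..<n} (\<lambda>_. space volume)" by (simp add: spN space_PiM)
    fix i and A :: "momentum set" assume i: "i \<in> {..<n}" and A: "A \<in> sets volume"
    have "(\<lambda>x. x i) \<in> measurable N (sigma UNIV (range (\<lambda>(a, b). box a b :: momentum set)))"
    proof (rule measurable_measure_of)
      fix B :: "momentum set" assume "B \<in> range (\<lambda>(a, b). box a b)"
      then obtain a b where B: "B = box a b" by auto
      \<comment> \<open>The unrestricted coordinates are exhausted by growing cubes, which keeps
        every side bounded.\<close>
      have "(\<lambda>x. x i) -` B \<inter> space N = (\<Union>M. Pi\<^sub>E {..<n} (\<lambda>j. if j = i then box a b else cube M))"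
      proof (rule set_eqI, rule iffI)
        fix x assume x: "x \<in> (\<lambda>x. x i) -` B \<inter> space N"
        obtain M where "\<forall>i<n. x i \<in> cube M" using cube_finite_cover by blast
        then show "x \<in> (\<Union>M. Pi\<^sub>E {..<n} (\<lambda>j. if j = i then box a b else cube M))"
          using x by (auto simp: spN space_PiM PiE_iff B intro!: exI[of _ M])
      next
        fix x assume "x \<in> (\<Union>M. Pi\<^sub>E {..<n} (\<lambda>j. if j = i then box a b else cube M))"
        then show "x \<in> (\<lambda>x. x i) -` B \<inter> space N"
          using i by (auto simp: spN space_PiM PiE_iff B split: if_splits)
      qed
      also have "... \<in> sets N"
      proof (rule sets.countable_UN, clarify)
        fix M
        have "Pi\<^sub>E {..<n} (\<lambda>j. if j = i then box a b else cube M)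
          = Pi\<^sub>E {..<n} (\<lambda>j. box (if j = i then a else - (real M *\<^sub>R One)) (if j = i then b else real M *\<^sub>R One))"
          by (rule PiE_cong) (auto simp: cube_def)
        also have "... \<in> ?E"
          by (intro CollectI exI[of _ "\<lambda>j. if j = i then a else - (real M *\<^sub>R One)"] exI[of _ "\<lambda>j. if j = i then b else real M *\<^sub>R One"]) simp
        finally show "Pi\<^sub>E {..<n} (\<lambda>j. if j = i then box a b else cube M) \<in> sets N"
          unfolding seN by (rule sigma_sets.Basic)
      qed
      finally show "(\<lambda>x. x i) -` B \<inter> space N \<in> sets N" .
    qed auto
    then have "(\<lambda>x. x i) -` A \<inter> space N \<in> sets N"
      using A by (intro measurable_sets) (auto simp: borel_eq_box[symmetric] sets_volume_momentum)
    then show "{x \<in> space N. x i \<in> A} \<in> sets N" by (simp add: vimage_def Int_def conj_commute)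
  qed
  then show "sets (particles n) \<subseteq> sigma_sets ?\<Omega> ?E" by (simp add: seN)
  show "sigma_sets ?\<Omega> ?E \<subseteq> sets (particles n)"
    by (rule sets.sigma_sets_subset) (auto intro!: sets_PiM_I_finite simp: sets_volume_momentum)
qed

text \<open>\<open>ennreal (g x)\<close> and \<open>ennreal (- g x)\<close> are the positive and the
  negative part of \<open>g\<close>. The measures with these densities are finite and equal on
  rectangles, which are stable under intersection and generate, so the densities agree and both
  parts vanish.\<close>

lemma AE_zero_if_box_integrals_zero:
  fixes g :: "(nat => momentum) => real"
  assumes [measurable]: "g \<in> borel_measurable (particles n)"
    and int: "!!a b. integrable (particles n) (\<lambda>x. indicator (rect n a b) x * g x)"
    and zero: "!!a b. (LINT x|particles n. indicator (rect n a b) x * g x) = 0"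
  shows "AE x in particles n. g x = 0"
proof -
  interpret sigma_finite_measure "particles n" by (rule sigma_finite_particle_space)
  let ?d = "density (particles n) (\<lambda>x. ennreal (g x))"
  let ?d' = "density (particles n) (\<lambda>x. ennreal (- g x))"
  let ?E = "{rect n a b |a b :: nat => momentum. True}"
  have Em: "B \<in> sets (particles n)" if "B \<in> ?E" for B
    unfolding sets_particles_boxes using that by (rule sigma_sets.Basic)
  have fin: "emeasure (?d) B ~= \<infinity>
      & emeasure (?d) B = emeasure (?d') B"
    if "B \<in> ?E" for B
  proof -
    let ?p = "\<integral>\<^sup>+x. ennreal (indicator B x * g x) \<partial>particles n"
    let ?q = "\<integral>\<^sup>+x. ennreal (- (indicator B x * g x)) \<partial>particles n"
    note [measurable] = Em[OF that]
    obtain a b where B: "B = rect n a b" using \<open>B \<in> ?E\<close> by auto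
    have i: "integrable (particles n) (\<lambda>x. indicator B x * g x)" and z: "(LINT x|particles n. indicator B x * g x) = 0"
      using int[of a b] zero[of a b] by (simp_all add: B)
    have e1: "emeasure (?d) B = ?p"
      by (subst emeasure_density) (auto intro!: nn_integral_cong simp: indicator_def)
    have e2: "emeasure (?d') B = ?q"
      by (subst emeasure_density) (auto intro!: nn_integral_cong simp: indicator_def)
    have f1: "?p ~= \<infinity>"
      and f2: "?q ~= \<infinity>"
      using i by (auto simp: real_integrable_def)
    have "enn2real ?p = enn2real ?q"
      using z real_lebesgue_integral_def[OF i] by simp
    moreover have "x = y" if "enn2real x = enn2real y" "x ~= \<infinity>" "y ~= \<infinity>" for x y :: ennreal
    proof -
      have "ennreal (enn2real x) = ennreal (enn2real y)" by (simp only: that(1))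
      then show ?thesis using that(2,3) unfolding ennreal_enn2real_if by simp
    qed
    ultimately have "?p = ?q"
      using f1 f2 by blast
    then show ?thesis using f1 unfolding e1 e2 by simp
  qed
  have "?d = ?d'"
  proof (rule measure_eqI_generator_eq[where E = ?E and \<Omega> = "space (particles n)" and A = "\<lambda>N. Pi\<^sub>E {..<n} (\<lambda>_. cube N)"])
    show "Int_stable ?E"
    proof (rule Int_stableI)
      fix A B assume "A \<in> ?E" "B \<in> ?E"
      then obtain a b c d :: "nat => momentum" where "A = rect n a b" "B = Pi\<^sub>E {..<n} (\<lambda>i. box (c i) (d i))" by auto
      then have "A \<inter> B = Pi\<^sub>E {..<n} (\<lambda>i. box (a i) (b i) \<inter> box (c i) (d i))" by (auto simp: PiE_Int)
      also have "... \<in> ?E" unfolding box_Int_box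
        by (intro CollectI exI conjI TrueI) (rule refl)
      finally show "A \<inter> B \<in> ?E" .
    qed
    show "?E \<subseteq> Pow (space (particles n))" by (auto simp: space_PiM PiE_iff)
    show "sets (?d) = sigma_sets (space (particles n)) ?E"
      "sets (?d') = sigma_sets (space (particles n)) ?E"
      using sets_particles_boxes by simp_all
    show rA: "range (\<lambda>N. Pi\<^sub>E {..<n} (\<lambda>_. cube N)) \<subseteq> ?E"
    proof clarify
      fix N show "\<exists>a b. Pi\<^sub>E {..<n} (\<lambda>_. cube N) = rect n a b & True"
        by (intro exI[of _ "\<lambda>_. - (real N *\<^sub>R One)"] exI[of _ "\<lambda>_. real N *\<^sub>R One"]) (simp add: cube_def)
    qed
    show "(\<Union>N. Pi\<^sub>E {..<n} (\<lambda>_. cube N)) = space (particles n)"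
    proof (rule set_eqI)
      fix x
      obtain M where "\<forall>i<n. x i \<in> cube M" using cube_finite_cover by blast
      then show "x \<in> (\<Union>N. Pi\<^sub>E {..<n} (\<lambda>_. cube N)) \<longleftrightarrow> x \<in> space (particles n)"
        by (auto simp: space_PiM PiE_iff)
    qed
    show "emeasure (?d) (Pi\<^sub>E {..<n} (\<lambda>_. cube N)) ~= \<infinity>" for N
      by (rule conjunct1[OF fin[OF subsetD[OF rA rangeI]]])
  qed (rule conjunct2[OF fin])
  then have "AE x in particles n. ennreal (g x) = ennreal (- g x)"
    by (subst (asm) density_unique_iff) auto
  then show ?thesis
  proof eventually_elim
    case (elim x) then show ?case by (cases "0 <= g x") (auto simp: ennreal_neg ennreal_eq_0_iff)
  qed
qed

lemma square_integrable_indicator: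
  assumes "A \<in> sets (volume :: momentum measure)" "bounded A"
  shows "square_integrable (\<lambda>k. indicator A k :: complex)"
proof -
  have "emeasure volume A < \<infinity>" using emeasure_bounded_finite[OF assms(2)] by (simp add: volume_momentum)
  then have "(\<integral>\<^sup>+k. indicator A k \<partial>volume) < \<infinity>" using assms by simp
  moreover have "ennreal ((cmod (indicator A k))^2) = indicator A k" for k by (simp add: indicator_def)
  ultimately show ?thesis using assms by (simp add: square_integrable_iff_nn_integral)
qed

abbreviation box_tensor :: "nat => (nat => momentum) => (nat => momentum) => momentum multiset => complex" where
  "box_tensor n a b \<equiv> sym_prod n (\<lambda>i k. indicator (box (a i) (b i)) k)"

lemma square_integrable_box_tensor: "square_integrable (box_tensor n a b)"
  by (intro square_integrable_sym_prod square_integrable_indicator) (auto simp: sets_volume_momentum)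

text \<open>As a function of \<open>n\<close> ordered momenta \<open>ps\<close> is symmetric, so all
  \<open>n!\<close> terms of the symmetrised product contribute the same integral. Orthogonality to
  the symmetrised product therefore says that the integral of \<open>ps\<close> over the rectangle
  itself vanishes.\<close>

theorem box_tensors_total:
  assumes orth: "!!n a b. cinner (L2_of (box_tensor n a b)) ps = 0"
  shows "ps = 0"
proof -
  have AE0: "AE x in particles n. fun_of ps (cfg n x) = 0" for n
  proof -
    define G where "G x = fun_of ps (cfg n x)" for x
    have G[measurable]: "G \<in> borel_measurable (particles n)" unfolding G_def by measurable
    have "(\<integral>\<^sup>+x. ennreal ((cmod (G x))^2) \<partial>particles n) <= (\<Sum>k. \<integral>\<^sup>+x. ennreal ((cmod (fun_of ps (configuration k x)))^2) \<partial>particles k)"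
      using sum_le_suminf[OF summableI, of "{n}" "\<lambda>k. \<integral>\<^sup>+x. ennreal ((cmod (fun_of ps (configuration k x)))^2) \<partial>particles k"]
      by (simp add: G_def)
    also have "... = (\<integral>\<^sup>+X. ennreal ((cmod (fun_of ps X))^2) \<partial>volume)"
      by (rule nn_integral_multiset[symmetric]) measurable
    also have "... < \<infinity>" by (simp add: nn_integral_fun_of)
    finally have G2: "integrable (particles n) (\<lambda>x. (cmod (G x))^2)"
      by (subst integrable_iff_bounded) auto
    have Bm: "rect n a b \<in> sets (particles n)" for a b
      by (intro sets_PiM_I_finite) (auto simp: sets_volume_momentum)
    have ind: "(\<Prod>i<n. indicator (box (a i) (b i)) (x i)) = (indicator (rect n a b) x :: complex)" if "x \<in> space (particles n)" for x a b
      using that by (auto simp: indicator_def space_PiM PiE_iff)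
    have Gint: "integrable (particles n) (\<lambda>x. indicator (rect n a b) x *\<^sub>R G x)" for a b
    proof (rule Bochner_Integration.integrable_bound)
      have "emeasure (particles n) (rect n a b) = (\<Prod>i<n. emeasure volume (box (a i) (b i)))"
        by (rule momentum.emeasure_PiM) (auto simp: sets_volume_momentum)
      also have "... < \<infinity>" using emeasure_lborel_box_finite
        by (auto simp: volume_momentum ennreal_prod_eq_top less_top[symmetric])
      finally show "integrable (particles n) (\<lambda>x. indicator (rect n a b) x + (cmod (G x))^2)"
        using G2 Bm by (intro Bochner_Integration.integrable_add integrable_real_indicator) auto
      show "AE x in particles n. norm (indicator (rect n a b) x *\<^sub>R G x) <= norm (indicator (rect n a b) x + (cmod (G x))^2)"
      proof (rule AE_I2)
        fix x
        have "y <= 1 + y^2" for y :: real using zero_le_power2[of "y - 1"] zero_le_power2[of y] unfolding power2_diff by (simp only: one_power2)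
        then show "norm (indicator (rect n a b) x *\<^sub>R G x) <= norm (indicator (rect n a b) x + (cmod (G x))^2)"
          by (auto simp: indicator_def)
      qed
      show "(\<lambda>x. indicator (rect n a b) x *\<^sub>R G x) \<in> borel_measurable (particles n)" using Bm by measurable
    qed
    have Gzero: "(LINT x|particles n. indicator (rect n a b) x *\<^sub>R G x) = 0" for a b
    proof -
      let ?S = "{\<pi>. \<pi> permutes {..<n}}"
      define F where "F x = (\<Prod>i<n. indicator (box (a i) (b i)) (x i)) * G x" for x
      have Fint: "integrable (particles n) F" and FG: "(LINT x|particles n. F x) = (LINT x|particles n. indicator (rect n a b) x *\<^sub>R G x)"
      proof -
        have e: "F x = indicator (rect n a b) x *\<^sub>R G x" if "x \<in> space (particles n)" for x
          unfolding F_def ind[OF that] by (simp add: indicator_def)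
        show "integrable (particles n) F" using Gint[of a b] by (subst Bochner_Integration.integrable_cong[OF refl e]) auto
        show "(LINT x|particles n. F x) = (LINT x|particles n. indicator (rect n a b) x *\<^sub>R G x)"
          by (rule Bochner_Integration.integral_cong[OF refl e])
      qed
      have Fm [measurable]: "F \<in> borel_measurable (particles n)" using Fint by (rule borel_measurable_integrable)
      have perm: "(\<Prod>i<n. indicator (box (a i) (b i)) (x (\<pi> i))) * G x = F (rearr n \<pi> x)" if "\<pi> permutes {..<n}" for \<pi> x
      proof -
        have "G (rearr n \<pi> x) = G (\<lambda>i. x (\<pi> i))" unfolding G_def by (rule arg_cong[OF configuration_cong]) simp
        also have "... = G x" unfolding G_def configuration_permute[OF that] ..
        finally show ?thesis by (simp add: F_def)
      qed
      \<comment> \<open>A permuted product of indicators is again the indicator of a rectangle, with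
        the inversely permuted sides, so integrability is known from \<open>Gint\<close>.\<close>
      have pint: "integrable (particles n) (\<lambda>x. F (rearr n \<pi> x))" if "\<pi> permutes {..<n}" for \<pi>
      proof (rule Bochner_Integration.integrable_bound[OF _ _ AE_I2])
        let ?R = "\<lambda>x. indicator (rect n (\<lambda>j. a (inv \<pi> j)) (\<lambda>j. b (inv \<pi> j))) x *\<^sub>R G x"
        show "integrable (particles n) ?R" by (rule Gint)
        have pin: "\<pi> i < n" if "i < n" for i using permutes_in_image[OF \<open>\<pi> permutes {..<n}\<close>, of i] that by simp
        have inv: "inv \<pi> i < n" if "i < n" for i using permutes_in_image[OF permutes_inv[OF \<open>\<pi> permutes {..<n}\<close>], of i] that by simp
        have "(rearr n \<pi>) \<in> measurable (particles n) (particles n)"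
          by (rule measurable_restrict, rule measurable_component_singleton) (use pin in auto)
        then show "(\<lambda>x. F (rearr n \<pi> x)) \<in> borel_measurable (particles n)" by (rule measurable_compose) simp
        fix x assume x: "x \<in> space (particles n)"
        have "(\<Prod>i<n. indicator (box (a i) (b i)) (x (\<pi> i)) :: complex) = (\<Prod>j<n. indicator (box (a (inv \<pi> j)) (b (inv \<pi> j))) (x j))"
          by (rule prod.reindex_bij_witness[of _ "inv \<pi>" \<pi>]) (use pin inv permutes_inverses[OF \<open>\<pi> permutes {..<n}\<close>] in auto)
        then show "norm (F (rearr n \<pi> x)) <= norm (?R x)"
          unfolding perm[OF that, symmetric] ind[OF x, of "\<lambda>j. a (inv \<pi> j)"] by (simp add: indicator_def norm_mult)
      qed
      have bm: "box_tensor n a b \<in> bmv" using square_integrable_box_tensor[of n a b] by (simp add: square_integrable_def)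
      have "0 = cinner (L2_of (box_tensor n a b)) (L2_of (fun_of ps))" by (simp add: L2_of_fun_of orth)
      also have "... = (LINT X|volume. cnj (box_tensor n a b X) * fun_of ps X)"
        by (rule cinner_L2_of[OF square_integrable_box_tensor square_integrable_fun_of])
      also have "... = (LINT x|particles n. cnj (box_tensor n a b (cfg n x)) * fun_of ps (cfg n x))"
        by (rule integral_sector) (use bm in "auto simp: sym_prod_size")
      also have "... = (LINT x|particles n. (\<Sum>\<pi>\<in>?S. F (rearr n \<pi> x)) / fact n)"
      proof (rule Bochner_Integration.integral_cong[OF refl])
        fix x
        have "cnj (box_tensor n a b (cfg n x)) = (\<Sum>\<pi>\<in>?S. \<Prod>i<n. indicator (box (a i) (b i)) (x (\<pi> i))) / fact n"
        proof -
          have "cnj (indicator A k) = (indicator A k :: complex)" for A :: "momentum set" and k by (simp add: indicator_def)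
          then show ?thesis unfolding sym_prod_configuration by simp
        qed
        then show "cnj (box_tensor n a b (cfg n x)) * fun_of ps (cfg n x) = (\<Sum>\<pi>\<in>?S. F (rearr n \<pi> x)) / fact n"
          by (simp add: sum_distrib_right perm[symmetric] G_def)
      qed
      also have "... = (\<Sum>\<pi>\<in>?S. LINT x|particles n. F (rearr n \<pi> x)) / fact n"
        by (subst integral_divide_zero, subst Bochner_Integration.integral_sum) (use pint in auto)
      also have "... = (\<Sum>\<pi>\<in>?S. LINT x|particles n. F x) / fact n"
        by (intro arg_cong2[where f = "(/)"] sum.cong refl integral_permute) auto
      also have "... = (LINT x|particles n. F x)" by (simp add: card_permutations)
      finally show ?thesis unfolding FG by simp
    qed
    have "AE x in particles n. Re (G x) = 0"
    proof (rule AE_zero_if_box_integrals_zero)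
      have *: "indicator (rect n a b) x * Re (G x) = Re (indicator (rect n a b) x *\<^sub>R G x)" for a b x by simp
      show "integrable (particles n) (\<lambda>x. indicator (rect n a b) x * Re (G x))" for a b
        unfolding * by (rule integrable_Re[OF Gint])
      show "(LINT x|particles n. indicator (rect n a b) x * Re (G x)) = 0" for a b
        unfolding * integral_Re[OF Gint] Gzero by simp
    qed measurable
    moreover have "AE x in particles n. Im (G x) = 0"
    proof (rule AE_zero_if_box_integrals_zero)
      have *: "indicator (rect n a b) x * Im (G x) = Im (indicator (rect n a b) x *\<^sub>R G x)" for a b x by simp
      show "integrable (particles n) (\<lambda>x. indicator (rect n a b) x * Im (G x))" for a b
        unfolding * by (rule integrable_Im[OF Gint])
      show "(LINT x|particles n. indicator (rect n a b) x * Im (G x)) = 0" for a b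
        unfolding * integral_Im[OF Gint] Gzero by simp
    qed measurable
    ultimately show ?thesis unfolding G_def by eventually_elim (simp add: complex_eq_iff)
  qed
  have "AE X in volume. fun_of ps X = 0"
  proof (rule AE_multisetI[OF AE0])
    have "fun_of ps -` {0} \<inter> space volume \<in> sets volume" by (rule measurable_sets[OF fun_of_measurable]) auto
    then show "{X. fun_of ps X = 0} \<in> sets volume" by (simp add: vimage_def)
  qed
  then show ?thesis using fun_of_zero by (intro L2_eqI) (auto elim!: eventually_elim2)
qed

lemma box_tensor_sym_tensor:
  "L2_of (box_tensor n a b) = sym_tensor (map (\<lambda>i. L2_of (indicator (box (a i) (b i)))) [0..<n])" (is "_ = sym_tensor ?h")
proof -
  have sq: "square_integrable (\<lambda>k. indicator (box (a i) (b i)) k :: complex)" for i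
    by (intro square_integrable_indicator) (auto simp: sets_volume_momentum)
  show ?thesis unfolding sym_tensor_eq
  proof (rule L2_of_cong)
    show "square_integrable (box_tensor n a b)" by (rule square_integrable_box_tensor)
    show "square_integrable (sym_prod (length ?h) (\<lambda>i. fun_of (?h ! i)))"
      by (rule square_integrable_sym_prod) (rule square_integrable_fun_of)
    show "AE X in volume. box_tensor n a b X = sym_prod (length ?h) (\<lambda>i. fun_of (?h ! i)) X"
      using sym_prod_cong_AE[of n "\<lambda>i. fun_of (?h ! i)" "\<lambda>i k. indicator (box (a i) (b i)) k"]
        fun_of_L2_of[OF sq] by (auto elim: eventually_mono)
  qed
qed

text \<open>The explicit operator acts correctly on symmetric tensors; any other bounded operator
  doing so agrees with it on a closed subspace that contains the total family of box
  tensors.\<close>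

lemma second_quant_wcomp:
  assumes c: "isometric_weight s c"
  shows "second_quant (wcomp s c) = wcomp_fock s c"
  unfolding second_quant_def
proof (rule the_equality)
  show "bounded_clinear (wcomp_fock s c) & (\<forall>hs. wcomp_fock s c (sym_tensor hs) = sym_tensor (map (wcomp s c) hs))"
    by (simp add: bounded_clinear_wcomp[OF c] wcomp_fock_sym_tensor[OF c])
  fix T assume T: "bounded_clinear T & (\<forall>hs. T (sym_tensor hs) = sym_tensor (map (wcomp s c) hs))"
  then have TL: "bounded_clinear T" by blast
  note L = bounded_clinearD[OF TL] bounded_clinearD[OF bounded_clinear_wcomp(2)[OF c]]
  let ?M = "{ps. T ps = wcomp_fock s c ps}"
  have "?M = UNIV"
  proof (rule closed_csubspace_UNIV)
    show "csubspace ?M" by (auto simp: csubspace_def L)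
    show "closed ?M" by (rule closed_Collect_eq) (auto intro: L)
    fix ps assume o: "!!ph. ph \<in> ?M ==> cinner ph ps = 0"
    show "ps = 0"
    proof (rule box_tensors_total)
      fix n a b show "cinner (L2_of (box_tensor n a b)) ps = 0"
        by (rule o) (use T in "simp add: box_tensor_sym_tensor wcomp_fock_sym_tensor[OF c]")
    qed
  qed
  then show "T = wcomp_fock s c" by auto
qed

section \<open>The dilation groups and the free field Hamiltonian\<close>

lemma isometry_cinner:
  assumes "bounded_clinear U" "!!x. norm (U x) = norm x"
  shows "cinner (U x) (U y) = cinner x y"
proof -
  note L = bounded_clinearD[OF assms(1)]
  have inner: "inner (U x) (U y) = inner x y" for x y
    unfolding dot_norm L(3)[symmetric] assms(2) ..
  show ?thesis
  proof (rule complex_eqI)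
    show "Re (cinner (U x) (U y)) = Re (cinner x y)" using inner[of x y] by (simp add: inner_eq_Re_cinner)
    show "Im (cinner (U x) (U y)) = Im (cinner x y)" using inner[of x "(- \<i>) *\<^sub>C y"]
      by (simp add: inner_eq_Re_cinner L cinner_scaleC_right)
  qed
qed

definition dil_weight :: "real => momentum => complex" where
  "dil_weight t = (\<lambda>_. cx (exp (3 * t / 2)))"

lemma isometric_dil_weight: "isometric_weight (exp t) (dil_weight t)"
proof -
  have "(exp (3 * t / 2))^2 = exp t ^ 3" by (simp add: exp_of_nat_mult[symmetric])
  then show ?thesis by (simp add: isometric_weight_def dil_weight_def)
qed

lemma dilation_eq: "dilation t = wcomp (exp t) (dil_weight t)"
  by (intro ext) (simp add: dilation_def wcomp_def dil_weight_def)

definition fock_dilation :: "real => momentum fock => momentum fock" where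
  "fock_dilation t = wcomp_fock (exp t) (dil_weight t)"

lemma dil_weight_add: "dil_weight (s + t) = (\<lambda>k. dil_weight s k * dil_weight t (exp s *\<^sub>R k))"
  by (simp add: dil_weight_def fun_eq_iff exp_add[symmetric] add_divide_distrib distrib_left flip: of_real_mult)

lemma dilation_add: "dilation (s + t) ph = dilation s (dilation t ph)"
  "fock_dilation (s + t) ps = fock_dilation s (fock_dilation t ps)"
  unfolding dilation_eq fock_dilation_def wcomp_compose[OF isometric_dil_weight isometric_dil_weight] dil_weight_add exp_add by simp_all

lemma dilation_zero: "dilation 0 ph = ph" "fock_dilation 0 ps = ps"
proof -
  have "(*\<^sub>R) 1 = (id :: momentum => momentum)" by (simp add: fun_eq_iff)
  then show "dilation 0 ph = ph" "fock_dilation 0 ps = ps"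
    by (simp_all add: dilation_eq fock_dilation_def wcomp_def wcomp_fock_def dil_weight_def L2_of_fun_of)
qed

text \<open>Away from the frontier, the indicator of a box is locally constant, hence stable under
  small dilations.\<close>

lemma box_frontier_AE: "AE k in (volume :: momentum measure). k \<in> box a b \<or> k \<notin> cbox a b"
proof -
  have "cbox a b - box a b \<in> null_sets lebesgue"
    using negligible_frontier_interval[of a b] by (simp add: negligible_iff_null_sets)
  then have "cbox a b - box a b \<in> null_sets lborel"
    by (subst (asm) null_sets_completion_iff) auto
  then have "AE k in lborel. k \<notin> cbox a b - box a b" by (rule AE_not_in)
  then show ?thesis unfolding volume_momentum by eventually_elim auto
qed

text \<open>Dominated convergence: pointwise convergence holds unless some momentum lies on the
  frontier of a box, which is a null event.\<close>

lemma fock_dilation_tendsto_box: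
  assumes t: "t ----> 0"
  shows "(\<lambda>j. fock_dilation (t j) (L2_of (box_tensor n a b))) ----> L2_of (box_tensor n a b)"
proof -
  let ?ps = "L2_of (box_tensor n a b)"
  define h where "h j i k = dil_weight (t j) k * indicator (box (a i) (b i)) (exp (t j) *\<^sub>R k)" for j i k
  obtain M where M: "!!j. \<bar>t j\<bar> <= M"
    using convergent_imp_Bseq[of t] t by (auto simp: convergent_def Bseq_def)
  have M0: "0 <= M" using order_trans[OF abs_ge_zero M] .
  obtain R where R: "!!i. i < n ==> box (a i) (b i) \<subseteq> cball 0 R"
  proof -
    have "bounded (\<Union>i\<in>{..<n}. box (a i) (b i))" by (intro bounded_UN) auto
    then obtain R where "\<forall>x\<in>(\<Union>i\<in>{..<n}. box (a i) (b i)). norm x <= R" unfolding bounded_iff by blast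
    then have "box (a i) (b i) \<subseteq> cball 0 R" if "i < n" for i using that by auto
    then show ?thesis using that by blast
  qed
  \<comment> \<open>For \<open>\<bar>t j\<bar> <= M\<close> all dilated boxes stay inside the ball
    of radius \<open>exp M * R\<close>, and the weight is at most
    \<open>exp (3 * M / 2)\<close>.\<close>
  define g where "g k = exp (3 * M / 2) * indicator (cball 0 (exp M * R)) (k :: momentum)" for k
  have g0: "0 <= g k" for k by (simp add: g_def)
  have hg: "cmod (h j i k) <= g k" if "i < n" for i j k
  proof (cases "exp (t j) *\<^sub>R k \<in> box (a i) (b i)")
    case True
    then have "exp (t j) * norm k <= R" using R[OF that] by auto
    then have "norm k <= exp (- t j) * R" by (simp add: exp_minus field_simps)
    also have "... <= exp M * R"
    proof (rule mult_right_mono)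
      show "exp (- t j) <= exp M" using M[of j] by auto
      show "0 <= R" using \<open>exp (t j) * norm k <= R\<close> by (rule order_trans[rotated]) simp
    qed
    finally show ?thesis using True M[of j] by (simp add: h_def g_def dil_weight_def norm_mult)
  qed (simp add: h_def g_def)
  have F: "square_integrable (sym_prod n (\<lambda>i k. cx (g k)))"
  proof (rule square_integrable_sym_prod)
    have "square_integrable (\<lambda>k. cx (exp (3 * M / 2)) * indicator (cball 0 (exp M * R)) (k :: momentum))"
      by (intro square_integrable_scale square_integrable_indicator) (auto simp: sets_volume_momentum)
    then show "square_integrable (\<lambda>k. cx (g k))" by (simp add: g_def[abs_def] of_real_indicator)
  qed
  have fd: "AE X in volume. fun_of (fock_dilation (t j) ?ps) X = sym_prod n (h j) X" for j
  proof -
    have "AE X in volume. fun_of ?ps (image_mset ((*\<^sub>R) (exp (t j))) X) = box_tensor n a b (image_mset ((*\<^sub>R) (exp (t j))) X)"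
      by (rule AE_scale_multiset[OF _ fun_of_L2_of[OF square_integrable_box_tensor]]) simp
    then show ?thesis using fun_of_wcomp_fock[OF isometric_dil_weight, of "t j" ?ps]
    proof eventually_elim
      case (elim X)
      have "fun_of (fock_dilation (t j) ?ps) X = (\<Prod>k\<in>#X. dil_weight (t j) k) * box_tensor n a b (image_mset ((*\<^sub>R) (exp (t j))) X)"
        using elim by (simp add: fock_dilation_def)
      also have "... = sym_prod n (h j) X" unfolding h_def by (rule sym_prod_image) simp
      finally show ?case .
    qed
  qed
  show ?thesis
  proof (rule L2_dominated_convergence[OF F])
    fix j
    show "AE X in volume. cmod (fun_of (fock_dilation (t j) ?ps) X) <= cmod (sym_prod n (\<lambda>i k. cx (g k)) X)"
      using fd[of j]
    proof eventually_elim
      case (elim X)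
      have "cmod (sym_prod n (h j) X) <= cmod (sym_prod n (\<lambda>i k. cx (g k)) X)"
      proof (cases "size X = n")
        case True
        have "cmod (\<Sum>ks\<in>permutations_of_multiset X. \<Prod>i<n. h j i (ks ! i)) <= (\<Sum>ks\<in>permutations_of_multiset X. \<Prod>i<n. g (ks ! i))"
          by (intro order_trans[OF norm_sum] sum_mono) (auto simp: prod_norm[symmetric] intro!: prod_mono hg)
        also have "... = cmod (cx (\<Sum>ks\<in>permutations_of_multiset X. \<Prod>i<n. g (ks ! i)))"
          unfolding norm_of_real by (intro abs_of_nonneg[symmetric] sum_nonneg prod_nonneg g0)
        finally show ?thesis using True by (simp add: sym_prod_def norm_divide divide_right_mono)
      qed (simp add: sym_prod_size)
      then show ?case using elim by simp
    qed
  next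
    have "AE k in volume. \<forall>i\<in>{..<n}. k \<in> box (a i) (b i) \<or> k \<notin> cbox (a i) (b i)"
      by (subst AE_finite_all) (auto intro: box_frontier_AE)
    then have "AE X in volume. \<forall>k\<in>#X. \<forall>i\<in>{..<n}. k \<in> box (a i) (b i) \<or> k \<notin> cbox (a i) (b i)" by (rule AE_all_elements)
    moreover have "AE X in volume. \<forall>j. fun_of (fock_dilation (t j) ?ps) X = sym_prod n (h j) X"
      unfolding AE_all_countable using fd by blast
    ultimately show "AE X in volume. (\<lambda>j. fun_of (fock_dilation (t j) ?ps) X) ----> fun_of ?ps X"
      using fun_of_L2_of[OF square_integrable_box_tensor, of n a b]
    proof eventually_elim
      case (elim X)
      have lim: "(\<lambda>j. h j i k) ----> indicator (box (a i) (b i)) k" if k: "k \<in># X" "i < n" for k i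
      proof -
        have c: "(\<lambda>j. exp (t j) *\<^sub>R k) ----> k"
          using tendsto_scaleR[OF tendsto_exp[OF t] tendsto_const[of k]] by simp
        have ind: "(\<lambda>j. indicator (box (a i) (b i)) (exp (t j) *\<^sub>R k) :: complex) ----> indicator (box (a i) (b i)) k"
        proof (cases "k \<in> box (a i) (b i)")
          case True
          have "\<forall>\<^sub>F j in sequentially. exp (t j) *\<^sub>R k \<in> box (a i) (b i)"
            by (rule topological_tendstoD[OF c open_box True])
          then show ?thesis using True by (auto intro: tendsto_eventually elim!: eventually_mono)
        next
          case False
          then have "k \<in> - cbox (a i) (b i)" using elim(1) k by auto
          then have "\<forall>\<^sub>F j in sequentially. exp (t j) *\<^sub>R k \<in> - cbox (a i) (b i)"
            by (intro topological_tendstoD[OF c] open_Compl closed_cbox)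
          then have "\<forall>\<^sub>F j in sequentially. exp (t j) *\<^sub>R k \<notin> box (a i) (b i)"
            by eventually_elim (use box_subset_cbox in blast)
          then show ?thesis using False by (auto intro: tendsto_eventually elim!: eventually_mono)
        qed
        have "(\<lambda>j. dil_weight (t j) k) ----> cx (exp (3 * 0 / 2))"
          unfolding dil_weight_def by (intro tendsto_intros t) simp
        from tendsto_mult[OF this ind] show ?thesis by (simp add: h_def)
      qed
      have "(\<lambda>j. sym_prod n (h j) X) ----> box_tensor n a b X"
      proof (cases "size X = n")
        case True
        have "(\<lambda>j. \<Sum>ks\<in>permutations_of_multiset X. \<Prod>i<n. h j i (ks ! i)) ----> (\<Sum>ks\<in>permutations_of_multiset X. \<Prod>i<n. indicator (box (a i) (b i)) (ks ! i))"
        proof (intro tendsto_sum tendsto_prod lim)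
          fix ks i assume "ks \<in> permutations_of_multiset X" and i: "i \<in> {..<n}"
          then have ks: "mset ks = X" by (simp add: permutations_of_multisetD)
          then show "ks ! i \<in># X" using True i by (auto simp: nth_mem_mset)
          show "i < n" using i by simp
        qed
        then show ?thesis using True by (simp add: sym_prod_def tendsto_divide_zero tendsto_divide)
      qed (simp add: sym_prod_size)
      then show ?case using elim by simp
    qed
  qed
qed

text \<open>Only strong continuity requires work. It is checked at \<open>0\<close> on the total
  family of box tensors, and the group law transports it to every parameter.\<close>

theorem unitary_group_fock_dilation: "unitary_group fock_dilation"
proof (rule unitary_groupI)
  have bc: "bounded_clinear (fock_dilation t)" for t
    unfolding fock_dilation_def by (rule bounded_clinear_wcomp[OF isometric_dil_weight])
  have nrm: "norm (fock_dilation t x) = norm x" for t x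
    unfolding fock_dilation_def by (rule norm_wcomp[OF isometric_dil_weight])
  note L = bounded_clinearD[OF bc]
  show "bounded_clinear (fock_dilation t)" for t by (rule bc)
  show "cinner (fock_dilation t x) (fock_dilation t y) = cinner x y" for t x y by (rule isometry_cinner[OF bc nrm])
  show "fock_dilation 0 x = x" for x by (rule dilation_zero)
  show "fock_dilation (s + t) x = fock_dilation s (fock_dilation t x)" for s t x by (rule dilation_add)
  \<comment> \<open>The vectors with continuous orbit at \<open>0\<close>; this subspace is closed
    because all operators of the group are isometries.\<close>
  define Mc where "Mc = {ps. ((\<lambda>t. fock_dilation t ps) \<longlongrightarrow> ps) (at 0)}"
  have "Mc = UNIV"
  proof (rule closed_csubspace_UNIV)
    show "csubspace Mc" unfolding csubspace_def Mc_def by (auto simp: L intro!: tendsto_intros)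
    show "closed Mc" unfolding closed_sequential_limits
    proof (intro allI impI, elim conjE)
      fix f ps assume f: "\<forall>n. f n \<in> Mc" and lim: "f ----> ps"
      show "ps \<in> Mc" unfolding Mc_def mem_Collect_eq
      proof (rule tendstoI)
        fix e :: real assume e: "0 < e"
        obtain n where n: "norm (f n - ps) < e / 3"
          using LIMSEQ_D[OF lim, of "e/3"] e by auto
        have "\<forall>\<^sub>F t in at 0. dist (fock_dilation t (f n)) (f n) < e / 3"
          by (rule tendstoD) (use f e in "auto simp: Mc_def")
        then show "\<forall>\<^sub>F t in at 0. dist (fock_dilation t ps) ps < e"
        proof eventually_elim
          case (elim t)
          have "fock_dilation t ps - ps = fock_dilation t (ps - f n) + (fock_dilation t (f n) - f n) + (f n - ps)"
            by (simp add: L)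
          also have "norm ... <= norm (fock_dilation t (ps - f n)) + norm (fock_dilation t (f n) - f n) + norm (f n - ps)"
            by (intro order_trans[OF norm_triangle_ineq] add_mono norm_triangle_ineq order_refl)
          also have "... < e" using n elim unfolding nrm by (simp add: dist_norm norm_minus_commute)
          finally show ?case by (simp add: dist_norm)
        qed
      qed
    qed
    fix ps assume o: "!!s. s \<in> Mc ==> cinner s ps = 0"
    show "ps = 0"
    proof (rule box_tensors_total)
      fix n a b
      have "L2_of (box_tensor n a b) \<in> Mc" unfolding Mc_def mem_Collect_eq tendsto_at_iff_sequentially o_def
        using fock_dilation_tendsto_box by auto
      then show "cinner (L2_of (box_tensor n a b)) ps = 0" by (rule o)
    qed
  qed
  then have c0: "((\<lambda>t. fock_dilation t ps) \<longlongrightarrow> ps) (at 0)" for ps by (auto simp: Mc_def)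
  show "continuous_on UNIV (\<lambda>t. fock_dilation t ps)" for ps
    unfolding continuous_on_eq_continuous_at[OF open_UNIV]
  proof (intro ballI)
    fix s :: real
    have "((\<lambda>t. fock_dilation s (fock_dilation t ps)) \<longlongrightarrow> fock_dilation s ps) (at 0)"
      by (rule bounded_linear.tendsto[OF L(1) c0])
    then have "((\<lambda>t. fock_dilation (s + t) ps) \<longlongrightarrow> fock_dilation s ps) (at 0)" by (simp add: dilation_add)
    then show "isCont (\<lambda>t. fock_dilation t ps) s" by (simp add: isCont_iff isCont_def LIM_offset_zero_iff)
  qed
qed

lemma norm_one_particle: "norm (sym_tensor [ph]) = norm (ph :: momentum L2)"
proof -
  have sq: "square_integrable (sym_prod (length [ph]) (\<lambda>i. fun_of ([ph] ! i)))"
    by (rule square_integrable_sym_prod) (rule square_integrable_fun_of)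
  then have m [measurable]: "sym_prod 1 (\<lambda>i. fun_of ([ph] ! i)) \<in> bmv" by (simp add: square_integrable_def)
  have perm: "permutations_of_multiset {#k#} = {[k]}" for k :: momentum
    by (auto simp: permutations_of_multiset_def)
  have "ennreal ((norm (sym_tensor [ph]))^2) = (\<integral>\<^sup>+X. ennreal ((cmod (sym_prod 1 (\<lambda>i. fun_of ([ph] ! i)) X))^2) \<partial>volume)"
    unfolding sym_tensor_eq using norm_L2_of_nn[OF sq] by simp
  also have "... = (\<integral>\<^sup>+x. ennreal ((cmod (sym_prod 1 (\<lambda>i. fun_of ([ph] ! i)) (configuration (Suc 0) x)))^2) \<partial>particles (Suc 0))"
    by (rule nn_integral_sector) (measurable, simp add: sym_prod_size)
  also have "... = (\<integral>\<^sup>+x. \<integral>\<^sup>+k. ennreal ((cmod (sym_prod 1 (\<lambda>i. fun_of ([ph] ! i)) (add_mset k (configuration 0 x))))^2) \<partial>volume \<partial>particles 0)"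
    by (rule nn_integral_particles_Suc) measurable
  also have "... = (\<integral>\<^sup>+x. \<integral>\<^sup>+k. ennreal ((cmod (fun_of ph k))^2) \<partial>volume \<partial>particles 0)"
    by (intro nn_integral_cong) (simp add: configuration_def sym_prod_def perm)
  also have "... = ennreal ((norm ph)^2)" by (simp add: nn_integral_fun_of PiM_empty)
  finally have "(norm (sym_tensor [ph]))^2 = (norm ph)^2" by simp
  then show ?thesis by (rule power2_eq_imp_eq) auto
qed

lemma one_particle_diff: "sym_tensor [ph] - sym_tensor [ps] = sym_tensor [ph - ps :: momentum L2]"
proof -
  have sq: "square_integrable (sym_prod (length [ph]) (\<lambda>i. fun_of ([ph] ! i)))" for ph :: "momentum L2"
    by (rule square_integrable_sym_prod) (rule square_integrable_fun_of)
  have lin: "sym_prod 1 (\<lambda>i. f) X - sym_prod 1 (\<lambda>i. g) X = sym_prod 1 (\<lambda>i k. f k - g k) X" for f g X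
    by (simp add: sym_prod_def sum_subtractf diff_divide_distrib)
  have e: "sym_prod (length [ph]) (\<lambda>i. fun_of ([ph] ! i)) = sym_prod 1 (\<lambda>i. fun_of ph)" for ph :: "momentum L2"
    by (intro ext) (simp, rule sym_prod_cong, simp)
  have "AE X in volume. sym_prod 1 (\<lambda>i. fun_of (ph - ps)) X = sym_prod 1 (\<lambda>i k. fun_of ph k - fun_of ps k) X"
    by (rule sym_prod_cong_AE) (rule fun_of_diff)
  then show ?thesis
    using fun_of_L2_of[OF sq[of ph]] fun_of_L2_of[OF sq[of ps]] fun_of_L2_of[OF sq[of "ph - ps"]]
      fun_of_diff[of "sym_tensor [ph]" "sym_tensor [ps]"]
    unfolding sym_tensor_eq e by (intro L2_eqI, eventually_elim) (simp add: lin[unfolded One_nat_def])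
qed

text \<open>Strong continuity is inherited from Fock space: \<open>sym_tensor [ph]\<close> embeds
  the one-particle space isometrically and intertwines the two groups.\<close>

theorem unitary_group_dilation: "unitary_group dilation"
proof (rule unitary_groupI)
  have bc: "bounded_clinear (dilation t)" for t
    unfolding dilation_eq by (rule bounded_clinear_wcomp[OF isometric_dil_weight])
  have nrm: "norm (dilation t x) = norm x" for t x
    unfolding dilation_eq by (rule norm_wcomp[OF isometric_dil_weight])
  show "bounded_clinear (dilation t)" for t by (rule bc)
  show "cinner (dilation t x) (dilation t y) = cinner x y" for t x y by (rule isometry_cinner[OF bc nrm])
  show "dilation 0 x = x" for x by (rule dilation_zero)
  show "dilation (s + t) x = dilation s (dilation t x)" for s t x by (rule dilation_add)
  show "continuous_on UNIV (\<lambda>t. dilation t ph)" for ph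
  proof -
    have e: "dist (dilation s ph) (dilation t ph) = dist (fock_dilation s (sym_tensor [ph])) (fock_dilation t (sym_tensor [ph]))" for s t
      by (simp add: dist_norm fock_dilation_def dilation_eq wcomp_fock_sym_tensor[OF isometric_dil_weight] one_particle_diff norm_one_particle)
    have "continuous_on UNIV (\<lambda>t. fock_dilation t (sym_tensor [ph]))"
      using unitary_group_fock_dilation by (auto simp: unitary_group_def)
    then show ?thesis unfolding continuous_on_iff e .
  qed
qed

theorem dGamma_D: "dGamma D = generator fock_dilation"
proof -
  have "exp_group D = dilation" by (rule exp_group_eq[OF unitary_group_dilation]) (simp add: D_def)
  then show ?thesis unfolding dGamma_def fock_dilation_def dilation_eq
    by (simp add: second_quant_wcomp[OF isometric_dil_weight])
qed

lemma \<omega>_measurable [measurable]: "\<omega> m \<in> bmv"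
proof -
  have "\<omega> m \<in> borel_measurable borel" unfolding \<omega>_def by measurable
  then show ?thesis by (simp add: volume_momentum)
qed

text \<open>A product of phases over a configuration is the phase of the sum, so the second
  quantised group is again a phase group, whose generator is known.\<close>

theorem H_field_eq: "H_field m = multiplication_op (\<lambda>X. cx (\<Sum>k\<in>#X. \<omega> m k))"
proof -
  have eg: "exp_group (multiplication_op (\<lambda>k. cx (\<omega> m k))) = phase_group (\<omega> m)"
    by (rule exp_group_eq) (rule phase_group, measurable)+
  have one: "(*\<^sub>R) 1 = (id :: momentum => momentum)" by (simp add: fun_eq_iff)
  have w: "isometric_weight 1 (\<lambda>k. cis (- t * \<omega> m k))" for t
    by (simp add: isometric_weight_def)
  have "second_quant (phase_group (\<omega> m) t) = phase_group (\<lambda>X. \<Sum>k\<in>#X. \<omega> m k) t" for t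
  proof -
    have "phase_group (\<omega> m) t = wcomp 1 (\<lambda>k. cis (- t * \<omega> m k))"
      by (intro ext) (simp add: phase_group_def mulop_def wcomp_def)
    then have "second_quant (phase_group (\<omega> m) t) = wcomp_fock 1 (\<lambda>k. cis (- t * \<omega> m k))"
      by (simp only: second_quant_wcomp[OF w])
    also have "... = phase_group (\<lambda>X. \<Sum>k\<in>#X. \<omega> m k) t"
    proof (rule ext)
      fix ps :: "momentum fock"
      have "(\<Prod>k\<in>#X. cis (- t * \<omega> m k)) = cis (- t * (\<Sum>k\<in>#X. \<omega> m k))" for X
        by (induction X) (simp_all add: cis_mult distrib_left)
      then show "wcomp_fock 1 (\<lambda>k. cis (- t * \<omega> m k)) ps = phase_group (\<lambda>X. \<Sum>k\<in>#X. \<omega> m k) t ps"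
        by (simp add: phase_group_def mulop_def wcomp_fock_def one)
    qed
    finally show ?thesis .
  qed
  then show ?thesis unfolding H_field_def dGamma_def eg
    by (simp add: phase_group(2))
qed

subsection \<open>Dilations of states\<close>

lemma tensor_op_mat_1: "(x, y) \<in> tensor_op (mat 1) A \<longleftrightarrow> (\<forall>j. (x $ j, y $ j) \<in> A)"
proof -
  have "(\<Sum>j\<in>UNIV. (mat 1 :: complex ^ 2 ^ 2) $ i $ j *\<^sub>C z $ j) = z $ i" for z :: state and i
    by (subst sum.remove[of _ i]) (auto simp: mat_def intro!: sum.neutral)
  then have "tensor_op (mat 1) A = {(x, \<chi> i. y $ i) |x y. \<forall>j. (x $ j, y $ j) \<in> A}" by (simp add: tensor_op_def)
  then show ?thesis by auto
qed

definition state_dilation :: "real => state => state" where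
  "state_dilation t x = (\<chi> i. fock_dilation t (x $ i))"

theorem unitary_group_state_dilation: "unitary_group state_dilation"
proof -
  interpret F: unitary_group_locale fock_dilation by unfold_locales (rule unitary_group_fock_dilation)
  have ci: "cinner (state_dilation t x) (state_dilation t y) = cinner x y" for t x y
    unfolding cinner_vec_def by (simp add: state_dilation_def F.cinner_U)
  have nrm: "norm (state_dilation t x) = norm x" for t x
  proof -
    have "cx ((norm (state_dilation t x))^2) = of_real ((norm x)^2)"
      using ci[of t x x] by (simp only: cinner_self)
    then have "(norm (state_dilation t x))^2 = (norm x)^2" using of_real_eq_iff by blast
    then show ?thesis by (rule power2_eq_imp_eq) auto
  qed
  show ?thesis
  proof (rule unitary_groupI)
    show "bounded_clinear (state_dilation t)" for t
      by (rule bounded_clinearI[where K=1]) (auto simp: nrm, auto simp: state_dilation_def vec_eq_iff F.lin scaleC_vec_def)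
    show "continuous_on UNIV (\<lambda>t. state_dilation t x)" for x
      unfolding state_dilation_def by (intro continuous_on_vec_lambda F.cont)
    show "cinner (state_dilation t x) (state_dilation t y) = cinner x y" for t x y by (rule ci)
  qed (auto simp: state_dilation_def vec_eq_iff F.zero F.add)
qed

theorem tensor_op_dGamma_D: "tensor_op (mat 1) (dGamma D) = generator state_dilation"
proof -
  have "(x, y) \<in> generator state_dilation \<longleftrightarrow> (\<forall>j. (x $ j, y $ j) \<in> generator fock_dilation)" for x y
  proof -
    have c: "(\<i> *\<^sub>C ((state_dilation t x - x) /\<^sub>R t)) $ j = \<i> *\<^sub>C ((fock_dilation t (x $ j) - x $ j) /\<^sub>R t)" for t j
      by (simp add: state_dilation_def scaleC_vec_def)
    show ?thesis unfolding generator_def mem_Collect_eq prod.case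
    proof
      assume l: "((\<lambda>t. \<i> *\<^sub>C ((state_dilation t x - x) /\<^sub>R t)) \<longlongrightarrow> y) (at 0)"
      show "\<forall>j. ((\<lambda>t. \<i> *\<^sub>C ((fock_dilation t (x $ j) - x $ j) /\<^sub>R t)) \<longlongrightarrow> y $ j) (at 0)"
        using tendsto_vec_nth[OF l] unfolding c by blast
    next
      assume "\<forall>j. ((\<lambda>t. \<i> *\<^sub>C ((fock_dilation t (x $ j) - x $ j) /\<^sub>R t)) \<longlongrightarrow> y $ j) (at 0)"
      then show "((\<lambda>t. \<i> *\<^sub>C ((state_dilation t x - x) /\<^sub>R t)) \<longlongrightarrow> y) (at 0)"
        by (intro vec_tendstoI) (simp only: c)
    qed
  qed
  then show ?thesis by (auto simp: tensor_op_mat_1 dGamma_D)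
qed

section \<open>Annihilation and creation operators\<close>

lemma sigma_finite_momentum: "sigma_finite_measure (volume :: momentum measure)"
  unfolding volume_momentum by (rule lborel.sigma_finite_measure_axioms)

lemma add_mset_joint_measurable [measurable]:
  "(\<lambda>(k, x). add_mset k (cfg n x)) \<in> measurable (volume \<Otimes>\<^sub>M particles n) volume"
  using measurable_compose[OF measurable_pair_swap' add_configuration_measurable]
  by (simp add: case_prod_unfold)

lemma nn_integral_add_mset_measurable [measurable]:
  assumes [measurable]: "f \<in> borel_measurable (volume :: momentum multiset measure)"
  shows "(\<lambda>X. \<integral>\<^sup>+k. f (add_mset k X) \<partial>volume) \<in> bmv"
proof (subst measurable_multiset_iff, simp, intro allI)
  fix n
  have "(\<lambda>(x, k). f (add_mset k (cfg n x))) \<in> borel_measurable (particles n \<Otimes>\<^sub>M volume)"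
    using measurable_compose[OF add_configuration_measurable assms] by (simp add: case_prod_unfold)
  then show "(\<lambda>x. \<integral>\<^sup>+k. f (add_mset k (cfg n x)) \<partial>volume) \<in> borel_measurable (particles n)"
    using sigma_finite_measure.borel_measurable_nn_integral[OF sigma_finite_momentum] by simp
qed

text \<open>Splitting off one particle turns sector \<open>n + 1\<close> of \<open>f\<close> into
  sector \<open>n\<close>. Only the vacuum sector of \<open>f\<close> is lost, whence an
  inequality.\<close>

lemma nn_integral_add_mset_le:
  assumes [measurable]: "f \<in> borel_measurable (volume :: momentum multiset measure)"
  shows "(\<integral>\<^sup>+X. \<integral>\<^sup>+k. f (add_mset k X) \<partial>volume \<partial>volume) <= (\<integral>\<^sup>+X. f X \<partial>volume)"
proof -
  define s where "s n = (\<integral>\<^sup>+x. f (cfg n x) \<partial>particles n)" for n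
  have "(\<integral>\<^sup>+X. \<integral>\<^sup>+k. f (add_mset k X) \<partial>volume \<partial>volume) = (\<Sum>n. s (Suc n))"
    unfolding s_def nn_integral_particles_Suc(1)[OF assms] by (rule nn_integral_multiset) measurable
  also have "... <= (\<Sum>n. s n)"
    using suminf_offset[of s 1] summableI by (simp add: add_increasing)
  also have "... = (\<integral>\<^sup>+X. f X \<partial>volume)" unfolding s_def by (rule nn_integral_multiset[symmetric]) measurable
  finally show ?thesis .
qed

lemma add_mset_left_measurable [measurable]:
  "(\<lambda>k. add_mset k X) \<in> measurable (volume :: momentum measure) volume"
proof -
  obtain x where x: "X = configuration (size X) x" using configuration_surj by blast
  define y where "y = (\<lambda>i\<in>{..<size X}. x i)"
  have "X = configuration (size X) y" by (subst x, rule configuration_cong) (simp add: y_def)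
  moreover have "y \<in> space (particles (size X))" by (simp add: y_def space_PiM)
  then have "(\<lambda>k. add_mset k (configuration (size X) y)) \<in> measurable volume volume"
    using measurable_compose[OF measurable_Pair1' add_configuration_measurable] by simp
  ultimately show ?thesis by simp
qed

text \<open>The Fubini statement for null sets of configurations, which permits working with slices
  of representatives.\<close>

lemma AE_add_mset_multiset:
  assumes "AE X in (volume :: momentum multiset measure). Q X"
  shows "AE X in volume. AE k in volume. Q (add_mset k X)"
proof -
  obtain N where N: "{X. \<not> Q X} \<subseteq> N" "N \<in> null_sets volume"
    using assms by (auto elim!: AE_E simp: null_sets_def)
  have [measurable]: "N \<in> sets volume" using N by auto
  have "(\<integral>\<^sup>+X. \<integral>\<^sup>+k. indicator N (add_mset k X) \<partial>volume \<partial>volume) <= (\<integral>\<^sup>+X. indicator N X \<partial>volume)"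
    by (rule nn_integral_add_mset_le) measurable
  also have "... = 0" using N(2) by auto
  finally have "AE X in volume. (\<integral>\<^sup>+k. indicator N (add_mset k X) \<partial>volume) = 0"
    by (subst (asm) le_zero_eq, subst (asm) nn_integral_0_iff_AE) auto
  then show ?thesis
  proof eventually_elim
    case (elim X)
    then have "AE k in volume. indicator N (add_mset k X) = (0::ennreal)"
      by (subst (asm) nn_integral_0_iff_AE) auto
    then show ?case by eventually_elim (use N(1) in "auto split: split_indicator_asm")
  qed
qed

text \<open>The dependence of \<open>ps\<close> on one further particle. The section is square
  integrable only for almost every \<open>X\<close>, so all identities for slices hold almost
  everywhere.\<close>

definition slice :: "momentum fock => momentum multiset => momentum L2" where
  "slice ps X = L2_of (\<lambda>k. fun_of ps (add_mset k X))"

lemma nn_integral_add_mset_fun_of: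
  "(\<integral>\<^sup>+X. \<integral>\<^sup>+k. ennreal ((cmod (fun_of ps (add_mset k X)))^2) \<partial>volume \<partial>volume)
    <= ennreal ((norm (ps :: momentum fock))^2)"
  unfolding nn_integral_fun_of[symmetric]
  using nn_integral_add_mset_le[of "\<lambda>X. ennreal ((cmod (fun_of ps X))^2)"] by simp

lemma slice_square_integrable: "AE X in volume. square_integrable (\<lambda>k. fun_of (ps :: momentum fock) (add_mset k X))"
proof -
  have "(\<integral>\<^sup>+X. \<integral>\<^sup>+k. ennreal ((cmod (fun_of ps (add_mset k X)))^2) \<partial>volume \<partial>volume) <= ennreal ((norm ps)^2)"
    by (rule nn_integral_add_mset_fun_of)
  also have "... < \<infinity>" by simp
  finally have "AE X in volume. (\<integral>\<^sup>+k. ennreal ((cmod (fun_of ps (add_mset k X)))^2) \<partial>volume) ~= \<infinity>"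
    by (intro nn_integral_noteq_infinite) auto
  then show ?thesis by eventually_elim (auto simp: square_integrable_iff_nn_integral less_top)
qed

lemma slice_add: "AE X in volume. slice (ps + ph) X = slice ps X + slice ph X"
  using slice_square_integrable[of ps] slice_square_integrable[of ph] slice_square_integrable[of "ps + ph"]
    AE_add_mset_multiset[OF fun_of_add[of ps ph]]
  by eventually_elim (auto simp: slice_def plus_L2_of intro!: L2_of_cong square_integrable_add)

lemma slice_mulop:
  assumes "bmult w" "!!X k. w (add_mset k X) = v X"
  shows "AE X in volume. slice (mulop w ps) X = v X *\<^sub>C slice ps X"
  using slice_square_integrable[of ps] slice_square_integrable[of "mulop w ps"]
    AE_add_mset_multiset[OF fun_of_mulop[OF assms(1), of ps]]
  by eventually_elim (auto simp: slice_def scaleC_L2_of assms(2) intro!: L2_of_cong square_integrable_scale)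

lemma slice_scaleC: "AE X in volume. slice (c *\<^sub>C ps) X = c *\<^sub>C slice ps X"
  using slice_square_integrable[of ps] slice_square_integrable[of "c *\<^sub>C ps"]
    AE_add_mset_multiset[OF fun_of_scaleC[of c ps]]
  by eventually_elim (auto simp: slice_def scaleC_L2_of intro!: L2_of_cong square_integrable_scale)

definition contraction :: "momentum L2 => momentum fock => momentum multiset => complex" where
  "contraction h ps X = (LINT k|volume. cnj (fun_of h k) * fun_of ps (add_mset k X))"

lemma contraction_measurable [measurable]: "contraction h ps \<in> bmv"
proof (subst measurable_multiset_iff, simp, intro allI)
  fix n
  have "(\<lambda>(x, k). cnj (fun_of h k) * fun_of ps (add_mset k (cfg n x))) \<in> borel_measurable (particles n \<Otimes>\<^sub>M volume)"
    using measurable_compose[OF add_configuration_measurable fun_of_measurable, of ps]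
    by (simp add: case_prod_unfold) measurable
  then show "(\<lambda>x. contraction h ps (cfg n x)) \<in> borel_measurable (particles n)"
    unfolding contraction_def using sigma_finite_measure.borel_measurable_lebesgue_integral[OF sigma_finite_momentum] by simp
qed

lemma contraction_slice: "AE X in volume. contraction h ps X = cinner h (slice ps X)"
  using slice_square_integrable[of ps]
proof eventually_elim
  case (elim X)
  show ?case unfolding contraction_def cinner_fun_of
    by (rule integral_cong_AE) (measurable, use fun_of_L2_of[OF elim] in "eventually_elim, simp add: slice_def")
qed

lemma nn_integral_contraction:
  "(\<integral>\<^sup>+X. ennreal ((cmod (contraction h ps X))^2) \<partial>volume) <= ennreal ((norm h * norm ps)^2)"
proof -
  have "(\<integral>\<^sup>+X. ennreal ((cmod (contraction h ps X))^2) \<partial>volume)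
    <= (\<integral>\<^sup>+X. ennreal ((norm h)^2) * (\<integral>\<^sup>+k. ennreal ((cmod (fun_of ps (add_mset k X)))^2) \<partial>volume) \<partial>volume)"
  proof (rule nn_integral_mono_AE)
    show "AE X in volume. ennreal ((cmod (contraction h ps X))^2) <= ennreal ((norm h)^2) * (\<integral>\<^sup>+k. ennreal ((cmod (fun_of ps (add_mset k X)))^2) \<partial>volume)"
      using contraction_slice[of h ps] slice_square_integrable[of ps]
    proof eventually_elim
      case (elim X)
      have "(cmod (contraction h ps X))^2 <= (norm h * norm (slice ps X))^2"
        unfolding elim(1) by (intro power_mono cinner_le_norm) simp
      then have "ennreal ((cmod (contraction h ps X))^2) <= ennreal ((norm h)^2) * ennreal ((norm (slice ps X))^2)"
        by (simp add: power_mult_distrib ennreal_mult[symmetric] ennreal_leI)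
      then show ?case using elim(2) by (simp add: slice_def norm_L2_of_nn)
    qed
  qed
  also have "... = ennreal ((norm h)^2) * (\<integral>\<^sup>+X. \<integral>\<^sup>+k. ennreal ((cmod (fun_of ps (add_mset k X)))^2) \<partial>volume \<partial>volume)"
    by (rule nn_integral_cmult) measurable
  also have "... <= ennreal ((norm h)^2) * ennreal ((norm ps)^2)"
    by (intro mult_left_mono nn_integral_add_mset_fun_of) auto
  finally show ?thesis by (simp add: power_mult_distrib ennreal_mult)
qed

text \<open>\<open>bann h\<close> is \<open>a(h) N\<^sup>-\<^sup>1\<^sup>/\<^sup>2\<close>, extended by \<open>0\<close> to the vacuum.\<close>

definition bann :: "momentum L2 => momentum fock => momentum fock" where
  "bann h ps = L2_of (contraction h ps)"

lemma square_integrable_contraction: "square_integrable (contraction h ps)"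
  unfolding square_integrable_iff_nn_integral using le_less_trans[OF nn_integral_contraction] by auto

lemma fun_of_bann: "AE X in volume. fun_of (bann h ps) X = cinner h (slice ps X)"
  using fun_of_L2_of[OF square_integrable_contraction, of h ps] contraction_slice[of h ps]
  by eventually_elim (simp add: bann_def)

lemma norm_bann: "norm (bann h ps) <= norm h * norm ps"
proof (rule power2_le_imp_le)
  have "ennreal ((norm (bann h ps))^2) <= ennreal ((norm h * norm ps)^2)"
    unfolding bann_def norm_L2_of_nn[OF square_integrable_contraction] by (rule nn_integral_contraction)
  then show "(norm (bann h ps))^2 <= (norm h * norm ps)^2" by (simp add: ennreal_le_iff)
qed simp

lemma bounded_clinear_bann: "bounded_clinear (bann h)"
proof (rule bounded_clinearI[OF _ _ norm_bann])
  show "bann h (ps + ph) = bann h ps + bann h ph" for ps ph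
    using fun_of_bann[of h ps] fun_of_bann[of h ph] fun_of_bann[of h "ps + ph"] slice_add[of ps ph] fun_of_add[of "bann h ps" "bann h ph"]
    by (intro L2_eqI, eventually_elim) (simp add: cinner_add_right)
  show "bann h (c *\<^sub>C ps) = c *\<^sub>C bann h ps" for c ps
    using fun_of_bann[of h ps] fun_of_bann[of h "c *\<^sub>C ps"] slice_scaleC[of c ps] fun_of_scaleC[of c "bann h ps"]
    by (intro L2_eqI, eventually_elim) (simp add: cinner_scaleC_right)
qed

lemma bann_add: "bann (h + h') ps = bann h ps + bann h' ps"
  using fun_of_bann[of h ps] fun_of_bann[of h' ps] fun_of_bann[of "h + h'" ps] fun_of_add[of "bann h ps" "bann h' ps"]
  by (intro L2_eqI, eventually_elim) (simp add: cinner_add_left)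

lemma bann_scaleC: "bann (c *\<^sub>C h) ps = cnj c *\<^sub>C bann h ps"
  using fun_of_bann[of h ps] fun_of_bann[of "c *\<^sub>C h" ps] fun_of_scaleC[of "cnj c" "bann h ps"]
  by (intro L2_eqI, eventually_elim) (simp add: cinner_scaleC_left)

lemma bann_diff: "bann (h - h') ps = bann h ps - bann h' ps"
  using bann_add[of h "(-1) *\<^sub>C h'" ps] bann_scaleC[of "-1" h' ps] by simp

text \<open>As \<open>bann h\<close> is \<open>a(h) N^(-1/2)\<close>, its adjoint is
  \<open>N^(-1/2) a*(h) = a*(h) (N + 1)^(-1/2)\<close>, which is already the creation part of the
  bounded field operator.\<close>

abbreviation cre :: "momentum L2 => momentum fock => momentum fock" where
  "cre h \<equiv> adj (bann h)"

lemmas cre_bounded = bounded_clinear_adj[OF bounded_clinear_bann norm_bann]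
lemmas cinner_cre_left = cinner_adj_left[OF bounded_clinear_bann]
lemmas cinner_cre_right = cinner_adj_right[OF bounded_clinear_bann]

lemma cre_scaleC: "cre (c *\<^sub>C h) ps = c *\<^sub>C cre h ps"
  by (rule cinner_eqI) (simp add: cinner_cre_right bann_scaleC cinner_scaleC_left cinner_scaleC_right)

lemma cre_diff: "cre (h - h') ps = cre h ps - cre h' ps"
  by (rule cinner_eqI) (simp add: cinner_cre_right bann_diff cinner_diff_left cinner_diff_right)

definition inv_root :: "momentum multiset => complex" where
  "inv_root X = cx (1 / sqrt (real (size X) + 1))"

lemma cnj_inv_root: "cnj (inv_root X) = inv_root X"
  by (simp add: inv_root_def)

lemma inv_root_nonzero: "inv_root X ~= 0"
  using real_sqrt_gt_zero[of "real (size X) + 1"] by (simp add: inv_root_def add_nonneg_pos)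

text \<open>With \<open>inv_root = (N + 1)^(-1/2)\<close> and
  \<open>shift_root = (N / (N + 1))^(1/2)\<close>, the operator \<open>a(h) (N + 1)^(-1/2)\<close>
  becomes \<open>bann h\<close> after \<open>shift_root\<close>. This avoids the undefined power of
  \<open>N\<close> on the vacuum.\<close>

definition shift_root :: "momentum multiset => complex" where
  "shift_root X = cx (sqrt (real (size X) / (real (size X) + 1)))"

lemma bounded_inv_root: "bmult inv_root"
  by (rule bmultI[where K=1]) (auto simp: inv_root_def[abs_def] norm_divide)

lemma shift_root_le: "cmod (shift_root X) <= 1"
  by (simp add: shift_root_def)

lemma bounded_shift_root: "bmult shift_root"
  by (rule bmultI[where K=1]) (auto simp: shift_root_def[abs_def])

text \<open>The pull-through relation \<open>(N + 1)^(-1/2) a(h) = a(h) N^(-1/2)\<close>; on a slice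
  with one particle added both multipliers depend only on the remaining particle number.\<close>

lemma inv_root_bann: "mulop inv_root (bann h (mulop shift_root ps)) = bann h (mulop inv_root ps)"
proof -
  define v where "v X = cx (sqrt ((real (size X) + 1) / (real (size X) + 2)))" for X :: "momentum multiset"
  define u where "u X = cx (1 / sqrt (real (size X) + 2))" for X :: "momentum multiset"
  have v: "shift_root (add_mset k X) = v X" for k X by (simp add: shift_root_def v_def add_ac)
  have u: "inv_root (add_mset k X) = u X" for k X by (simp add: inv_root_def u_def add_ac)
  have uv: "inv_root X * v X = u X" for X
    by (simp add: inv_root_def v_def u_def real_sqrt_divide flip: of_real_mult)
  show ?thesis
    using fun_of_mulop[OF bounded_inv_root, of "bann h (mulop shift_root ps)"] fun_of_bann[of h "mulop shift_root ps"]
      slice_mulop[OF bounded_shift_root v, of ps] fun_of_bann[of h "mulop inv_root ps"] slice_mulop[OF bounded_inv_root u, of ps]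
    by (intro L2_eqI, eventually_elim) (simp add: cinner_scaleC_right uv[symmetric] mult.assoc)
qed

text \<open>\<open>field_op h h'\<close> is \<open>(a(h) + a(h')\<^sup>*) (N + 1)\<^sup>-\<^sup>1\<^sup>/\<^sup>2\<close>.\<close>

definition field_op :: "momentum L2 => momentum L2 => momentum fock => momentum fock" where
  "field_op h h' y = bann h (mulop shift_root y) + cre h' y"

lemma bounded_clinear_field_op: "bounded_clinear (field_op h h')"
  unfolding field_op_def
  by (intro bounded_clinear_add bounded_clinear_compose[OF bounded_clinear_bann bounded_clinear_mulop[OF bounded_shift_root]] cre_bounded)

lemma norm_field_op: "norm (field_op h h' y) <= (norm h + norm h') * norm y"
proof -
  have "norm (mulop shift_root y) <= 1 * norm y"
    by (rule mulop_norm_le) (use bounded_shift_root shift_root_le in "auto simp: bmult_def")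
  then have "norm (bann h (mulop shift_root y)) <= norm h * norm y"
    by (intro order_trans[OF norm_bann mult_left_mono]) auto
  then show ?thesis unfolding field_op_def
    using norm_triangle_ineq[of "bann h (mulop shift_root y)" "cre h' y"] cre_bounded(2)[of h' y] by (simp add: distrib_right)
qed

lemma field_op_diff: "field_op h1 h1' y - field_op h2 h2' y = field_op (h1 - h2) (h1' - h2') y"
  by (simp add: field_op_def bann_diff cre_diff)

lemma field_op_scaleC: "field_op (cnj c *\<^sub>C h) (c *\<^sub>C h') y = c *\<^sub>C field_op h h' y"
  by (simp add: field_op_def bann_scaleC cre_scaleC scaleC_add_right)

text \<open>Symmetry of the field on the domain of \<open>(N + 1)^(1/2)\<close>, whose elements are
  written with \<open>inv_root\<close>. The two test functions are kept apart because complex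
  dilations make them different; passing to the adjoint exchanges them.\<close>

lemma field_op_symmetric:
  "cinner (mulop inv_root x) (field_op h h' y) = cinner (field_op h' h x) (mulop inv_root y)"
proof -
  have sa: "cinner (mulop inv_root a) b = cinner a (mulop inv_root b)" for a b
    using cinner_mulop_left[OF bounded_inv_root, of a b] by (simp add: cnj_inv_root)
  have 1: "cinner (mulop inv_root x) (bann h (mulop shift_root y)) = cinner (cre h x) (mulop inv_root y)" for h x y
    unfolding sa inv_root_bann cinner_cre_left ..
  have 2: "cinner (mulop inv_root x) (cre h' y) = cinner (bann h' (mulop shift_root x)) (mulop inv_root y)"
    unfolding cinner_cre_right inv_root_bann[symmetric] sa ..
  show ?thesis unfolding field_op_def cinner_add_right cinner_add_left 1 2 by simp
qed

text \<open>Dividing by the square root of \<open>size X + 1\<close> turns the graph of an unbounded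
  operator into an equation between bounded ones.\<close>

lemma annihilation_iff: "(ps, \<eta>) \<in> annihilation h \<longleftrightarrow> mulop inv_root \<eta> = bann h ps"
proof -
  let ?r = "\<lambda>X :: momentum multiset. cx (sqrt (real (size X) + 1))"
  have ir: "inv_root X * ?r X = 1" for X
    using real_sqrt_gt_zero[of "real (size X) + 1"] by (simp add: inv_root_def add_nonneg_pos)
  have "y = ?r X * z \<longleftrightarrow> inv_root X * y = z" for X y z
  proof
    assume "y = ?r X * z"
    then have "inv_root X * y = (inv_root X * ?r X) * z" by (simp only: mult.assoc)
    then show "inv_root X * y = z" by (simp only: ir mult_1_left)
  next
    assume z: "inv_root X * y = z"
    have "?r X * z = (inv_root X * ?r X) * y" unfolding z[symmetric] by (simp only: mult_ac)
    then show "y = ?r X * z" by (simp only: ir mult_1_left)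
  qed
  then have "(ps, \<eta>) \<in> annihilation h \<longleftrightarrow> (AE X in volume. inv_root X * fun_of \<eta> X = contraction h ps X)"
    by (simp add: annihilation_def contraction_def)
  also have "... \<longleftrightarrow> (AE X in volume. fun_of (mulop inv_root \<eta>) X = fun_of (bann h ps) X)"
  proof -
    have "AE X in volume. (inv_root X * fun_of \<eta> X = contraction h ps X) \<longleftrightarrow> (fun_of (mulop inv_root \<eta>) X = fun_of (bann h ps) X)"
      using fun_of_mulop[OF bounded_inv_root, of \<eta>] fun_of_bann[of h ps] contraction_slice[of h ps]
      by eventually_elim simp
    then show ?thesis by (rule eventually_subst)
  qed
  also have "... \<longleftrightarrow> mulop inv_root \<eta> = bann h ps" by (auto intro: L2_eqI)
  finally show ?thesis .
qed

lemma mulop_inv_root_inj: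
  assumes e: "mulop inv_root x = mulop inv_root y" shows "x = y"
proof (rule L2_eqI)
  show "AE X in volume. fun_of x X = fun_of y X"
    using fun_of_mulop[OF bounded_inv_root, of x] fun_of_mulop[OF bounded_inv_root, of y] unfolding e
    by eventually_elim (use inv_root_nonzero in simp)
qed

lemma annihilation_inv_root: "(mulop inv_root y, bann h (mulop shift_root y)) \<in> annihilation h"
  unfolding annihilation_iff by (rule inv_root_bann)

lemma creation_inv_root: "(mulop inv_root y, cre h y) \<in> creation h"
  unfolding creation_def adjoint_op_def
proof (clarsimp)
  fix u v assume "(u, v) \<in> annihilation h"
  then have uv: "mulop inv_root v = bann h u" by (simp add: annihilation_iff)
  have "cinner (mulop inv_root y) v = cinner y (mulop inv_root v)"
    using cinner_mulop_left[OF bounded_inv_root, of y v] by (simp add: cnj_inv_root)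
  then show "cinner (mulop inv_root y) v = cinner (cre h y) u" by (simp add: uv cinner_cre_left)
qed

lemma dense_range_inv_root: "closure (range (mulop inv_root)) = UNIV"
proof (rule closed_csubspace_UNIV)
  note L = bounded_clinearD[OF bounded_clinear_mulop[OF bounded_inv_root]]
  have "csubspace (range (mulop inv_root))" unfolding csubspace_def
  proof (intro conjI ballI allI)
    show "0 \<in> range (mulop inv_root)" by (rule range_eqI[of _ _ 0]) (simp add: L)
    show "x + y \<in> range (mulop inv_root)" if xy: "x \<in> range (mulop inv_root)" "y \<in> range (mulop inv_root)" for x y
    proof -
      from xy obtain a b where "x = mulop inv_root a" "y = mulop inv_root b" by blast
      then have "x + y = mulop inv_root (a + b)" by (simp add: L)
      then show ?thesis by blast
    qed
    show "c *\<^sub>C x \<in> range (mulop inv_root)" if x: "x \<in> range (mulop inv_root)" for x c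
    proof -
      from x obtain a where "x = mulop inv_root a" by blast
      then have "c *\<^sub>C x = mulop inv_root (c *\<^sub>C a)" by (simp add: L)
      then show ?thesis by blast
    qed
  qed
  then show "csubspace (closure (range (mulop inv_root)))" by (rule csubspace_closure)
  fix x assume o: "!!s. s \<in> closure (range (mulop inv_root)) ==> cinner s x = 0"
  have z: "cinner (mulop inv_root y) x = 0" for y
    by (rule o) (rule subsetD[OF closure_subset rangeI])
  have "cinner y (mulop inv_root x) = 0" for y
    using z[of y] cinner_mulop_left[OF bounded_inv_root, of y x] by (simp add: cnj_inv_root)
  then have "mulop inv_root x = mulop inv_root 0" by (intro cinner_eqI) (simp add: L)
  then show "x = 0" by (rule mulop_inv_root_inj)
qed simp

lemma creation_single_valued: "(x, y) \<in> creation (h :: momentum L2) ==> (x, y') \<in> creation h ==> y = y'"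
proof -
  assume xy: "(x, y) \<in> creation h" "(x, y') \<in> creation h"
  have e: "cinner y u = cinner y' u" if uv: "(u, v) \<in> annihilation h" for u v
  proof -
    have "cinner x v = cinner y u" "cinner x v = cinner y' u"
      using xy uv by (auto simp: creation_def adjoint_op_def)
    then show ?thesis by simp
  qed
  have "norm (y - y') <= 0"
  proof (rule norm_le_by_cinner_dense[OF dense_range_inv_root])
    fix u assume "u \<in> range (mulop inv_root)"
    then obtain a where "u = mulop inv_root a" by blast
    then have "cinner y u = cinner y' u" using e annihilation_inv_root by blast
    then have "cinner (y - y') u = 0" by (simp add: cinner_diff_left)
    then have "cinner u (y - y') = 0" by (subst cinner_commute) simp
    then show "cmod (cinner u (y - y')) <= 0 * norm u" by simp
  qed simp
  then show "y = y'" by simp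
qed

text \<open>On the domain of \<open>(N + 1)^(1/2)\<close> the sum of the two graphs is single valued
  and given by a bounded operator. This suffices for the model, since the domain of the free
  Hamiltonian is contained in it.\<close>

theorem field_graph:
  "(mulop inv_root y, z) \<in> op_add (annihilation h) (creation h) \<longleftrightarrow> z = field_op h h y"
proof
  assume "(mulop inv_root y, z) \<in> op_add (annihilation h) (creation h)"
  then obtain a b where ab: "z = a + b" "(mulop inv_root y, a) \<in> annihilation h" "(mulop inv_root y, b) \<in> creation h"
    by (auto simp: op_add_def)
  have "a = bann h (mulop shift_root y)"
    using ab(2) annihilation_inv_root[of y h] mulop_inv_root_inj by (auto simp: annihilation_iff)
  moreover have "b = cre h y" using creation_single_valued[OF ab(3) creation_inv_root] .
  ultimately show "z = field_op h h y" by (simp add: ab field_op_def)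
next
  assume "z = field_op h h y"
  then show "(mulop inv_root y, z) \<in> op_add (annihilation h) (creation h)"
    using annihilation_inv_root creation_inv_root by (auto simp: op_add_def field_op_def) blast
qed

subsection \<open>Covariance under dilations\<close>

abbreviation scl :: "real => momentum multiset => momentum multiset" where
  "scl t \<equiv> image_mset ((*\<^sub>R) (exp t))"

lemma fock_dilation_mulop:
  assumes w: "bmult w" "bmult v" and wv: "!!X. w (scl t X) = v X"
  shows "fock_dilation t (mulop w ps) = mulop v (fock_dilation t ps)"
  unfolding fock_dilation_def
  using fun_of_wcomp_fock[OF isometric_dil_weight, of t "mulop w ps"] AE_scale_multiset[OF exp_gt_zero[of t] fun_of_mulop[OF w(1), of ps]]
    fun_of_mulop[OF w(2), of "wcomp_fock (exp t) (dil_weight t) ps"] fun_of_wcomp_fock[OF isometric_dil_weight, of t ps]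
  by (intro L2_eqI, eventually_elim) (simp add: wv)

lemma slice_fock_dilation:
  "AE X in volume. slice (fock_dilation t ps) X
    = (\<Prod>k\<in>#X. dil_weight t k) *\<^sub>C dilation t (slice ps (scl t X))"
proof -
  have w: "AE X in volume. AE k in volume. fun_of (fock_dilation t ps) (add_mset k X)
    = (\<Prod>k\<in>#add_mset k X. dil_weight t k) * fun_of ps (image_mset ((*\<^sub>R) (exp t)) (add_mset k X))"
    unfolding fock_dilation_def by (rule AE_add_mset_multiset[OF fun_of_wcomp_fock[OF isometric_dil_weight]])
  show ?thesis
    using w slice_square_integrable[of "fock_dilation t ps"] AE_scale_multiset[OF exp_gt_zero[of t] slice_square_integrable[of ps]]
  proof eventually_elim
    case (elim X)
    let ?Y = "image_mset ((*\<^sub>R) (exp t)) X"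
    have "AE k in volume. fun_of (slice ps ?Y) (exp t *\<^sub>R k) = fun_of ps (add_mset (exp t *\<^sub>R k) ?Y)"
      unfolding slice_def by (rule AE_scale_momentum[OF exp_gt_zero fun_of_L2_of[OF elim(3)]])
    then show ?case
      using fun_of_L2_of[OF elim(2)] elim(1) fun_of_wcomp[OF isometric_dil_weight, of t "slice ps ?Y"]
        fun_of_scaleC[of "\<Prod>k\<in>#X. dil_weight t k" "dilation t (slice ps ?Y)"]
      by (intro L2_eqI, eventually_elim) (simp add: slice_def dilation_eq mult_ac)
  qed
qed

lemma bann_dilation: "fock_dilation t (bann h ps) = bann (dilation t h) (fock_dilation t ps)"
proof -
  interpret d: unitary_group_locale dilation by unfold_locales (rule unitary_group_dilation)
  show ?thesis
    using fun_of_wcomp_fock[OF isometric_dil_weight, of t "bann h ps"] AE_scale_multiset[OF exp_gt_zero[of t] fun_of_bann[of h ps]]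
      fun_of_bann[of "dilation t h" "fock_dilation t ps"] slice_fock_dilation[of t ps]
    by (intro L2_eqI, eventually_elim) (simp add: fock_dilation_def cinner_scaleC_right d.cinner_U)
qed

lemma cre_dilation: "fock_dilation t (cre h ps) = cre (dilation t h) (fock_dilation t ps)"
proof (rule cinner_eqI)
  interpret U: unitary_group_locale fock_dilation by unfold_locales (rule unitary_group_fock_dilation)
  fix u
  have "cinner u (fock_dilation t (cre h ps)) = cinner (fock_dilation (-t) u) (cre h ps)"
    using U.cinner_move[of "-t" u] by simp
  also have "... = cinner (fock_dilation t (bann h (fock_dilation (-t) u))) (fock_dilation t ps)"
    by (simp add: cinner_cre_right U.cinner_U)
  also have "... = cinner u (cre (dilation t h) (fock_dilation t ps))"
    by (simp add: bann_dilation U.minus cinner_cre_right)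
  finally show "cinner u (fock_dilation t (cre h ps)) = cinner u (cre (dilation t h) (fock_dilation t ps))" .
qed

lemma field_op_dilation:
  "fock_dilation t (field_op h h' y) = field_op (dilation t h) (dilation t h') (fock_dilation t y)"
proof -
  interpret U: unitary_group_locale fock_dilation by unfold_locales (rule unitary_group_fock_dilation)
  have "fock_dilation t (mulop shift_root y) = mulop shift_root (fock_dilation t y)"
    by (rule fock_dilation_mulop[OF bounded_shift_root bounded_shift_root]) (simp add: shift_root_def)
  then show ?thesis by (simp add: field_op_def U.lin bann_dilation cre_dilation)
qed

section \<open>Complex dilations of the dispersion relation and of the form factor\<close>

text \<open>Cauchy estimates on discs of radius \<open>1/16\<close> around points of the ball of
  radius \<open>1/16\<close>, all inside the ball of radius \<open>1/8\<close>. The second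
  derivative is at most \<open>2 * (2 * B) * 16^2 = 1024 * B\<close>, and the same constant is used
  for the lower orders.\<close>

lemma holomorphic_taylor_bounds:
  assumes hol: "ph holomorphic_on ball 0 (1/8)" and B: "0 < B" "!!z. z \<in> ball 0 (1/8) ==> cmod (ph z) <= B"
    and th: "th \<in> ball 0 (1/16)" "th' \<in> ball 0 (1/16)"
  shows "cmod (deriv ph th) <= 1024 * B"
    "cmod (ph th' - ph th) <= 1024 * B * cmod (th' - th)"
    "cmod (ph th' - ph th - (th' - th) * deriv ph th) <= 1024 * B * (cmod (th' - th))^2"
proof -
  \<comment> \<open>\<open>2 * B\<close> instead of \<open>B\<close>, because the values have to lie
    in an open ball.\<close>
  have db: "cmod ((deriv ^^ n) ph z) <= fact n * (2 * B) / (1/16) ^ n" if z: "z \<in> ball 0 (1/16)" and n: "0 < n" for z n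
  proof (rule Cauchy_higher_deriv_bound[where y = 0])
    have sub: "cball z (1/16) \<subseteq> ball 0 (1/8)"
    proof
      fix w assume "w \<in> cball z (1/16)"
      then show "w \<in> ball 0 (1/8)" using z norm_triangle_ineq[of z "w - z"] by (simp add: dist_norm norm_minus_commute)
    qed
    show "ph holomorphic_on ball z (1/16)" by (rule holomorphic_on_subset[OF hol]) (use sub ball_subset_cball in blast)
    show "continuous_on (cball z (1/16)) ph" by (rule continuous_on_subset[OF holomorphic_on_imp_continuous_on[OF hol] sub])
    show "ph w \<in> ball 0 (2 * B)" if "w \<in> ball z (1/16)" for w
    proof -
      have "w \<in> ball 0 (1/8)" using sub that by (meson ball_subset_cball subsetD)
      then show ?thesis using B(2)[of w] B(1) by simp
    qed
  qed (use n in auto)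
  have d: "((deriv ^^ i) ph has_field_derivative (deriv ^^ Suc i) ph z) (at z within ball 0 (1/16))" if z: "z \<in> ball 0 (1/16)" for i z
  proof -
    have "(deriv ^^ i) ph holomorphic_on ball 0 (1/8)" by (rule holomorphic_higher_deriv[OF hol]) simp
    moreover have "z \<in> ball 0 (1/8)" using z by simp
    ultimately have "((deriv ^^ i) ph has_field_derivative deriv ((deriv ^^ i) ph) z) (at z)"
      by (intro holomorphic_derivI[of _ "ball 0 (1/8)"]) auto
    then show ?thesis by (simp add: has_field_derivative_at_within)
  qed
  have b1: "cmod ((deriv ^^ Suc 0) ph z) <= 32 * B" if "z \<in> ball 0 (1/16)" for z using db[OF that, of 1] by simp
  have b2: "cmod ((deriv ^^ Suc 1) ph z) <= 1024 * B" if "z \<in> ball 0 (1/16)" for z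
    using db[OF that, of 2] by (simp add: numeral_2_eq_2)
  show "cmod (deriv ph th) <= 1024 * B" using b1[OF th(1)] B(1) by simp
  have "cmod ((deriv ^^ 0) ph th' - (\<Sum>i\<le>0. (deriv ^^ i) ph th * (th' - th) ^ i / fact i)) <= 32 * B * cmod (th' - th) ^ Suc 0 / fact 0"
    by (rule complex_Taylor[OF convex_ball d b1 th]) auto
  then have "cmod (ph th' - ph th) <= 32 * B * cmod (th' - th)" by simp
  also have "... <= 1024 * B * cmod (th' - th)" using B(1) by (intro mult_right_mono) auto
  finally show "cmod (ph th' - ph th) <= 1024 * B * cmod (th' - th)" .
  have "cmod ((deriv ^^ 0) ph th' - (\<Sum>i\<le>1. (deriv ^^ i) ph th * (th' - th) ^ i / fact i)) <= 1024 * B * cmod (th' - th) ^ Suc 1 / fact 1"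
    by (rule complex_Taylor[OF convex_ball d b2 th]) auto
  then show "cmod (ph th' - ph th - (th' - th) * deriv ph th) <= 1024 * B * (cmod (th' - th))^2"
    by (simp add: power2_eq_square algebra_simps)
qed

text \<open>The derivative is a pointwise limit of difference quotients; the increments are at most
  \<open>1/16\<close>, which keeps the argument inside the domain of holomorphy.\<close>

lemma deriv_measurable:
  assumes m: "!!z. z \<in> ball 0 (1/8) ==> (\<lambda>k. ph k z) \<in> borel_measurable M"
    and hol: "!!k. ph k holomorphic_on ball 0 (1/8)" and th: "th \<in> ball 0 (1/16)"
  shows "(\<lambda>k. deriv (ph k) th) \<in> borel_measurable M"
proof (rule borel_measurable_LIMSEQ_metric)
  define e where "e n = cx (1 / (16 * real (Suc n)))" for n
  have e0: "e n ~= 0" for n unfolding e_def of_real_eq_0_iff by (simp del: of_nat_Suc)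
  have eb: "th + e n \<in> ball 0 (1/8)" for n
  proof -
    have "cmod (e n) = 1 / (16 * real (Suc n))" unfolding e_def norm_of_real by simp
    also have "... <= 1 / 16" by (simp add: field_simps)
    finally show ?thesis using th norm_triangle_ineq[of th "e n"] by simp
  qed
  have "th \<in> ball 0 (1/8)" using th by simp
  then show "(\<lambda>k. (ph k (th + e n) - ph k th) / e n) \<in> borel_measurable M" for n
    using m[OF eb[of n]] m[of th] by measurable
  fix k
  have "(ph k has_field_derivative deriv (ph k) th) (at th)"
    by (rule holomorphic_derivI[OF hol]) (use th in auto)
  then have "((\<lambda>h. (ph k (th + h) - ph k th) / h) \<longlongrightarrow> deriv (ph k) th) (at 0)" by (simp add: DERIV_def)
  moreover have "e ----> 0"
  proof -
    have "(\<lambda>n. cx ((1 / 16) * inverse (real (Suc n)))) ----> cx ((1/16) * 0)"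
      by (intro tendsto_of_real tendsto_mult tendsto_const LIMSEQ_inverse_real_of_nat)
    then show ?thesis by (simp add: e_def[abs_def] inverse_eq_divide)
  qed
  ultimately show "(\<lambda>n. (ph k (th + e n) - ph k th) / e n) ----> deriv (ph k) th"
    using e0 by (auto simp: tendsto_at_iff_sequentially o_def)
qed

section \<open>Analytic continuation of the dispersion relation and of the form factor\<close>

definition qth :: "real => complex => momentum => complex" where
  "qth m th k = exp (2 * th) * cx ((norm k)^2) + cx (m^2)"

definition \<omega>th :: "real => complex => momentum => complex" where
  "\<omega>th m th k = csqrt (qth m th k)"

text \<open>The continuation to complex \<open>th\<close> of
  \<open>exp (3 * th / 2) * f (exp th *\<^sub>R k)\<close>, which is the dilated form factor for
  real \<open>th\<close>. The principal square roots are harmless because their arguments keep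
  positive real part.\<close>

definition fth :: "real => real => complex => momentum => complex" where
  "fth m La th k = exp (3 * th / 2) * exp (- (exp (2 * th) * cx ((norm k)^2 / La^2))) / csqrt (\<omega>th m th k)"

lemma exp_small_bounds:
  assumes "th \<in> ball 0 (1/8)"
  shows "1/2 <= Re (exp (2 * th))" "cmod (exp (2 * th)) <= 3/2" "1/2 <= exp (2 * Re th)" "cmod (exp (3 * th / 2)) <= 2"
proof -
  have r: "\<bar>Re th\<bar> < 1/8" "\<bar>Im th\<bar> < 1/8"
    using assms abs_Re_le_cmod[of th] abs_Im_le_cmod[of th] by auto
  have e1: "3/4 <= exp (2 * Re th)" using exp_ge_add_one_self[of "2 * Re th"] r by linarith
  then show "1/2 <= exp (2 * Re th)" by simp
  have e2: "exp (2 * Re th) <= 3/2"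
  proof -
    have "exp (2 * Re th) <= exp (1/4)" using r by simp
    also have "... <= 1 + 2 * (1/4)" using exp_bound_lemma[of "1/4::real"] by simp
    finally show ?thesis by simp
  qed
  then show "cmod (exp (2 * th)) <= 3/2" by simp
  have c: "1 - (2 * Im th)^2 / 2 <= cos (2 * Im th)"
  proof -
    have "(sin (Im th))^2 <= (Im th)^2" using abs_sin_x_le_abs_x[of "Im th"] by (simp add: abs_le_square_iff)
    then show ?thesis by (simp only: cos_double_sin) (simp add: power_mult_distrib)
  qed
  have "(2 * Im th)^2 <= (1/4)^2" using r by (subst abs_le_square_iff[symmetric]) simp
  then have c': "3/4 <= cos (2 * Im th)" using c by (simp add: power2_eq_square)
  have "(3/4) * (3/4) <= exp (2 * Re th) * cos (2 * Im th)" by (rule mult_mono[OF e1 c']) auto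
  then show "1/2 <= Re (exp (2 * th))" by (simp add: Re_exp)
  have "cmod (exp (3 * th / 2)) = exp (3 * Re th / 2)" by simp
  also have "... <= exp (1/4)" using r by simp
  also have "... <= 1 + 2 * (1/4)" using exp_bound_lemma[of "1/4::real"] by simp
  finally show "cmod (exp (3 * th / 2)) <= 2" by simp
qed

lemma \<omega>_square: "(\<omega> m k)^2 = (norm k)^2 + m^2"
  by (simp add: \<omega>_def)

lemma \<omega>_ge: "0 <= m ==> m <= \<omega> m k"
  unfolding \<omega>_def by (rule real_le_rsqrt) simp

lemma qth_bounds:
  assumes "th \<in> ball 0 (1/8)"
  shows "(\<omega> m k)^2 / 2 <= Re (qth m th k)" "cmod (qth m th k) <= 2 * (\<omega> m k)^2"
proof -
  note e = exp_small_bounds[OF assms]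
  have "(\<omega> m k)^2 / 2 <= 1/2 * (norm k)^2 + m^2" unfolding \<omega>_square by simp
  also have "... <= Re (exp (2 * th)) * (norm k)^2 + m^2"
    by (intro add_right_mono mult_right_mono[OF e(1)]) simp
  also have "... = Re (qth m th k)"
    unfolding qth_def plus_complex.simps Re_complex_of_real times_complex.simps Im_complex_of_real by simp
  finally show "(\<omega> m k)^2 / 2 <= Re (qth m th k)" .
  have "cmod (qth m th k) <= cmod (exp (2 * th)) * (norm k)^2 + m^2"
    unfolding qth_def by (rule order_trans[OF norm_triangle_ineq]) (simp add: norm_mult norm_power)
  also have "... <= 3/2 * (norm k)^2 + m^2" using mult_right_mono[OF e(2), of "(norm k)^2"] by simp
  finally have "cmod (qth m th k) <= 3/2 * (norm k)^2 + m^2" .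
  then show "cmod (qth m th k) <= 2 * (\<omega> m k)^2"
  proof -
    have "3/2 * x + y <= 2 * (x + y)" if "0 <= x" "0 <= y" for x y :: real using that by (simp add: field_simps)
    from order_trans[OF \<open>cmod (qth m th k) <= 3/2 * (norm k)^2 + m^2\<close> this[of "(norm k)^2" "m^2"]]
    show ?thesis unfolding \<omega>_square by simp
  qed
qed

lemma qth_nonpos:
  assumes "0 < m" "th \<in> ball 0 (1/8)" shows "qth m th k \<notin> \<real>\<^sub>\<le>\<^sub>0"
proof -
  have "0 < (\<omega> m k)^2" using \<omega>_ge[of m k] assms by simp
  then have "0 < Re (qth m th k)" using qth_bounds(1)[OF assms(2), of m k] by linarith
  then show ?thesis by (auto simp: complex_nonpos_Reals_iff)
qed

lemma \<omega>th_bounds: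
  assumes "0 < m" "th \<in> ball 0 (1/8)"
  shows "\<omega> m k / 2 <= Re (\<omega>th m th k)" "cmod (\<omega>th m th k) <= 2 * \<omega> m k" "\<omega>th m th k \<notin> \<real>\<^sub>\<le>\<^sub>0"
proof -
  note q = qth_bounds[OF assms(2), of m k]
  have o: "0 < \<omega> m k" using \<omega>_ge[of m k] assms by simp
  show 1: "\<omega> m k / 2 <= Re (\<omega>th m th k)"
  proof -
    have "(\<omega> m k / 2)^2 = (\<omega> m k)^2 / 4" by (simp add: power_divide)
    also have "... <= (cmod (qth m th k) + Re (qth m th k)) / 2"

    proof -
      have "a / 4 <= (c + b) / 2" if "a / 2 <= b" "0 <= c" for a b c :: real using that by (simp add: field_simps)
      from this[OF q(1) norm_ge_zero] show ?thesis .
    qed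
    finally have "(\<omega> m k / 2)^2 <= (cmod (qth m th k) + Re (qth m th k)) / 2" .
    then show ?thesis unfolding \<omega>th_def csqrt.sel by (rule real_le_rsqrt)
  qed
  have "cmod (\<omega>th m th k) <= sqrt ((2 * \<omega> m k)^2)"
    unfolding \<omega>th_def norm_csqrt by (intro real_sqrt_le_mono order_trans[OF q(2)]) (simp add: power_mult_distrib)
  then have "cmod (\<omega>th m th k) <= \<bar>2 * \<omega> m k\<bar>" unfolding real_sqrt_abs .
  then show "cmod (\<omega>th m th k) <= 2 * \<omega> m k" using o by simp
  show "\<omega>th m th k \<notin> \<real>\<^sub>\<le>\<^sub>0" using 1 o by (auto simp: complex_nonpos_Reals_iff)
qed

lemma \<omega>th_holomorphic:
  assumes "0 < m" shows "(\<lambda>th. \<omega>th m th k) holomorphic_on ball 0 (1/8)"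
  unfolding \<omega>th_def
proof (rule holomorphic_on_csqrt')
  show "(\<lambda>th. qth m th k) holomorphic_on ball 0 (1/8)" unfolding qth_def by (intro holomorphic_intros)
qed (rule qth_nonpos[OF assms])

lemma \<omega>th_continuous:
  assumes "0 < m" "th \<in> ball 0 (1/8)" shows "continuous_on UNIV (\<omega>th m th)"
  unfolding \<omega>th_def
proof (rule continuous_on_compose2[of "- \<real>\<^sub>\<le>\<^sub>0" csqrt UNIV "qth m th"])
  show "continuous_on (- \<real>\<^sub>\<le>\<^sub>0) csqrt" by (rule holomorphic_on_imp_continuous_on[OF holomorphic_on_csqrt])
  show "continuous_on UNIV (qth m th)" unfolding qth_def by (intro continuous_intros)
  show "qth m th ` UNIV \<subseteq> - \<real>\<^sub>\<le>\<^sub>0" using qth_nonpos[OF assms] by auto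
qed

lemma \<omega>th_measurable:
  assumes "0 < m" "th \<in> ball 0 (1/8)" shows "\<omega>th m th \<in> bmv"
  using borel_measurable_continuous_onI[OF \<omega>th_continuous[OF assms]] by (simp add: volume_momentum)

lemma qth_scale: "qth m th (exp be *\<^sub>R k) = qth m (th + cx be) k"
proof -
  have "cx ((norm (exp be *\<^sub>R k))^2) = exp (2 * cx be) * cx ((norm k)^2)"
    by (simp add: power_mult_distrib exp_double exp_of_real)
  then show ?thesis by (simp add: qth_def distrib_left exp_add)
qed

lemma \<omega>th_scale: "\<omega>th m th (exp be *\<^sub>R k) = \<omega>th m (th + cx be) k"
  by (simp add: \<omega>th_def qth_scale)

lemma \<omega>th_zero: "\<omega>th m 0 k = cx (\<omega> m k)"
  unfolding \<omega>th_def qth_def \<omega>_def by (subst of_real_sqrt) auto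

lemma \<omega>th_cnj:
  assumes "0 < m" "th \<in> ball 0 (1/8)" shows "cnj (\<omega>th m th k) = \<omega>th m (cnj th) k"
  unfolding \<omega>th_def by (subst cnj_csqrt[OF qth_nonpos[OF assms]]) (simp add: qth_def exp_cnj)

text \<open>The square of the dilated dispersion gives twice real part times imaginary part as
  \<open>exp (2 * Re th) * sin (2 * Im th) * (norm k)^2\<close>. Here \<open>(norm k)^2\<close>
  factors as \<open>(\<omega> m k - m) * (\<omega> m k + m)\<close>, and the real part is at most
  \<open>2 * \<omega> m k\<close>. Particles at rest gain nothing, which is why the thresholds in
  \<open>mN m\<close> matter.\<close>

lemma \<omega>th_Im:
  assumes m: "0 < m" and th: "th \<in> ball 0 (1/8)" and sig: "sig = 1 \<or> sig = - 1" and ep: "ep = - sig * Im th" "0 <= ep"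
  shows "ep / 16 * (\<omega> m k - m) <= - sig * Im (\<omega>th m th k)"
proof -
  have o: "0 < \<omega> m k" using \<omega>_ge[of m k] m by simp
  note b = \<omega>th_bounds[OF m th, of k]
  have ep1: "ep < 1/8" using abs_Im_le_cmod[of th] th ep sig by auto
  \<comment> \<open>The third-order remainder is at most \<open>(8/6) * ep / 64\<close> for
    \<open>ep < 1/8\<close>, far below the spare \<open>ep\<close> in \<open>2 * ep\<close>.\<close>
  have sin: "ep <= sin (2 * ep)"
  proof -
    have "\<bar>sin (2 * ep) - 2 * ep\<bar> <= (2 * ep) ^ 3 / 6"
      using Maclaurin_sin_bound[of "2 * ep" 3] ep by (simp add: eval_nat_numeral sin_coeff_def)
    also have "... = (8 / 6) * ep * ep^2" by (simp add: power2_eq_square power3_eq_cube)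
    also have "... <= (8 / 6) * ep * (1/8)^2" using ep ep1 by (intro mult_left_mono power_mono) auto
    finally show ?thesis using ep by (simp add: power2_eq_square)
  qed
  have "\<omega>th m th k * \<omega>th m th k = qth m th k" unfolding \<omega>th_def by (simp add: power2_eq_square[symmetric])
  then have "Im (qth m th k) = 2 * Re (\<omega>th m th k) * Im (\<omega>th m th k)" by (metis mult.assoc mult.commute mult_2 times_complex.sel(2))
  moreover have "Im (qth m th k) = exp (2 * Re th) * sin (2 * Im th) * (norm k)^2"
    unfolding qth_def plus_complex.simps Re_complex_of_real times_complex.simps Im_complex_of_real by (simp add: Im_exp)
  moreover have "- sig * sin (2 * Im th) = sin (2 * ep)" using ep(1) sig by auto
  ultimately have e: "2 * Re (\<omega>th m th k) * (- sig * Im (\<omega>th m th k)) = exp (2 * Re th) * sin (2 * ep) * (norm k)^2"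
    by (metis (no_types, lifting) mult.assoc mult.commute)
  have "1/2 * ep * (norm k)^2 <= exp (2 * Re th) * sin (2 * ep) * (norm k)^2"
    by (intro mult_right_mono mult_mono exp_small_bounds(3)[OF th] sin) (use ep in auto)
  then have 1: "1/2 * ep * (norm k)^2 <= 2 * Re (\<omega>th m th k) * (- sig * Im (\<omega>th m th k))" unfolding e .
  have R: "0 < Re (\<omega>th m th k)" using b(1) o by linarith
  then have nn: "0 <= - sig * Im (\<omega>th m th k)"
  proof -
    have "0 <= 1/2 * ep * (norm k)^2" using ep(2) by simp
    from order_trans[OF this 1] have "2 * Re (\<omega>th m th k) * 0 <= 2 * Re (\<omega>th m th k) * (- sig * Im (\<omega>th m th k))" by (simp only: mult_zero_right)
    then show ?thesis by (subst (asm) mult_le_cancel_left_pos) (use R in simp)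
  qed
  have "2 * Re (\<omega>th m th k) * (- sig * Im (\<omega>th m th k)) <= (4 * \<omega> m k) * (- sig * Im (\<omega>th m th k))"
    using b(2) complex_Re_le_cmod[of "\<omega>th m th k"] by (intro mult_right_mono nn) linarith
  with 1 have 2: "1/2 * ep * (norm k)^2 <= (4 * \<omega> m k) * (- sig * Im (\<omega>th m th k))" by linarith
  have "(norm k)^2 = (\<omega> m k - m) * (\<omega> m k + m)" using \<omega>_square[of m k] by (simp add: power2_eq_square algebra_simps)
  moreover have "(\<omega> m k - m) * \<omega> m k <= (\<omega> m k - m) * (\<omega> m k + m)"
    using \<omega>_ge[of m k] m by (intro mult_left_mono) auto
  ultimately have "1/2 * ep * ((\<omega> m k - m) * \<omega> m k) <= 1/2 * ep * (norm k)^2" using ep by (intro mult_left_mono) auto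
  with 2 have "\<omega> m k * (ep / 8 * (\<omega> m k - m)) <= \<omega> m k * (- sig * Im (\<omega>th m th k))"
    by (simp add: algebra_simps)
  then have "ep / 8 * (\<omega> m k - m) <= - sig * Im (\<omega>th m th k)" by (rule mult_left_le_imp_le) (rule o)
  moreover have "ep / 16 * (\<omega> m k - m) <= ep / 8 * (\<omega> m k - m)" using ep \<omega>_ge[of m k] m by (intro mult_right_mono) auto
  ultimately show ?thesis by linarith
qed

text \<open>The integral of the squared Gaussian factorises over coordinates into one-dimensional
  normal densities of variance \<open>La^2 / 2\<close>.\<close>

lemma gaussian_square_integrable:
  assumes La: "0 < La"
  shows "square_integrable (\<lambda>k :: momentum. cx (c * exp (- (norm k)\<^sup>2 / (2 * La^2))))"
proof -
  define s where "s = La / sqrt 2"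
  have s: "0 < s" "2 * s^2 = La^2" using La by (auto simp: s_def power_divide)
  have e: "2 * pi * s^2 = pi * La^2" by (simp flip: s(2))
  have "exp (- x\<^sup>2 / La^2) = sqrt (pi * La^2) * normal_density 0 s x" for x
    unfolding normal_density_def e s(2) using La by simp
  then have "integrable lborel (\<lambda>x. exp (- x\<^sup>2 / La^2))" using s(1) by simp
  then have 1: "(\<integral>\<^sup>+x. ennreal (exp (- x\<^sup>2 / La^2)) \<partial>lborel) < \<infinity>"
    by (simp add: nn_integral_eq_integral)
  have "(norm k)^2 = (\<Sum>b\<in>Basis. (k \<bullet> b)^2)" for k :: momentum
    unfolding power2_norm_eq_inner euclidean_inner[of k k] by (simp add: power2_eq_square)
  then have "ennreal (exp (- (norm k)\<^sup>2 / La^2)) = (\<Prod>b\<in>Basis. ennreal (exp (- (k \<bullet> b)\<^sup>2 / La^2)))" for k :: momentum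
    by (simp add: prod_ennreal exp_sum[symmetric] sum_divide_distrib[symmetric] sum_negf)
  then have "(\<integral>\<^sup>+k. ennreal (exp (- (norm k)\<^sup>2 / La^2)) \<partial>(volume :: momentum measure))
    = (\<Prod>b\<in>(Basis :: momentum set). \<integral>\<^sup>+x. ennreal (exp (- x\<^sup>2 / La^2)) \<partial>lborel)"
    unfolding volume_momentum by (subst nn_integral_lborel_prod[symmetric]) auto
  also have "... < \<infinity>" using 1 by (simp add: power_less_top_ennreal)
  finally have fin: "(\<integral>\<^sup>+k. ennreal (exp (- (norm k)\<^sup>2 / La^2)) \<partial>(volume :: momentum measure)) < \<infinity>" .
  have [measurable]: "(\<lambda>k :: momentum. exp (- (norm k)\<^sup>2 / La^2)) \<in> bmv"
    "(\<lambda>k :: momentum. exp (- (norm k)\<^sup>2 / (2 * La^2))) \<in> bmv" by measurable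
  have "(cmod (cx (c * exp (- (norm k)\<^sup>2 / (2 * La^2)))))^2 = c^2 * exp (- (norm k)\<^sup>2 / La^2)" for k :: momentum
    unfolding norm_of_real by (simp add: power_mult_distrib exp_double[symmetric] abs_mult)
  then have "(\<integral>\<^sup>+k. ennreal ((cmod (cx (c * exp (- (norm k)\<^sup>2 / (2 * La^2)))))^2) \<partial>(volume :: momentum measure))
    = ennreal (c^2) * (\<integral>\<^sup>+k. ennreal (exp (- (norm k)\<^sup>2 / La^2)) \<partial>(volume :: momentum measure))"
    by (simp add: ennreal_mult nn_integral_cmult)
  also have "... < \<infinity>" using fin by (simp add: ennreal_mult_less_top)
  finally show ?thesis unfolding square_integrable_iff_nn_integral by simp
qed

text \<open>One majorant of \<open>fth\<close> for all \<open>th\<close> in the ball of radius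
  \<open>1/8\<close>: \<open>2\<close> bounds the unitary factor, \<open>m / 2\<close> bounds the
  dilated dispersion from below, and the halved exponent comes from
  \<open>Re (exp (2 * th)) >= 1/2\<close>.\<close>

definition gauss :: "real => real => momentum => real" where
  "gauss m La k = 2 / sqrt (m / 2) * exp (- (norm k)\<^sup>2 / (2 * La^2))"

lemma gauss_pos: "0 < m ==> 0 < gauss m La k"
  by (simp add: gauss_def)

lemma fth_bound:
  assumes m: "0 < m" and th: "th \<in> ball 0 (1/8)"
  shows "cmod (fth m La th k) <= gauss m La k"
proof -
  note e = exp_small_bounds[OF th]
  have "m / 2 <= cmod (\<omega>th m th k)"
    using \<omega>th_bounds(1)[OF m th, of k] \<omega>_ge[of m k] m complex_Re_le_cmod[of "\<omega>th m th k"] by linarith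
  then have s: "sqrt (m / 2) <= cmod (csqrt (\<omega>th m th k))" by simp
  have s0: "0 < sqrt (m / 2)" using m by simp
  have "cmod (exp (- (exp (2 * th) * cx ((norm k)^2 / La^2)))) = exp (- (Re (exp (2 * th)) * ((norm k)^2 / La^2)))"
    unfolding norm_exp_eq_Re uminus_complex.sel times_complex.sel Re_complex_of_real Im_complex_of_real by simp
  also have "... <= exp (- (norm k)\<^sup>2 / (2 * La^2))"
    using mult_right_mono[OF e(1), of "(norm k)^2 / La^2"] by simp
  finally have g: "cmod (exp (- (exp (2 * th) * cx ((norm k)^2 / La^2)))) <= exp (- (norm k)\<^sup>2 / (2 * La^2))" .
  have "cmod (fth m La th k) <= 2 * exp (- (norm k)\<^sup>2 / (2 * La^2)) / sqrt (m / 2)"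
    unfolding fth_def norm_divide norm_mult
    by (intro frac_le mult_mono mult_nonneg_nonneg e(4) g s s0) auto
  then show ?thesis by (simp add: gauss_def)
qed

lemma csqrt_\<omega>th_nonzero:
  assumes "0 < m" "th \<in> ball 0 (1/8)" shows "csqrt (\<omega>th m th k) ~= 0"
  using \<omega>th_bounds(3)[OF assms, of k] by auto

lemma fth_holomorphic:
  assumes "0 < m" shows "(\<lambda>th. fth m La th k) holomorphic_on ball 0 (1/8)"
  unfolding fth_def
  by (intro holomorphic_on_divide holomorphic_on_csqrt' \<omega>th_holomorphic[OF assms] \<omega>th_bounds(3)[OF assms] csqrt_\<omega>th_nonzero[OF assms])
     (auto intro!: holomorphic_intros)

lemma fth_measurable:
  assumes m: "0 < m" and La: "0 < La" and th: "th \<in> ball 0 (1/8)" shows "fth m La th \<in> bmv"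
proof -
  have "continuous_on UNIV (\<lambda>k. csqrt (\<omega>th m th k))"
    by (rule continuous_on_compose2[OF holomorphic_on_imp_continuous_on[OF holomorphic_on_csqrt] \<omega>th_continuous[OF m th]])
       (use \<omega>th_bounds(3)[OF m th] in auto)
  then have "continuous_on UNIV (fth m La th)"
    unfolding fth_def using csqrt_\<omega>th_nonzero[OF m th] La by (intro continuous_intros) auto
  then show ?thesis using borel_measurable_continuous_onI by (simp add: volume_momentum)
qed

lemma square_integrable_fth:
  assumes m: "0 < m" and La: "0 < La" and [measurable]: "u \<in> bmv" and u: "!!k. cmod (u k) <= C * gauss m La k"
  shows "square_integrable u" "norm (L2_of u) <= C * norm (L2_of (\<lambda>k. cx (gauss m La k)))"
proof -
  have sg: "square_integrable (\<lambda>k. cx (gauss m La k))"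
    unfolding gauss_def by (rule gaussian_square_integrable[OF La])
  have C: "0 <= C" using order_trans[OF norm_ge_zero u, of 0] gauss_pos[OF m, of La 0] by (simp add: zero_le_mult_iff)
  have "integrable volume (\<lambda>k. C^2 * (cmod (cx (gauss m La k)))^2)"
    using sg by (simp add: square_integrable_def)
  then have "integrable volume (\<lambda>k. (cmod (u k))^2)"
  proof (rule Bochner_Integration.integrable_bound)
    show "AE k in volume. norm ((cmod (u k))^2) <= norm (C^2 * (cmod (cx (gauss m La k)))^2)"
    proof (rule AE_I2)
      fix k
      have "(cmod (u k))^2 <= (C * gauss m La k)^2" by (rule power_mono[OF u]) simp
      then show "norm ((cmod (u k))^2) <= norm (C^2 * (cmod (cx (gauss m La k)))^2)"
        by (simp add: power_mult_distrib)
    qed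
  qed measurable
  then show su: "square_integrable u" by (simp add: square_integrable_def)
  show "norm (L2_of u) <= C * norm (L2_of (\<lambda>k. cx (gauss m La k)))"
  proof (rule L2_norm_le[OF _ C])
    show "AE k in volume. cmod (fun_of (L2_of u) k) <= C * cmod (fun_of (L2_of (\<lambda>k. cx (gauss m La k))) k)"
      using fun_of_L2_of[OF su] fun_of_L2_of[OF sg]
    proof eventually_elim
      case (elim k)
      then show ?case using u[of k] gauss_pos[OF m, of La k] by simp
    qed
  qed
qed

definition Fth :: "real => real => complex => momentum L2" where
  "Fth m La th = L2_of (fth m La th)"

definition Fth' :: "real => real => complex => momentum L2" where
  "Fth' m La th = L2_of (\<lambda>k. deriv (\<lambda>th. fth m La th k) th)"

definition gauss_norm :: "real => real => real" where
  "gauss_norm m La = 1024 * norm (L2_of (\<lambda>k. cx (gauss m La k)))"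

text \<open>The pointwise Taylor estimates hold with the same majorant \<open>gauss\<close> for
  every \<open>k\<close>, so they pass to norms: the dilated form factor is analytic as a map into
  the one-particle space.\<close>

lemma Fth_estimates:
  assumes m: "0 < m" and La: "0 < La" and th: "th \<in> ball 0 (1/16)" "th' \<in> ball 0 (1/16)"
  shows "norm (Fth m La th) <= gauss_norm m La" "norm (Fth' m La th) <= gauss_norm m La"
    "norm (Fth m La th' - Fth m La th) <= gauss_norm m La * cmod (th' - th)"
    "norm (Fth m La th' - Fth m La th - (th' - th) *\<^sub>C Fth' m La th) <= gauss_norm m La * (cmod (th' - th))^2"
proof -
  have th8: "th \<in> ball 0 (1/8)" "th' \<in> ball 0 (1/8)" using th by auto
  note bnd = holomorphic_taylor_bounds[OF fth_holomorphic[OF m, of La] gauss_pos[OF m] fth_bound[OF m] th]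
  have dm [measurable]: "(\<lambda>k. deriv (\<lambda>th. fth m La th k) th) \<in> bmv"
    by (rule deriv_measurable[OF fth_measurable[OF m La] fth_holomorphic[OF m] th(1)])
  have fm [measurable]: "fth m La th \<in> bmv" "fth m La th' \<in> bmv"
    using fth_measurable[OF m La] th8 by auto
  note S = square_integrable_fth[OF m La]
  have b1: "cmod (fth m La th k) <= 1024 * gauss m La k" for k
    using fth_bound[OF m th8(1), of La k] gauss_pos[OF m, of La k] by simp
  have b1': "cmod (fth m La th' k) <= 1024 * gauss m La k" for k
    using fth_bound[OF m th8(2), of La k] gauss_pos[OF m, of La k] by simp
  show "norm (Fth m La th) <= gauss_norm m La" unfolding Fth_def gauss_norm_def by (rule S(2)[OF fm(1) b1])
  show "norm (Fth' m La th) <= gauss_norm m La" unfolding Fth'_def gauss_norm_def by (rule S(2)[OF dm bnd(1)])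
  have s1: "square_integrable (fth m La th)" by (rule S(1)[OF fm(1) b1])
  have s2: "square_integrable (fth m La th')" by (rule S(1)[OF fm(2) b1'])
  have s3: "square_integrable (\<lambda>k. deriv (\<lambda>th. fth m La th k) th)" by (rule S(1)[OF dm bnd(1)])
  have sub: "L2_of a - L2_of b = L2_of (\<lambda>k. a k - b k)" if "square_integrable a" "square_integrable b" for a b :: "momentum => complex"
  proof -
    have m: "- L2_of b = L2_of (\<lambda>x. - b x)" using scaleC_L2_of[OF that(2), of "-1"] by simp
    have "L2_of a - L2_of b = L2_of a + - L2_of b" by simp
    also have "... = L2_of (\<lambda>x. a x + - b x)" unfolding m
      by (rule plus_L2_of[OF that(1)]) (use square_integrable_scale[OF that(2), of "-1"] in simp)
    finally show ?thesis by simp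
  qed
  have sqd: "square_integrable (\<lambda>k. a k - b k)" if "square_integrable a" "square_integrable b" for a b :: "momentum => complex"
    using square_integrable_add[OF that(1) square_integrable_scale[OF that(2), of "-1"]] by simp
  have e1: "Fth m La th' - Fth m La th = L2_of (\<lambda>k. fth m La th' k - fth m La th k)"
    unfolding Fth_def by (rule sub[OF s2 s1])
  have "norm (Fth m La th' - Fth m La th) <= (1024 * cmod (th' - th)) * norm (L2_of (\<lambda>k. cx (gauss m La k)))"
    unfolding e1 by (rule S(2)) (use bnd(2) in "auto simp: mult_ac")
  then show "norm (Fth m La th' - Fth m La th) <= gauss_norm m La * cmod (th' - th)" by (simp add: gauss_norm_def mult_ac)
  have e2: "Fth m La th' - Fth m La th - (th' - th) *\<^sub>C Fth' m La th
    = L2_of (\<lambda>k. fth m La th' k - fth m La th k - (th' - th) * deriv (\<lambda>th. fth m La th k) th)"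
    unfolding e1 Fth'_def scaleC_L2_of[OF s3] by (rule sub[OF sqd[OF s2 s1] square_integrable_scale[OF s3]])
  have "norm (Fth m La th' - Fth m La th - (th' - th) *\<^sub>C Fth' m La th) <= (1024 * (cmod (th' - th))^2) * norm (L2_of (\<lambda>k. cx (gauss m La k)))"
    unfolding e2 by (rule S(2)) (use bnd(3) in "auto simp: mult_ac")
  then show "norm (Fth m La th' - Fth m La th - (th' - th) *\<^sub>C Fth' m La th) <= gauss_norm m La * (cmod (th' - th))^2"
    by (simp add: gauss_norm_def mult_ac)
qed

text \<open>A real dilation only translates the parameter: the Gaussian and the dispersion depend on
  \<open>exp (2 * th)\<close> times the squared momentum, and the unitary weight completes the
  prefactor.\<close>

lemma Fth_dilation:
  assumes m: "0 < m" and La: "0 < La" and th: "th \<in> ball 0 (1/16)" "th + cx be \<in> ball 0 (1/16)"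
  shows "dilation be (Fth m La th) = Fth m La (th + cx be)"
proof (rule L2_eqI)
  have sq: "square_integrable (fth m La th)" if "th \<in> ball 0 (1/16)" for th
  proof (rule square_integrable_fth(1)[OF m La, where C = 1])
    have th8: "th \<in> ball 0 (1/8)" using that by simp
    show "fth m La th \<in> bmv" by (rule fth_measurable[OF m La th8])
    show "cmod (fth m La th k) <= 1 * gauss m La k" for k using fth_bound[OF m th8] by simp
  qed
  have sc: "dil_weight be k * fth m La th (exp be *\<^sub>R k) = fth m La (th + cx be) k" for k
  proof -
    have "exp (2 * th) * cx ((norm (exp be *\<^sub>R k))^2 / La^2) = exp (2 * (th + cx be)) * cx ((norm k)^2 / La^2)"
      by (simp add: power_mult_distrib distrib_left exp_add exp_double exp_of_real)
    moreover have "cx (exp (3 * be / 2)) * exp (3 * th / 2) = exp (3 * (th + cx be) / 2)"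
      by (simp add: exp_of_real[symmetric] exp_add[symmetric] add_divide_distrib distrib_left add.commute)
    ultimately show ?thesis unfolding fth_def dil_weight_def \<omega>th_scale by (simp flip: mult.assoc times_divide_eq_right)
  qed
  show "AE k in volume. fun_of (dilation be (Fth m La th)) k = fun_of (Fth m La (th + cx be)) k"
    unfolding dilation_eq
    using fun_of_wcomp[OF isometric_dil_weight, of be "Fth m La th"] AE_scale_momentum[OF exp_gt_zero[of be] fun_of_L2_of[OF sq[OF th(1)]]]
      fun_of_L2_of[OF sq[OF th(2)]]
    by eventually_elim (simp add: Fth_def sc)
qed

lemma form_factor_eq:
  assumes "0 < m" shows "form_factor m La = Fth m La 0"
proof -
  have "fth m La 0 k = cx (exp (- (norm k)\<^sup>2 / La^2) * \<omega> m k powr (- 1 / 2))" for k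
  proof -
    have o: "0 < \<omega> m k" using \<omega>_ge[of m k] assms by simp
    have "csqrt (\<omega>th m 0 k) = cx (sqrt (\<omega> m k))" unfolding \<omega>th_zero using o of_real_sqrt[of "\<omega> m k"] by simp
    moreover have "\<omega> m k powr (- 1 / 2) = 1 / sqrt (\<omega> m k)"
    proof -
      have "\<omega> m k powr (- (1 / 2)) = inverse (\<omega> m k powr (1 / 2))" by (rule powr_minus)
      also have "\<omega> m k powr (1 / 2) = sqrt (\<omega> m k)" using o by (intro powr_half_sqrt) simp
      finally show ?thesis by (simp add: inverse_eq_divide)
    qed
    moreover have "exp (- cx ((norm k)^2 / La^2)) = cx (exp (- (norm k)\<^sup>2 / La^2))"
      by (simp flip: exp_of_real)
    ultimately show ?thesis by (simp add: fth_def)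
  qed
  then have "fth m La 0 = (\<lambda>k. cx (exp (- (norm k)\<^sup>2 / La^2) * \<omega> m k powr (- 1 / 2)))" by (rule ext)
  then show ?thesis unfolding form_factor_def Fth_def by simp
qed

section \<open>Multipliers on states\<close>

definition mulS :: "(2 => momentum multiset => complex) => state => state" where
  "mulS w x = (\<chi> i. mulop (w i) (x $ i))"

lemma norm_vec_square: "(norm (x :: 'a::complex_inner ^ 'n))^2 = (\<Sum>i\<in>UNIV. (norm (x $ i))^2)"
  by (simp add: norm_vec_def L2_set_def sum_nonneg)

lemma norm_vec_le:
  fixes x y :: "'a::complex_inner ^ 'n"
  assumes "!!i. norm (x $ i) <= K * norm (y $ p i)" "bij p" "0 <= K"
  shows "norm x <= K * norm y"
proof (rule power2_le_imp_le)
  have "(norm x)^2 <= (\<Sum>i\<in>UNIV. K^2 * (norm (y $ p i))^2)"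
    unfolding norm_vec_square by (intro sum_mono) (use power_mono[OF assms(1)] in "simp add: power_mult_distrib")
  also have "... = K^2 * (\<Sum>i\<in>UNIV. (norm (y $ i))^2)"
    unfolding sum_distrib_left[symmetric] by (subst sum.reindex_bij_betw[OF assms(2)]) simp
  finally show "(norm x)^2 <= (K * norm y)^2" by (simp add: norm_vec_square power_mult_distrib)
qed (use assms in auto)

definition bm :: "(2 => momentum multiset => complex) => bool" where
  "bm w \<longleftrightarrow> (\<forall>i. bmult (w i))"

lemma bmD: "bm w ==> bmult (w i)" by (simp add: bm_def)

lemma bmI:
  "(!!i. w i \<in> bmv) ==> (!!i X. cmod (w i X) <= K) ==> bm w"
  unfolding bm_def by (auto intro: bmultI)

lemma bm_mult: "bm w ==> bm v ==> bm (\<lambda>i X. w i X * v i X)"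
  unfolding bm_def
proof (intro allI)
  fix i assume a: "\<forall>i. bmult (w i)" "\<forall>i. bmult (v i)"
  then obtain K L where b: "!!X. cmod (w i X) <= K" "!!X. cmod (v i X) <= L"
    and [measurable]: "w i \<in> bmv" "v i \<in> bmv"
    unfolding bmult_def by metis
  have "0 <= K" using order_trans[OF norm_ge_zero b(1)] .
  then show "bmult (\<lambda>X. w i X * v i X)"
    by (intro bmultI[where K = "K * L"]) (auto simp: norm_mult intro!: mult_mono b)
qed

lemma bm_add: "bm w ==> bm v ==> bm (\<lambda>i X. w i X + v i X)"
  unfolding bm_def
proof (intro allI)
  fix i assume a: "\<forall>i. bmult (w i)" "\<forall>i. bmult (v i)"
  then obtain K L where b: "!!X. cmod (w i X) <= K" "!!X. cmod (v i X) <= L"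
    and [measurable]: "w i \<in> bmv" "v i \<in> bmv"
    unfolding bmult_def by metis
  then show "bmult (\<lambda>X. w i X + v i X)"
    by (intro bmultI[where K = "K + L"]) (auto intro!: order_trans[OF norm_triangle_ineq] add_mono b)
qed

lemma bm_const: "bm (\<lambda>i X. c)"
  by (rule bmI) auto

lemma bounded_clinear_vecI:
  assumes "!!i. bounded_clinear (F i)" "!!i x. norm (F i x) <= K * norm (x :: momentum fock)" "bij p" "0 <= K"
  shows "bounded_clinear (\<lambda>x :: state. (\<chi> i. F i (x $ p i)))" "norm (\<chi> i. F i (x $ p i)) <= K * norm (x :: state)"
proof -
  note L = bounded_clinearD[OF assms(1)]
  show b: "norm (\<chi> i. F i (x $ p i)) <= K * norm x" for x :: state
    by (rule norm_vec_le[where p = p]) (use assms in auto)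
  show "bounded_clinear (\<lambda>x :: state. (\<chi> i. F i (x $ p i)))"
    by (rule bounded_clinearI[OF _ _ b]) (simp_all add: vec_eq_iff L scaleC_vec_def)
qed

lemma mulS_norm_le:
  assumes "bm w" "!!i X. cmod (w i X) <= K" shows "norm (mulS w x) <= K * norm x"
  unfolding mulS_def
proof (rule norm_vec_le[where p = "\<lambda>i. i"])
  show "norm ((\<chi> i. mulop (w i) (x $ i)) $ i) <= K * norm (x $ i)" for i
    using assms by (simp add: bm_def bmult_def mulop_norm_le)
  show "0 <= K" using order_trans[OF norm_ge_zero assms(2)] .
qed (rule bij_id[unfolded id_def])

lemma bounded_clinear_mulS: assumes "bm w" shows "bounded_clinear (mulS w)"
proof -
  note L = bounded_clinearD[OF bounded_clinear_mulop[OF bmD[OF assms]]]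
  have "\<exists>K. \<forall>X. cmod (w i X) <= K" for i using assms by (auto simp: bm_def bmult_def)
  then obtain K where K: "!!i X. cmod (w i X) <= K i" by metis
  have K0: "0 <= K i" for i using order_trans[OF norm_ge_zero K] .
  have "cmod (w i X) <= sum K UNIV" for i X
    using K[of i X] member_le_sum[of i UNIV K] K0 by (auto intro: order_trans)
  then have b: "norm (mulS w x) <= sum K UNIV * norm x" for x by (rule mulS_norm_le[OF assms])
  show ?thesis
    by (rule bounded_clinearI[OF _ _ b]) (simp_all add: mulS_def vec_eq_iff L scaleC_vec_def)
qed

lemma mulS_mulS: "bm w ==> bm v ==> mulS w (mulS v x) = mulS (\<lambda>i X. w i X * v i X) x"
  by (simp add: mulS_def vec_eq_iff mulop_mulop bmD)

lemma mulop_add_multiplier: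
  assumes "bmult w" "bmult v" "bmult (\<lambda>X. w X + v X)"
  shows "mulop (\<lambda>X. w X + v X) ps = mulop w ps + mulop v ps"
  using fun_of_mulop[OF assms(1), of ps] fun_of_mulop[OF assms(2), of ps] fun_of_mulop[OF assms(3), of ps] fun_of_add[of "mulop w ps" "mulop v ps"]
  by (intro L2_eqI, eventually_elim) (simp add: distrib_right)

lemma mulop_const: "mulop (\<lambda>X. c) ps = c *\<^sub>C ps"
  unfolding mulop_def by (simp add: scaleC_L2_of[OF square_integrable_fun_of, symmetric] L2_of_fun_of)

lemma mulS_add: "bm w ==> bm v ==> mulS (\<lambda>i X. w i X + v i X) x = mulS w x + mulS v x"
  using bmD[OF bm_add[of w v]] by (simp add: mulS_def vec_eq_iff mulop_add_multiplier bmD)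

lemma mulS_const: "mulS (\<lambda>i X. c) x = c *\<^sub>C x"
  by (simp add: mulS_def vec_eq_iff mulop_const scaleC_vec_def)

lemma mulS_scale: "bm w ==> mulS (\<lambda>i X. c * w i X) x = c *\<^sub>C mulS w x"
  using mulS_mulS[OF bm_const, of w c x] by (simp add: mulS_const)

lemma mulS_diff: "bm w ==> bm v ==> mulS (\<lambda>i X. w i X - v i X) x = mulS w x - mulS v x"
  using mulS_add[of w "\<lambda>i X. (-1) * v i X" x] bm_mult[OF bm_const[of "-1"], of v] mulS_scale[of v "-1" x] by simp

lemma cinner_mulS_left: "bm w ==> cinner (mulS w x) y = cinner x (mulS (\<lambda>i X. cnj (w i X)) y)"
  by (simp add: cinner_vec_def mulS_def cinner_mulop_left bmD)

text \<open>Pointwise lower bounds for the imaginary part of a symbol become operator bounds; two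
  squares are carried because the gain near the shell and the spectral parameter enter
  separately.\<close>

lemma Im_cinner_mulop_ge:
  assumes u: "bmult u" and a: "bmult a" and b: "bmult b"
    and le: "!!X. c * (cmod (a X))^2 + d * (cmod (b X))^2 <= Im (u X)"
  shows "c * (norm (mulop a ps))^2 + d * (norm (mulop b ps))^2 <= Im (cinner ps (mulop u ps))"
proof -
  have [measurable]: "u \<in> bmv" "a \<in> bmv" "b \<in> bmv"
    using assms by (auto simp: bmult_def)
  have sq: "integrable volume (\<lambda>X. (cmod (w X))^2 * (cmod (fun_of ps X))^2)" if w: "bmult w" for w
    using square_integrable_mult[OF w square_integrable_fun_of[of ps]]
    by (simp add: square_integrable_def norm_mult power_mult_distrib)
  have nrm: "(norm (mulop w ps))^2 = (LINT X|volume. (cmod (w X))^2 * (cmod (fun_of ps X))^2)"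
    if w: "bmult w" for w
  proof -
    have [measurable]: "w \<in> bmv" using w by (auto simp: bmult_def)
    show ?thesis unfolding norm_fun_of
    proof (rule integral_cong_AE)
      show "AE X in volume. (cmod (fun_of (mulop w ps) X))^2 = (cmod (w X))^2 * (cmod (fun_of ps X))^2"
        using fun_of_mulop[OF w, of ps] by eventually_elim (simp add: norm_mult power_mult_distrib)
    qed measurable
  qed
  have iu: "integrable volume (\<lambda>X. u X * (cnj (fun_of ps X) * fun_of ps X))"
    using square_integrable_inner[OF square_integrable_fun_of[of ps] square_integrable_mult[OF u square_integrable_fun_of[of ps]]]
    by (simp add: mult_ac)
  have "c * (norm (mulop a ps))^2 + d * (norm (mulop b ps))^2
    = (LINT X|volume. c * ((cmod (a X))^2 * (cmod (fun_of ps X))^2) + d * ((cmod (b X))^2 * (cmod (fun_of ps X))^2))"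
    unfolding nrm[OF a] nrm[OF b] using sq[OF a] sq[OF b] by simp
  also have "... <= (LINT X|volume. Im (u X * (cnj (fun_of ps X) * fun_of ps X)))"
  proof (rule integral_mono)
    show "integrable volume (\<lambda>X. c * ((cmod (a X))^2 * (cmod (fun_of ps X))^2) + d * ((cmod (b X))^2 * (cmod (fun_of ps X))^2))"
      using sq[OF a] sq[OF b] by simp
    show "integrable volume (\<lambda>X. Im (u X * (cnj (fun_of ps X) * fun_of ps X)))" by (rule integrable_Im[OF iu])
    fix X
    have "cnj (fun_of ps X) * fun_of ps X = cx ((cmod (fun_of ps X))^2)"
      by (metis complex_norm_square mult.commute)
    then have "Im (u X * (cnj (fun_of ps X) * fun_of ps X)) = Im (u X) * (cmod (fun_of ps X))^2"
      by (simp only: times_complex.sel Re_complex_of_real Im_complex_of_real mult_zero_right add_0)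
    then show "c * ((cmod (a X))^2 * (cmod (fun_of ps X))^2) + d * ((cmod (b X))^2 * (cmod (fun_of ps X))^2)
      <= Im (u X * (cnj (fun_of ps X) * fun_of ps X))"
      using mult_right_mono[OF le[of X], of "(cmod (fun_of ps X))^2"] by (simp only: distrib_right mult.assoc) simp
  qed
  also have "... = Im (cinner ps (mulop u ps))" unfolding cinner_mulop[OF u] by (rule integral_Im[OF iu])
  finally show ?thesis .
qed

lemma Im_cinner_mulS_ge:
  assumes "bm u" "bm a" "bm b" and le: "!!i X. c * (cmod (a i X))^2 + d * (cmod (b i X))^2 <= Im (u i X)"
  shows "c * (norm (mulS a x))^2 + d * (norm (mulS b x))^2 <= Im (cinner x (mulS u x))"
proof -
  have "c * (norm (mulS a x))^2 + d * (norm (mulS b x))^2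
    = (\<Sum>i\<in>UNIV. c * (norm (mulop (a i) (x $ i)))^2 + d * (norm (mulop (b i) (x $ i)))^2)"
    by (simp add: norm_vec_square mulS_def sum.distrib sum_distrib_left)
  also have "... <= (\<Sum>i\<in>UNIV. Im (cinner (x $ i) (mulop (u i) (x $ i))))"
    by (intro sum_mono Im_cinner_mulop_ge bmD assms le)
  also have "... = Im (cinner x (mulS u x))" by (simp add: cinner_vec_def mulS_def)
  finally show ?thesis .
qed

lemma norm_mulS_le_mulS:
  assumes "bm a" "bm b" "!!i X. cmod (a i X) <= K * cmod (b i X)" "0 <= K"
  shows "norm (mulS a x) <= K * norm (mulS b x)"
proof (rule norm_vec_le[where p = "\<lambda>i. i"])
  fix i
  show "norm (mulS a x $ i) <= K * norm (mulS b x $ i)" unfolding mulS_def vec_lambda_beta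
  proof (rule L2_norm_le[OF _ assms(4)])
    show "AE X in volume. cmod (fun_of (mulop (a i) (x $ i)) X) <= K * cmod (fun_of (mulop (b i) (x $ i)) X)"
      using fun_of_mulop[OF bmD[OF assms(1), of i], of "x $ i"] fun_of_mulop[OF bmD[OF assms(2), of i], of "x $ i"]
      by eventually_elim (use assms(3) in "simp add: norm_mult mult.assoc[symmetric] mult_right_mono")
  qed
qed (use assms in "auto intro: bij_id[unfolded id_def]")

lemma state_dilation_mulS:
  assumes "bm w" "bm v" "!!i X. w i (scl t X) = v i X"
  shows "state_dilation t (mulS w x) = mulS v (state_dilation t x)"
  using assms by (simp add: state_dilation_def mulS_def vec_eq_iff fock_dilation_mulop bmD)

definition flip :: "2 => 2" where "flip i = (if i = 1 then 2 else 1)"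

lemma flip_flip [simp]: "flip (flip i) = i"
  using exhaust_2[of i] by (auto simp: flip_def)

lemma bij_flip: "bij flip"
  by (metis bijI' flip_flip)

section \<open>The dilated spin-boson operators\<close>

locale spin_boson =
  fixes m La e1 :: real
  assumes m: "0 < m" and La: "0 < La" and e1: "m < e1" "e1 \<notin> mN m"
begin

definition en :: "2 => real" where "en i = (if i = 1 then e1 else 0)"

definition Hs :: "momentum multiset => real" where "Hs X = (\<Sum>k\<in>#X. \<omega> m k)"

definition L :: "2 => momentum multiset => real" where "L i X = 1 + en i + Hs X"

definition excl :: "2 => momentum multiset => bool" where "excl i X \<longleftrightarrow> i = 1 & X = {#}"

text \<open>The pair \<open>excl\<close> is the state \<open>\<phi>\<^sub>1 \<otimes> \<Omega>\<close> removed by the compression; there the compressed free energy is \<open>0\<close>.\<close>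

abbreviation Lc :: "2 => momentum multiset => complex" where "Lc i X \<equiv> cx (L i X)"

abbreviation "invL \<equiv> (\<lambda>i X. 1 / Lc i X)"

abbreviation "h0m \<equiv> (\<lambda>i X. cx (en i + Hs X) / Lc i X)"

definition ht :: "complex => 2 => momentum multiset => complex" where
  "ht th i X = (if excl i X then 0 else cx (en i) + (\<Sum>k\<in>#X. \<omega>th m th k))"

definition ht' :: "complex => 2 => momentum multiset => complex" where
  "ht' th i X = (\<Sum>k\<in>#X. deriv (\<lambda>th. \<omega>th m th k) th)"

definition pb :: "2 => momentum multiset => complex" where
  "pb i X = (if excl i X then 0 else 1)"

text \<open>Chosen so that \<open>inv_root * \<rho> = 1 / L\<close>: on vectors \<open>R0 y\<close>
  the field becomes its bounded version after multiplication by \<open>\<rho>\<close>.\<close>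

definition \<rho> :: "2 => momentum multiset => complex" where
  "\<rho> i X = cx (sqrt (real (size X) + 1) / L i X)"

abbreviation "hm th ze \<equiv> (\<lambda>i X. (ht th i X - ze) / Lc i X)"

abbreviation "pbrho \<equiv> (\<lambda>i X. pb i X * \<rho> i X)"

definition R0 :: "state => state" where "R0 = mulS invL"

definition spin_field :: "momentum L2 => momentum L2 => state => state" where
  "spin_field h h' y = mulS pb (\<chi> i. field_op h h' (mulS pbrho y $ flip i))"

text \<open>The annihilation part carries the conjugate parameter because it is antilinear in its
  test function; in this way \<open>B\<close> is analytic in \<open>th\<close>.\<close>

definition B :: "complex => state => state" where
  "B th = spin_field (Fth m La (cnj th)) (Fth m La th)"

definition B' :: "complex => state => state" where
  "B' th = spin_field (Fth' m La (cnj th)) (Fth' m La th)"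

text \<open>With \<open>R0 = (1 + H\<^sub>0)\<^sup>-\<^sup>1\<close>, the domain of \<open>H\<^sub>0\<close> is the range of \<open>R0\<close>, and the bounded operator \<open>Q g 0 ze\<close> is
  the compressed Hamiltonian minus \<open>ze\<close>, composed with \<open>R0\<close>.\<close>

definition Q :: "real => complex => complex => state => state" where
  "Q g th ze y = mulS (hm th ze) y + cx g *\<^sub>C B th y"

definition Q' :: "real => complex => state => state" where
  "Q' g th y = mulS (\<lambda>i X. ht' th i X / Lc i X) y + cx g *\<^sub>C B' th y"

lemma en_nonneg: "0 <= en i" using e1 m by (simp add: en_def)

lemma Hs_ge: "m * real (size X) <= Hs X"
  unfolding Hs_def using m \<omega>_ge[of m] by (induction X) (auto simp: algebra_simps add_mono)

lemma Hs_nonneg: "0 <= Hs X"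
  using order_trans[OF _ Hs_ge[of X]] m by simp

lemma L_ge: "1 <= L i X" "Hs X <= L i X"
  using en_nonneg[of i] Hs_nonneg[of X] by (auto simp: L_def)

lemma L_pos: "0 < L i X" using L_ge(1)[of i X] by linarith

lemma Hs_measurable [measurable]: "Hs \<in> bmv"
  unfolding Hs_def[abs_def] by measurable

lemma L_measurable [measurable]: "L i \<in> bmv"
  unfolding L_def[abs_def] by measurable

lemma excl_measurable [measurable]: "Measurable.pred volume (excl i)"
proof -
  have "excl i = (\<lambda>X. i = 1 & size X = 0)" by (auto simp: excl_def fun_eq_iff)
  moreover have "Measurable.pred volume (\<lambda>X :: momentum multiset. i = 1 & size X = 0)" by measurable
  ultimately show ?thesis by (simp only:)
qed

lemma pb_measurable [measurable]: "pb i \<in> bmv"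
  unfolding pb_def[abs_def] by measurable

lemma pb_simps: "cmod (pb i X) <= 1" "pb i X * pb i X = pb i X" "cnj (pb i X) = pb i X"
  by (auto simp: pb_def)

lemma bm_pb: "bm pb" by (rule bmI[of _ 1]) (auto simp: pb_simps)

lemma bm_R0: "bm invL"
  by (rule bmI[of _ 1]) (use L_ge(1) L_pos in "auto simp: norm_divide abs_of_pos")

text \<open>The positive mass enters here: the particle number is at most the field energy divided
  by \<open>m\<close>.\<close>

lemma \<rho>_bound: "cmod (\<rho> i X) <= 1 + 1 / m"
proof -
  have "sqrt (real (size X) + 1) <= real (size X) + 1"
    by (rule real_le_lsqrt) (auto simp: power2_eq_square algebra_simps)
  also have "... <= (1 + 1 / m) * (1 + m * real (size X))"
    using m by (simp add: field_simps)
  also have "... <= (1 + 1 / m) * L i X"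
    using Hs_ge[of X] en_nonneg[of i] m by (intro mult_left_mono) (auto simp: L_def)
  finally show ?thesis using L_pos[of i X] unfolding \<rho>_def norm_of_real by (simp add: pos_divide_le_eq abs_of_pos)
qed

lemma \<rho>_measurable [measurable]: "\<rho> i \<in> bmv"
  unfolding \<rho>_def[abs_def] by measurable

lemma bm_\<rho>: "bm pbrho"
  by (intro bm_mult bm_pb bmI[OF _ \<rho>_bound]) measurable

lemma inv_root_\<rho>: "inv_root X * \<rho> i X = 1 / Lc i X"
proof -
  have "sqrt (real (size X) + 1) ~= 0" by (simp add: add_nonneg_eq_0_iff)
  then show ?thesis by (simp add: inv_root_def \<rho>_def flip: of_real_mult)
qed

lemma bounded_clinear_spin_field: "bounded_clinear (spin_field h h')"
  and norm_spin_field: "norm (spin_field h h' y) <= (norm h + norm h') * (1 + 1 / m) * norm y"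
proof -
  note c = bounded_clinear_vecI[OF bounded_clinear_field_op norm_field_op bij_flip, of h h']
  note p = bounded_clinear_mulS[OF bm_pb] and q = bounded_clinear_mulS[OF bm_\<rho>]
  show "bounded_clinear (spin_field h h')"
    unfolding spin_field_def[abs_def]
    using bounded_clinear_compose[OF p bounded_clinear_compose[OF c(1) q]] by (simp add: comp_def)
  have "norm (spin_field h h' y) <= 1 * norm (\<chi> i. field_op h h' (mulS pbrho y $ flip i))"
    unfolding spin_field_def by (rule mulS_norm_le[OF bm_pb pb_simps(1)])
  also have "... <= (norm h + norm h') * norm (mulS pbrho y)"
    using c(2) by simp
  also have "... <= (norm h + norm h') * ((1 + 1 / m) * norm y)"
  proof (intro mult_left_mono mulS_norm_le[OF bm_\<rho>])
    show "cmod (pb i X * \<rho> i X) <= 1 + 1 / m" for i X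
      using mult_mono[OF pb_simps(1)[of i X] \<rho>_bound[of i X]] by (simp add: norm_mult)
  qed auto
  finally show "norm (spin_field h h' y) <= (norm h + norm h') * (1 + 1 / m) * norm y" by (simp add: mult.assoc)
qed

lemma spin_field_diff: "spin_field h1 h1' y - spin_field h2 h2' y = spin_field (h1 - h2) (h1' - h2') y"
proof -
  have "(\<chi> i. field_op h1 h1' (u i)) - (\<chi> i. field_op h2 h2' (u i)) = (\<chi> i. field_op (h1 - h2) (h1' - h2') (u i))"
    for u :: "2 => momentum fock"
    by (simp add: vec_eq_iff field_op_diff)
  then show ?thesis
    unfolding spin_field_def bounded_clinearD(4)[OF bounded_clinear_mulS[OF bm_pb], symmetric] by simp
qed

lemma spin_field_scaleC: "spin_field (cnj c *\<^sub>C h) (c *\<^sub>C h') y = c *\<^sub>C spin_field h h' y"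
proof -
  have "(\<chi> i. field_op (cnj c *\<^sub>C h) (c *\<^sub>C h') (u i)) = c *\<^sub>C (\<chi> i. field_op h h' (u i))"
    for u :: "2 => momentum fock"
    by (simp add: vec_eq_iff field_op_scaleC scaleC_vec_def)
  then show ?thesis
    unfolding spin_field_def bounded_clinearD(2)[OF bounded_clinear_mulS[OF bm_pb], symmetric] by simp
qed

lemma spin_field_symmetric: "cinner (R0 x) (spin_field h h' y) = cinner (spin_field h' h x) (R0 y)"
proof -
  define x' where "x' = mulS pbrho x"
  define y' where "y' = mulS pbrho y"
  have c: "mulS pb (R0 x) $ i = mulop inv_root (mulS pbrho x $ i)" for x i
  proof -
    have "mulop inv_root (mulS pbrho x $ i) = mulop (\<lambda>X. inv_root X * (pb i X * \<rho> i X)) (x $ i)"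
      by (simp add: mulS_def mulop_mulop bounded_inv_root bmD[OF bm_\<rho>])
    also have "(\<lambda>X. inv_root X * (pb i X * \<rho> i X)) = (\<lambda>X. pb i X * (1 / Lc i X))"
      unfolding inv_root_\<rho>[symmetric] by (simp add: mult_ac)
    also have "mulop ... (x $ i) = mulS pb (R0 x) $ i"
      unfolding R0_def mulS_mulS[OF bm_pb bm_R0] by (simp add: mulS_def)
    finally show ?thesis by simp
  qed
  have "cinner (R0 x) (spin_field h h' y) = cinner (mulS pb (R0 x)) (\<chi> i. field_op h h' (y' $ flip i))"
    by (simp add: spin_field_def cinner_mulS_left[OF bm_pb] pb_simps y'_def)
  also have "... = (\<Sum>i\<in>UNIV. cinner (field_op h' h (x' $ i)) (mulop inv_root (y' $ flip i)))"
    by (simp add: cinner_vec_def c field_op_symmetric x'_def)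
  also have "... = (\<Sum>i\<in>UNIV. cinner (field_op h' h (x' $ flip i)) (mulop inv_root (y' $ i)))"
    by (subst sum.reindex_bij_betw[OF bij_flip, symmetric]) simp
  also have "... = cinner (\<chi> i. field_op h' h (x' $ flip i)) (mulS pb (R0 y))"
    by (simp add: cinner_vec_def c y'_def)
  also have "... = cinner (spin_field h' h x) (R0 y)"
    by (simp add: spin_field_def cinner_mulS_left[OF bm_pb] pb_simps x'_def)
  finally show ?thesis .
qed

text \<open>\<open>R0\<close> does not commute with dilations, so the dilated field is expressed by
  a vector \<open>y'\<close> that compensates for the change of \<open>\<rho>\<close>; it is later
  supplied by \<open>W\<close>.\<close>

lemma state_dilation_spin_field:
  assumes y': "mulS pbrho y' = mulS (\<lambda>i X. pb i X * \<rho> i (scl t X)) (state_dilation t y)"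
  shows "state_dilation t (spin_field h h' y) = spin_field (dilation t h) (dilation t h') y'"
proof -
  have pbs: "pb i (scl t X) = pb i X" for i X
    by (simp add: pb_def excl_def)
  have b: "bm (\<lambda>i X. pb i X * \<rho> i (scl t X))"
    by (intro bm_mult bm_pb bmI[OF _ \<rho>_bound]) measurable
  have "state_dilation t (spin_field h h' y) = mulS pb (state_dilation t (\<chi> i. field_op h h' (mulS pbrho y $ flip i)))"
    unfolding spin_field_def by (rule state_dilation_mulS[OF bm_pb bm_pb pbs])
  also have "state_dilation t (\<chi> i. field_op h h' (mulS pbrho y $ flip i))
    = (\<chi> i. field_op (dilation t h) (dilation t h') (state_dilation t (mulS pbrho y) $ flip i))"
    by (simp add: state_dilation_def field_op_dilation)
  also have "state_dilation t (mulS pbrho y) = mulS pbrho y'"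
    unfolding y' by (rule state_dilation_mulS[OF bm_\<rho> b]) (simp add: pbs)
  finally show ?thesis by (simp add: spin_field_def)
qed

end

lemma bm_diff: "bm w ==> bm v ==> bm (\<lambda>i X. w i X - v i X)"
  using bm_add[of w "\<lambda>i X. (-1) * v i X"] bm_mult[OF bm_const[of "-1"], of v] by simp

lemma sum_mset_subtractf: "(\<Sum>k\<in>#X. c k - d k) = (\<Sum>k\<in>#X. c k) - (\<Sum>k\<in>#X. d k :: 'a::ab_group_add)"
  by (induction X) simp_all

section \<open>Dependence of the operators on the dilation parameter, the coupling and the
  energy\<close>

context spin_boson
begin

definition CB :: real where "CB = 2 * gauss_norm m La * (1 + 1 / m)"

lemma gauss_norm_nonneg: "0 <= gauss_norm m La" by (simp add: gauss_norm_def)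

lemma CB_nonneg: "0 <= CB" using gauss_norm_nonneg m by (simp add: CB_def)

lemma spin_field_le:
  assumes "norm h <= gauss_norm m La * a" "norm h' <= gauss_norm m La * a"
  shows "norm (spin_field h h' y) <= CB * a * norm y"
proof -
  have "norm (spin_field h h' y) <= (norm h + norm h') * (1 + 1 / m) * norm y" by (rule norm_spin_field)
  also have "... <= (gauss_norm m La * a + gauss_norm m La * a) * (1 + 1 / m) * norm y"
    using assms m by (intro mult_right_mono add_mono) auto
  finally show ?thesis by (simp add: CB_def algebra_simps)
qed

lemma cnj_ball: "th \<in> ball 0 r ==> cnj th \<in> ball (0::complex) r" by simp

lemma cmod_cnj_diff: "cmod (cnj a - cnj b) = cmod (a - b)"
  by (metis complex_cnj_diff complex_mod_cnj)

lemma B_estimates: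
  assumes th: "th \<in> ball 0 (1/16)" "th' \<in> ball 0 (1/16)"
  shows "norm (B th y) <= CB * norm y" "norm (B' th y) <= CB * norm y"
    "norm (B th' y - B th y) <= CB * cmod (th' - th) * norm y"
    "norm (B th' y - B th y - (th' - th) *\<^sub>C B' th y) <= CB * (cmod (th' - th))^2 * norm y"
proof -
  note E = Fth_estimates[OF m La th] and E' = Fth_estimates[OF m La cnj_ball[OF th(1)] cnj_ball[OF th(2)]]
  note E'' = E' [unfolded cmod_cnj_diff]
  show "norm (B th y) <= CB * norm y"
    using spin_field_le[of "Fth m La (cnj th)" 1 "Fth m La th" y] E E'' by (simp add: B_def)
  show "norm (B' th y) <= CB * norm y"
    using spin_field_le[of "Fth' m La (cnj th)" 1 "Fth' m La th" y] E E'' by (simp add: B'_def)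
  show "norm (B th' y - B th y) <= CB * cmod (th' - th) * norm y"
    unfolding B_def spin_field_diff by (rule spin_field_le[OF E''(3) E(3)])
  have sc: "(th' - th) *\<^sub>C B' th y = spin_field ((cnj th' - cnj th) *\<^sub>C Fth' m La (cnj th)) ((th' - th) *\<^sub>C Fth' m La th) y"
    unfolding B'_def spin_field_scaleC[symmetric] by simp
  show "norm (B th' y - B th y - (th' - th) *\<^sub>C B' th y) <= CB * (cmod (th' - th))^2 * norm y"
    unfolding sc unfolding B_def spin_field_diff by (rule spin_field_le[OF E''(4) E(4)])
qed

lemma B_symmetric: "cinner (R0 x) (B th y) = cinner (B (cnj th) x) (R0 y)"
  by (simp add: B_def spin_field_symmetric)

text \<open>For the real part of \<open>th\<close> the interaction is symmetric and its form is
  real, so only the change of \<open>B\<close> along the imaginary direction is left. The error is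
  therefore proportional to \<open>Im th\<close>, like the gain of the free part, and a small
  coupling can absorb it.\<close>

lemma Im_B_le:
  assumes th: "th \<in> ball 0 (1/16)"
  shows "\<bar>Im (cinner (R0 y) (B th y))\<bar> <= CB * \<bar>Im th\<bar> * norm (R0 y) * norm y"
proof -
  define thr where "thr = cx (Re th)"
  have r: "thr \<in> ball 0 (1/16)" using th abs_Re_le_cmod[of th] by (simp add: thr_def)
  have "cinner (R0 y) (B thr y) = cinner (B thr y) (R0 y)" using B_symmetric[of y thr y] by (simp add: thr_def)
  then have "Im (cinner (R0 y) (B thr y)) = 0"
    by (metis cinner_commute cnj.sel(2) neg_equal_zero)
  then have "\<bar>Im (cinner (R0 y) (B th y))\<bar> = \<bar>Im (cinner (R0 y) (B th y - B thr y))\<bar>"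
    by (simp add: cinner_diff_right)
  also have "... <= cmod (cinner (R0 y) (B th y - B thr y))" by (rule abs_Im_le_cmod)
  also have "... <= norm (R0 y) * norm (B th y - B thr y)" by (rule cinner_le_norm)
  also have "... <= norm (R0 y) * (CB * cmod (th - thr) * norm y)"
    by (intro mult_left_mono B_estimates(3)[OF r th]) auto
  also have "cmod (th - thr) = \<bar>Im th\<bar>" by (simp add: thr_def cmod_def)
  finally show ?thesis by (simp add: mult_ac)
qed

lemma \<omega>th_taylor:
  assumes th: "th \<in> ball 0 (1/16)" "th' \<in> ball 0 (1/16)"
  shows "cmod (deriv (\<lambda>th. \<omega>th m th k) th) <= 2048 * \<omega> m k"
    "cmod (\<omega>th m th' k - \<omega>th m th k) <= 2048 * cmod (th' - th) * \<omega> m k"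
    "cmod (\<omega>th m th' k - \<omega>th m th k - (th' - th) * deriv (\<lambda>th. \<omega>th m th k) th) <= 2048 * (cmod (th' - th))^2 * \<omega> m k"
proof -
  have "0 < 2 * \<omega> m k" using \<omega>_ge[of m k] m by linarith
  from holomorphic_taylor_bounds[OF \<omega>th_holomorphic[OF m] this \<omega>th_bounds(2)[OF m] th]
  show "cmod (deriv (\<lambda>th. \<omega>th m th k) th) <= 2048 * \<omega> m k"
    "cmod (\<omega>th m th' k - \<omega>th m th k) <= 2048 * cmod (th' - th) * \<omega> m k"
    "cmod (\<omega>th m th' k - \<omega>th m th k - (th' - th) * deriv (\<lambda>th. \<omega>th m th k) th) <= 2048 * (cmod (th' - th))^2 * \<omega> m k"
    by (simp_all add: mult_ac)
qed

lemma sum_mset_cmod_le: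
  assumes "!!k. cmod (c k) <= K * \<omega> m k"
  shows "cmod (\<Sum>k\<in>#X. c k) <= K * Hs X"
  unfolding Hs_def
proof (induction X)
  case (add k X)
  have "cmod (\<Sum>k\<in>#add_mset k X. c k) <= cmod (c k) + cmod (\<Sum>k\<in>#X. c k)" by (simp add: norm_triangle_ineq)
  then show ?case using add assms[of k] by (simp add: distrib_left)
qed simp

text \<open>The one-particle remainders are proportional to \<open>\<omega> m k\<close>; summed over
  the particles they are controlled by \<open>Hs\<close> and hence by \<open>L\<close>, so that
  division by \<open>L\<close> leaves multipliers bounded uniformly in the particle number.\<close>

lemma ht_taylor:
  assumes th: "th \<in> ball 0 (1/16)" "th' \<in> ball 0 (1/16)"
  shows "cmod (ht' th i X) <= 2048 * L i X"
    "cmod (ht th' i X - ht th i X) <= 2048 * cmod (th' - th) * L i X"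
    "cmod (ht th' i X - ht th i X - (th' - th) * ht' th i X) <= 2048 * (cmod (th' - th))^2 * L i X"
proof -
  note T = \<omega>th_taylor[OF th]
  have HL: "K * Hs X <= K * L i X" if "0 <= K" for K using L_ge(2)[of X i] that by (rule mult_left_mono)
  show "cmod (ht' th i X) <= 2048 * L i X"
    unfolding ht'_def by (rule order_trans[OF sum_mset_cmod_le[OF T(1)] HL]) simp
  show "cmod (ht th' i X - ht th i X) <= 2048 * cmod (th' - th) * L i X"
  proof (cases "excl i X")
    case False
    then have "ht th' i X - ht th i X = (\<Sum>k\<in>#X. \<omega>th m th' k - \<omega>th m th k)" by (simp add: ht_def sum_mset_subtractf)
    then show ?thesis using order_trans[OF sum_mset_cmod_le[OF T(2)] HL] by simp
  qed (use L_pos[of i X] in "simp add: ht_def")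
  show "cmod (ht th' i X - ht th i X - (th' - th) * ht' th i X) <= 2048 * (cmod (th' - th))^2 * L i X"
  proof (cases "excl i X")
    case False
    then have "ht th' i X - ht th i X - (th' - th) * ht' th i X
      = (\<Sum>k\<in>#X. \<omega>th m th' k - \<omega>th m th k - (th' - th) * deriv (\<lambda>th. \<omega>th m th k) th)"
      by (simp add: ht_def ht'_def sum_mset_subtractf sum_mset_distrib_left)
    then show ?thesis using order_trans[OF sum_mset_cmod_le[OF T(3)] HL] by simp
  next
    case True
    then have "X = {#}" by (simp add: excl_def)
    then show ?thesis using L_pos[of i X] True by (simp add: ht_def ht'_def)
  qed
qed

lemma ht_bound: "th \<in> ball 0 (1/8) ==> cmod (ht th i X) <= 2 * L i X"
proof -
  assume "th \<in> ball 0 (1/8)"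
  from sum_mset_cmod_le[OF \<omega>th_bounds(2)[OF m this], of X]
  have "cmod (cx (en i) + (\<Sum>k\<in>#X. \<omega>th m th k)) <= en i + 2 * Hs X"
    using norm_triangle_ineq[of "cx (en i)"] en_nonneg[of i] by (smt (verit) norm_of_real)
  then show ?thesis using L_pos[of i X] en_nonneg[of i] by (auto simp: ht_def L_def)
qed

lemma ht_measurable: "th \<in> ball 0 (1/8) ==> ht th i \<in> bmv"
  using \<omega>th_measurable[OF m, of th, measurable] unfolding ht_def[abs_def] by measurable

lemma ht'_measurable:
  assumes "th \<in> ball 0 (1/16)" shows "ht' th i \<in> bmv"
proof -
  have "(\<lambda>k. deriv (\<lambda>th. \<omega>th m th k) th) \<in> bmv"
    by (rule deriv_measurable[OF _ \<omega>th_holomorphic[OF m] assms]) (rule \<omega>th_measurable[OF m])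
  then show ?thesis unfolding ht'_def[abs_def] by measurable
qed

lemma over_L_le: "cmod c <= K * L i X ==> cmod (c / Lc i X) <= K"
  using L_pos[of i X] by (simp add: norm_divide abs_of_pos pos_divide_le_eq)

lemma bm_over_L:
  assumes [measurable]: "!!i. c i \<in> bmv" and "!!i X. cmod (c i X) <= K * L i X"
  shows "bm (\<lambda>i X. c i X / Lc i X)"
  by (rule bmI[OF _ over_L_le[OF assms(2)]]) measurable

lemma ball_8: "th \<in> ball 0 (1/16) ==> th \<in> ball (0::complex) (1/8)" by simp

lemma bm_ht:
  assumes "th \<in> ball 0 (1/8)" shows "bm (hm th ze)"
proof (rule bm_over_L)
  show "(\<lambda>X. ht th i X - ze) \<in> bmv" for i using ht_measurable[OF assms, of i] by measurable
  show "cmod (ht th i X - ze) <= (2 + cmod ze) * L i X" for i X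
    using ht_bound[OF assms, of i X] norm_triangle_ineq4[of "ht th i X" ze] mult_left_mono[OF L_ge(1)[of i X], of "cmod ze"]
    by (simp add: distrib_right)
qed

lemma bm_ht':
  assumes "th \<in> ball 0 (1/16)" shows "bm (\<lambda>i X. ht' th i X / Lc i X)"
  by (rule bm_over_L[OF ht'_measurable[OF assms] ht_taylor(1)[OF assms assms]])

lemma bounded_clinear_R0: "bounded_clinear R0"
  unfolding R0_def by (rule bounded_clinear_mulS[OF bm_R0])

lemma norm_R0: "norm (R0 y) <= norm y"
  using mulS_norm_le[OF bm_R0, of 1 y] L_ge(1) L_pos unfolding R0_def
  by (simp add: norm_divide abs_of_pos)

lemma bounded_clinear_Q: "th \<in> ball 0 (1/16) ==> bounded_clinear (Q g th ze)"
  unfolding Q_def[abs_def] B_def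
  by (intro bounded_clinear_add bounded_clinear_scaleC bounded_clinear_mulS bm_ht ball_8
      bounded_clinear_compose[OF bounded_clinear_scaleC[OF bounded_clinear_ident] bounded_clinear_spin_field])

lemma norm_real_scaleC: "0 <= g ==> g <= 1 ==> norm y <= K ==> norm (cx g *\<^sub>C (y :: state)) <= K"
  using mult_right_mono[of g 1 "norm y"] by (simp add: norm_scaleC)

lemma Q_taylor:
  assumes th: "th \<in> ball 0 (1/16)" "th' \<in> ball 0 (1/16)" and g: "0 <= g" "g <= 1"
  shows "norm (Q' g th y) <= (2048 + CB) * norm y"
    "norm (Q g th' ze y - Q g th ze y) <= (2048 + CB) * cmod (th' - th) * norm y"
    "norm (Q g th' ze y - Q g th ze y - (th' - th) *\<^sub>C Q' g th y) <= (2048 + CB) * (cmod (th' - th))^2 * norm y"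
proof -
  note b = bm_ht[OF ball_8[OF th(1)], of ze] bm_ht[OF ball_8[OF th(2)], of ze] bm_ht'[OF th(1)]
  have 1: "norm (mulS (\<lambda>i X. ht' th i X / Lc i X) y) <= 2048 * norm y"
    by (rule mulS_norm_le[OF b(3) over_L_le[OF ht_taylor(1)[OF th]]])
  have 2: "norm (mulS (hm th' ze) y - mulS (hm th ze) y)
    <= 2048 * cmod (th' - th) * norm y"
    unfolding mulS_diff[OF b(2,1), symmetric]
  proof (rule mulS_norm_le)
    show "bm (\<lambda>i X. (ht th' i X - ze) / Lc i X - (ht th i X - ze) / Lc i X)"
      by (rule bm_diff[OF b(2,1)])
    show "cmod ((ht th' i X - ze) / Lc i X - (ht th i X - ze) / Lc i X) <= 2048 * cmod (th' - th)" for i X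
      using over_L_le[OF ht_taylor(2)[OF th, of i X]] by (simp add: diff_divide_distrib)
  qed
  have 3: "norm (mulS (hm th' ze) y - mulS (hm th ze) y
      - (th' - th) *\<^sub>C mulS (\<lambda>i X. ht' th i X / Lc i X) y)
    <= 2048 * (cmod (th' - th))^2 * norm y"
  proof -
    have b4: "bm (\<lambda>i X. (ht th' i X - ze) / Lc i X - (ht th i X - ze) / Lc i X)"
      by (rule bm_diff[OF b(2,1)])
    have b5: "bm (\<lambda>i X. (th' - th) * (ht' th i X / Lc i X))" by (rule bm_mult[OF bm_const b(3)])
    show ?thesis
      unfolding mulS_diff[OF b(2,1), symmetric] mulS_scale[OF b(3), symmetric] mulS_diff[OF b4 b5, symmetric]
    proof (rule mulS_norm_le)
      show "bm (\<lambda>i X. (ht th' i X - ze) / Lc i X - (ht th i X - ze) / Lc i X - (th' - th) * (ht' th i X / Lc i X))"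
        by (rule bm_diff[OF b4 b5])
      show "cmod ((ht th' i X - ze) / Lc i X - (ht th i X - ze) / Lc i X - (th' - th) * (ht' th i X / Lc i X))
        <= 2048 * (cmod (th' - th))^2" for i X
        using over_L_le[OF ht_taylor(3)[OF th, of i X]] by (simp add: diff_divide_distrib)
    qed
  qed
  note E = B_estimates[OF th, of y]
  show "norm (Q' g th y) <= (2048 + CB) * norm y"
    unfolding Q'_def distrib_right
    by (rule order_trans[OF norm_triangle_ineq add_mono[OF 1 norm_real_scaleC[OF g E(2)]]])
  have "Q g th' ze y - Q g th ze y = (mulS (hm th' ze) y - mulS (hm th ze) y)
     + cx g *\<^sub>C (B th' y - B th y)" by (simp add: Q_def scaleC_diff_right)
  also have "norm ... <= (2048 + CB) * cmod (th' - th) * norm y"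
    unfolding distrib_right
    by (rule order_trans[OF norm_triangle_ineq add_mono[OF 2 norm_real_scaleC[OF g E(3)]]])
  finally show "norm (Q g th' ze y - Q g th ze y) <= (2048 + CB) * cmod (th' - th) * norm y" .
  have "Q g th' ze y - Q g th ze y - (th' - th) *\<^sub>C Q' g th y
     = (mulS (hm th' ze) y - mulS (hm th ze) y
        - (th' - th) *\<^sub>C mulS (\<lambda>i X. ht' th i X / Lc i X) y)
     + cx g *\<^sub>C (B th' y - B th y - (th' - th) *\<^sub>C B' th y)"
    by (simp add: Q_def Q'_def scaleC_diff_right scaleC_add_right scaleC_scaleC mult.commute)
  also have "norm ... <= (2048 + CB) * (cmod (th' - th))^2 * norm y"
    unfolding distrib_right
    by (rule order_trans[OF norm_triangle_ineq add_mono[OF 3 norm_real_scaleC[OF g E(4)]]])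
  finally show "norm (Q g th' ze y - Q g th ze y - (th' - th) *\<^sub>C Q' g th y) <= (2048 + CB) * (cmod (th' - th))^2 * norm y" .
qed

lemma ht_cnj: "th \<in> ball 0 (1/8) ==> cnj (ht th i X) = ht (cnj th) i X"
proof -
  assume th: "th \<in> ball 0 (1/8)"
  have "cnj (\<Sum>k\<in>#X. \<omega>th m th k) = (\<Sum>k\<in>#X. \<omega>th m (cnj th) k)"
    by (induction X) (auto simp: \<omega>th_cnj[OF m th])
  then show ?thesis by (simp add: ht_def)
qed

text \<open>Says that the adjoint of the dilated operator at \<open>(th, ze)\<close> is the one at
  the conjugate parameters, written without unbounded operators: both arguments stand for
  \<open>R0 x\<close> and \<open>R0 y\<close>.\<close>

lemma Q_symmetric:
  assumes th: "th \<in> ball 0 (1/16)"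
  shows "cinner (R0 x) (Q g th ze y) = cinner (Q g (cnj th) (cnj ze) x) (R0 y)"
proof -
  define u where "u = (hm th ze)"
  define v where "v = (hm (cnj th) (cnj ze))"
  define r where "r = invL"
  have b: "bm u" "bm v" "bm r" using bm_ht[OF ball_8[OF th]] bm_ht[OF ball_8[OF cnj_ball[OF th]]] bm_R0
    by (auto simp: u_def v_def r_def)
  have c: "cnj (v i X) = u i X" "cnj (r i X) = r i X" for i X
    by (auto simp: u_def v_def r_def ht_cnj[OF ball_8[OF th], symmetric])
  have "cinner (R0 x) (mulS u y) = cinner (mulS v x) (R0 y)"
    unfolding R0_def r_def[symmetric] cinner_mulS_left[OF b(2)] cinner_mulS_left[OF b(3)] c
    using mulS_mulS[OF b(3,1), of y] mulS_mulS[OF b(1,3), of y] by (simp add: mult.commute)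
  then show ?thesis
    by (simp add: Q_def u_def v_def cinner_add_right cinner_add_left cinner_scaleC_left cinner_scaleC_right B_symmetric)
qed

lemma Q_perturb:
  assumes "th \<in> ball 0 (1/16)"
  shows "Q g th ze y - Q g' th ze' y = cx (g - g') *\<^sub>C B th y - (ze - ze') *\<^sub>C R0 y"
proof -
  note b = bm_ht[OF ball_8[OF assms], of ze] bm_ht[OF ball_8[OF assms], of ze']
  have "mulS (hm th ze) y - mulS (hm th ze') y
    = mulS (\<lambda>i X. (ze' - ze) * (1 / Lc i X)) y"
    unfolding mulS_diff[OF b, symmetric] by (simp add: diff_divide_distrib)
  also have "... = (ze' - ze) *\<^sub>C R0 y" unfolding R0_def by (rule mulS_scale[OF bm_R0])
  finally show ?thesis unfolding Q_def
    by (simp add: scaleC_diff_left algebra_simps)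
qed

end

section \<open>Covariance under real dilations, and states near and far from the energy
  shell\<close>

context spin_boson
begin

text \<open>The dilation conjugated by \<open>R0\<close>: dilating \<open>R0 y\<close> gives
  \<open>R0 (W be y)\<close>. The quotient of the two energies is bounded for small
  \<open>be\<close>.\<close>

definition W :: "real => state => state" where
  "W be y = mulS (\<lambda>i X. cx (L i X / L i (scl be X))) (state_dilation be y)"

lemma Hs_scale:
  assumes "\<bar>be\<bar> < 1/8" shows "Hs X <= 2 * Hs (scl be X)"
proof -
  have b: "cx be \<in> ball 0 (1/8)" using assms by simp
  have "\<omega> m k <= 2 * \<omega> m (exp be *\<^sub>R k)" for k
    using \<omega>th_bounds(1)[OF m b, of k] \<omega>th_scale[of m 0 be k, symmetric] by (simp add: \<omega>th_zero)
  then show ?thesis unfolding Hs_def by (induction X) (auto intro: add_mono)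
qed

lemma L_scale:
  assumes "\<bar>be\<bar> < 1/8" shows "L i X <= 2 * L i (scl be X)"
  using Hs_scale[OF assms, of X] en_nonneg[of i] by (simp add: L_def)

lemma L_scale_measurable [measurable]: "(\<lambda>X. L i (image_mset ((*\<^sub>R) s) X)) \<in> bmv"
  by (rule measurable_compose[OF image_mset_scale_measurable L_measurable])

lemma bm_W:
  assumes "\<bar>be\<bar> < 1/8" shows "bm (\<lambda>i X. cx (L i X / L i (scl be X)))"
proof (rule bmI)
  show "cmod (cx (L i X / L i (scl be X))) <= 2" for i X
    using L_scale[OF assms, of i X] L_pos[of i X] L_pos[of i "image_mset ((*\<^sub>R) (exp be)) X"]
    unfolding norm_of_real by (simp add: abs_of_pos pos_divide_le_eq)
qed measurable

lemma bm_R0_scale: "bm (\<lambda>i X. 1 / cx (L i (scl be X)))"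
  by (rule bmI[of _ 1]) (use L_ge(1) L_pos in "auto simp: norm_divide abs_of_pos")

lemma state_dilation_R0:
  assumes "\<bar>be\<bar> < 1/8" shows "state_dilation be (R0 y) = R0 (W be y)"
proof -
  have "state_dilation be (R0 y) = mulS (\<lambda>i X. 1 / cx (L i (scl be X))) (state_dilation be y)"
    unfolding R0_def by (rule state_dilation_mulS[OF bm_R0 bm_R0_scale]) simp
  also have "... = R0 (W be y)"
    unfolding R0_def W_def mulS_mulS[OF bm_R0 bm_W[OF assms]] using L_pos by (simp add: less_imp_neq[THEN not_sym])
  finally show ?thesis .
qed

lemma state_dilation_Q:
  assumes b: "\<bar>be\<bar> < 1/8" and th: "th \<in> ball 0 (1/16)" "th + cx be \<in> ball 0 (1/16)"
  shows "state_dilation be (Q g th ze y) = Q g (th + cx be) ze (W be y)"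
proof -
  let ?s = "image_mset ((*\<^sub>R) (exp be)) :: momentum multiset => momentum multiset"
  note lin = bounded_clinearD[OF unitary_opD(1)]
  have U: "unitary_op (state_dilation be)" using unitary_group_state_dilation by (simp add: unitary_group_def)
  have L0: "L i X ~= 0" for i X using L_pos[of i X] by simp
  have hts: "ht th i (?s X) = ht (th + cx be) i X" for i X
    by (simp add: ht_def excl_def \<omega>th_scale image_mset.compositionality comp_def)
  have bs: "bm (\<lambda>i X. (ht (th + cx be) i X - ze) / cx (L i (?s X)))"
    using bm_mult[OF bm_ht[OF ball_8[OF th(2)], of ze] bm_W[OF b]] by (simp add: L0)
  have "state_dilation be (mulS (hm th ze) y)
    = mulS (\<lambda>i X. (ht (th + cx be) i X - ze) / cx (L i (?s X))) (state_dilation be y)"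
    by (rule state_dilation_mulS[OF bm_ht[OF ball_8[OF th(1)]] bs]) (simp add: hts)
  also have "... = mulS (hm (th + cx be) ze) (W be y)"
    unfolding W_def mulS_mulS[OF bm_ht[OF ball_8[OF th(2)]] bm_W[OF b]] by (simp add: L0)
  finally have 1: "state_dilation be (mulS (hm th ze) y) = ..." .
  have br: "bm (\<lambda>i X. pb i X * \<rho> i X * cx (L i X / L i (?s X)))" by (rule bm_mult[OF bm_\<rho> bm_W[OF b]])
  have "mulS pbrho (W be y) = mulS (\<lambda>i X. pb i X * \<rho> i (?s X)) (state_dilation be y)"
    unfolding W_def mulS_mulS[OF bm_\<rho> bm_W[OF b]] by (simp add: \<rho>_def L0)
  from state_dilation_spin_field[OF this]
  have 2: "state_dilation be (B th y) = B (th + cx be) (W be y)"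
    using Fth_dilation[OF m La th] Fth_dilation[OF m La cnj_ball[OF th(1)], of be] cnj_ball[OF th(2)] by (simp add: B_def)
  show ?thesis unfolding Q_def lin(3)[OF U] lin(2)[OF U] 1 2 ..
qed

abbreviation dl :: real where "dl \<equiv> \<delta> m 0 e1"

lemma dl_le: "1 <= n ==> dl <= \<bar>e1 - m * real n\<bar>"
  unfolding \<delta>_def using infdist_le[of "m * real n" "mN m" "e1 - 0"] by (auto simp: mN_def dist_real_def)

text \<open>With \<open>n\<close> the integer part of \<open>e1 / m\<close>, which is at least
  \<open>1\<close>, the energy \<open>e1\<close> lies strictly between the consecutive multiples
  \<open>m n\<close> and \<open>m (n + 1)\<close>. The smaller of the two gaps bounds the distance
  from below, and the gap to \<open>m n\<close> is less than \<open>m\<close>.\<close>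

lemma dl_facts: "0 < dl" "dl <= m" "dl <= e1 - m"
proof -
  show 1: "dl <= e1 - m" using dl_le[of 1] e1 by simp
  define n where "n = nat \<lfloor>e1 / m\<rfloor>"
  have f: "1 <= \<lfloor>e1 / m\<rfloor>" using e1 m by (simp add: le_floor_iff)
  then have rn: "real n = of_int \<lfloor>e1 / m\<rfloor>" unfolding n_def by simp
  have n: "1 <= n" using f unfolding n_def by linarith
  have a: "m * real n <= e1" "e1 < m * (real n + 1)"
    unfolding rn using mult_left_mono[OF of_int_floor_le[of "e1 / m"], of m] real_of_int_floor_add_one_gt[of "e1 / m"] m
    by (simp_all add: field_simps)
  show "dl <= m" using dl_le[OF n] a by (simp add: algebra_simps)
  have ne: "m * real n ~= e1" using e1(2) n by (auto simp: mN_def)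
  define c where "c = min (e1 - m * real n) (m * (real n + 1) - e1)"
  have "0 < c" using a ne by (simp add: c_def)
  also have "c <= dl"
    unfolding \<delta>_def
  proof (subst infdist_notempty)
    show "mN m ~= {}" by (auto simp: mN_def)
    show "c <= (INF a\<in>mN m. dist (e1 - 0) a)"
    proof (rule cINF_greatest)
      show "mN m ~= {}" by (auto simp: mN_def)
      fix x assume "x \<in> mN m"
      then obtain k where x: "x = m * real k" by (auto simp: mN_def)
      show "c <= dist (e1 - 0) x"
      proof (cases "k <= n")
        case True
        then have "m * real k <= m * real n" using m by simp
        then show ?thesis by (simp add: x dist_real_def c_def)
      next
        case False
        then have "m * (real n + 1) <= m * real k" using m by simp
        then show ?thesis by (simp add: x dist_real_def c_def)
      qed
    qed
  qed
  finally show "0 < dl" .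
qed

definition I :: "real set" where "I = {e1 - dl / 4 .. e1 + dl / 4}"

definition near :: "real => 2 => momentum multiset => bool" where
  "near z i X \<longleftrightarrow> cmod (ht 0 i X - cx z) < dl / 4"

lemma ht_zero: "ht 0 i X = cx (if excl i X then 0 else en i + Hs X)"
proof -
  have "(\<Sum>k\<in>#X. \<omega>th m 0 k) = cx (Hs X)"
    unfolding Hs_def by (induction X) (auto simp: \<omega>th_zero)
  then show ?thesis by (simp add: ht_def)
qed

lemma near_iff: "near z i X \<longleftrightarrow> \<bar>(if excl i X then 0 else en i + Hs X) - z\<bar> < dl / 4"
  unfolding near_def ht_zero of_real_diff[symmetric] norm_of_real ..

text \<open>The removed state has energy \<open>0\<close>, and the upper level with a particle has
  energy at least \<open>e1 + m\<close>, so a state near the shell is in the lower level. Its field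
  energy differs from \<open>e1\<close> by less than \<open>dl / 2\<close>, whereas
  \<open>e1\<close> has distance at least \<open>dl\<close> from the rest energy
  \<open>m * size X\<close>; the excess over the rest energy is what is left.\<close>

lemma nearD:
  assumes z: "z \<in> I" and n: "near z i X"
  shows "\<not> excl i X" "L i X <= 1 + 2 * e1" "dl / 2 <= Hs X - m * real (size X)"
proof -
  note d = dl_facts
  have zz: "e1 - dl / 4 <= z" "z <= e1 + dl / 4" using z by (auto simp: I_def)
  show 1: "\<not> excl i X"
  proof
    assume "excl i X"
    then have "\<bar>z\<bar> < dl / 4" using n by (simp add: near_iff)
    then show False using zz d by linarith
  qed
  have 2: "\<bar>en i + Hs X - z\<bar> < dl / 4" using n 1 by (simp add: near_iff)
  show "L i X <= 1 + 2 * e1" unfolding L_def using 2 zz d by linarith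
  have i: "i ~= 1"
  proof
    assume "i = 1"
    then have "X ~= {#}" using 1 by (simp add: excl_def)
    then have "m * 1 <= m * real (size X)" using m by (intro mult_left_mono) (auto simp: Suc_le_eq nonempty_has_size)
    moreover have "\<bar>e1 + Hs X - z\<bar> < dl / 4" using 2 \<open>i = 1\<close> by (simp add: en_def)
    ultimately show False using zz d Hs_ge[of X] by linarith
  qed
  then have 3: "\<bar>Hs X - z\<bar> < dl / 4" using 2 by (simp add: en_def)
  have "X ~= {#}" using 3 zz d by (auto simp: Hs_def)
  then have "1 <= size X" by (simp add: Suc_le_eq nonempty_has_size)
  from dl_le[OF this] show "dl / 2 <= Hs X - m * real (size X)"
    using 3 zz Hs_ge[of X] d by linarith
qed

text \<open>If \<open>t >= dl / 4\<close> is the distance of the free energy from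
  \<open>Re ze\<close>, then \<open>L <= 1 + 2 * e1 + dl + t\<close>, and this \<open>c1\<close>
  gives \<open>2 * (c1 * L) <= t\<close>.\<close>

definition c1 :: real where "c1 = dl / 16 / (1 + 2 * e1 + dl)"

text \<open>The radius of admissible dilations: a dilation changes the free energy by at most
  \<open>2048 * rr * L <= c1 * L\<close>, half of the ellipticity away from the shell.\<close>

definition rr :: real where "rr = min (1/32) (c1 / 2048)"

lemma c1_pos: "0 < c1" "c1 <= 1/16" "c1 * (1 + 2 * e1 + dl) = dl / 16"
  using dl_facts e1 m by (auto simp: c1_def field_simps)

lemma rr_facts: "0 < rr" "rr <= 1/32" "2048 * rr <= c1"
  using c1_pos by (auto simp: rr_def)

lemma ball_rr: "th \<in> ball 0 rr ==> th \<in> ball (0::complex) (1/16)"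
  using rr_facts by simp

text \<open>Away from the shell the undilated symbol is elliptic with constant
  \<open>2 * c1\<close>; the perturbation caused by \<open>th\<close> uses up at most half of
  it.\<close>

lemma farD:
  assumes z: "Re ze \<in> I" and n: "\<not> near (Re ze) i X" and th: "th \<in> ball 0 rr"
  shows "c1 * L i X <= cmod (ht th i X - ze)"
proof -
  note d = dl_facts
  have zz: "e1 - dl / 4 <= Re ze" "Re ze <= e1 + dl / 4" using z by (auto simp: I_def)
  define h where "h = (if excl i X then 0 else en i + Hs X)"
  define t where "t = \<bar>h - Re ze\<bar>"
  have t: "dl / 4 <= t" using n by (simp add: near_iff t_def h_def)
  have "L i X <= 1 + 2 * e1 + dl + t"
  proof (cases "excl i X")
    case True
    then have "L i X = 1 + e1" by (simp add: excl_def L_def en_def Hs_def)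
    then show ?thesis using t d e1 m by simp
  next
    case False
    then have "L i X = 1 + h" by (simp add: h_def L_def)
    then show ?thesis unfolding t_def using zz d e1 m by (simp add: abs_le_iff)
  qed
  then have "c1 * L i X <= c1 * (1 + 2 * e1 + dl) + c1 * t"
    using c1_pos(1) by (simp add: mult_left_mono flip: distrib_left)
  also have "... <= dl / 16 + 1 / 16 * t"
    using c1_pos(3) t d mult_right_mono[OF c1_pos(2), of t] by linarith
  finally have 1: "2 * (c1 * L i X) <= t" using t d by linarith
  have "t <= cmod (ht 0 i X - ze)"
    using abs_Re_le_cmod[of "ht 0 i X - ze"] by (simp add: ht_zero t_def h_def split: if_splits)
  also have "... <= cmod (ht th i X - ze) + cmod (ht th i X - ht 0 i X)"
    using norm_triangle_ineq4[of "ht th i X - ze" "ht th i X - ht 0 i X"] by simp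
  also have "cmod (ht th i X - ht 0 i X) <= 2048 * cmod th * L i X"
    using ht_taylor(2)[of 0 th i X] ball_rr[OF th] by simp
  also have "2048 * cmod th * L i X <= c1 * L i X"
    using th rr_facts(3) L_pos[of i X] by (intro mult_right_mono) auto
  finally show ?thesis using 1 by linarith
qed

lemma ht_Im:
  assumes th: "th \<in> ball 0 (1/8)" and sig: "sig = 1 \<or> sig = - 1" and ep: "ep = - sig * Im th" "0 <= ep"
  shows "0 <= - sig * Im (ht th i X)"
    "\<not> excl i X ==> ep / 16 * (Hs X - m * real (size X)) <= - sig * Im (ht th i X)"
proof -
  have s: "ep / 16 * (Hs X - m * real (size X)) <= - sig * Im (\<Sum>k\<in>#X. \<omega>th m th k)"
    unfolding Hs_def
  proof (induction X)
    case (add k X)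
    then show ?case using \<omega>th_Im[OF m th sig ep, of k] by (simp add: algebra_simps)
  qed simp
  show 1: "ep / 16 * (Hs X - m * real (size X)) <= - sig * Im (ht th i X)" if "\<not> excl i X"
    using s that by (simp add: ht_def)
  have "0 <= ep / 16 * (Hs X - m * real (size X))" using ep(2) Hs_ge[of X] by (intro mult_nonneg_nonneg) auto
  then show "0 <= - sig * Im (ht th i X)"
    using 1 by (cases "excl i X") (auto simp: ht_def)
qed

end

section \<open>Coercivity and invertibility\<close>

text \<open>The lower bound with one constant \<open>K\<close> along the whole segment allows steps
  of a fixed length: each step inverts the next operator by a contraction with factor
  \<open>1/2\<close>, starting from surjectivity of \<open>A\<close>.\<close>

lemma method_of_continuity:
  fixes A C :: "'a::{complex_inner,banach} => 'a"
  assumes A: "bounded_clinear A" and C: "bounded_clinear C" "!!y. norm (C y) <= M * norm y"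
    and K: "!!t y. 0 <= t ==> t <= a ==> norm y <= K * norm (A y + cx t *\<^sub>C C y)"
    and A_surj: "surj A" and a: "0 <= a" and K0: "0 <= K" "0 <= M"
  shows "surj (\<lambda>y. A y + cx a *\<^sub>C C y)"
proof -
  define T where "T t y = A y + cx t *\<^sub>C C y" for t y
  have T_diff: "T t (x - y) = T t x - T t y" for t x y
    by (simp add: T_def bounded_clinearD[OF A] bounded_clinearD[OF C(1)] scaleC_diff_right)
  have step: "surj (T s)" if T: "surj (T t)" and t: "0 <= t" "t <= a" and st: "\<bar>s - t\<bar> * (K * M) <= 1/2" for s t
  proof -
    define Y where "Y v = (SOME y. T t y = v)" for v
    have Y: "T t (Y v) = v" for v unfolding Y_def by (rule someI_ex) (use T in "metis surjD")
    have "\<exists>y. T s y = v" for v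
    proof -
      define f where "f y = Y (v - cx (s - t) *\<^sub>C C y)" for y
      have "dist (f x) (f y) <= 1/2 * dist x y" for x y
      proof -
        have "norm (f x - f y) <= K * norm (T t (f x - f y))" using K[OF t, of "f x - f y"] by (simp add: T_def)
        also have "T t (f x - f y) = - (cx (s - t) *\<^sub>C C (x - y))"
          unfolding T_diff f_def Y by (simp add: bounded_clinearD[OF C(1)] scaleC_diff_right)
        also have "norm ... <= \<bar>s - t\<bar> * (M * norm (x - y))"
          unfolding norm_minus_cancel norm_scaleC norm_of_real by (intro mult_left_mono C) simp
        also have "K * (\<bar>s - t\<bar> * (M * norm (x - y))) <= 1/2 * norm (x - y)"
          using mult_right_mono[OF st, of "norm (x - y)"] by (simp add: mult_ac)
        finally show ?thesis using K0(1) by (simp add: dist_norm mult_left_mono)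
      qed
      then obtain y where "f y = y" using banach_fix_type[of "1/2" f] by auto
      then have "T t y = v - cx (s - t) *\<^sub>C C y" using Y unfolding f_def by metis
      then have "T s y = v" by (simp add: T_def scaleC_diff_left algebra_simps)
      then show ?thesis by blast
    qed
    then show ?thesis unfolding surj_def by metis
  qed
  \<comment> \<open>So many steps that the step length \<open>a / n\<close> times
    \<open>K * M\<close> is at most \<open>1/2\<close>.\<close>
  obtain n :: nat where n: "a * (K * M) * 2 < real n" using reals_Archimedean2 by blast
  then have n0: "0 < real n" using a K0 by (smt (verit) mult_nonneg_nonneg)
  have "surj (T (a * real j / real n))" if "j <= n" for j
    using that
  proof (induction j)
    case 0
    have "T 0 = A" using scaleR_scaleC[of 0, symmetric] by (simp add: T_def fun_eq_iff)
    then show ?case using A_surj by simp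
  next
    case (Suc j)
    show ?case
    proof (rule step)
      show "surj (T (a * real j / real n))" using Suc by simp
      show "0 <= a * real j / real n" using a by simp
      have "a * real j <= a * real n" using Suc a by (intro mult_left_mono) auto
      then show "a * real j / real n <= a" using n0 by (simp add: divide_le_eq)
      have "a * real (Suc j) / real n - a * real j / real n = a / real n"
        by (simp add: diff_divide_distrib[symmetric] algebra_simps)
      then show "\<bar>a * real (Suc j) / real n - a * real j / real n\<bar> * (K * M) <= 1/2"
        using n n0 a by (simp add: field_simps)
    qed
  qed
  from this[of n] show ?thesis using n0 by (simp add: T_def[abs_def])
qed

context spin_boson
begin

text \<open>The sign \<open>sig\<close> selects the half plane of \<open>ze\<close>; the imaginary part of \<open>th\<close> has the opposite sign.\<close>

definition adm :: "real => complex => complex => bool" where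
  "adm sig th ze \<longleftrightarrow> (sig = 1 \<or> sig = - 1) & th \<in> ball 0 rr & 0 <= - sig * Im th & 0 < sig * Im ze & Re ze \<in> I"

definition nearS :: "real => 2 => momentum multiset => complex" where
  "nearS z i X = (if near z i X then 1 else 0)"

lemma near_measurable [measurable]: "Measurable.pred volume (near z i)"
proof -
  have [measurable]: "ht 0 i \<in> bmv" by (rule ht_measurable) simp
  show ?thesis unfolding near_def[abs_def] by measurable
qed

lemma nearS_measurable [measurable]: "nearS z i \<in> bmv"
  unfolding nearS_def[abs_def] by measurable

lemma bm_nearS: "bm (nearS z)"
  by (rule bmI[of _ 1]) (auto simp: nearS_def)

lemma near_far_split: "norm y <= norm (mulS (nearS z) y) + norm (mulS (\<lambda>i X. 1 - nearS z i X) y)"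
proof -
  have "y = mulS (\<lambda>i X. nearS z i X + (1 - nearS z i X)) y" by (simp add: mulS_def mulop_one)
  also have "... = mulS (nearS z) y + mulS (\<lambda>i X. 1 - nearS z i X) y"
    by (rule mulS_add[OF bm_nearS bm_diff[OF bm_const bm_nearS]])
  finally show ?thesis using norm_triangle_ineq[of "mulS (nearS z) y"] by metis
qed

lemma far_estimate:
  assumes a: "adm sig th ze" and g: "0 <= g"
  shows "c1 * norm (mulS (\<lambda>i X. 1 - nearS (Re ze) i X) y) <= norm (Q g th ze y) + g * CB * norm y"
proof -
  have th: "th \<in> ball 0 rr" and z: "Re ze \<in> I" using a by (auto simp: adm_def)
  note b = bm_ht[OF ball_8[OF ball_rr[OF th]], of ze]
  have "norm (mulS (\<lambda>i X. 1 - nearS (Re ze) i X) y) <= 1 / c1 * norm (mulS (hm th ze) y)"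
  proof (rule norm_mulS_le_mulS[OF bm_diff[OF bm_const bm_nearS] b])
    show "cmod (1 - nearS (Re ze) i X) <= 1 / c1 * cmod ((ht th i X - ze) / Lc i X)" for i X
      using farD[OF z _ th, of i X] c1_pos(1) L_pos[of i X]
      by (auto simp: nearS_def norm_divide abs_of_pos field_simps)
  qed (use c1_pos in auto)
  moreover have "mulS (hm th ze) y = Q g th ze y - cx g *\<^sub>C B th y"
    by (simp add: Q_def)
  moreover have "norm (cx g *\<^sub>C B th y) <= g * (CB * norm y)"
    unfolding norm_scaleC norm_of_real using B_estimates(1)[OF ball_rr[OF th] ball_rr[OF th], of y] g by (simp add: mult_left_mono)
  ultimately show ?thesis using norm_triangle_ineq4[of "Q g th ze y" "cx g *\<^sub>C B th y"] c1_pos(1)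
    by (simp add: field_simps)
qed

text \<open>Near the shell the energy is bounded by \<open>1 + 2 * e1\<close>, so \<open>R0\<close>
  can be undone there at a fixed price.\<close>

lemma near_estimate:
  assumes "z \<in> I"
  shows "norm (mulS (nearS z) y) <= (1 + 2 * e1) * norm (mulS (nearS z) (R0 y))"
  unfolding R0_def mulS_mulS[OF bm_nearS bm_R0]
proof (rule norm_mulS_le_mulS[OF bm_nearS bm_mult[OF bm_nearS bm_R0]])
  show "cmod (nearS z i X) <= (1 + 2 * e1) * cmod (nearS z i X * (1 / Lc i X))" for i X
    using nearD(2)[OF assms, of i X] L_pos[of i X] by (auto simp: nearS_def norm_divide abs_of_pos)
qed (use e1 m in auto)

text \<open>Taking the imaginary part of the form of \<open>Q\<close> with \<open>R0 y\<close>: the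
  free symbol contributes the escape gain near the shell and the distance of \<open>ze\<close> from
  the real axis everywhere, both with the same sign. This is why the signs of \<open>Im th\<close>
  and \<open>Im ze\<close> are opposed; \<open>dl / 32\<close> is \<open>1/16\<close> of the excess
  energy \<open>dl / 2\<close>.\<close>

lemma coercive:
  assumes a: "adm sig th ze" and g: "0 <= g"
  shows "- sig * Im th * (dl / 32) * (norm (mulS (nearS (Re ze)) (R0 y)))^2 + sig * Im ze * (norm (R0 y))^2
    <= cmod (cinner (R0 y) (Q g th ze y)) + g * CB * (- sig * Im th) * norm (R0 y) * norm y"
proof -
  have th: "th \<in> ball 0 rr" and z: "Re ze \<in> I" and s: "sig = 1 \<or> sig = - 1" and e: "0 <= - sig * Im th" and e': "0 < sig * Im ze"
    using a by (auto simp: adm_def)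
  note b = bm_ht[OF ball_8[OF ball_rr[OF th]], of ze]
  \<comment> \<open>The symbol of the form of the free part in terms of \<open>y\<close>; the factor
    \<open>- sig\<close> makes its imaginary part nonnegative.\<close>
  define u where "u i X = cx (- sig) * ((1 / Lc i X) * ((ht th i X - ze) / Lc i X))" for i X
  have bu: "bm u" unfolding u_def[abs_def] by (rule bm_mult[OF bm_const bm_mult[OF bm_R0 b]])
  have c: "cinner y (mulS u y) = cx (- sig) * cinner (R0 y) (mulS (hm th ze) y)"
    unfolding u_def R0_def mulS_scale[OF bm_mult[OF bm_R0 b]] cinner_scaleC_right cinner_mulS_left[OF bm_R0]
    by (simp add: mulS_mulS[OF bm_R0 b])
  have "- sig * Im th * (dl / 32) * (norm (mulS (\<lambda>i X. nearS (Re ze) i X * (1 / Lc i X)) y))^2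
      + sig * Im ze * (norm (mulS invL y))^2 <= Im (cinner y (mulS u y))"
  proof (rule Im_cinner_mulS_ge[OF bu bm_mult[OF bm_nearS bm_R0] bm_R0])
    fix i X
    have n: "- sig * Im th * (dl / 32) * (cmod (nearS (Re ze) i X))^2 <= - sig * Im (ht th i X)"
    proof (cases "near (Re ze) i X")
      case True
      have "- sig * Im th * (dl / 32) = - sig * Im th / 16 * (dl / 2)" by simp
      also have "... <= - sig * Im th / 16 * (Hs X - m * real (size X))"
        using nearD(3)[OF z True] e by (intro mult_left_mono) auto
      also have "... <= - sig * Im (ht th i X)" by (rule ht_Im(2)[OF ball_8[OF ball_rr[OF th]] s refl e nearD(1)[OF z True]])
      finally show ?thesis using True by (simp add: nearS_def)
    qed (use ht_Im(1)[OF ball_8[OF ball_rr[OF th]] s refl e] in "auto simp: nearS_def")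
    have "Im (u i X) = (- sig * Im (ht th i X) + sig * Im ze) * (1 / L i X)^2"
      by (simp add: u_def power2_eq_square field_simps)
    moreover have "(- sig * Im th * (dl / 32) * (cmod (nearS (Re ze) i X))^2 + sig * Im ze) * (1 / L i X)^2 <= (- sig * Im (ht th i X) + sig * Im ze) * (1 / L i X)^2"
      using n by (intro mult_right_mono) auto
    ultimately show "- sig * Im th * (dl / 32) * (cmod (nearS (Re ze) i X * (1 / Lc i X)))^2
        + sig * Im ze * (cmod (1 / Lc i X))^2 <= Im (u i X)"
      by (simp add: norm_mult norm_divide power_mult_distrib power_divide diff_divide_distrib)
  qed
  also have "mulS (\<lambda>i X. nearS (Re ze) i X * (1 / Lc i X)) y = mulS (nearS (Re ze)) (R0 y)"
    unfolding R0_def by (rule mulS_mulS[OF bm_nearS bm_R0, symmetric])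
  also have "mulS invL y = R0 y" by (simp add: R0_def)
  also have "Im (cinner y (mulS u y)) = Im (cx (- sig) * cinner (R0 y) (Q g th ze y)) + sig * g * Im (cinner (R0 y) (B th y))"
    unfolding c by (simp add: Q_def cinner_add_right cinner_scaleC_right distrib_left)
  also have "Im (cx (- sig) * cinner (R0 y) (Q g th ze y)) <= cmod (cinner (R0 y) (Q g th ze y))"
    using s abs_Im_le_cmod[of "cx (- sig) * cinner (R0 y) (Q g th ze y)"] by (auto simp: norm_mult)
  also have "sig * g * Im (cinner (R0 y) (B th y)) <= g * \<bar>Im (cinner (R0 y) (B th y))\<bar>"
  proof -
    have "sig * x <= \<bar>x\<bar>" for x :: real using s by auto
    from mult_left_mono[OF this[of "Im (cinner (R0 y) (B th y))"] g] show ?thesis by (simp only: mult_ac)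
  qed
  also have "... <= g * (CB * \<bar>Im th\<bar> * norm (R0 y) * norm y)"
    by (intro mult_left_mono Im_B_le[OF ball_rr[OF th]] g)
  also have "\<bar>Im th\<bar> = - sig * Im th" using s e by auto
  finally show ?thesis by (simp add: mult.assoc)
qed

text \<open>Collects the near constant, with \<open>(1 + 2 * e1)^2\<close> from undoing
  \<open>R0\<close>, and the far constant with \<open>1 / c1^2\<close>. The powers of
  \<open>1 + CB\<close> leave room for the coupling terms, which the choice of \<open>g1\<close>
  then absorbs.\<close>

definition KE :: real where "KE = 64 * (1 + 2 * e1)^2 * (1 + CB) / dl + 4 * (1 + CB)^2 / c1^2"

definition g1 :: real where "g1 = 1 / (2 * KE)"

lemma KE_ge: "4 <= KE" "CB / c1 <= KE" "64 * (1 + 2 * e1)^2 / dl <= KE" "4 / c1^2 <= KE"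
  "64 * (1 + 2 * e1)^2 / dl * CB + 4 / c1^2 * CB^2 <= KE"
proof -
  define p where "p = 64 * (1 + 2 * e1)^2 / dl"
  define q where "q = 1 / c1"
  have p: "0 <= p" using dl_facts by (simp add: p_def)
  have q: "1 <= q" using c1_pos by (simp add: q_def)
  have K: "KE = p * (1 + CB) + 4 * ((1 + CB) * q)^2"
    by (simp add: KE_def p_def q_def power_mult_distrib power_divide field_simps)
  have r: "q <= (1 + CB) * q" "CB * q <= (1 + CB) * q" using q CB_nonneg by (simp_all add: distrib_right)
  then have r1: "1 <= (1 + CB) * q" using q by linarith
  then have r2: "(1 + CB) * q <= ((1 + CB) * q)^2" using mult_right_mono[OF r1, of "(1 + CB) * q"] by (simp add: power2_eq_square)
  have pc: "p <= p * (1 + CB)" "p * CB <= p * (1 + CB)" using p CB_nonneg by (simp_all add: distrib_left)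
  have pn: "0 <= p * (1 + CB)" using p CB_nonneg by simp
  show "4 <= KE" "CB / c1 <= KE" unfolding K using r r1 r2 pn by (auto simp: q_def)
  show "64 * (1 + 2 * e1)^2 / dl <= KE" unfolding K p_def[symmetric] using pc zero_le_power2[of "(1 + CB) * q"] by linarith
  have "q^2 <= ((1 + CB) * q)^2" "(CB * q)^2 <= ((1 + CB) * q)^2" using r q CB_nonneg by (intro power_mono; simp)+
  then show "4 / c1^2 <= KE" "64 * (1 + 2 * e1)^2 / dl * CB + 4 / c1^2 * CB^2 <= KE"
    unfolding K p_def[symmetric] using pn pc(2) by (simp_all add: q_def power_mult_distrib power_divide mult.commute)
qed

lemma g1_pos: "0 < g1" "g1 <= 1" "g1 * KE = 1/2"
  using KE_ge(1) by (auto simp: g1_def field_simps)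

text \<open>The near part is controlled by the form, at the price of \<open>1 / Im th\<close>, the
  far part by ellipticity. All terms carrying \<open>g\<close> add up to at most half of
  \<open>(norm y)^2\<close>, which accounts for the factor \<open>2\<close>.\<close>

lemma Q_coercive:
  assumes a: "adm sig th ze" and g: "0 <= g" "g <= g1" and ep: "0 < - sig * Im th"
  shows "(norm y)^2 <= 2 * KE * ((norm (Q g th ze y))^2 + cmod (cinner (R0 y) (Q g th ze y)) / (- sig * Im th))"
proof -
  define ep where "ep = - sig * Im th"
  define f where "f = cmod (cinner (R0 y) (Q g th ze y))"
  define q where "q = norm (Q g th ze y)"
  define n where "n = norm (mulS (nearS (Re ze)) y)"
  define n' where "n' = norm (mulS (nearS (Re ze)) (R0 y))"
  define fa where "fa = norm (mulS (\<lambda>i X. 1 - nearS (Re ze) i X) y)"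
  have z: "Re ze \<in> I" and \<eta>: "0 < sig * Im ze" using a by (auto simp: adm_def)
  have e0: "0 < ep" using ep by (simp add: ep_def)
  have "ep * (dl / 32) * n'^2 + sig * Im ze * (norm (R0 y))^2 <= f + g * CB * ep * norm (R0 y) * norm y"
    using coercive[OF a g(1), of y] unfolding ep_def f_def n'_def .
  moreover have "0 <= sig * Im ze * (norm (R0 y))^2" by (rule mult_nonneg_nonneg[OF less_imp_le[OF \<eta>] zero_le_power2])
  moreover have "g * CB * ep * norm (R0 y) * norm y <= g * CB * ep * norm y * norm y"
    using norm_R0[of y] g e0 CB_nonneg by (intro mult_right_mono mult_left_mono) auto
  ultimately have "ep * (dl / 32) * n'^2 <= f + g * CB * ep * (norm y)^2" by (simp add: power2_eq_square mult.assoc)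
  then have N': "n'^2 <= 32 / dl * (f / ep + g * CB * (norm y)^2)" using e0 dl_facts(1) by (simp add: field_simps)
  define t where "t = 64 * (1 + 2 * e1)^2 / dl * (f / ep + g * CB * (norm y)^2)"
  have "n <= (1 + 2 * e1) * n'" unfolding n_def n'_def by (rule near_estimate[OF z])
  then have "n^2 <= (1 + 2 * e1)^2 * n'^2" using power_mono[of n "(1 + 2 * e1) * n'" 2] by (simp only: power_mult_distrib n_def norm_ge_zero)
  also have "... <= (1 + 2 * e1)^2 * (32 / dl * (f / ep + g * CB * (norm y)^2))" by (intro mult_left_mono N') auto
  also have "... = t / 2" by (simp add: t_def)
  finally have N: "2 * n^2 <= 64 * (1 + 2 * e1)^2 / dl * (f / ep + g * CB * (norm y)^2)"
    unfolding t_def[symmetric] by simp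
  have "fa <= 1 / c1 * (q + g * CB * norm y)"
    using far_estimate[OF a g(1), of y] c1_pos(1) unfolding fa_def q_def by (simp add: field_simps)
  then have "fa^2 <= (1 / c1)^2 * (q + g * CB * norm y)^2" using power_mono[of fa "1 / c1 * (q + g * CB * norm y)" 2] by (simp only: power_mult_distrib fa_def norm_ge_zero)
  also have "... <= (1 / c1)^2 * (2 * q^2 + 2 * (g * CB * norm y)^2)"
  proof (intro mult_left_mono)
    show "(q + g * CB * norm y)^2 <= 2 * q^2 + 2 * (g * CB * norm y)^2"
      using zero_le_power2[of "q - g * CB * norm y"] unfolding power2_sum power2_diff by linarith
  qed simp
  also have "... = 4 / c1^2 * (q^2 + (g * CB * norm y)^2) / 2"
    by (simp add: power_divide add_divide_distrib)
  finally have "2 * fa^2 <= 4 / c1^2 * (q^2 + (g * CB * norm y)^2)" unfolding pos_le_divide_eq[OF zero_less_numeral] by (simp only: mult.commute)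
  \<comment> \<open>The far part is quadratic in \<open>g\<close>; since \<open>g <= 1\<close> it
    can be treated together with the linear terms of the near part.\<close>
  also have "(g * CB * norm y)^2 <= g * CB^2 * (norm y)^2"
  proof -
    have "g^2 <= g" using g g1_pos mult_left_mono[of g 1 g] by (simp add: power2_eq_square)
    then show ?thesis unfolding power_mult_distrib by (intro mult_right_mono) auto
  qed
  finally have F: "2 * fa^2 <= 4 / c1^2 * (q^2 + g * CB^2 * (norm y)^2)" by (simp add: mult_left_mono divide_right_mono)
  have "(norm y)^2 <= (n + fa)^2" using near_far_split[of y "Re ze"] by (simp add: n_def fa_def power_mono)
  also have "... <= 2 * n^2 + 2 * fa^2" using zero_le_power2[of "n - fa"] unfolding power2_sum power2_diff by linarith
  also have "... <= 64 * (1 + 2 * e1)^2 / dl * (f / ep) + 4 / c1^2 * q^2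
     + (64 * (1 + 2 * e1)^2 / dl * CB + 4 / c1^2 * CB^2) * (g * (norm y)^2)"
    using add_mono[OF N F] by (simp only: distrib_left distrib_right mult_ac add_ac)
  also have "... <= KE * (f / ep) + KE * q^2 + KE * (g * (norm y)^2)"
    using KE_ge e0 g by (intro add_mono mult_right_mono) (auto simp: f_def)
  also have "KE * (g * (norm y)^2) <= 1/2 * (norm y)^2"
  proof -
    have "g * KE <= 1/2" using mult_right_mono[OF g(2), of KE] KE_ge(1) g1_pos(3) by linarith
    from mult_right_mono[OF this zero_le_power2, of "norm y"] show ?thesis by (simp only: mult_ac)
  qed
  finally show ?thesis unfolding ep_def[symmetric] f_def[symmetric] q_def[symmetric] by (simp add: distrib_left)
qed

text \<open>Bounding the form by \<open>norm y * norm (Q y)\<close> makes the coercivity estimate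
  linear. Only the case \<open>norm y > norm (Q y)\<close> has content, because otherwise
  \<open>4 * KE / ep >= 1\<close> suffices.\<close>

lemma Q_lower_bound:
  assumes a: "adm sig th ze" and g: "0 <= g" "g <= g1" and ep: "0 < - sig * Im th"
  shows "norm y <= 4 * KE / (- sig * Im th) * norm (Q g th ze y)"
proof -
  define ep where "ep = - sig * Im th"
  have "ep <= cmod th" unfolding ep_def using a abs_Im_le_cmod[of th] by (auto simp: adm_def)
  then have e1: "ep <= 1" "0 < ep" using a rr_facts ep by (simp_all add: adm_def ep_def)
  show ?thesis
  proof (cases "norm y <= norm (Q g th ze y)")
    case True
    have "1 <= 4 * KE / ep" using KE_ge(1) e1 by (simp add: pos_le_divide_eq)
    from mult_right_mono[OF this, of "norm (Q g th ze y)"] show ?thesis using True by (simp add: ep_def)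
  next
    case False
    define q where "q = norm (Q g th ze y)"
    have "cmod (cinner (R0 y) (Q g th ze y)) <= norm y * q"
      using cinner_le_norm[of "R0 y" "Q g th ze y"] mult_right_mono[OF norm_R0[of y], of q] by (simp add: q_def)
    then have "cmod (cinner (R0 y) (Q g th ze y)) / ep <= norm y * q / ep" using e1 by (simp add: divide_right_mono)
    moreover have "q^2 <= norm y * q / ep"
    proof -
      have "ep * (q * q) <= 1 * (norm y * q)" using False e1 by (intro mult_mono mult_right_mono) (auto simp: q_def)
      then show ?thesis using e1 by (simp add: pos_le_divide_eq power2_eq_square mult.commute)
    qed
    ultimately have "q^2 + cmod (cinner (R0 y) (Q g th ze y)) / ep <= 2 * (norm y * q / ep)" by linarith
    from mult_left_mono[OF this, of "2 * KE"] Q_coercive[OF a g ep, of y]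
    have "norm y * norm y <= norm y * (4 * KE / ep * q)"
      using KE_ge(1) unfolding ep_def[symmetric] q_def[symmetric] power2_eq_square by (simp add: mult_ac)
    moreover have "0 < norm y" using False norm_ge_zero[of "Q g th ze y"] by linarith
    ultimately show ?thesis unfolding ep_def[symmetric] q_def[symmetric] by (simp only: mult_le_cancel_left_pos)
  qed
qed

lemma R0_le_real:
  assumes a: "adm sig th ze" and g: "0 <= g" and ep: "Im th = 0"
  shows "sig * Im ze * (norm (R0 y))^2 <= cmod (cinner (R0 y) (Q g th ze y))"
  using coercive[OF a g, of y] ep by simp

text \<open>Without dilation the distance of \<open>ze\<close> from the real axis must take over.
  The constant degenerates there, so this bound serves only for invertibility and for continuity at
  zero dilation, never for uniform estimates.\<close>

lemma Q_lower_bound_real: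
  assumes a: "adm sig th ze" and g: "0 <= g" "g <= g1" and ep: "Im th = 0"
  shows "norm y <= 2 * ((1 + 2 * e1) / (sig * Im ze) + 1 / c1) * norm (Q g th ze y)"
proof -
  define q where "q = norm (Q g th ze y)"
  have z: "Re ze \<in> I" and \<eta>: "0 < sig * Im ze" using a by (auto simp: adm_def)
  have "sig * Im ze * (norm (R0 y))^2 <= norm (R0 y) * q"
    using R0_le_real[OF a g(1) ep, of y] cinner_le_norm[of "R0 y" "Q g th ze y"] by (simp add: q_def)
  then have "norm (R0 y) * (sig * Im ze * norm (R0 y)) <= norm (R0 y) * q" by (simp add: power2_eq_square mult_ac)
  then have "sig * Im ze * norm (R0 y) <= q"
    by (cases "norm (R0 y) = 0") (auto simp: q_def mult_le_cancel_left)
  then have w: "norm (R0 y) <= q / (sig * Im ze)" using \<eta> by (simp add: pos_le_divide_eq mult_ac)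
  have "norm (mulS (nearS (Re ze)) (R0 y)) <= 1 * norm (R0 y)"
    by (rule mulS_norm_le[OF bm_nearS]) (simp add: nearS_def)
  then have "(1 + 2 * e1) * norm (mulS (nearS (Re ze)) (R0 y)) <= (1 + 2 * e1) * (q / (sig * Im ze))"
    using w e1 m by (intro mult_left_mono) auto
  then have n: "norm (mulS (nearS (Re ze)) y) <= (1 + 2 * e1) / (sig * Im ze) * q"
    using near_estimate[OF z, of y] by simp
  have "g * (CB / c1) <= g1 * KE" using g KE_ge c1_pos CB_nonneg by (intro mult_mono) auto
  then have "g * CB / c1 * norm y <= 1 / 2 * norm y" using g1_pos(3) by (intro mult_right_mono) auto
  moreover have "norm (mulS (\<lambda>i X. 1 - nearS (Re ze) i X) y) <= 1 / c1 * q + g * CB / c1 * norm y"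
    using far_estimate[OF a g(1), of y] c1_pos(1) by (simp add: q_def field_simps)
  ultimately have "norm y <= (1 + 2 * e1) / (sig * Im ze) * q + 1 / c1 * q + 1 / 2 * norm y"
    using near_far_split[of y "Re ze"] n by linarith
  then show ?thesis unfolding q_def[symmetric] by (simp only: distrib_right distrib_left mult.assoc)
qed

text \<open>The constant does not depend on \<open>g\<close>, as the method of continuity in the
  coupling demands.\<close>

lemma Q_bounded_below:
  assumes a: "adm sig th ze"
  obtains K where "0 <= K" "!!g y. 0 <= g ==> g <= g1 ==> norm y <= K * norm (Q g th ze y)"
proof (cases "Im th = 0")
  case True
  have "0 <= 2 * ((1 + 2 * e1) / (sig * Im ze) + 1 / c1)"
    using a e1 m c1_pos by (auto simp: adm_def)
  then show ?thesis using that Q_lower_bound_real[OF a _ _ True] by blast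
next
  case False
  then have e: "0 < - sig * Im th" using a by (auto simp: adm_def)
  then have "0 <= 4 * KE / (- sig * Im th)" using KE_ge(1) by (intro divide_nonneg_nonneg) auto
  then show ?thesis using that Q_lower_bound[OF a _ _ e] by blast
qed

text \<open>The free symbol is bounded below by a multiple of \<open>L\<close>: far from the shell
  by ellipticity, near it because \<open>L\<close> is bounded and the imaginary part is at least
  that of \<open>ze\<close> in modulus. The inverse is an explicit multiplier.\<close>

lemma surj_Q_free:
  assumes a: "adm sig th ze" shows "surj (mulS (hm th ze))"
proof -
  have th: "th \<in> ball 0 rr" and z: "Re ze \<in> I" and s: "sig = 1 \<or> sig = - 1" and e: "0 <= - sig * Im th" and \<eta>: "0 < sig * Im ze"
    using a by (auto simp: adm_def)
  note th8 = ball_8[OF ball_rr[OF th]]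
  define c where "c = min c1 (sig * Im ze / (1 + 2 * e1))"
  have e1': "0 < 1 + 2 * e1" using e1 m by simp
  have c: "0 < c" using c1_pos \<eta> e1' by (simp add: c_def)
  have lower: "c * L i X <= cmod (ht th i X - ze)" for i X
  proof (cases "near (Re ze) i X")
    case True
    have "c * L i X <= sig * Im ze / (1 + 2 * e1) * (1 + 2 * e1)"
      using nearD(2)[OF z True] L_pos[of i X] \<eta> e1' by (intro mult_mono) (auto simp: c_def)
    also have "... <= - sig * Im (ht th i X) + sig * Im ze" using ht_Im(1)[OF th8 s refl e, of i X] e1' by simp
    also have "... <= cmod (ht th i X - ze)" using s abs_Im_le_cmod[of "ht th i X - ze"] by auto
    finally show ?thesis .
  next
    case False
    have "c * L i X <= c1 * L i X" using L_pos[of i X] by (intro mult_right_mono) (auto simp: c_def)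
    then show ?thesis using farD[OF z False th] by linarith
  qed
  have L0: "L i X ~= 0" for i X using L_pos[of i X] by simp
  have nz: "ht th i X - ze ~= 0" for i X using lower[of i X] mult_pos_pos[OF c L_pos[of i X]] by auto
  have bi: "bm (\<lambda>i X. Lc i X / (ht th i X - ze))"
  proof (rule bmI)
    show "(\<lambda>X. Lc i X / (ht th i X - ze)) \<in> bmv" for i
      using ht_measurable[OF th8, of i, measurable] by measurable
    show "cmod (Lc i X / (ht th i X - ze)) <= 1 / c" for i X
      using lower[of i X] c nz[of i X] L_pos[of i X] by (simp add: norm_divide abs_of_pos field_simps)
  qed
  have "mulS (hm th ze) (mulS (\<lambda>i X. Lc i X / (ht th i X - ze)) v) = v" for v
  proof -
    have "(\<lambda>i X. (ht th i X - ze) / Lc i X * (Lc i X / (ht th i X - ze))) = (\<lambda>i X. 1)"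
      using nz L0 by (auto simp: fun_eq_iff)
    then show ?thesis unfolding mulS_mulS[OF bm_ht[OF th8] bi] by (simp only:) (simp add: mulS_def mulop_one)
  qed
  then show ?thesis by (rule surjI)
qed

lemma bij_Q:
  assumes a: "adm sig th ze" and g: "0 <= g" "g <= g1"
  shows "bij (Q g th ze)"
proof -
  have th: "th \<in> ball 0 rr" using a by (auto simp: adm_def)
  obtain K where K: "0 <= K" "!!g y. 0 <= g ==> g <= g1 ==> norm y <= K * norm (Q g th ze y)"
    using Q_bounded_below[OF a] by blast
  have "surj (\<lambda>y. mulS (hm th ze) y + cx g *\<^sub>C B th y)"
  proof (rule method_of_continuity[OF _ _ B_estimates(1)[OF ball_rr[OF th] ball_rr[OF th]] _ surj_Q_free[OF a] g(1) K(1) CB_nonneg])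
    show "bounded_clinear (mulS (hm th ze))"
      by (rule bounded_clinear_mulS[OF bm_ht[OF ball_8[OF ball_rr[OF th]]]])
    show "bounded_clinear (B th)" unfolding B_def by (rule bounded_clinear_spin_field)
    show "norm y <= K * norm (mulS (hm th ze) y + cx t *\<^sub>C B th y)"
      if "0 <= t" "t <= g" for t y
      using K(2)[of t y] that g by (simp add: Q_def)
  qed
  moreover have "inj (Q g th ze)"
  proof (rule injI)
    fix x y assume "Q g th ze x = Q g th ze y"
    then have "Q g th ze (x - y) = 0" by (simp add: bounded_clinearD[OF bounded_clinear_Q[OF ball_rr[OF th]]])
    then show "x = y" using K(2)[OF g, of "x - y"] by simp
  qed
  ultimately show ?thesis by (simp add: bij_def Q_def[abs_def])
qed

end

section \<open>The resolvent along imaginary dilations\<close>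

text \<open>The derivative is bounded only on the open interval, so \<open>a = 0\<close> is allowed
  although the bound blows up there; this is how the real axis is reached.\<close>

lemma sqrt_path_bound:
  fixes f :: "real => complex"
  assumes ab: "0 <= a" "a <= b" and cont: "continuous_on {a..b} f"
    and f': "!!x. a < x ==> x < b ==> (f has_vector_derivative f' x) (at x)"
    and K: "!!x. a < x ==> x < b ==> cmod (f' x) <= K / sqrt x"
  shows "cmod (f b - f a) <= 2 * K * (sqrt b - sqrt a)"
proof (cases "a < b")
  case True
  have "norm (f b - f a) <= 2 * K * sqrt b - 2 * K * sqrt a"
  proof (rule differentiable_bound_general[OF True cont])
    show "continuous_on {a..b} (\<lambda>x. 2 * K * sqrt x)" by (intro continuous_intros)
    show "((\<lambda>x. 2 * K * sqrt x) has_vector_derivative K / sqrt x) (at x)" if "a < x" "x < b" for x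
      using that ab by (auto intro!: derivative_eq_intros simp: has_real_derivative_iff_has_vector_derivative[symmetric] field_simps)
  qed (use f' K in auto)
  then show ?thesis by (simp add: right_diff_distrib)
qed (use ab in simp)

lemma inverse_sqrt_path_bound:
  fixes f :: "real => complex"
  assumes ab: "0 < a" "a <= b" and cont: "continuous_on {a..b} f"
    and f': "!!x. a < x ==> x < b ==> (f has_vector_derivative f' x) (at x)"
    and K: "!!x. a < x ==> x < b ==> cmod (f' x) <= K / (x * sqrt x)"
  shows "cmod (f b - f a) <= 2 * K * (1 / sqrt a - 1 / sqrt b)"
proof (cases "a < b")
  case True
  have "norm (f b - f a) <= - (2 * K / sqrt b) - - (2 * K / sqrt a)"
  proof (rule differentiable_bound_general[OF True cont])
    show "continuous_on {a..b} (\<lambda>x. - (2 * K / sqrt x))" using ab by (intro continuous_intros) auto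
    show "((\<lambda>x. - (2 * K / sqrt x)) has_vector_derivative K / (x * sqrt x)) (at x)" if "a < x" "x < b" for x
      using that ab by (auto intro!: derivative_eq_intros simp: has_real_derivative_iff_has_vector_derivative[symmetric] field_simps)
  qed (use f' K in auto)
  then show ?thesis by (simp add: right_diff_distrib)
qed (use ab in simp)

text \<open>Bridges norm estimates with a quadratic remainder and complex differentiability.\<close>

lemma has_field_derivative_quadratic:
  fixes F :: "complex => complex"
  assumes "eventually (\<lambda>h. cmod (F (z + h) - F z - h * d) <= C * (cmod h)^2) (at 0)"
  shows "(F has_field_derivative d) (at z)"
proof -
  have nz: "\<forall>\<^sub>F h :: complex in at 0. h ~= 0" by (simp add: eventually_at_filter)
  have "((\<lambda>h. (F (z + h) - F z) / h - d) \<longlongrightarrow> 0) (at 0)"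
  proof (rule Lim_null_comparison)
    show "\<forall>\<^sub>F h in at 0. norm ((F (z + h) - F z) / h - d) <= C * cmod h"
      using assms nz
    proof eventually_elim
      case (elim h)
      note h = elim(2)
      have "(F (z + h) - F z) / h - d = (F (z + h) - F z - h * d) / h" using h by (simp add: field_simps)
      then show ?case using elim(1) h by (simp add: norm_divide divide_le_eq power2_eq_square mult.assoc)
    qed
    show "((\<lambda>h. C * cmod h) \<longlongrightarrow> 0) (at (0::complex))" by (auto intro!: tendsto_eq_intros)
  qed
  then show ?thesis unfolding DERIV_def by (rule LIM_zero_cancel)
qed

interpretation sd: unitary_group_locale state_dilation
  by unfold_locales (rule unitary_group_state_dilation)

abbreviation AD :: "state operator" where "AD \<equiv> generator state_dilation"

section \<open>Analyticity and covariance of the dilated resolvent\<close>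

context spin_boson
begin

definition Y :: "real => complex => complex => state => state" where "Y g th ze = inv (Q g th ze)"

text \<open>Since \<open>Q\<close> is the dilated Hamiltonian minus \<open>ze\<close>, composed with
  \<open>R0\<close>, this \<open>G\<close> is the dilated resolvent, and \<open>Y\<close> is the
  same vector before \<open>R0\<close> is applied.\<close>

definition G :: "real => complex => complex => state => state" where "G g th ze v = R0 (Y g th ze v)"

lemma admD:
  assumes "adm sig th ze"
  shows "th \<in> ball 0 rr" "th \<in> ball 0 (1/16)" "adm (- sig) (cnj th) (cnj ze)"
  using assms ball_rr[of th] by (auto simp: adm_def)

lemma Q_Y: "adm sig th ze ==> 0 <= g ==> g <= g1 ==> Q g th ze (Y g th ze v) = v"
  unfolding Y_def by (rule surj_f_inv_f[OF bij_is_surj[OF bij_Q]])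

lemma Y_Q: "adm sig th ze ==> 0 <= g ==> g <= g1 ==> Y g th ze (Q g th ze v) = v"
  unfolding Y_def by (rule inv_f_f[OF bij_is_inj[OF bij_Q]])

lemma Y_eqI: "adm sig th ze ==> 0 <= g ==> g <= g1 ==> Q g th ze y = v ==> Y g th ze v = y"
  using Y_Q by blast

lemma bounded_clinear_Y:
  assumes a: "adm sig th ze" and g: "0 <= g" "g <= g1" shows "bounded_clinear (Y g th ze)"
proof -
  obtain K where K: "0 <= K" "!!g y. 0 <= g ==> g <= g1 ==> norm y <= K * norm (Q g th ze y)"
    using Q_bounded_below[OF a] by blast
  note lin = bounded_clinearD[OF bounded_clinear_Q[OF admD(2)[OF a]]] and q = Q_Y[OF a g]
  show ?thesis
  proof (rule bounded_clinearI)
    show "Y g th ze (x + y) = Y g th ze x + Y g th ze y" for x y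
      by (rule Y_eqI[OF a g]) (simp add: lin q)
    show "Y g th ze (c *\<^sub>C x) = c *\<^sub>C Y g th ze x" for c x
      by (rule Y_eqI[OF a g]) (simp add: lin q)
    show "norm (Y g th ze x) <= K * norm x" for x
      using K(2)[OF g, of "Y g th ze x"] by (simp add: q)
  qed
qed

lemma bounded_clinear_G:
  "adm sig th ze ==> 0 <= g ==> g <= g1 ==> bounded_clinear (G g th ze)"
  unfolding G_def[abs_def] by (rule bounded_clinear_compose[OF bounded_clinear_R0 bounded_clinear_Y])

lemma norm_G: "norm (G g th ze v) <= norm (Y g th ze v)"
  unfolding G_def by (rule norm_R0)

lemma G_adjoint:
  assumes a: "adm sig th ze" and g: "0 <= g" "g <= g1"
  shows "cinner u (G g th ze v) = cinner (G g (cnj th) (cnj ze) u) v"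
proof -
  have "cinner (R0 (Y g (cnj th) (cnj ze) u)) (Q g th ze (Y g th ze v))
    = cinner (Q g (cnj th) (cnj ze) (Y g (cnj th) (cnj ze) u)) (R0 (Y g th ze v))"
    by (rule Q_symmetric[OF admD(2)[OF a]])
  then show ?thesis by (simp add: G_def Q_Y[OF a g] Q_Y[OF admD(3)[OF a] g])
qed

lemma G_covariant:
  assumes a: "adm sig th ze" "adm sig (th + cx be) ze" and g: "0 <= g" "g <= g1"
  shows "state_dilation be (G g th ze v) = G g (th + cx be) ze (state_dilation be v)"
proof -
  have "\<bar>be\<bar> <= cmod (th + cx be) + cmod th"
    using norm_triangle_ineq4[of "th + cx be" th] by simp
  then have b: "\<bar>be\<bar> < 1/8" using admD(2)[OF a(1)] admD(2)[OF a(2)] by simp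
  have "Q g (th + cx be) ze (W be (Y g th ze v)) = state_dilation be v"
    unfolding state_dilation_Q[OF b admD(2)[OF a(1)] admD(2)[OF a(2)], symmetric] Q_Y[OF a(1) g] ..
  from Y_eqI[OF a(2) g this] show ?thesis by (simp add: G_def state_dilation_R0[OF b])
qed

text \<open>The second resolvent identity in terms of \<open>Q\<close>; it serves for changes of
  dilation, coupling and spectral parameter alike.\<close>

lemma Y_difference:
  assumes a: "adm sig th ze" "adm sig th' ze'" and g: "0 <= g" "g <= g1" "0 <= g'" "g' <= g1"
  shows "Y g' th' ze' v - Y g th ze v = - Y g' th' ze' (Q g' th' ze' (Y g th ze v) - Q g th ze (Y g th ze v))"
  unfolding bounded_clinearD(4)[OF bounded_clinear_Y[OF a(2) g(3,4)]] Y_Q[OF a(2) g(3,4)] Q_Y[OF a(1) g(1,2)]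
  by simp

text \<open>The matrix element is analytic in \<open>th\<close>, so its derivative may be computed
  along real increments. There covariance moves the dilation from the resolvent to \<open>u\<close>
  and \<open>v\<close>, which lie in the domain of the generator.\<close>

lemma G_derivative:
  assumes a: "adm sig th ze" and ep: "0 < - sig * Im th" and g: "0 <= g" "g <= g1"
    and u: "(u, au) \<in> AD" and v: "(v, av) \<in> AD"
  shows "((\<lambda>th. cinner u (G g th ze v)) has_field_derivative
    cinner (\<i> *\<^sub>C au) (G g th ze v) + cinner (G g (cnj th) (cnj ze) u) (\<i> *\<^sub>C av)) (at th)"
proof -
  let ?U = state_dilation
  define y where "y = Y g th ze v"
  define q where "q = Q' g th y"
  define ep where "ep = - sig * Im th"
  define M where "M = 2048 + CB"
  define K where "K = 8 * KE / ep"
  have e0: "0 < ep" using ep by (simp add: ep_def)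
  have g': "g <= 1" using g g1_pos by simp
  have s: "sig = 1 \<or> sig = -1" using a by (simp add: adm_def)
  have th: "th \<in> ball 0 rr" by (rule admD[OF a])
  have K0: "0 <= K" using KE_ge(1) e0 by (simp add: K_def)
  have M0: "0 <= M" using CB_nonneg by (simp add: M_def)
  have near: "eventually (\<lambda>h. adm sig (th + h) ze & ep / 2 <= - sig * Im (th + h)) (at 0)"
    unfolding eventually_at
  proof (intro exI[of _ "min (ep / 2) (rr - cmod th)"] conjI ballI impI)
    fix h :: complex assume "h ~= 0 & dist h 0 < min (ep / 2) (rr - cmod th)"
    then have h: "cmod h < ep / 2" "cmod h < rr - cmod th" by auto
    show e: "ep / 2 <= - sig * Im (th + h)" using s h(1) abs_Im_le_cmod[of h] unfolding ep_def by (auto simp: abs_le_iff)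
    show "adm sig (th + h) ze"
      using a e e0 h(2) norm_triangle_ineq[of th h] unfolding adm_def by simp
  qed (use e0 th in simp)
  have Yb: "norm (Y g (th + h) ze w) <= K * norm w" if "adm sig (th + h) ze" "ep / 2 <= - sig * Im (th + h)" for h :: complex and w
  proof -
    have p: "0 < - sig * Im (th + h)" using that(2) e0 by linarith
    have "norm (Y g (th + h) ze w) <= 4 * KE / (- sig * Im (th + h)) * norm w"
      using Q_lower_bound[OF that(1) g p, of "Y g (th + h) ze w"] unfolding Q_Y[OF that(1) g] .
    also have "4 * KE / (- sig * Im (th + h)) <= 4 * KE / (ep / 2)"
      by (rule divide_left_mono[OF that(2) _ mult_pos_pos[OF p]]) (use e0 KE_ge(1) in auto)
    finally show ?thesis by (simp add: K_def mult_right_mono)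
  qed
  have "eventually (\<lambda>h. cmod (cinner u (G g (th + h) ze v) - cinner u (G g th ze v) - h * (- cinner u (R0 (Y g th ze q))))
    <= (norm u * (K * M * (norm y + norm (Y g th ze q)))) * (cmod h)^2) (at 0)"
    using near
  proof eventually_elim
    case (elim h)
    then have ah: "adm sig (th + h) ze" and eh: "ep / 2 <= - sig * Im (th + h)" by auto
    note T = Q_taylor(2,3)[OF admD(2)[OF a] admD(2)[OF ah] g(1) g', where ze = ze, folded M_def]
    note YL = bounded_clinearD[OF bounded_clinear_Y[OF ah g]]
    \<comment> \<open>The second-order remainder of the inverse: to first order \<open>Y\<close>
      changes by \<open>- h\<close> times \<open>Y\<close> applied to \<open>q\<close>, the
      derivative of \<open>Q\<close> at \<open>y\<close>.\<close>
    let ?d = "Y g (th + h) ze v - y + h *\<^sub>C Y g th ze q"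
    have e1: "?d
      = - Y g (th + h) ze (Q g (th + h) ze y - Q g th ze y - h *\<^sub>C q)
        + h *\<^sub>C Y g (th + h) ze (Q g (th + h) ze (Y g th ze q) - Q g th ze (Y g th ze q))"
    proof -
      have 1: "Y g (th + h) ze (Q g (th + h) ze (Y g th ze q) - Q g th ze (Y g th ze q)) = Y g th ze q - Y g (th + h) ze q"
        using Y_difference[OF a ah g g, of q] by (metis minus_diff_eq minus_minus)
      have 2: "Y g (th + h) ze (Q g (th + h) ze y - Q g th ze y) = y - Y g (th + h) ze v"
        using Y_difference[OF a ah g g, of v] unfolding y_def[symmetric] by (metis minus_diff_eq minus_minus)
      show ?thesis
        unfolding 1 YL(4)[of "Q g (th + h) ze y - Q g th ze y"] 2 YL(2) by (simp add: scaleC_diff_right)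
    qed
    have "norm ?d
      <= K * (M * (cmod h)^2 * norm y) + cmod h * (K * (M * cmod h * norm (Y g th ze q)))"
      unfolding e1
    proof (rule order_trans[OF norm_triangle_ineq add_mono])
      have "norm (Q g (th + h) ze y - Q g th ze y - h *\<^sub>C q) <= M * (cmod h)^2 * norm y"
        using T(2)[of y] by (simp add: q_def)
      then show "norm (- Y g (th + h) ze (Q g (th + h) ze y - Q g th ze y - h *\<^sub>C q)) <= K * (M * (cmod h)^2 * norm y)"
        using order_trans[OF Yb[OF ah eh] mult_left_mono[OF _ K0]] by simp
      have "norm (Q g (th + h) ze (Y g th ze q) - Q g th ze (Y g th ze q)) <= M * cmod h * norm (Y g th ze q)"
        using T(1)[of "Y g th ze q"] by simp
      then show "norm (h *\<^sub>C Y g (th + h) ze (Q g (th + h) ze (Y g th ze q) - Q g th ze (Y g th ze q)))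
          <= cmod h * (K * (M * cmod h * norm (Y g th ze q)))"
        unfolding norm_scaleC by (intro mult_left_mono order_trans[OF Yb[OF ah eh] mult_left_mono[OF _ K0]]) auto
    qed
    also have "... = K * M * (norm y + norm (Y g th ze q)) * (cmod h)^2" by (simp add: power2_eq_square algebra_simps)
    finally have n: "norm ?d <= ..." .
    have "cinner u (G g (th + h) ze v) - cinner u (G g th ze v) - h * (- cinner u (R0 (Y g th ze q)))
      = cinner u (R0 ?d)"
      by (simp add: G_def y_def bounded_clinearD[OF bounded_clinear_R0] cinner_add_right cinner_diff_right cinner_scaleC_right)
    also have "cmod ... <= norm u * norm ?d"
      by (rule order_trans[OF cinner_le_norm mult_left_mono[OF norm_R0]]) simp
    also have "... <= norm u * (K * M * (norm y + norm (Y g th ze q)) * (cmod h)^2)" by (rule mult_left_mono[OF n]) simp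
    finally show ?case by (simp add: mult.assoc)
  qed
  then have D: "((\<lambda>th. cinner u (G g th ze v)) has_field_derivative - cinner u (R0 (Y g th ze q))) (at th)"
    by (rule has_field_derivative_quadratic)
  \<comment> \<open>The complex derivative restricted to real increments; uniqueness of derivatives
    identifies it with the expression from covariance.\<close>
  have "((\<lambda>be. cinner u (G g (th + cx be) ze v)) has_vector_derivative - cinner u (R0 (Y g th ze q))) (at (0::real))"
  proof -
    have r: "((\<lambda>be. th + cx be) has_vector_derivative 1) (at 0)"
      by (auto intro!: derivative_eq_intros)
    show ?thesis using field_vector_diff_chain_at[OF r, of "\<lambda>th. cinner u (G g th ze v)"] D by (simp add: comp_def)
  qed
  moreover have "((\<lambda>be. cinner u (G g (th + cx be) ze v)) has_vector_derivative
      cinner (\<i> *\<^sub>C au) (G g th ze v) + cinner (G g (cnj th) (cnj ze) u) (\<i> *\<^sub>C av)) (at (0::real))"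
  proof -
    have d: "((\<lambda>be. ?U (- be) x) has_vector_derivative \<i> *\<^sub>C ax) (at 0)" if "(x, ax) \<in> AD" for x ax
    proof -
      have 1: "((\<lambda>be. ?U be x) has_vector_derivative (- \<i>) *\<^sub>C ax) (at (- 0))"
        using sd.generator_iff that by simp
      have 2: "((\<lambda>be::real. - be) has_vector_derivative - 1) (at 0)" by (auto intro!: derivative_eq_intros)
      have 3: "(- 1) *\<^sub>R ((- \<i>) *\<^sub>C ax) = \<i> *\<^sub>C ax" by (simp only: scaleR_scaleC scaleC_scaleC) simp
      show ?thesis using vector_diff_chain_at[OF 2 1] unfolding 3 comp_def .
    qed
    have GL: "bounded_linear (G g th ze)" by (rule bounded_clinearD(1)[OF bounded_clinear_G[OF a g]])
    \<comment> \<open>The product rule for the two dilated test vectors around the fixed operator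
      \<open>G g th ze\<close>; \<open>E1\<close> shows that this is the same function of
      \<open>be\<close>.\<close>
    have D1: "((\<lambda>be. cinner (?U (- be) u) (G g th ze (?U (- be) v))) has_vector_derivative
      cinner (?U (- 0) u) (G g th ze (\<i> *\<^sub>C av)) + cinner (\<i> *\<^sub>C au) (G g th ze (?U (- 0) v))) (at 0)"
      by (rule bounded_bilinear.has_vector_derivative[OF bounded_bilinear_cinner d[OF u] bounded_linear.has_vector_derivative[OF GL d[OF v]]])
    have E1: "\<forall>\<^sub>F be in nhds 0. cinner (?U (- be) u) (G g th ze (?U (- be) v)) = cinner u (G g (th + cx be) ze v)"
    proof -
      have "\<forall>\<^sub>F h in nhds 0. h ~= 0 --> adm sig (th + h) ze"
        using near unfolding eventually_at_filter by eventually_elim auto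
      then have "\<forall>\<^sub>F h in nhds 0. adm sig (th + h) ze"
        by eventually_elim (use a in "metis add.right_neutral")
      moreover have "filterlim cx (nhds 0) (nhds 0)"
        using tendsto_of_real[OF filterlim_ident[of "nhds (0::real)"]] by simp
      ultimately have "\<forall>\<^sub>F be in nhds 0. adm sig (th + cx be) ze" by (rule eventually_compose_filterlim)
      then show ?thesis
      proof eventually_elim
        case (elim be)
        have "cinner (?U (- be) u) (G g th ze (?U (- be) v)) = cinner u (?U be (G g th ze (?U (- be) v)))"
          using sd.cinner_move[of "- be"] by simp
        also have "?U be (G g th ze (?U (- be) v)) = G g (th + cx be) ze (?U be (?U (- be) v))"
          by (rule G_covariant[OF a elim g])
        also have "?U be (?U (- be) v) = v" using sd.add[of be "- be" v] sd.zero by simp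
        finally show ?case .
      qed
    qed
    have E2: "\<forall>\<^sub>F be in nhds 0. be \<in> UNIV --> cinner (?U (- be) u) (G g th ze (?U (- be) v)) = cinner u (G g (th + cx be) ze v)"
      using E1 by simp
    have E3: "cinner (?U (- 0) u) (G g th ze (?U (- 0) v)) = cinner u (G g (th + cx 0) ze v)"
      by (simp add: sd.zero)
    show ?thesis
      using D1 unfolding has_vector_derivative_cong_ev[OF E2 E3]
      by (simp add: sd.zero G_adjoint[OF a g] add.commute)
  qed
  ultimately have "- cinner u (R0 (Y g th ze q)) = cinner (\<i> *\<^sub>C au) (G g th ze v) + cinner (G g (cnj th) (cnj ze) u) (\<i> *\<^sub>C av)"
    by (rule vector_derivative_unique_at)
  then show ?thesis using D by simp
qed

end

section \<open>Uniform bounds\<close>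

context spin_boson
begin

definition path :: "real => real => complex" where "path sig ep = Complex 0 (- sig * ep)"

definition sadm :: "real => complex => bool" where
  "sadm sig ze \<longleftrightarrow> (sig = 1 \<or> sig = - 1) & 0 < sig * Im ze & Re ze \<in> I"

text \<open>Contains the image of the unit ball under the inverse Japanese bracket, so bounds on
  these vectors are bounds for the weighted operator.\<close>

definition unit_vec :: "state => bool" where
  "unit_vec v \<longleftrightarrow> norm v <= 1 & (\<exists>av. (v, av) \<in> AD & norm av <= 1)"

lemma path_simps: "path sig 0 = 0" "cnj (path sig ep) = path (- sig) ep"
  by (auto simp: path_def complex_eq_iff)

lemma sadmD:
  assumes "sadm sig ze" shows "sig * sig = 1" "\<bar>sig\<bar> = 1" "sadm (- sig) (cnj ze)" "- sig * Im (path sig ep) = ep"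
  using assms by (auto simp: sadm_def path_def)

lemma adm_path: "sadm sig ze ==> 0 <= ep ==> ep < rr ==> adm sig (path sig ep) ze"
proof -
  assume a: "sadm sig ze" "0 <= ep" "ep < rr"
  have "cmod (path sig ep) = ep" using sadmD(2)[OF a(1)] a(2) by (simp add: path_def cmod_def abs_mult)
  then show ?thesis using a sadmD(4)[OF a(1), of ep] by (simp add: adm_def sadm_def)
qed

text \<open>Short enough for the absorption in \<open>diagonal_bound\<close>, where
  \<open>4 * (1 + N)\<close> is multiplied by \<open>sqrt (2 * KE) * sqrt eps0\<close>, and strictly
  inside the admissible radius.\<close>

definition eps0 :: real where "eps0 = min (rr / 2) (1 / (128 * KE))"

lemma eps0: "0 < eps0" "eps0 < rr" "eps0 <= 1" "sqrt (2 * KE) * sqrt eps0 <= 1/8"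
proof -
  show "0 < eps0" "eps0 < rr" "eps0 <= 1" using rr_facts KE_ge(1) by (auto simp: eps0_def)
  have "eps0 <= 1 / (128 * KE)" by (simp add: eps0_def)
  then have "2 * KE * eps0 <= (1/8)^2" using KE_ge(1) by (simp add: field_simps power2_eq_square)
  then have "sqrt (2 * KE * eps0) <= sqrt ((1/8)^2)" by (rule real_sqrt_le_mono)
  then show "sqrt (2 * KE) * sqrt eps0 <= 1/8" unfolding real_sqrt_mult real_sqrt_abs by simp
qed

lemma Y_square:
  assumes s: "sadm sig ze" and ep: "0 < ep" "ep < rr" and g: "0 <= g" "g <= g1"
  shows "(norm (Y g (path sig ep) ze v))^2 <= 2 * KE * ((norm v)^2 + cmod (cinner (G g (path sig ep) ze v) v) / ep)"
proof -
  note a = adm_path[OF s less_imp_le[OF ep(1)] ep(2)]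
  show ?thesis using Q_coercive[OF a g, of "Y g (path sig ep) ze v"] ep
    unfolding sadmD(4)[OF s] Q_Y[OF a g] G_def by simp
qed

lemma Y_bound:
  assumes s: "sadm sig ze" and ep: "0 < ep" "ep < rr" and g: "0 <= g" "g <= g1"
  shows "norm (Y g (path sig ep) ze v) <= 4 * KE / ep * norm v"
proof -
  note a = adm_path[OF s less_imp_le[OF ep(1)] ep(2)]
  show ?thesis using Q_lower_bound[OF a g, of "Y g (path sig ep) ze v"] ep
    unfolding sadmD(4)[OF s] Q_Y[OF a g] by simp
qed

text \<open>The factor \<open>Complex 0 (- sig)\<close> is the velocity of \<open>path sig\<close>;
  the rest is the complex derivative from \<open>G_derivative\<close>.\<close>

definition dF :: "real => real => complex => state => state => state => state => real => complex" where
  "dF g sig ze u au v av ep = Complex 0 (- sig) *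
     (cinner (\<i> *\<^sub>C au) (G g (path sig ep) ze v) + cinner (G g (path (- sig) ep) (cnj ze) u) (\<i> *\<^sub>C av))"

lemma F_derivative:
  assumes s: "sadm sig ze" and ep: "0 < ep" "ep < rr" and g: "0 <= g" "g <= g1"
    and u: "(u, au) \<in> AD" and v: "(v, av) \<in> AD"
  shows "((\<lambda>ep. cinner u (G g (path sig ep) ze v)) has_vector_derivative dF g sig ze u au v av ep) (at ep)"
proof -
  note a = adm_path[OF s less_imp_le[OF ep(1)] ep(2)]
  have p: "(path sig has_vector_derivative Complex 0 (- sig)) (at ep)"
  proof -
    have e: "path sig = (\<lambda>ep. ep *\<^sub>R Complex 0 (- sig))" by (auto simp: path_def fun_eq_iff complex_eq_iff)
    show ?thesis unfolding e by (auto intro!: derivative_eq_intros)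
  qed
  have "- sig * Im (path sig ep) > 0" unfolding sadmD(4)[OF s] by (rule ep)
  from field_vector_diff_chain_at[OF p G_derivative[OF a this g u v]]
  show ?thesis by (simp add: comp_def dF_def path_simps)
qed

lemma norm_i_scaleC: "norm (\<i> *\<^sub>C (x :: state)) = norm x" by (simp add: norm_scaleC)

lemma derivative_bound:
  fixes au av p q :: state
  assumes "\<bar>sig\<bar> = 1" "norm au <= 1" "norm av <= 1" "norm p <= K" "norm q <= K"
  shows "cmod (Complex 0 (- sig) * (cinner (\<i> *\<^sub>C au) p + cinner q (\<i> *\<^sub>C av))) <= 2 * K"
proof -
  have K: "0 <= K" using order_trans[OF norm_ge_zero assms(4)] .
  have "cmod (cinner (\<i> *\<^sub>C au) p) <= 1 * K"
    by (rule order_trans[OF cinner_le_norm mult_mono]) (use assms in "auto simp: norm_i_scaleC")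
  moreover have "cmod (cinner q (\<i> *\<^sub>C av)) <= K * 1"
    by (rule order_trans[OF cinner_le_norm mult_mono]) (use assms K in "auto simp: norm_i_scaleC")
  moreover have "cmod (Complex 0 (- sig)) = 1" using assms(1) by (simp add: cmod_def)
  ultimately show ?thesis unfolding norm_mult
    using norm_triangle_ineq[of "cinner (\<i> *\<^sub>C au) p" "cinner q (\<i> *\<^sub>C av)"] by simp
qed

lemma dF_difference_bound:
  assumes "\<bar>sig\<bar> = 1" "norm au <= 1" "norm av <= 1"
    and "norm (G g (path sig ep) ze v - G g' (path sig ep) ze' v) <= K"
    and "norm (G g (path (- sig) ep) (cnj ze) u - G g' (path (- sig) ep) (cnj ze') u) <= K"
  shows "cmod (dF g sig ze u au v av ep - dF g' sig ze' u au v av ep) <= 2 * K"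
  using derivative_bound[OF assms] by (simp add: dF_def cinner_diff_right cinner_diff_left algebra_simps)

text \<open>Twice the bound \<open>4 * KE / eps0\<close> for the diagonal element at the far end of
  the path, plus \<open>1\<close>, as the absorption in \<open>diagonal_bound\<close> produces
  it.\<close>

definition K2 :: real where "K2 = 8 * KE / eps0 + 1"

definition K3 :: real where "K3 = sqrt (2 * KE) * (1 + K2)"

lemma K2_ge: "1 <= K2" using KE_ge(1) eps0(1) by (simp add: K2_def)

lemma K3_nonneg: "0 <= K3" using KE_ge(1) K2_ge by (simp add: K3_def)

text \<open>Coercivity controls the full vector by a single diagonal matrix element divided by
  \<open>ep\<close>; a bound on that element therefore gives growth of order
  \<open>1 / sqrt ep\<close> only.\<close>

lemma Y_le_of_diagonal:
  assumes s: "sadm sig ze" and ep: "0 < ep" "ep <= eps0" and g: "0 <= g" "g <= g1"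
    and v: "norm v <= 1" and N: "cmod (cinner (G g (path sig ep) ze v) v) <= N"
  shows "norm (Y g (path sig ep) ze v) <= sqrt (2 * KE) * (1 + N) / sqrt ep"
proof (rule power2_le_imp_le)
  have N0: "0 <= N" using order_trans[OF norm_ge_zero N] .
  have e: "ep < rr" "ep <= 1" using ep eps0 by auto
  have "(norm v)^2 + cmod (cinner (G g (path sig ep) ze v) v) / ep <= 1 / ep + N / ep"
  proof (intro add_mono divide_right_mono N)
    have "(norm v)^2 <= 1" using v by (simp add: power_le_one)
    then show "(norm v)^2 <= 1 / ep" using ep e by (simp add: le_divide_eq) (use mult_mono[of "(norm v)^2" 1 ep 1] in auto)
  qed (use ep in auto)
  also have "... = (1 + N) / ep" by (simp add: add_divide_distrib)
  \<comment> \<open>Gives away a power of \<open>1 + N\<close> so that the square root can be taken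
    exactly; the result stays linear in \<open>N\<close>, which suffices for absorption.\<close>
  also have "... <= (1 + N)^2 / ep" using N0 ep by (intro divide_right_mono) (auto simp: power2_eq_square)
  finally have "2 * KE * ((norm v)^2 + cmod (cinner (G g (path sig ep) ze v) v) / ep) <= 2 * KE * ((1 + N)^2 / ep)"
    using KE_ge(1) by (intro mult_left_mono) auto
  also have "... = (sqrt (2 * KE) * (1 + N) / sqrt ep)^2"
    using KE_ge(1) ep by (simp add: power_mult_distrib power_divide)
  finally show "(norm (Y g (path sig ep) ze v))^2 <= (sqrt (2 * KE) * (1 + N) / sqrt ep)^2"
    using Y_square[OF s ep(1) e(1) g, of v] by linarith
  show "0 <= sqrt (2 * KE) * (1 + N) / sqrt ep" using KE_ge(1) N0 ep by simp
qed

text \<open>Instead of solving the differential inequality for the diagonal element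
  \<open>f\<close>, its maximum \<open>N\<close> on the compact interval \<open>{ep..eps0}\<close>
  is considered. The derivative is at most a multiple of \<open>(1 + N) / sqrt t\<close>, and its
  integral over the short interval is at most \<open>(1 + N) / 2\<close>.\<close>

lemma diagonal_bound:
  assumes s: "sadm sig ze" and ep: "0 < ep" "ep <= eps0" and g: "0 <= g" "g <= g1" and v: "unit_vec v"
  shows "cmod (cinner v (G g (path sig ep) ze v)) <= K2"
proof -
  obtain av where av: "(v, av) \<in> AD" "norm av <= 1" "norm v <= 1" using v by (auto simp: unit_vec_def)
  define f where "f t = cinner v (G g (path sig t) ze v)" for t
  have der: "(f has_vector_derivative dF g sig ze v av v av t) (at t)" if "0 < t" "t < rr" for t
    unfolding f_def by (rule F_derivative[OF s that g av(1) av(1)])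
  have cont: "continuous_on {a..eps0} f" if "0 < a" for a
    by (rule continuous_on_vector_derivative[OF has_vector_derivative_at_within[OF der]]) (use that eps0 in auto)
  have "compact {ep..eps0}" "{ep..eps0} ~= {}" "continuous_on {ep..eps0} (\<lambda>t. cmod (f t))"
    using ep cont[OF ep(1)] by (auto intro: continuous_on_norm)
  from continuous_attains_sup[OF this] obtain x where x: "x \<in> {ep..eps0}" and mx: "!!t. t \<in> {ep..eps0} ==> cmod (f t) <= cmod (f x)"
    by blast
  define N where "N = cmod (f x)"
  have x0: "0 < x" "x <= eps0" using x ep by auto
  have "cmod (f eps0 - f x) <= 2 * (2 * (sqrt (2 * KE) * (1 + N))) * (sqrt eps0 - sqrt x)"
  proof (rule sqrt_path_bound[OF _ x0(2) cont[OF x0(1)]])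
    fix t assume t: "x < t" "t < eps0"
    then have t0: "0 < t" "t <= eps0" "t < rr" using x0 eps0 by auto
    show "(f has_vector_derivative dF g sig ze v av v av t) (at t)" by (rule der[OF t0(1,3)])
    note a = adm_path[OF s less_imp_le[OF t0(1)] t0(3)]
    have N: "cmod (cinner v (G g (path sig t) ze v)) <= N" using mx[of t] t x by (auto simp: N_def f_def)
    have 1: "cmod (cinner (G g (path sig t) ze v) v) <= N" using N by (metis cinner_commute complex_mod_cnj)
    have 2: "cmod (cinner (G g (path (- sig) t) (cnj ze) v) v) <= N" using N G_adjoint[OF a g, of v v] by (simp add: path_simps)
    have "cmod (dF g sig ze v av v av t) <= 2 * (sqrt (2 * KE) * (1 + N) / sqrt t)"
      unfolding dF_def by (rule derivative_bound[OF sadmD(2)[OF s] av(2,2)])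
        (rule order_trans[OF norm_G Y_le_of_diagonal[OF s t0(1,2) g av(3) 1]],
         rule order_trans[OF norm_G Y_le_of_diagonal[OF sadmD(3)[OF s] t0(1,2) g av(3) 2]])
    then show "cmod (dF g sig ze v av v av t) <= 2 * (sqrt (2 * KE) * (1 + N)) / sqrt t" by simp
  qed (use x0 in auto)
  also have "... <= 2 * (2 * (sqrt (2 * KE) * (1 + N))) * sqrt eps0"
    using x0 KE_ge(1) by (intro mult_left_mono) (auto simp: N_def)
  also have "... = 4 * (1 + N) * (sqrt (2 * KE) * sqrt eps0)" by simp
  also have "... <= 4 * (1 + N) * (1/8)" by (intro mult_left_mono eps0(4)) (simp add: N_def)
  finally have "cmod (f eps0 - f x) <= (1 + N) / 2" by simp
  \<comment> \<open>The maximum now bounds itself, and half of it is absorbed; the bound depends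
    neither on \<open>ep\<close> nor on the distance of \<open>ze\<close> from the real
    axis.\<close>
  then have "N <= cmod (f eps0) + (1 + N) / 2" using norm_triangle_ineq2[of "f x" "f eps0"] norm_minus_commute[of "f x" "f eps0"] unfolding N_def by linarith
  then have N: "N <= 2 * cmod (f eps0) + 1" by (simp add: field_simps)
  have "cmod (f eps0) <= norm v * norm (G g (path sig eps0) ze v)" unfolding f_def by (rule cinner_le_norm)
  also have "... <= 1 * (4 * KE / eps0 * 1)"
  proof (intro mult_mono av order_trans[OF norm_G])
    have "4 * KE / eps0 * norm v <= 4 * KE / eps0 * 1" using KE_ge(1) eps0 av by (intro mult_left_mono) auto
    then show "norm (Y g (path sig eps0) ze v) <= 4 * KE / eps0 * 1" using Y_bound[OF s eps0(1,2) g, of v] by linarith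
  qed auto
  finally have "N <= K2" using N by (simp add: K2_def)
  then show ?thesis using mx[of ep] ep by (simp add: f_def N_def)
qed

lemma Y_weighted:
  assumes s: "sadm sig ze" and ep: "0 < ep" "ep <= eps0" and g: "0 <= g" "g <= g1" and v: "unit_vec v"
  shows "norm (Y g (path sig ep) ze v) <= K3 / sqrt ep"
  unfolding K3_def
proof (rule Y_le_of_diagonal[OF s ep g])
  show "norm v <= 1" using v by (simp add: unit_vec_def)
  show "cmod (cinner (G g (path sig ep) ze v) v) <= K2"
    using diagonal_bound[OF assms] by (metis cinner_commute complex_mod_cnj)
qed

text \<open>Continuity at \<open>0\<close> comes from the second resolvent identity:
  \<open>Q\<close> changes by order \<open>t\<close>, and the resolvent at \<open>t\<close> grows
  like \<open>1 / sqrt t\<close>. The constant \<open>K\<close> depends on \<open>Im ze\<close>, but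
  only the continuity is used.\<close>

lemma F_continuous:
  assumes s: "sadm sig ze" and g: "0 <= g" "g <= g1" and u: "unit_vec u" and v: "unit_vec v"
  shows "continuous_on {0..eps0} (\<lambda>ep. cinner u (G g (path sig ep) ze v))"
proof -
  obtain au where au: "(u, au) \<in> AD" "norm u <= 1" using u by (auto simp: unit_vec_def)
  obtain av where av: "(v, av) \<in> AD" using v by (auto simp: unit_vec_def)
  define f where "f t = cinner u (G g (path sig t) ze v)" for t
  have a0: "adm sig (path sig 0) ze" by (rule adm_path[OF s]) (use rr_facts in auto)
  obtain K where K: "0 <= K" "!!g y. 0 <= g ==> g <= g1 ==> norm y <= K * norm (Q g (path sig 0) ze y)"
    using Q_bounded_below[OF a0] by blast
  have b: "cmod (f t - f 0) <= K * (2048 + CB) * K3 * sqrt t" if t: "0 < t" "t <= eps0" for t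
  proof -
    have tr: "0 <= t" "t < rr" using t eps0 by auto
    note a = adm_path[OF s tr]
    define d where "d = Y g (path sig 0) ze v - Y g (path sig t) ze v"
    define y where "y = Y g (path sig t) ze v"
    have "norm d <= K * norm (Q g (path sig 0) ze y - Q g (path sig t) ze y)"
      using K(2)[OF g, of "Y g (path sig 0) ze (Q g (path sig 0) ze y - Q g (path sig t) ze y)"] Y_difference[OF a a0 g g, of v]
      unfolding Q_Y[OF a0 g] d_def y_def by simp
    also have "norm (Q g (path sig 0) ze y - Q g (path sig t) ze y) <= (2048 + CB) * cmod (path sig 0 - path sig t) * norm y"
      by (rule Q_taylor(2)[OF admD(2)[OF a] admD(2)[OF a0] g(1)]) (use g g1_pos in simp)
    also have "cmod (path sig 0 - path sig t) = t" using sadmD(2)[OF s] t by (simp add: path_def cmod_def abs_mult)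
    finally have "norm d <= K * ((2048 + CB) * t * norm y)" using K(1) by (simp add: mult_left_mono)
    also have "... <= K * ((2048 + CB) * t * (K3 / sqrt t))"
      unfolding y_def using K(1) CB_nonneg t by (intro mult_left_mono Y_weighted[OF s t g v]) auto
    also have "... = K * ((2048 + CB) * (K3 * (t / sqrt t)))" by simp
    also have "t / sqrt t = sqrt t" using t by (simp add: real_div_sqrt)
    finally have d: "norm d <= K * ((2048 + CB) * (K3 * sqrt t))" .
    have "f t - f 0 = - cinner u (R0 d)"
      by (simp add: f_def G_def d_def bounded_clinearD[OF bounded_clinear_R0] cinner_diff_right)
    then have "cmod (f t - f 0) <= norm u * norm (R0 d)" using cinner_le_norm[of u "R0 d"] by simp
    also have "... <= 1 * norm d" by (intro mult_mono au norm_R0) auto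
    finally show ?thesis using d by (simp add: mult.assoc)
  qed
  have "continuous_on {0..eps0} f"
    unfolding continuous_on_def
  proof
    fix x assume x: "x \<in> {0..eps0}"
    show "(f \<longlongrightarrow> f x) (at x within {0..eps0})"
    proof (cases "x = 0")
      case True
      have "((\<lambda>t. f t - f 0) \<longlongrightarrow> 0) (at 0 within {0..eps0})"
      proof (rule Lim_null_comparison)
        show "\<forall>\<^sub>F t in at 0 within {0..eps0}. norm (f t - f 0) <= K * (2048 + CB) * K3 * sqrt t"
          unfolding eventually_at_filter by (rule always_eventually) (use b in auto)
        show "((\<lambda>t. K * (2048 + CB) * K3 * sqrt t) \<longlongrightarrow> 0) (at 0 within {0..eps0})"
          by (auto intro!: tendsto_eq_intros)
      qed
      then show ?thesis using True by (simp add: LIM_zero_iff)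
    next
      case False
      then have "0 < x" "x < rr" using x eps0 by auto
      from has_vector_derivative_continuous[OF F_derivative[OF s this g au(1) av]]
      show ?thesis unfolding f_def continuous_within by (rule tendsto_within_subset) simp
    qed
  qed
  then show ?thesis by (simp add: f_def[abs_def])
qed

definition C1 :: real where "C1 = 4 * KE / eps0 + 4 * K3"

text \<open>Integrates the derivative from \<open>eps0\<close>, where the crude bound holds, down to
  zero dilation; \<open>2 * K3 / sqrt t\<close> is integrable, so nothing depends on
  \<open>Im ze\<close>.\<close>

lemma G_bounded:
  assumes s: "sadm sig ze" and g: "0 <= g" "g <= g1" and u: "unit_vec u" and v: "unit_vec v"
  shows "cmod (cinner u (G g 0 ze v)) <= C1"
proof -
  obtain au where au: "(u, au) \<in> AD" "norm au <= 1" "norm u <= 1" using u by (auto simp: unit_vec_def)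
  obtain av where av: "(v, av) \<in> AD" "norm av <= 1" "norm v <= 1" using v by (auto simp: unit_vec_def)
  define f where "f t = cinner u (G g (path sig t) ze v)" for t
  have "cmod (f eps0 - f 0) <= 2 * (2 * K3) * (sqrt eps0 - sqrt 0)"
  proof (rule sqrt_path_bound)
    show "continuous_on {0..eps0} f" unfolding f_def by (rule F_continuous[OF s g u v])
    fix t assume t: "0 < t" "t < eps0"
    then have t0: "t <= eps0" "t < rr" using eps0 by auto
    show "(f has_vector_derivative dF g sig ze u au v av t) (at t)"
      unfolding f_def by (rule F_derivative[OF s t(1) t0(2) g au(1) av(1)])
    have "cmod (dF g sig ze u au v av t) <= 2 * (K3 / sqrt t)"
      unfolding dF_def by (rule derivative_bound[OF sadmD(2)[OF s] au(2) av(2)])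
        (rule order_trans[OF norm_G Y_weighted[OF s t(1) t0(1) g v]],
         rule order_trans[OF norm_G Y_weighted[OF sadmD(3)[OF s] t(1) t0(1) g u]])
    then show "cmod (dF g sig ze u au v av t) <= 2 * K3 / sqrt t" by simp
  qed (use eps0 in auto)
  also have "... <= 4 * K3 * 1"
    using eps0 K3_nonneg mult_left_mono[of "sqrt eps0" 1 "4 * K3"] by simp
  finally have 1: "cmod (f eps0 - f 0) <= 4 * K3" by simp
  have "cmod (f eps0) <= norm u * norm (G g (path sig eps0) ze v)" unfolding f_def by (rule cinner_le_norm)
  also have "... <= 1 * (4 * KE / eps0 * 1)"
  proof (intro mult_mono au order_trans[OF norm_G])
    have "4 * KE / eps0 * norm v <= 4 * KE / eps0 * 1" using KE_ge(1) eps0 av by (intro mult_left_mono) auto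
    then show "norm (Y g (path sig eps0) ze v) <= 4 * KE / eps0 * 1" using Y_bound[OF s eps0(1,2) g, of v] by linarith
  qed auto
  finally have "cmod (f 0) <= C1"
    using 1 norm_triangle_ineq2[of "f 0" "f eps0"] by (simp add: C1_def norm_minus_commute)
  then show ?thesis by (simp add: f_def path_simps)
qed

lemma C1_nonneg: "0 <= C1" using KE_ge(1) eps0(1) K3_nonneg by (simp add: C1_def)

text \<open>Comparison with the free resolvent at the same dilation. The identity is arranged so
  that the vector left on the right is the free one, to which the weighted bound applies; the other
  inverse costs \<open>1 / ep\<close>.\<close>

lemma Y_perturbed:
  assumes s: "sadm sig ze" "sadm sig ze'" and ep: "0 < ep" "ep < rr" and g: "0 <= g" "g <= g1"
  shows "norm (Y g (path sig ep) ze v - Y 0 (path sig ep) ze' v)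
    <= 4 * KE / ep * ((CB + 1) * (g + cmod (ze - ze'))) * norm (Y 0 (path sig ep) ze' v)"
proof -
  note a = adm_path[OF s(1) less_imp_le[OF ep(1)] ep(2)] and a' = adm_path[OF s(2) less_imp_le[OF ep(1)] ep(2)]
  define y where "y = Y 0 (path sig ep) ze' v"
  define k where "k = g + cmod (ze - ze')"
  have k: "g <= k" "cmod (ze - ze') <= k" using g by (auto simp: k_def)
  have "norm (Y g (path sig ep) ze v - y) = norm (Y g (path sig ep) ze (Q g (path sig ep) ze y - Q 0 (path sig ep) ze' y))"
    unfolding y_def using Y_difference[OF a' a order_refl less_imp_le[OF g1_pos(1)] g, of v] by simp
  also have "... <= 4 * KE / ep * norm (Q g (path sig ep) ze y - Q 0 (path sig ep) ze' y)"
    by (rule Y_bound[OF s(1) ep g])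
  also have "... <= 4 * KE / ep * (((CB + 1) * k) * norm y)"
  proof (intro mult_left_mono)
    have "norm (Q g (path sig ep) ze y - Q 0 (path sig ep) ze' y) <= g * norm (B (path sig ep) y) + cmod (ze - ze') * norm (R0 y)"
      unfolding Q_perturb[OF admD(2)[OF a]] using g
      by (intro order_trans[OF norm_triangle_ineq4]) (simp add: norm_scaleC)
    also have "... <= k * (CB * norm y) + k * norm y"
      using B_estimates(1)[OF admD(2)[OF a] admD(2)[OF a], of y] norm_R0[of y] k g
      by (intro add_mono mult_mono) auto
    finally show "norm (Q g (path sig ep) ze y - Q 0 (path sig ep) ze' y) <= (CB + 1) * k * norm y" by (simp add: algebra_simps)
  qed (use KE_ge(1) ep in auto)
  finally show ?thesis by (simp add: y_def k_def mult.assoc)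
qed

text \<open>The four summands belong to the case of a large perturbation, to the path below and
  above \<open>k = g + cmod (ze - ze')\<close>, and to the endpoint \<open>eps0\<close>.\<close>

definition C2 :: real where
  "C2 = 2 * C1 / sqrt eps0 + 8 * K3 + 16 * KE * (CB + 1) * K3 + (4 * KE / eps0)^2 * (CB + 1)"

lemma C2_nonneg: "0 <= C2"
  using C1_nonneg K3_nonneg KE_ge(1) CB_nonneg eps0(1) by (simp add: C2_def)

lemma G_difference:
  assumes s: "sadm sig ze" "sadm sig ze'" and g: "0 < g" "g <= g1" and u: "unit_vec u" and v: "unit_vec v"
  shows "cmod (cinner u (G g 0 ze v) - cinner u (G 0 0 ze' v)) <= C2 * sqrt (g + cmod (ze - ze'))"
proof -
  define k where "k = g + cmod (ze - ze')"
  have k0: "0 < k" using g by (simp add: k_def add_pos_nonneg)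
  have gg: "0 <= g" "g <= g1" "(0::real) <= 0" "0 <= g1" using g g1_pos by auto
  have nn: "0 <= 2 * C1 / sqrt eps0" "0 <= 8 * K3" "0 <= 16 * KE * (CB + 1) * K3" "0 <= (4 * KE / eps0)^2 * (CB + 1)"
    using C1_nonneg K3_nonneg KE_ge(1) CB_nonneg eps0(1) by auto
  show ?thesis unfolding k_def[symmetric]
  proof (cases "eps0 <= k")
    \<comment> \<open>For a large perturbation the uniform bounds of the two resolvents are
      enough.\<close>
    case True
    have "cmod (cinner u (G g 0 ze v) - cinner u (G 0 0 ze' v)) <= C1 + C1"
      by (intro order_trans[OF norm_triangle_ineq4 add_mono] G_bounded[OF s(1) gg(1,2) u v] G_bounded[OF s(2) gg(3,4) u v])
    also have "... = 2 * C1 / sqrt eps0 * sqrt eps0" using eps0(1) by simp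
    also have "... <= C2 * sqrt k"
      using True eps0(1) nn C2_nonneg by (intro mult_mono) (auto simp: C2_def)
    finally show "cmod (cinner u (G g 0 ze v) - cinner u (G 0 0 ze' v)) <= C2 * sqrt k" .
  next
    case False
    then have k1: "k < eps0" "k < rr" "k <= 1" using eps0 by auto
    obtain au where au: "(u, au) \<in> AD" "norm au <= 1" "norm u <= 1" using u by (auto simp: unit_vec_def)
    obtain av where av: "(v, av) \<in> AD" "norm av <= 1" "norm v <= 1" using v by (auto simp: unit_vec_def)
    define f where "f t = cinner u (G g (path sig t) ze v) - cinner u (G 0 (path sig t) ze' v)" for t
    define f' where "f' t = dF g sig ze u au v av t - dF 0 sig ze' u au v av t" for t
    have cont: "continuous_on {0..eps0} f" unfolding f_def
      by (intro continuous_on_diff F_continuous[OF s(1) gg(1,2) u v] F_continuous[OF s(2) gg(3,4) u v])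
    have der: "(f has_vector_derivative f' t) (at t)" if "0 < t" "t < rr" for t
      unfolding f_def f'_def
      by (intro has_vector_derivative_diff F_derivative[OF s(1) that gg(1,2) au(1) av(1)] F_derivative[OF s(2) that gg(3,4) au(1) av(1)])
    \<comment> \<open>Below \<open>k\<close> the two resolvents are estimated separately, since
      their difference is no better than each of them.\<close>
    have "cmod (f k - f 0) <= 2 * (4 * K3) * (sqrt k - sqrt 0)"
    proof (rule sqrt_path_bound)
      show "continuous_on {0..k} f" by (rule continuous_on_subset[OF cont]) (use k1 in auto)
      fix t assume "0 < t" "t < k"
      then have t: "0 < t" "t <= eps0" "t < rr" using k1 by auto
      show "(f has_vector_derivative f' t) (at t)" by (rule der[OF t(1,3)])
      have "cmod (f' t) <= 2 * (K3 / sqrt t + K3 / sqrt t)"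
        unfolding f'_def
        by (rule dF_difference_bound[OF sadmD(2)[OF s(1)] au(2) av(2)];
            rule order_trans[OF norm_triangle_ineq4 add_mono];
            rule order_trans[OF norm_G];
            rule Y_weighted[OF s(1) t(1,2) gg(1,2) v] Y_weighted[OF s(2) t(1,2) gg(3,4) v]
              Y_weighted[OF sadmD(3)[OF s(1)] t(1,2) gg(1,2) u] Y_weighted[OF sadmD(3)[OF s(2)] t(1,2) gg(3,4) u])
      then show "cmod (f' t) <= 4 * K3 / sqrt t" by simp
    qed (use k0 in auto)
    then have 1: "cmod (f k - f 0) <= 8 * K3 * sqrt k" by simp
    \<comment> \<open>Above \<open>k\<close> the perturbation gains a factor \<open>k\<close> and
      loses \<open>1 / t\<close>; integrating \<open>k\<close> times \<open>t\<close> to the power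
      \<open>-3/2\<close> from \<open>k\<close> on gives \<open>sqrt k\<close>, matching the other
      piece.\<close>
    have "cmod (f eps0 - f k) <= 2 * (8 * KE * (CB + 1) * K3 * k) * (1 / sqrt k - 1 / sqrt eps0)"
    proof (rule inverse_sqrt_path_bound)
      show "continuous_on {k..eps0} f" by (rule continuous_on_subset[OF cont]) (use k0 in auto)
      fix t assume "k < t" "t < eps0"
      then have t: "0 < t" "t <= eps0" "t < rr" using k0 eps0 by auto
      show "(f has_vector_derivative f' t) (at t)" by (rule der[OF t(1,3)])
      have b: "norm (G g (path \<tau> t) \<xi> w - G 0 (path \<tau> t) \<xi>' w) <= 4 * KE / t * ((CB + 1) * k) * (K3 / sqrt t)"
        if \<tau>: "sadm \<tau> \<xi>" "sadm \<tau> \<xi>'" "cmod (\<xi> - \<xi>') = cmod (ze - ze')" and w: "unit_vec w" for \<tau> \<xi> \<xi>' w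
      proof -
        have "G g (path \<tau> t) \<xi> w - G 0 (path \<tau> t) \<xi>' w = R0 (Y g (path \<tau> t) \<xi> w - Y 0 (path \<tau> t) \<xi>' w)"
          by (simp add: G_def bounded_clinearD[OF bounded_clinear_R0])
        then have "norm (G g (path \<tau> t) \<xi> w - G 0 (path \<tau> t) \<xi>' w) <= norm (Y g (path \<tau> t) \<xi> w - Y 0 (path \<tau> t) \<xi>' w)"
          using norm_R0 by simp
        also have "... <= 4 * KE / t * ((CB + 1) * k) * norm (Y 0 (path \<tau> t) \<xi>' w)"
          using Y_perturbed[OF \<tau>(1,2) t(1,3) gg(1,2), of w] by (simp add: k_def \<tau>(3))
        also have "... <= 4 * KE / t * ((CB + 1) * k) * (K3 / sqrt t)"
          using KE_ge(1) CB_nonneg k0 t by (intro mult_left_mono Y_weighted[OF \<tau>(2) t(1,2) gg(3,4) w]) auto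
        finally show ?thesis .
      qed
      have "cmod (f' t) <= 2 * (4 * KE / t * ((CB + 1) * k) * (K3 / sqrt t))"
        unfolding f'_def
        by (rule dF_difference_bound[OF sadmD(2)[OF s(1)] au(2) av(2) b[OF s refl v] b[OF sadmD(3)[OF s(1)] sadmD(3)[OF s(2)] cmod_cnj_diff u]])
      then show "cmod (f' t) <= 8 * KE * (CB + 1) * K3 * k / (t * sqrt t)" by (simp add: mult_ac)
    qed (use k0 k1 in auto)
    also have "... <= 2 * (8 * KE * (CB + 1) * K3 * k) * (1 / sqrt k)"
      using KE_ge(1) CB_nonneg k0 K3_nonneg eps0(1) by (intro mult_left_mono) auto
    also have "... = 16 * KE * (CB + 1) * K3 * (k / sqrt k)" by simp
    also have "k / sqrt k = sqrt k" using k0 by (simp add: real_div_sqrt)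
    finally have 2: "cmod (f eps0 - f k) <= 16 * KE * (CB + 1) * K3 * sqrt k" .
    have "f eps0 = cinner u (R0 (Y g (path sig eps0) ze v - Y 0 (path sig eps0) ze' v))"
      by (simp add: f_def G_def bounded_clinearD[OF bounded_clinear_R0] cinner_diff_right)
    then have "cmod (f eps0) <= norm u * norm (R0 (Y g (path sig eps0) ze v - Y 0 (path sig eps0) ze' v))"
      using cinner_le_norm by simp
    also have "... <= 1 * norm (Y g (path sig eps0) ze v - Y 0 (path sig eps0) ze' v)"
      by (intro mult_mono au norm_R0) auto
    also have "... <= 4 * KE / eps0 * ((CB + 1) * k) * norm (Y 0 (path sig eps0) ze' v)"
      using Y_perturbed[OF s eps0(1,2) gg(1,2), of v] by (simp add: k_def)
    also have "... <= 4 * KE / eps0 * ((CB + 1) * k) * (4 * KE / eps0 * norm v)"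
      using KE_ge(1) CB_nonneg k0 eps0(1) by (intro mult_left_mono Y_bound[OF s(2) eps0(1,2) gg(3,4)]) auto
    also have "... <= 4 * KE / eps0 * ((CB + 1) * k) * (4 * KE / eps0 * 1)"
      using KE_ge(1) CB_nonneg k0 eps0(1) av(3) by (intro mult_left_mono) auto
    also have "... = (4 * KE / eps0)^2 * (CB + 1) * k" by (simp add: power2_eq_square mult_ac)
    also have "... <= (4 * KE / eps0)^2 * (CB + 1) * sqrt k"
    proof (rule mult_left_mono[OF _ nn(4)])
      show "k <= sqrt k" using k0 k1 by (intro real_le_rsqrt) (simp add: power2_eq_square mult_left_le)
    qed
    finally have 3: "cmod (f eps0) <= ..." .
    have "cmod (f 0) <= cmod (f k - f 0) + cmod (f eps0 - f k) + cmod (f eps0)"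
      using norm_triangle_ineq4[of "f k" "f k - f 0"] norm_triangle_ineq4[of "f eps0" "f eps0 - f k"] by simp
    also have "... <= 8 * K3 * sqrt k + 16 * KE * (CB + 1) * K3 * sqrt k + (4 * KE / eps0)^2 * (CB + 1) * sqrt k"
      using 1 2 3 by linarith
    also have "... <= C2 * sqrt k"
      using mult_right_mono[OF nn(1), of "sqrt k"] k0 unfolding C2_def by (simp only: distrib_right) simp
    finally show "cmod (cinner u (G g 0 ze v) - cinner u (G 0 0 ze' v)) <= C2 * sqrt k"
      by (simp add: f_def path_simps)
  qed
qed

end

section \<open>Identification of the compressed Hamiltonian\<close>

lemma fun_of_vacuum: "AE X in volume. fun_of (vacuum :: momentum fock) X = (if X = {#} then 1 else 0)"
proof -
  have "square_integrable (sym_prod 0 (\<lambda>_ _. 0) :: momentum multiset => complex)"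
    by (rule square_integrable_sym_prod) simp
  moreover have "(sym_prod 0 (\<lambda>_ _. 0) :: momentum multiset => complex) = (\<lambda>X. if X = {#} then 1 else 0)"
    by (auto simp: sym_prod_def fun_eq_iff)
  ultimately show ?thesis unfolding vacuum_def by (intro fun_of_L2_of) simp
qed

lemma orth_projection_eq:
  assumes "csubspace S" "y \<in> S" "!!s. s \<in> S ==> cinner s (x - y) = 0"
  shows "orth_projection S x = y"
  unfolding orth_projection_def
proof (rule the_equality)
  fix y' assume y': "y' \<in> S & (\<forall>s\<in>S. cinner s (x - y') = 0)"
  have d: "y' - y \<in> S" using csubspaceD[OF assms(1)] y' assms(2) by blast
  have "cinner (y' - y) (y' - y) = cinner (y' - y) (x - y) - cinner (y' - y) (x - y')"
    by (simp add: cinner_diff_right)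
  then show "y' = y" using assms(3)[OF d] y' d by (simp add: cinner_self)
qed (use assms in auto)

lemma multiplication_op_iff:
  "(ph, ps) \<in> multiplication_op w \<longleftrightarrow> (AE k in volume. fun_of ps k = w k * fun_of ph k)"
  by (simp add: multiplication_op_def)

context spin_boson
begin

lemma fun_of_mulS: "bm w ==> AE X in volume. fun_of (mulS w x $ i) X = w i X * fun_of (x $ i) X"
  unfolding mulS_def vec_lambda_beta by (rule fun_of_mulop[OF bmD])

lemma mulS_pb_vacuum: "mulS pb (pure_tensor \<phi>\<^sub>1 vacuum) = 0"
proof -
  have "mulS pb (pure_tensor \<phi>\<^sub>1 vacuum) $ i = 0" for i
  proof (cases "i = 1")
    case True
    show ?thesis
    proof (rule L2_eqI)
      show "AE X in volume. fun_of (mulS pb (pure_tensor \<phi>\<^sub>1 vacuum) $ i) X = fun_of 0 X"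
        using fun_of_mulS[OF bm_pb, of "pure_tensor \<phi>\<^sub>1 vacuum" i] fun_of_vacuum fun_of_zero
          fun_of_scaleC[of "\<phi>\<^sub>1 $ i" vacuum]
        by eventually_elim (auto simp: pure_tensor_def pb_def excl_def True)
    qed
  next
    case False
    then have "i = 2" using exhaust_2[of i] by auto
    then have "pure_tensor \<phi>\<^sub>1 vacuum $ i = 0" by (simp add: pure_tensor_def \<phi>\<^sub>1_def vector_2)
    then show ?thesis by (simp add: mulS_def bounded_clinearD[OF bounded_clinear_mulop[OF bmD[OF bm_pb]]])
  qed
  then show ?thesis by (simp add: vec_eq_iff)
qed

text \<open>A single multiset has positive measure here: the empty one is the whole vacuum sector,
  so the projection onto \<phi>1 \<otimes> \<Omega> is multiplication by an indicator.\<close>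

lemma P_eq: "P x = x - mulS pb x"
  unfolding P_def
proof (rule orth_projection_eq)
  define \<Phi> where "\<Phi> = pure_tensor \<phi>\<^sub>1 (vacuum :: momentum fock)"
  have "csubspace {c *\<^sub>C \<Phi> |c. True}"
    unfolding csubspace_def
    by (auto simp: scaleC_scaleC simp flip: scaleC_add_left intro: exI[of _ 0])
  then show "csubspace {c *\<^sub>C pure_tensor \<phi>\<^sub>1 (vacuum :: momentum fock) |c. True}" by (simp add: \<Phi>_def)
  define c where "c = fun_of (x $ 1) {#}"
  have "(x - mulS pb x) $ i = (c *\<^sub>C \<Phi>) $ i" for i
  proof (rule L2_eqI)
    show "AE X in volume. fun_of ((x - mulS pb x) $ i) X = fun_of ((c *\<^sub>C \<Phi>) $ i) X"
      using fun_of_mulS[OF bm_pb, of x i] fun_of_vacuum fun_of_diff[of "x $ i" "mulS pb x $ i"]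
        fun_of_scaleC[of "c * \<phi>\<^sub>1 $ i" vacuum]
    proof eventually_elim
      case (elim X)
      have "\<phi>\<^sub>1 $ i = (if i = 1 then 1 else 0)" using exhaust_2[of i] by (auto simp: \<phi>\<^sub>1_def vector_2)
      then show ?case using elim
        by (auto simp: \<Phi>_def pure_tensor_def scaleC_vec_def scaleC_scaleC pb_def excl_def c_def)
    qed
  qed
  then have "x - mulS pb x = c *\<^sub>C \<Phi>" by (simp add: vec_eq_iff)
  then show "x - mulS pb x \<in> {c *\<^sub>C pure_tensor \<phi>\<^sub>1 vacuum |c. True}" by (auto simp: \<Phi>_def)
  fix s assume "s \<in> {c *\<^sub>C pure_tensor \<phi>\<^sub>1 (vacuum :: momentum fock) |c. True}"
  then have "mulS pb s = 0"
    using mulS_pb_vacuum by (auto simp: bounded_clinearD[OF bounded_clinear_mulS[OF bm_pb]])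
  then show "cinner s (x - (x - mulS pb x)) = 0"
    using cinner_mulS_left[OF bm_pb, of s x] by (simp add: pb_simps cinner_zero_left)
qed

lemma compress_iff: "(x, z) \<in> compress A \<longleftrightarrow> (\<exists>u. (mulS pb x, u) \<in> A & z = mulS pb u)"
proof -
  have "(x, z) \<in> P_bar \<longleftrightarrow> z = mulS pb x" for x z
  proof -
    have "(x, z) \<in> P_bar \<longleftrightarrow> z = x + (- 1) *\<^sub>C P x"
      by (auto simp: P_bar_def op_diff_def op_add_def op_scale_def fun_graph_def)
    then show ?thesis by (simp add: P_eq)
  qed
  then show ?thesis by (auto simp: compress_def op_comp_def)
qed

lemma H0_pointwise:
  "(x, z) \<in> H\<^sub>0 m 0 e1 \<longleftrightarrow> (\<forall>i. AE X in volume. fun_of (z $ i) X = cx (en i + Hs X) * fun_of (x $ i) X)"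
proof -
  have K: "(\<chi> i. \<Sum>j\<in>UNIV. (K_matrix 0 e1 $ i $ j) *\<^sub>C (x $ j)) = (\<chi> i. cx (en i) *\<^sub>C (x $ i))" for x :: state
  proof -
    have "(\<Sum>j\<in>UNIV. (K_matrix 0 e1 $ i $ j) *\<^sub>C (x $ j)) = cx (en i) *\<^sub>C (x $ i)" for i
      using exhaust_2[of i] by (auto simp: sum_2 K_matrix_def vector_2 en_def)
    then show ?thesis by simp
  qed
  have "(x, z) \<in> H\<^sub>0 m 0 e1 \<longleftrightarrow> (\<exists>a. (\<forall>j. (x $ j, a $ j) \<in> H_field m) & z = (\<chi> i. cx (en i) *\<^sub>C (x $ i)) + a)"
  proof -
    have "(x, y) \<in> tensor_op (K_matrix 0 e1) Id \<longleftrightarrow> y = (\<chi> i. cx (en i) *\<^sub>C (x $ i))" for y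
    proof -
      have "(\<forall>j. (x $ j, y $ j) \<in> Id) \<longleftrightarrow> x = y" for y :: state by (simp add: vec_eq_iff)
      then show ?thesis unfolding tensor_op_def by (auto simp: K)
    qed
    then show ?thesis unfolding H\<^sub>0_def op_add_def by (auto simp: tensor_op_mat_1)
  qed
  also have "... \<longleftrightarrow> (\<forall>j. (x $ j, z $ j - cx (en j) *\<^sub>C (x $ j)) \<in> H_field m)"
  proof safe
    assume h: "\<forall>j. (x $ j, z $ j - cx (en j) *\<^sub>C (x $ j)) \<in> H_field m"
    show "\<exists>a. (\<forall>j. (x $ j, a $ j) \<in> H_field m) & z = (\<chi> i. cx (en i) *\<^sub>C (x $ i)) + a"
      using h by (intro exI[of _ "\<chi> j. z $ j - cx (en j) *\<^sub>C (x $ j)"]) (simp add: vec_eq_iff)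
  qed simp
  also have "... \<longleftrightarrow> (\<forall>i. AE X in volume. fun_of (z $ i) X = cx (en i + Hs X) * fun_of (x $ i) X)"
  proof (intro iff_allI)
    fix i
    show "(x $ i, z $ i - cx (en i) *\<^sub>C (x $ i)) \<in> H_field m
      \<longleftrightarrow> (AE X in volume. fun_of (z $ i) X = cx (en i + Hs X) * fun_of (x $ i) X)"
      unfolding H_field_eq multiplication_op_iff Hs_def[symmetric]
    proof
      assume "AE X in volume. fun_of (z $ i - cx (en i) *\<^sub>C (x $ i)) X = cx (Hs X) * fun_of (x $ i) X"
      then show "AE X in volume. fun_of (z $ i) X = cx (en i + Hs X) * fun_of (x $ i) X"
        using fun_of_diff[of "z $ i" "cx (en i) *\<^sub>C (x $ i)"] fun_of_scaleC[of "cx (en i)" "x $ i"]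
        by eventually_elim (simp add: distrib_right diff_eq_eq add.commute)
    next
      assume "AE X in volume. fun_of (z $ i) X = cx (en i + Hs X) * fun_of (x $ i) X"
      then show "AE X in volume. fun_of (z $ i - cx (en i) *\<^sub>C (x $ i)) X = cx (Hs X) * fun_of (x $ i) X"
        using fun_of_diff[of "z $ i" "cx (en i) *\<^sub>C (x $ i)"] fun_of_scaleC[of "cx (en i)" "x $ i"]
        by eventually_elim (simp add: distrib_right)
    qed
  qed
  finally show ?thesis .
qed

lemma bm_h0: "bm h0m"
proof (rule bm_over_L)
  show "(\<lambda>X. cx (en i + Hs X)) \<in> bmv" for i by measurable
  show "cmod (cx (en i + Hs X)) <= 1 * L i X" for i X
    unfolding norm_of_real using en_nonneg[of i] Hs_nonneg[of X] by (simp add: L_def)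
qed

lemma R0_component: "AE X in volume. fun_of (R0 y $ i) X = fun_of (y $ i) X / Lc i X"
  using fun_of_mulS[OF bm_R0, of y i] unfolding R0_def by eventually_elim simp

lemma R0_inj: "R0 x = R0 y ==> x = y"
proof -
  assume e: "R0 x = R0 y"
  have "x $ i = y $ i" for i
  proof (rule L2_eqI)
    show "AE X in volume. fun_of (x $ i) X = fun_of (y $ i) X"
      using R0_component[of x i] R0_component[of y i] unfolding e
    proof eventually_elim
      case (elim X)
      then show ?case using L_pos[of i X] by simp
    qed
  qed
  then show ?thesis by (simp add: vec_eq_iff)
qed

text \<open>For \<open>(x, z)\<close> in the graph the preimage under \<open>R0\<close> is
  \<open>x + z\<close>, that is \<open>(1 + H\<^sub>0) x\<close>. Hence the domain is the range of
  \<open>R0\<close>.\<close>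

lemma H0_iff: "(x, z) \<in> H\<^sub>0 m 0 e1 \<longleftrightarrow>
  (\<exists>y. x = R0 y & z = mulS h0m y)"
proof
  assume "(x, z) \<in> H\<^sub>0 m 0 e1"
  then have h: "AE X in volume. fun_of (z $ i) X = cx (en i + Hs X) * fun_of (x $ i) X" for i
    by (simp add: H0_pointwise)
  have L1: "Lc i X = 1 + cx (en i + Hs X)" for i X by (simp add: L_def)
  have x: "x $ i = R0 (x + z) $ i" for i
  proof (rule L2_eqI)
    show "AE X in volume. fun_of (x $ i) X = fun_of (R0 (x + z) $ i) X"
      using h[of i] R0_component[of "x + z" i] fun_of_add[of "x $ i" "z $ i"]
    proof eventually_elim
      case (elim X)
      have "fun_of (x $ i) X + fun_of (z $ i) X = Lc i X * fun_of (x $ i) X"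
        unfolding L1 elim(1) by (simp add: distrib_right)
      then show ?case using elim(2,3) L_pos[of i X] by simp
    qed
  qed
  have z: "z $ i = mulS h0m (x + z) $ i" for i
  proof (rule L2_eqI)
    show "AE X in volume. fun_of (z $ i) X = fun_of (mulS h0m (x + z) $ i) X"
      using h[of i] fun_of_mulS[OF bm_h0, of "x + z" i] fun_of_add[of "x $ i" "z $ i"]
    proof eventually_elim
      case (elim X)
      have "fun_of (x $ i) X + fun_of (z $ i) X = Lc i X * fun_of (x $ i) X"
        unfolding L1 elim(1) by (simp add: distrib_right)
      then show ?case using elim L_pos[of i X] by simp
    qed
  qed
  show "\<exists>y. x = R0 y & z = mulS h0m y"
    using x z by (intro exI[of _ "x + z"]) (simp add: vec_eq_iff)
next
  assume "\<exists>y. x = R0 y & z = mulS h0m y"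
  then obtain y where y: "x = R0 y" "z = mulS h0m y" by blast
  have "AE X in volume. fun_of (z $ i) X = cx (en i + Hs X) * fun_of (x $ i) X" for i
    using R0_component[of y i] fun_of_mulS[OF bm_h0, of y i] unfolding y by eventually_elim simp
  then show "(x, z) \<in> H\<^sub>0 m 0 e1" by (simp add: H0_pointwise)
qed

lemma bm_\<rho>': "bm \<rho>" by (rule bmI[OF \<rho>_measurable \<rho>_bound])

text \<open>The domain of the free Hamiltonian lies in that of \<open>(N + 1)^(1/2)\<close>, so the
  field graph reduces to the bounded field operator; the Pauli matrix exchanges the two
  levels.\<close>

lemma V_iff: "(R0 y, b) \<in> V m La \<longleftrightarrow> b = (\<chi> i. field_op (Fth m La 0) (Fth m La 0) (mulS \<rho> y $ flip i))"
proof -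
  have R: "R0 y $ j = mulop inv_root (mulS \<rho> y $ j)" for j
    by (simp add: R0_def mulS_def mulop_mulop bounded_inv_root bmD[OF bm_\<rho>'] inv_root_\<rho>)
  have S: "(\<chi> i. \<Sum>j\<in>UNIV. (\<sigma>\<^sub>1 $ i $ j) *\<^sub>C (w $ j)) = (\<chi> i. w $ flip i)" for w :: state
  proof -
    have "(\<Sum>j\<in>UNIV. (\<sigma>\<^sub>1 $ i $ j) *\<^sub>C (w $ j)) = w $ flip i" for i
      using exhaust_2[of i] by (auto simp: sum_2 \<sigma>\<^sub>1_def vector_2 flip_def)
    then show ?thesis by simp
  qed
  have w: "(\<forall>j. (R0 y $ j, w $ j) \<in> op_add (annihilation (form_factor m La)) (creation (form_factor m La)))
    \<longleftrightarrow> w = (\<chi> j. field_op (Fth m La 0) (Fth m La 0) (mulS \<rho> y $ j))" for w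
    unfolding R field_graph form_factor_eq[OF m] by (simp add: vec_eq_iff)
  have "(R0 y, b) \<in> V m La \<longleftrightarrow> (\<exists>w. b = (\<chi> i. w $ flip i) &
    (\<forall>j. (R0 y $ j, w $ j) \<in> op_add (annihilation (form_factor m La)) (creation (form_factor m La))))"
    unfolding V_def tensor_op_def S by auto
  also have "... \<longleftrightarrow> b = (\<chi> i. field_op (Fth m La 0) (Fth m La 0) (mulS \<rho> y $ flip i))"
    unfolding w by simp
  finally show ?thesis .
qed

lemma H_iff: "(x, z) \<in> H m La 0 e1 g \<longleftrightarrow> (\<exists>y. x = R0 y &
  z = mulS h0m y
    + cx g *\<^sub>C (\<chi> i. field_op (Fth m La 0) (Fth m La 0) (mulS \<rho> y $ flip i)))"
proof -
  have "(x, z) \<in> H m La 0 e1 g \<longleftrightarrow> (\<exists>a b. (x, a) \<in> H\<^sub>0 m 0 e1 & (x, b) \<in> V m La & z = a + cx g *\<^sub>C b)"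
    unfolding H_def op_add_def op_scale_def by auto
  also have "... \<longleftrightarrow> (\<exists>y. x = R0 y & (\<exists>b. (R0 y, b) \<in> V m La &
      z = mulS h0m y + cx g *\<^sub>C b))"
    unfolding H0_iff by blast
  finally show ?thesis unfolding V_iff by simp
qed

lemma H0_eq: "H\<^sub>0 m 0 e1 = H m La 0 e1 0"
  unfolding set_eq_iff split_paired_All H_iff H0_iff by simp

section \<open>The compressed Hamiltonian, its resolvent and the absence of eigenvalues\<close>

lemma R0_pb: "mulS pb (R0 y) = R0 (mulS pb y)"
  unfolding R0_def mulS_mulS[OF bm_R0 bm_pb] mulS_mulS[OF bm_pb bm_R0] by (simp add: mult.commute)

text \<open>The compression restricts only the projected part of \<open>x\<close>. The remainder is
  a multiple of \<phi>1 \<otimes> \<Omega>, where \<open>L\<close> is \<open>1 + e1\<close>, so it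
  lies in the domain as well and its preimage under \<open>R0\<close> is explicit.\<close>

lemma mulS_pb_range:
  assumes x: "mulS pb x = R0 y" obtains y' where "x = R0 y'" "mulS pb y' = y"
proof
  define y' where "y' = mulS pb y + cx (1 + e1) *\<^sub>C (x - mulS pb x)"
  note pl = bounded_clinearD[OF bounded_clinear_mulS[OF bm_pb]]
  have pp: "mulS pb (mulS pb w) = mulS pb w" for w
    unfolding mulS_mulS[OF bm_pb bm_pb] pb_simps(2) ..
  have "R0 (mulS pb y) = R0 y" unfolding R0_pb[symmetric] x[symmetric] pp ..
  then have y: "mulS pb y = y" by (rule R0_inj)
  show "mulS pb y' = y" by (simp add: y'_def pl pp y)
  have "R0 (x - mulS pb x) = mulS (\<lambda>i X. 1 / Lc i X - (1 / Lc i X) * pb i X) x"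
    unfolding mulS_diff[OF bm_R0 bm_mult[OF bm_R0 bm_pb]] R0_def[symmetric]
    by (simp add: bounded_clinearD[OF bounded_clinear_R0]) (simp add: R0_def mulS_mulS[OF bm_R0 bm_pb])
  also have "(\<lambda>i X. 1 / Lc i X - (1 / Lc i X) * pb i X) = (\<lambda>i X. (1 / cx (1 + e1)) * (1 - pb i X))"
    by (auto simp: fun_eq_iff pb_def excl_def L_def en_def Hs_def)
  also have "mulS ... x = (1 / cx (1 + e1)) *\<^sub>C (x - mulS pb x)"
    unfolding mulS_scale[OF bm_diff[OF bm_const bm_pb]] mulS_diff[OF bm_const bm_pb] by (simp add: mulS_const)
  finally have "R0 (x - mulS pb x) = (1 / cx (1 + e1)) *\<^sub>C (x - mulS pb x)" .
  then have "cx (1 + e1) *\<^sub>C R0 (x - mulS pb x) = x - mulS pb x"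
    using e1 m by (simp add: scaleC_scaleC flip: of_real_add of_real_mult del: of_real_1)
  then show "x = R0 y'" unfolding y'_def bounded_clinearD(3)[OF bounded_clinear_R0] bounded_clinearD(2)[OF bounded_clinear_R0] y x[symmetric] by simp
qed

text \<open>Both projections are already built into \<open>Q\<close>: \<open>ht\<close> vanishes on
  the removed state, and the field carries \<open>pb\<close> on both sides.\<close>

lemma compress_H: "(x, z) \<in> compress (H m La 0 e1 g) \<longleftrightarrow> (\<exists>y. x = R0 y & z = Q g 0 0 y)"
proof -
  have b0: "bm (\<lambda>i X. ht 0 i X / Lc i X)" using bm_ht[of 0 0] by simp
  have z: "mulS pb (mulS h0m (mulS pb y)
      + cx g *\<^sub>C (\<chi> i. field_op (Fth m La 0) (Fth m La 0) (mulS \<rho> (mulS pb y) $ flip i))) = Q g 0 0 y" for y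
  proof -
    have "mulS pb (mulS h0m (mulS pb y))
      = mulS (\<lambda>i X. ht 0 i X / Lc i X) y"
      unfolding mulS_mulS[OF bm_h0 bm_pb] mulS_mulS[OF bm_pb bm_mult[OF bm_h0 bm_pb]]
      by (rule arg_cong[where f = "\<lambda>w. mulS w y"]) (auto simp: fun_eq_iff pb_def ht_zero)
    moreover have "mulS \<rho> (mulS pb y) = mulS pbrho y"
      unfolding mulS_mulS[OF bm_\<rho>' bm_pb] by (simp add: mult.commute)
    ultimately show ?thesis
      by (simp add: bounded_clinearD[OF bounded_clinear_mulS[OF bm_pb]] Q_def B_def spin_field_def)
  qed
  show ?thesis unfolding compress_iff H_iff
  proof safe
    fix y assume "mulS pb x = R0 y"
    then obtain y' where y': "x = R0 y'" "mulS pb y' = y" by (rule mulS_pb_range)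
    show "\<exists>y'. x = R0 y' & mulS pb (mulS h0m y
      + cx g *\<^sub>C (\<chi> i. field_op (Fth m La 0) (Fth m La 0) (mulS \<rho> y $ flip i))) = Q g 0 0 y'"
      using y'(1) z[of y'] unfolding y'(2) by blast
  next
    fix y
    show "\<exists>u. (\<exists>y'. mulS pb (R0 y) = R0 y' & u = mulS h0m y'
      + cx g *\<^sub>C (\<chi> i. field_op (Fth m La 0) (Fth m La 0) (mulS \<rho> y' $ flip i))) & Q g 0 0 y = mulS pb u"
      by (rule exI, rule conjI, rule exI, rule conjI, rule R0_pb, rule refl, rule z[symmetric])
  qed
qed

lemma Q_shift: "Q g 0 ze y = Q g 0 \<xi> y - (ze - \<xi>) *\<^sub>C R0 y"
  using Q_perturb[of 0 g ze y g \<xi>] by (simp add: algebra_simps)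

lemma adm_zero: "sadm sig ze ==> adm sig 0 ze"
  using adm_path[of sig ze 0] rr_facts by (simp add: path_simps)

text \<open>Elements of the resolvent graph are the pairs of \<open>Q g 0 ze y\<close> and
  \<open>R0 y\<close>; bijectivity of \<open>Q\<close> makes this the graph of an everywhere defined
  function.\<close>

lemma resolvent_eq:
  assumes s: "sadm sig ze" and g: "0 <= g" "g <= g1"
  shows "resolvent (compress (H m La 0 e1 g)) ze = fun_graph (G g 0 ze)"
proof -
  note a = adm_zero[OF s]
  have "(v, x) \<in> resolvent (compress (H m La 0 e1 g)) ze \<longleftrightarrow> x = G g 0 ze v" for v x
  proof -
    have "(v, x) \<in> resolvent (compress (H m La 0 e1 g)) ze
      \<longleftrightarrow> (\<exists>z. (x, z) \<in> compress (H m La 0 e1 g) & v = z - ze *\<^sub>C x)"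
      unfolding resolvent_def op_inverse_def op_diff_def op_add_def op_scale_def by auto
    also have "... \<longleftrightarrow> (\<exists>y. x = R0 y & v = Q g 0 ze y)"
      unfolding compress_H Q_shift[of g ze _ 0] by auto
    also have "... \<longleftrightarrow> x = G g 0 ze v"
      unfolding G_def using Q_Y[OF a g] Y_Q[OF a g] by metis
    finally show ?thesis .
  qed
  then show ?thesis by (auto simp: fun_graph_def)
qed

text \<open>An eigenvector satisfies \<open>x = G (- \<i> \<eta> x)\<close> for every \<eta> > 0.
  Moving \<open>G\<close> to a weighted vector \<open>v\<close> and using
  \<open>\<eta> * (norm (G v))^2 <= C1\<close> at the conjugate parameter shows that
  \<open>(cmod (cinner v x))^2\<close> is at most of order \<eta>. So \<open>x\<close> is orthogonal
  to the dense domain of the generator.\<close>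

lemma no_eigenvalue:
  assumes z: "z \<in> I" and g: "0 <= g" "g <= g1"
  shows "cx z \<notin> point_spectrum (compress (H m La 0 e1 g))"
proof
  assume "cx z \<in> point_spectrum (compress (H m La 0 e1 g))"
  then obtain x y where x: "x ~= 0" "x = R0 y" "cx z *\<^sub>C x = Q g 0 0 y"
    unfolding point_spectrum_def compress_H by auto
  have orth: "(cmod (cinner v x))^2 <= \<eta> * (C1 * (norm x)^2)" if v: "unit_vec v" and \<eta>: "0 < \<eta>" for v \<eta>
  proof -
    define ze where "ze = Complex z \<eta>"
    have s: "sadm 1 ze" using z \<eta> by (simp add: sadm_def ze_def)
    note s' = sadmD(3)[OF s] and a = adm_zero[OF s]
    have "cx z - ze = - \<i> * cx \<eta>" by (simp add: ze_def complex_eq_iff)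
    then have "Q g 0 ze y = (- \<i> * cx \<eta>) *\<^sub>C x"
      unfolding Q_shift[of g ze y 0] x(3)[symmetric] x(2)[symmetric] by (simp flip: scaleC_diff_left)
    from Y_eqI[OF a g this] have "x = G g 0 ze ((- \<i> * cx \<eta>) *\<^sub>C x)" by (simp add: G_def x(2))
    then have "cinner v x = cinner v (G g 0 ze ((- \<i> * cx \<eta>) *\<^sub>C x))" by simp
    also have "... = (- \<i> * cx \<eta>) * cinner (G g 0 (cnj ze) v) x"
      using G_adjoint[OF a g, of v] by (simp add: cinner_scaleC_right)
    finally have "cmod (cinner v x) = \<eta> * cmod (cinner (G g 0 (cnj ze) v) x)" using \<eta> by (simp add: norm_mult)
    also have "... <= \<eta> * (norm (G g 0 (cnj ze) v) * norm x)" using \<eta> by (intro mult_left_mono cinner_le_norm) auto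
    finally have "(cmod (cinner v x))^2 <= (\<eta> * (norm (G g 0 (cnj ze) v) * norm x))^2" by (rule power_mono) simp
    also have "... = \<eta> * (\<eta> * (norm (G g 0 (cnj ze) v))^2 * (norm x)^2)" by (simp add: power2_eq_square mult_ac)
    also have "... <= \<eta> * (C1 * (norm x)^2)"
    proof (intro mult_left_mono mult_right_mono)
      \<comment> \<open>The coercivity inequality without dilation: it turns the uniform bound for
        the diagonal element into a bound for the norm of the resolvent vector.\<close>
      have "- 1 * Im (cnj ze) * (norm (R0 (Y g 0 (cnj ze) v)))^2 <= cmod (cinner (R0 (Y g 0 (cnj ze) v)) (Q g 0 (cnj ze) (Y g 0 (cnj ze) v)))"
        by (rule R0_le_real[OF adm_zero[OF s'] g(1)]) simp
      also have "... = cmod (cinner v (G g 0 (cnj ze) v))"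
        unfolding Q_Y[OF adm_zero[OF s'] g] G_def by (metis cinner_commute complex_mod_cnj)
      also have "... <= C1" by (rule G_bounded[OF s' g v v])
      finally show "\<eta> * (norm (G g 0 (cnj ze) v))^2 <= C1" by (simp add: G_def ze_def)
    qed (use \<eta> in auto)
    finally show ?thesis .
  qed
  have orth0: "cinner v x = 0" if v: "unit_vec v" for v
  proof (rule ccontr)
    define c where "c = C1 * (norm x)^2"
    define b where "b = (cmod (cinner v x))^2"
    assume "cinner v x ~= 0"
    then have b: "0 < b" by (simp add: b_def)
    have c: "0 <= c" using C1_nonneg by (simp add: c_def)
    \<comment> \<open>This value of \<eta> makes the right side less than \<open>b\<close>; the
      \<open>1\<close> keeps the denominator positive if \<open>c = 0\<close>.\<close>
    have "b <= b / (2 * (c + 1)) * c" unfolding b_def c_def by (rule orth[OF v]) (use b c in "auto simp: b_def c_def")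
    also have "... <= b / (2 * (c + 1)) * (c + 1)" using b c by (intro mult_left_mono) auto
    also have "... = b / 2" using c by (simp add: field_simps)
    finally show False using b by simp
  qed
  have "cinner v x = 0" if d: "v \<in> Domain AD" for v
  proof -
    obtain av where av: "(v, av) \<in> AD" using d by blast
    define r where "r = 1 / (1 + norm v + norm av)"
    have r: "0 < r" "r * norm v <= 1" "r * norm av <= 1"
      by (simp_all add: r_def add_pos_nonneg divide_le_eq)
    have "(cx r *\<^sub>C v, cx r *\<^sub>C av) \<in> AD"
      by (rule self_adjointD(4)[OF sd.generator_self_adjoint av])
    then have "unit_vec (cx r *\<^sub>C v)" using r unfolding unit_vec_def by (auto simp: norm_scaleC)
    from orth0[OF this] show ?thesis using r(1) by (simp add: cinner_scaleC_left)
  qed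
  then have "norm x <= 0" by (intro norm_le_by_cinner_dense[OF sd.generator_dense]) auto
  then show False using x(1) by simp
qed

end

section \<open>The limiting absorption principle\<close>

lemma weighted_fun_graph:
  assumes "op_inverse (japanese_bracket (tensor_op (mat 1) (dGamma D))) = fun_graph S"
  shows "weighted (fun_graph T) = fun_graph (\<lambda>x. S (T (S x)))"
  unfolding weighted_def weight_def assms op_comp_def fun_graph_def by auto

lemma op_diff_fun_graph: "op_diff (fun_graph A) (fun_graph B) = fun_graph (\<lambda>x. A x - B x)"
  by (auto simp: op_diff_def op_add_def op_scale_def fun_graph_def)

text \<open>Self-adjointness of the weight lets it act on both test vectors, and scaling to unit
  vectors turns the bound for matrix elements into a bound for the operator norm.\<close>

lemma (in spin_boson) op_norm_leI:
  fixes S T :: "state => state"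
  assumes S: "bounded_clinear S" "!!x y. cinner (S x) y = cinner x (S y)"
    and unit: "!!x. norm x <= 1 ==> unit_vec (S x)" and T: "bounded_clinear T" and C: "0 <= C"
    and b: "!!u v. unit_vec u ==> unit_vec v ==> cmod (cinner u (T v)) <= C"
  shows "op_norm_le (fun_graph (\<lambda>x. S (T (S x)))) C"
proof -
  have F: "bounded_clinear (\<lambda>x. S (T (S x)))"
    by (rule bounded_clinear_compose[OF S(1) bounded_clinear_compose[OF T S(1)]])
  note lin = bounded_clinearD[OF F]
  have 1: "cmod (cinner u (S (T (S x)))) <= C" if "norm u <= 1" "norm x <= 1" for u x
    using b[OF unit[OF that(1)] unit[OF that(2)]] by (simp add: S(2))
  have 2: "cmod (cinner u (S (T (S x)))) <= C * norm x * norm u" for u x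
  proof (cases "u = 0 \<or> x = 0")
    case True
    then show ?thesis using lin(5) by auto
  next
    case False
    then have n: "0 < norm u" "0 < norm x" by auto
    define a where "a = cx (1 / norm u)"
    define c where "c = cx (1 / norm x)"
    have "cmod (cinner (a *\<^sub>C u) (S (T (S (c *\<^sub>C x))))) <= C"
      by (rule 1) (use n in "simp_all add: norm_scaleC a_def c_def norm_divide")
    then have "cmod (cinner u (S (T (S x)))) / (norm u * norm x) <= C"
      unfolding lin(2) cinner_scaleC_left cinner_scaleC_right by (simp add: norm_mult norm_divide a_def c_def mult.commute)
    then show ?thesis using n by (simp add: divide_le_eq mult_ac)
  qed
  have "norm (S (T (S x))) <= C * norm x" for x
    by (rule norm_le_by_cinner[OF 2]) (use C in simp)
  then have "onorm (\<lambda>x. S (T (S x))) <= C" by (intro onorm_bound C)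
  then show ?thesis unfolding op_norm_le_def using lin(1) by blast
qed

theorem proposition3p8:
  fixes m \<Lambda> e0 e1 :: real
  assumes "0 < m" and "0 < \<Lambda>" and "e0 = 0" and "m < e1" and "e1 \<notin> mN m"
  shows "\<exists>g\<^sub>0>0. \<exists>C>0. \<forall>g. 0 < g \<and> g < g\<^sub>0 \<longrightarrow>
    (\<forall>\<epsilon>\<in>{0<..<1}.
     \<forall>z\<in>{e1 - \<delta> m e0 e1 / 4 .. e1 + \<delta> m e0 e1 / 4}.
     \<forall>z'\<in>{e1 - \<delta> m e0 e1 / 4 .. e1 + \<delta> m e0 e1 / 4}.
       point_spectrum (compress (H m \<Lambda> e0 e1 g))
         \<inter> complex_of_real ` {e1 - \<delta> m e0 e1 / 4 .. e1 + \<delta> m e0 e1 / 4} = {}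
     \<and> (\<forall>s\<in>{1, -1}.
          op_norm_le (weighted (resolvent (compress (H m \<Lambda> e0 e1 g)) (Complex z (- s * \<epsilon>)))) C
        \<and> op_norm_le (weighted (resolvent (compress (H\<^sub>0 m e0 e1)) (Complex z (- s * \<epsilon>)))) C
        \<and> op_norm_le (weighted (op_diff
              (resolvent (compress (H m \<Lambda> e0 e1 g)) (Complex z (- s * \<epsilon>)))
              (resolvent (compress (H\<^sub>0 m e0 e1)) (Complex z' (- s * \<epsilon>)))))
            (C * (sqrt g + sqrt \<bar>z - z'\<bar>))))"
proof -
  interpret spin_boson m \<Lambda> e1 by unfold_locales (use assms in auto)
  have sa: "self_adjoint (tensor_op (mat 1) (dGamma D))"
    unfolding tensor_op_dGamma_D by (rule sd.generator_self_adjoint)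
  obtain S where S: "bounded_clinear S" "op_inverse (japanese_bracket (tensor_op (mat 1) (dGamma D))) = fun_graph S"
    "\<And>x y. cinner (S x) y = cinner x (S y)"
    "\<And>x. \<exists>y. (S x, y) \<in> tensor_op (mat 1) (dGamma D) \<and> (norm y)\<^sup>2 + (norm (S x))\<^sup>2 = (norm x)\<^sup>2"
    by (rule inverse_japanese_bracket[OF sa]) blast
  have unit: "unit_vec (S x)" if x: "norm x \<le> 1" for x
  proof -
    obtain y where y: "(S x, y) \<in> AD" "(norm y)\<^sup>2 + (norm (S x))\<^sup>2 = (norm x)\<^sup>2"
      using S(4)[of x] unfolding tensor_op_dGamma_D by blast
    have "(norm x)\<^sup>2 \<le> 1\<^sup>2" using x by (intro power_mono) auto
    then have "(norm y)\<^sup>2 \<le> 1\<^sup>2" "(norm (S x))\<^sup>2 \<le> 1\<^sup>2"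
      using y(2) zero_le_power2[of "norm y"] zero_le_power2[of "norm (S x)"] by linarith+
    then have "norm y \<le> 1" "norm (S x) \<le> 1" by (auto intro: power2_le_imp_le)
    then show ?thesis using y(1) by (auto simp: unit_vec_def)
  qed
  note leI = op_norm_leI[OF S(1) S(3) unit]
  \<comment> \<open>The summand \<open>1\<close> only ensures strict positivity.\<close>
  define C where "C = C1 + C2 + 1"
  have C: "0 < C" "C1 \<le> C" "C2 \<le> C" "0 \<le> C" using C1_nonneg C2_nonneg by (auto simp: C_def)
  have main: "op_norm_le (weighted (resolvent (compress (H m \<Lambda> 0 e1 g)) \<zeta>)) C"
      "op_norm_le (weighted (resolvent (compress (H\<^sub>0 m 0 e1)) \<zeta>)) C"
      "op_norm_le (weighted (op_diff (resolvent (compress (H m \<Lambda> 0 e1 g)) \<zeta>) (resolvent (compress (H\<^sub>0 m 0 e1)) \<zeta>')))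
          (C * (sqrt g + sqrt (cmod (\<zeta> - \<zeta>'))))"
    if s: "sadm \<sigma> \<zeta>" "sadm \<sigma> \<zeta>'" and g: "0 < g" "g < g1" for \<sigma> \<zeta> \<zeta>' g
  proof -
    have gg: "0 \<le> g" "g \<le> g1" "(0::real) \<le> 0" "0 \<le> g1" using g by auto
    note L = bounded_clinear_G[OF adm_zero[OF s(1)] gg(1,2)] bounded_clinear_G[OF adm_zero[OF s(1)] gg(3,4)]
      bounded_clinear_G[OF adm_zero[OF s(2)] gg(3,4)]
    note R = resolvent_eq[OF s(1) gg(1,2)] resolvent_eq[OF s(1) gg(3,4), folded H0_eq] resolvent_eq[OF s(2) gg(3,4), folded H0_eq]
    show "op_norm_le (weighted (resolvent (compress (H m \<Lambda> 0 e1 g)) \<zeta>)) C"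
      unfolding R weighted_fun_graph[OF S(2)]
      by (rule leI[OF _ L(1) C(4)]) (auto intro: order_trans[OF G_bounded[OF s(1) gg(1,2)] C(2)])
    show "op_norm_le (weighted (resolvent (compress (H\<^sub>0 m 0 e1)) \<zeta>)) C"
      unfolding R weighted_fun_graph[OF S(2)]
      by (rule leI[OF _ L(2) C(4)]) (auto intro: order_trans[OF G_bounded[OF s(1) gg(3,4)] C(2)])
    show "op_norm_le (weighted (op_diff (resolvent (compress (H m \<Lambda> 0 e1 g)) \<zeta>) (resolvent (compress (H\<^sub>0 m 0 e1)) \<zeta>')))
        (C * (sqrt g + sqrt (cmod (\<zeta> - \<zeta>'))))"
      unfolding R op_diff_fun_graph weighted_fun_graph[OF S(2)]
    proof (rule leI[OF _ bounded_clinear_diff[OF L(1,3)]])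
      show "0 \<le> C * (sqrt g + sqrt (cmod (\<zeta> - \<zeta>')))" using C g by simp
      fix u v assume uv: "unit_vec u" "unit_vec v"
      have "cmod (cinner u (G g 0 \<zeta> v - G 0 0 \<zeta>' v)) \<le> C2 * sqrt (g + cmod (\<zeta> - \<zeta>'))"
        using G_difference[OF s g(1) gg(2) uv] by (simp add: cinner_diff_right)
      also have "\<dots> \<le> C * (sqrt g + sqrt (cmod (\<zeta> - \<zeta>')))"
        using C C2_nonneg g by (intro mult_mono sqrt_add_le_add_sqrt) auto
      finally show "cmod (cinner u (G g 0 \<zeta> v - G 0 0 \<zeta>' v)) \<le> C * (sqrt g + sqrt (cmod (\<zeta> - \<zeta>')))" .
    qed
  qed
  have pp: "point_spectrum (compress (H m \<Lambda> 0 e1 g)) \<inter> complex_of_real ` {e1 - \<delta> m 0 e1 / 4 .. e1 + \<delta> m 0 e1 / 4} = {}"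
    if "0 < g" "g < g1" for g
    using no_eigenvalue[of _ g] that unfolding I_def by auto
  show ?thesis unfolding \<open>e0 = 0\<close>
  proof (rule exI[of _ g1], rule conjI[OF g1_pos(1)], rule exI[of _ C], rule conjI[OF C(1)],
      intro allI impI ballI conjI)
    fix g \<epsilon> z z' :: real
    assume g: "0 < g \<and> g < g1" and \<epsilon>: "\<epsilon> \<in> {0<..<1}"
      and z: "z \<in> {e1 - \<delta> m 0 e1 / 4 .. e1 + \<delta> m 0 e1 / 4}" "z' \<in> {e1 - \<delta> m 0 e1 / 4 .. e1 + \<delta> m 0 e1 / 4}"
    show "point_spectrum (compress (H m \<Lambda> 0 e1 g)) \<inter> complex_of_real ` {e1 - \<delta> m 0 e1 / 4 .. e1 + \<delta> m 0 e1 / 4} = {}"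
      by (rule pp) (use g in auto)
    fix s :: real assume s: "s \<in> {1, - 1}"
    \<comment> \<open>Adding \<open>s * \<epsilon>\<close> times the imaginary unit to
      \<open>H - z\<close> means evaluating the resolvent at imaginary part
      \<open>- s * \<epsilon>\<close>, so the half plane has sign \<open>- s\<close>.\<close>
    have sa: "sadm (- s) (Complex w (- s * \<epsilon>))" if "w \<in> I" for w
      using s \<epsilon> that by (auto simp: sadm_def)
    have "cmod (Complex z (- s * \<epsilon>) - Complex z' (- s * \<epsilon>)) = \<bar>z - z'\<bar>" by (simp add: cmod_def)
    note F = main[OF sa sa, OF z[folded I_def] conjunct1[OF g] conjunct2[OF g], unfolded this]
    show "op_norm_le (weighted (resolvent (compress (H m \<Lambda> 0 e1 g)) (Complex z (- s * \<epsilon>)))) C"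
      "op_norm_le (weighted (resolvent (compress (H\<^sub>0 m 0 e1)) (Complex z (- s * \<epsilon>)))) C"
      "op_norm_le (weighted (op_diff
              (resolvent (compress (H m \<Lambda> 0 e1 g)) (Complex z (- s * \<epsilon>)))
              (resolvent (compress (H\<^sub>0 m 0 e1)) (Complex z' (- s * \<epsilon>)))))
            (C * (sqrt g + sqrt \<bar>z - z'\<bar>))"
      by (rule F)+
  qed
qed

end
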